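(* Let $H$ be a separable complex Hilbert space and let $X=\{X_t:t\in\mathbb{Z}\}$ be a zero-mean weakly stationary functional time series in $H$ that has a Cramér--Karhunen--Loève representation with discontinuity points $-\pi<\omega_1<\dots<\omega_k\le\pi$, functional orthogonal increment process $Z$, and eigenpairs $(\nu_j^\omega,\phi_j^\omega)_{j\ge1}$ (in the sense of the context). Then, for any càdlàg function $p:[-\pi,\pi]\to\mathbb{N}$, the random function $$X_t^\star=\int_{(-\pi,\pi]\setminus\{\omega_1,\dots,\omega_k\}}e^{\mathrm{i}\omega t}\Big(\sum_{j=1}^{p(\omega)}\phi_j^\omega\otimes\phi_j^\omega\Big)dZ_\omega+\sum_{\ell=1}^k\Big(\sum_{j=1}^{p(\omega_\ell)}\phi_j^{\omega_\ell}\otimes\phi_j^{\omega_\ell}\Big)(Z_{\omega_\ell}-Z_{\omega_\ell^-})e^{\mathrm{i}t\omega_\ell}$$ minimizes the mean squared error among all linear rank reductions of $\{X_t\}$ to a process $\{Y_t\}$ with representation $Y_t=\int_{-\pi}^{\pi}e^{\mathrm{i}\omega t}A_\omega\,dZ_\omega$, where $A\in\mathcal{B}_\infty$ with $\mathrm{rank}(A_\omega)\le p(\omega)$; that is, $$\|X_t-X_t^\star\|_{\mathbb{H}}^2\le\|X_t-Y_t\|_{\mathbb{H}}^2$$ for every such $\{Y_t\}$ subject to the constraint $\mathrm{rank}(A_\omega)\le p(\omega)$. The minimized error is given by $$\|X_t-X_t^\star\|_{\mathbb{H}}^2=\int_{(-\pi,\pi]\setminus\{\omega_1,\dots,\ome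ga_k\}}\Big(\sum_{j>p(\omega)}\nu_j^\omega\Big)d\omega+\sum_{\ell=1}^k\Big(\sum_{j>p(\omega_\ell)}\nu_j^{\omega_\ell}\Big).$$
   Context: $\mathbb{H}=L^2_H(\Omega,\mathbb{P})$ is the Hilbert space of $H$-valued random elements with $\mathbb{E}\|Y\|^2<\infty$, with inner product $\mathbb{E}\langle\cdot,\cdot\rangle$. For $x,y\in H$, $x\otimes y$ is the operator $g\mapsto\langle g,y\rangle x$. $X$ is (zero-mean) weakly stationary if $\mathbb{E}\|X_t\|^2<\infty$, $\mathbb{E}X_t=0$ and $\mathbb{E}(X_t\otimes X_s)=\mathbb{E}(X_{t-s}\otimes X_0)$ for all $t,s\in\mathbb{Z}$; its lag covariance operators are $\mathcal{C}_h=\mathbb{E}(X_h\otimes X_0)$. $S_1(H)^+$ is the cone of non-negative definite trace class operators, with trace norm. Spectral measure: $\mathscr{F}$ is the unique countably additive (ultraweakly, i.e. after pairing $\mathrm{tr}(\,\cdot\,A)$ with every trace class $A\ge0$) $S_1(H)^+$-valued Borel measure on $[-\pi,\pi]$ without mass at $-\pi$ such that $\mathcal{C}_h=\int_{-\pi}^\pi e^{\mathrm{i}h\omega}d\mathscr{F}(\omega)$ for all $h\in\mathbb{Z}$; write $\mathscr{F}(\omega)=\mathscr{F}([-\pi,\omega])$ and $\mu_{\mathscr{F}}(E)=\mathrm{tr}(\mathscr{F}(E))$, a finite scalar measure. Process $Z$: there is an isometric isomorphism $\mathcal{T}$ from the closed linear span of $\{X_t\}$ in $\mathbb{H}$ onto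 $L^2([-\pi,\pi],\mu_{\mathscr{F}})$ with $\mathcal{T}X_t=e^{\mathrm{i}t\cdot}$, and $Z_\omega=\mathcal{T}^{-1}(1_{(-\pi,\omega]})$. $Z$ has mean zero, orthogonal increments, $\mathbb{E}[(Z_\omega-Z_\lambda)\otimes(Z_\omega-Z_\lambda)]=\mathscr{F}(\omega)-\mathscr{F}(\lambda)$ for $\lambda\le\omega$, and $X_t=\int_{-\pi}^\pi e^{\mathrm{i}t\omega}dZ_\omega$. $Z_{\omega_\ell^-}$ is the limit in $\mathbb{H}$ of $Z_\omega$ as $\omega\uparrow\omega_\ell$, and $\mathscr{F}(\omega_\ell^-)$ the corresponding left limit of $\mathscr{F}$. $\mathcal{B}_\infty=L^2_{S_\infty(H)}([-\pi,\pi],\mu_{\mathscr{F}})$ is the Bochner space of strongly measurable functions $U:[-\pi,\pi]\to S_\infty(H)$ with $\|U\|^2_{\mathcal{B}_\infty}=\int\|U_\omega\|_\infty^2\,d\mu_{\mathscr{F}}(\omega)<\infty$, where $S_\infty(H)$ denotes the bounded linear operators on $H$ with operator norm $\|\cdot\|_\infty$. For $U\in\mathcal{B}_\infty$, $\int_{-\pi}^\pi U_\omega dZ_\omega\in\mathbb{H}$ is the continuous linear extension to $\mathcal{B}_\infty$ of $\sum_iU_i1_{(\alpha_i,\alpha_{i+1}]}\mapsto\sum_iU_i(Z_{\alpha_{i+1}}-Z_{\alpha_i})$; integrals over a subset $M$ are integrals of $U1_M$. Cramér--Karhunen--Loève representation: let $k\ge0$, $-\pi<\omega_1<\dots<\omega_k\le\pi$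 and $M=(-\pi,\pi]\setminus\{\omega_1,\dots,\omega_k\}$. Suppose $X_t=\int_Me^{\mathrm{i}t\omega}dZ_\omega+\sum_{\ell=1}^k(Z_{\omega_\ell}-Z_{\omega_\ell^-})e^{\mathrm{i}t\omega_\ell}$, and there is an operator-valued function $\omega\mapsto\mathcal{F}_\omega$ (with values in $S_1(H)^+$ for almost every $\omega$) such that $\mathscr{F}(E)=\int_E\mathcal{F}_\omega\,d\omega$ for all Borel $E\subseteq M$, with eigendecomposition $\mathcal{F}_\omega=\sum_{j\ge1}\nu_j^\omega\phi_j^\omega\otimes\phi_j^\omega$; and let $\mathscr{F}(\omega_\ell)-\mathscr{F}(\omega_\ell^-)=\sum_{j\ge1}\nu_j^{\omega_\ell}\phi_j^{\omega_\ell}\otimes\phi_j^{\omega_\ell}$ be the eigendecompositions at the jumps, $\ell=1,\dots,k$. In all cases the eigenvalues are in non-increasing order, $(\phi_j^\omega)_j$ is orthonormal, and the eigenvectors are chosen measurably in $\omega$ so that the integrands below are in $\mathcal{B}_\infty$. Then $X$ is said to have the Cramér--Karhunen--Loève representation $$X_t=\int_Me^{\mathrm{i}t\omega}\Big(\sum_{j\ge1}\phi_j^\omega\otimes\phi_j^\omega\Big)dZ_\omega+\sum_{\ell=1}^k\Big(\sum_{j\ge1}\phi_j^{\omega_\ell}\otimes\phi_j^{\omega_\ell}\Big)(Z_{\omega_\ell}-Z_{\omega_\ell^-})e^{\mathrm{i}t\omega_\ell}.$$ *)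

theory Defs
  imports "HOL-Probability.Probability"
begin

section \<open>Complex Hilbert spaces\<close>

text \<open>The library only has real inner product spaces. The class below adds a complex
  structure to a real Hilbert space; the real inner product is the real part of the
  complex one, which is linear in the first argument. Positive definiteness and
  \<open>norm x ^ 2 = cinner x x\<close> follow from the axioms of \<open>real_inner\<close>.\<close>

class complex_hilbert_space = real_inner + banach +
  fixes scaleC :: "complex \<Rightarrow> 'a \<Rightarrow> 'a" (infixr \<open>*\<^sub>C\<close> 75)
    and cinner :: "'a \<Rightarrow> 'a \<Rightarrow> complex"
  assumes scaleC_add_right: "c *\<^sub>C (x + y) = c *\<^sub>C x + c *\<^sub>C y"
    and scaleC_add_left: "(c + d) *\<^sub>C x = c *\<^sub>C x + d *\<^sub>C x"
    and scaleC_scaleC: "c *\<^sub>C d *\<^sub>C x = (c * d) *\<^sub>C x"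
    and scaleC_of_real: "complex_of_real r *\<^sub>C x = r *\<^sub>R x"
    and cinner_add_left: "cinner (x + y) z = cinner x z + cinner y z"
    and cinner_scaleC_left: "cinner (c *\<^sub>C x) y = c * cinner x y"
    and cinner_commute: "cinner x y = cnj (cinner y x)"
    and inner_eq_Re_cinner: "inner x y = Re (cinner x y)"

interpretation chilbert: vector_space "scaleC :: complex \<Rightarrow> 'a \<Rightarrow> 'a :: complex_hilbert_space"
proof
  fix a b :: complex and x y :: 'a
  show "a *\<^sub>C (x + y) = a *\<^sub>C x + a *\<^sub>C y" by (rule scaleC_add_right)
  show "(a + b) *\<^sub>C x = a *\<^sub>C x + b *\<^sub>C x" by (rule scaleC_add_left)
  show "a *\<^sub>C b *\<^sub>C x = (a * b) *\<^sub>C x" by (rule scaleC_scaleC)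
  show "1 *\<^sub>C x = x" using scaleC_of_real[of 1 x] by simp
qed


section \<open>Bounded operators\<close>

text \<open>Elements of \<open>'h \<Rightarrow>\<^sub>L 'h\<close> are real-linear, so complex linearity is a separate predicate.
  The operator norm does not depend on the scalar field.\<close>

definition clinear_op :: "('h::complex_hilbert_space \<Rightarrow>\<^sub>L 'h) \<Rightarrow> bool" where
  "clinear_op A \<longleftrightarrow> (\<forall>c x. blinfun_apply A (c *\<^sub>C x) = c *\<^sub>C blinfun_apply A x)"

definition scale_op :: "complex \<Rightarrow> ('h::complex_hilbert_space \<Rightarrow>\<^sub>L 'h) \<Rightarrow> ('h \<Rightarrow>\<^sub>L 'h)" where
  "scale_op c A = Blinfun (\<lambda>x. c *\<^sub>C blinfun_apply A x)"

definition outer :: "'h::complex_hilbert_space \<Rightarrow> 'h \<Rightarrow> ('h \<Rightarrow>\<^sub>L 'h)" where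
  "outer x y = Blinfun (\<lambda>g. cinner g y *\<^sub>C x)"

text \<open>The rank is the complex dimension of the range. As \<open>dim\<close> is \<open>0\<close> for
  infinite-dimensional spaces, that case has to be separated.\<close>

definition crank :: "('h::complex_hilbert_space \<Rightarrow>\<^sub>L 'h) \<Rightarrow> enat" where
  "crank A =
    (if \<exists>B. finite B \<and> range (blinfun_apply A) \<subseteq> chilbert.span B
     then enat (chilbert.dim (range (blinfun_apply A))) else \<infinity>)"

definition is_onb :: "'h::complex_hilbert_space set \<Rightarrow> bool" where
  "is_onb B \<longleftrightarrow> (\<forall>x\<in>B. \<forall>y\<in>B. cinner x y = (if x = y then 1 else 0))
     \<and> closure (chilbert.span B) = UNIV"

definition some_onb :: "'h::complex_hilbert_space set" where
  "some_onb = (SOME B. is_onb B)"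

text \<open>The trace is only applied to trace class operators, for which it does not depend on the
  orthonormal basis.\<close>

definition tr :: "('h::complex_hilbert_space \<Rightarrow>\<^sub>L 'h) \<Rightarrow> complex" where
  "tr A = (\<Sum>\<^sub>\<infinity>e\<in>some_onb. cinner (blinfun_apply A e) e)"

text \<open>The cone \<open>S\<^sub>1(H)\<^sup>+\<close>. A non-negative definite \<open>A\<close> equals its absolute value, so it is
  trace class iff the series defining its trace converges.\<close>

definition S1_pos :: "('h::complex_hilbert_space \<Rightarrow>\<^sub>L 'h) set" where
  "S1_pos = {A. clinear_op A
     \<and> (\<forall>x. cinner (blinfun_apply A x) x \<in> \<real> \<and> 0 \<le> Re (cinner (blinfun_apply A x) x))
     \<and> (\<lambda>e. cinner (blinfun_apply A e) e) summable_on some_onb}"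

text \<open>Eigendecomposition \<open>A = (\<Sum>j\<ge>1. \<nu> j * (\<phi> j \<otimes> \<phi> j))\<close> with non-increasing eigenvalues and
  orthonormal eigenvectors; index \<open>0\<close> is not used. A finite orthonormal system (the only
  possibility if the space is finite-dimensional) is padded by zeros.\<close>

definition eigen_system ::
    "('h::complex_hilbert_space \<Rightarrow>\<^sub>L 'h) \<Rightarrow> (nat \<Rightarrow> real) \<Rightarrow> (nat \<Rightarrow> 'h) \<Rightarrow> bool" where
  "eigen_system A \<nu> \<phi> \<longleftrightarrow>
     (\<forall>i\<ge>1. \<forall>j\<ge>1. i \<noteq> j \<longrightarrow> cinner (\<phi> i) (\<phi> j) = 0)
   \<and> (\<forall>j\<ge>1. norm (\<phi> j) = 1 \<or> (\<phi> j = 0 \<and> \<nu> j = 0 \<and> \<phi> (Suc j) = 0))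
   \<and> (\<forall>i\<ge>1. \<forall>j\<ge>i. \<nu> j \<le> \<nu> i)
   \<and> (\<forall>x. ((\<lambda>j. \<nu> j *\<^sub>R (cinner x (\<phi> j) *\<^sub>C \<phi> j)) has_sum blinfun_apply A x) {1..})"

text \<open>\<open>\<Sum>j\<ge>1. \<phi> j \<otimes> \<phi> j\<close>, convergent in the strong operator topology.\<close>

definition full_projection :: "(nat \<Rightarrow> 'h::complex_hilbert_space) \<Rightarrow> ('h \<Rightarrow>\<^sub>L 'h)" where
  "full_projection \<phi> = Blinfun (\<lambda>x. \<Sum>\<^sub>\<infinity>j\<in>{1..}. cinner x (\<phi> j) *\<^sub>C \<phi> j)"

definition truncated_projection :: "nat \<Rightarrow> (nat \<Rightarrow> 'h::complex_hilbert_space) \<Rightarrow> ('h \<Rightarrow>\<^sub>L 'h)" where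
  "truncated_projection n \<phi> = (\<Sum>j\<in>{1..n}. outer (\<phi> j) (\<phi> j))"


section \<open>Square integrable random elements and weak stationarity\<close>

text \<open>Elements of \<open>L\<^sup>2\<close> are represented by functions, and equality is equality almost everywhere.\<close>

definition L2 :: "'a measure \<Rightarrow> ('a \<Rightarrow> 'b::{banach, second_countable_topology}) set" where
  "L2 M = {Y \<in> borel_measurable M. integrable M (\<lambda>x. (norm (Y x))\<^sup>2)}"

definition L2_norm :: "'a measure \<Rightarrow> ('a \<Rightarrow> 'b::{banach, second_countable_topology}) \<Rightarrow> real" where
  "L2_norm M Y = sqrt (\<integral>x. (norm (Y x))\<^sup>2 \<partial>M)"

text \<open>\<open>E(X \<otimes> Y)\<close>, as the Bochner integral of \<open>(X \<otimes> Y) g\<close> for each \<open>g\<close>.\<close>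

definition cov_op :: "'w measure \<Rightarrow> ('w \<Rightarrow> 'h::{complex_hilbert_space, second_countable_topology})
    \<Rightarrow> ('w \<Rightarrow> 'h) \<Rightarrow> ('h \<Rightarrow>\<^sub>L 'h)" where
  "cov_op P X Y = Blinfun (\<lambda>g. \<integral>x. cinner g (Y x) *\<^sub>C X x \<partial>P)"

definition weakly_stationary :: "'w measure \<Rightarrow>
    (int \<Rightarrow> 'w \<Rightarrow> 'h::{complex_hilbert_space, second_countable_topology}) \<Rightarrow> bool" where
  "weakly_stationary P X \<longleftrightarrow>
     (\<forall>t. X t \<in> L2 P \<and> (\<integral>x. X t x \<partial>P) = 0)
   \<and> (\<forall>t s. cov_op P (X t) (X s) = cov_op P (X (t - s)) (X 0))"


section \<open>The spectral measure\<close>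

abbreviation freq_borel :: "real measure" where
  "freq_borel \<equiv> restrict_space borel {- pi..pi}"

text \<open>The scalar measure \<open>E \<mapsto> tr (F E A)\<close>.\<close>

definition paired_measure ::
    "(real set \<Rightarrow> ('h::complex_hilbert_space \<Rightarrow>\<^sub>L 'h)) \<Rightarrow> ('h \<Rightarrow>\<^sub>L 'h) \<Rightarrow> real measure" where
  "paired_measure F A =
     measure_of {- pi..pi} (sets freq_borel) (\<lambda>E. ennreal (Re (tr (F E o\<^sub>L A))))"

definition trace_measure ::
    "(real set \<Rightarrow> ('h::complex_hilbert_space \<Rightarrow>\<^sub>L 'h)) \<Rightarrow> real measure" where
  "trace_measure F = measure_of {- pi..pi} (sets freq_borel) (\<lambda>E. ennreal (Re (tr (F E))))"

text \<open>Countable additivity and the integral with respect to the operator-valued measure are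
  understood ultraweakly. The predicate determines \<open>F\<close> on the Borel subsets of \<open>[-\<pi>, \<pi>]\<close>.\<close>

definition is_spectral_measure :: "'w measure \<Rightarrow>
    (int \<Rightarrow> 'w \<Rightarrow> 'h::{complex_hilbert_space, second_countable_topology}) \<Rightarrow>
    (real set \<Rightarrow> ('h \<Rightarrow>\<^sub>L 'h)) \<Rightarrow> bool" where
  "is_spectral_measure P X F \<longleftrightarrow>
     (\<forall>E\<in>sets freq_borel. F E \<in> S1_pos)
   \<and> (\<forall>A\<in>S1_pos. \<forall>E. range E \<subseteq> sets freq_borel \<longrightarrow> disjoint_family E \<longrightarrow>
        (\<lambda>i::nat. tr (F (E i) o\<^sub>L A)) sums tr (F (\<Union>i. E i) o\<^sub>L A))
   \<and> F {- pi} = 0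
   \<and> (\<forall>h. \<forall>A\<in>S1_pos. tr (cov_op P (X h) (X 0) o\<^sub>L A)
        = (\<integral>\<omega>. cis (of_int h * \<omega>) \<partial>(paired_measure F A)))"

text \<open>\<open>F(\<omega>) - F(\<omega>\<^sup>-)\<close> for the distribution function \<open>F(\<omega>) = F [-\<pi>, \<omega>]\<close>.\<close>

definition spectral_jump ::
    "(real set \<Rightarrow> ('h::complex_hilbert_space \<Rightarrow>\<^sub>L 'h)) \<Rightarrow> real \<Rightarrow> ('h \<Rightarrow>\<^sub>L 'h)" where
  "spectral_jump F a = F {- pi..a} - Lim (at_left a) (\<lambda>\<omega>. F {- pi..\<omega>})"


section \<open>The functional orthogonal increment process\<close>

definition closed_span :: "'w measure \<Rightarrow>
    (int \<Rightarrow> 'w \<Rightarrow> 'h::{complex_hilbert_space, second_countable_topology}) \<Rightarrow> ('w \<Rightarrow> 'h) set" where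
  "closed_span P X = {Y \<in> L2 P. \<forall>\<epsilon>>0. \<exists>S c. finite S \<and>
     L2_norm P (\<lambda>x. Y x - (\<Sum>t\<in>S. c t *\<^sub>C X t x)) < \<epsilon>}"

definition spectral_isometry :: "'w measure \<Rightarrow>
    (int \<Rightarrow> 'w \<Rightarrow> 'h::{complex_hilbert_space, second_countable_topology}) \<Rightarrow> real measure \<Rightarrow>
    (('w \<Rightarrow> 'h) \<Rightarrow> real \<Rightarrow> complex) \<Rightarrow> bool" where
  "spectral_isometry P X \<mu> T \<longleftrightarrow>
     (\<forall>Y\<in>closed_span P X. T Y \<in> L2 \<mu> \<and> L2_norm \<mu> (T Y) = L2_norm P Y)
   \<and> (\<forall>Y\<in>closed_span P X. \<forall>Y'\<in>closed_span P X. \<forall>a b.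
        AE \<omega> in \<mu>. T (\<lambda>x. a *\<^sub>C Y x + b *\<^sub>C Y' x) \<omega> = a * T Y \<omega> + b * T Y' \<omega>)
   \<and> (\<forall>g\<in>L2 \<mu>. \<exists>Y\<in>closed_span P X. AE \<omega> in \<mu>. T Y \<omega> = g \<omega>)
   \<and> (\<forall>t. AE \<omega> in \<mu>. T (X t) \<omega> = cis (of_int t * \<omega>))"

definition is_increment_process :: "'w measure \<Rightarrow>
    (int \<Rightarrow> 'w \<Rightarrow> 'h::{complex_hilbert_space, second_countable_topology}) \<Rightarrow>
    (real set \<Rightarrow> ('h \<Rightarrow>\<^sub>L 'h)) \<Rightarrow> (real \<Rightarrow> 'w \<Rightarrow> 'h) \<Rightarrow> bool" where
  "is_increment_process P X F Z \<longleftrightarrow>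
     (\<exists>T. spectral_isometry P X (trace_measure F) T
        \<and> (\<forall>a\<in>{- pi..pi}. Z a \<in> closed_span P X
             \<and> (AE \<omega> in trace_measure F. T (Z a) \<omega> = indicator {- pi<..a} \<omega>)))"

text \<open>A version of the mean square limit \<open>Z\<^bsub>a\<^sup>-\<^esub>\<close>, and the jump of \<open>Z\<close> at \<open>a\<close>.\<close>

definition left_limit :: "'w measure \<Rightarrow>
    (real \<Rightarrow> 'w \<Rightarrow> 'h::{complex_hilbert_space, second_countable_topology}) \<Rightarrow> real \<Rightarrow> 'w \<Rightarrow> 'h" where
  "left_limit P Z a = (SOME Y. Y \<in> L2 P \<and>
     ((\<lambda>\<omega>. L2_norm P (\<lambda>x. Z \<omega> x - Y x)) \<longlongrightarrow> 0) (at_left a))"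

definition process_jump :: "'w measure \<Rightarrow>
    (real \<Rightarrow> 'w \<Rightarrow> 'h::{complex_hilbert_space, second_countable_topology}) \<Rightarrow> real \<Rightarrow> 'w \<Rightarrow> 'h" where
  "process_jump P Z a x = Z a x - left_limit P Z a x"


section \<open>The Bochner space and the stochastic integral\<close>

text \<open>Borel measurability is not adequate for functions into the non-separable space of bounded
  operators; strong measurability is approximability by simple functions almost everywhere.\<close>

definition strongly_measurable :: "'a measure \<Rightarrow> ('a \<Rightarrow> 'b::real_normed_vector) \<Rightarrow> bool" where
  "strongly_measurable M U \<longleftrightarrow> (\<exists>s. (\<forall>n::nat. simple_function M (s n))
     \<and> (AE x in M. (\<lambda>n. s n x) \<longlonglongrightarrow> U x))"

text \<open>The square of the norm of \<open>B\<^sub>\<infinity>\<close>. The integrand agrees with a Borel measurable function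
  only almost everywhere, which is enough for \<open>nn_integral\<close> but not for \<open>integrable\<close>.\<close>

definition B_inf_norm2 :: "real measure \<Rightarrow> (real \<Rightarrow> ('h::complex_hilbert_space \<Rightarrow>\<^sub>L 'h)) \<Rightarrow> ennreal" where
  "B_inf_norm2 \<mu> U = (\<integral>\<^sup>+\<omega>. ennreal ((norm (U \<omega>))\<^sup>2) \<partial>\<mu>)"

definition B_inf :: "real measure \<Rightarrow> (real \<Rightarrow> ('h::complex_hilbert_space \<Rightarrow>\<^sub>L 'h)) set" where
  "B_inf \<mu> = {U. strongly_measurable \<mu> U \<and> (AE \<omega> in \<mu>. clinear_op (U \<omega>)) \<and> B_inf_norm2 \<mu> U < \<infinity>}"

definition step_data :: "nat \<Rightarrow> (nat \<Rightarrow> real) \<Rightarrow> (nat \<Rightarrow> ('h::complex_hilbert_space \<Rightarrow>\<^sub>L 'h)) \<Rightarrow> bool" where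
  "step_data n \<alpha> U \<longleftrightarrow> mono_on {..n} \<alpha> \<and> \<alpha> ` {..n} \<subseteq> {- pi..pi} \<and> (\<forall>i<n. clinear_op (U i))"

definition step_fun :: "nat \<Rightarrow> (nat \<Rightarrow> real) \<Rightarrow> (nat \<Rightarrow> ('h::complex_hilbert_space \<Rightarrow>\<^sub>L 'h)) \<Rightarrow>
    real \<Rightarrow> ('h \<Rightarrow>\<^sub>L 'h)" where
  "step_fun n \<alpha> U \<omega> = (\<Sum>i<n. indicat_real {\<alpha> i<..\<alpha> (Suc i)} \<omega> *\<^sub>R U i)"

definition step_integral :: "(real \<Rightarrow> 'w \<Rightarrow> 'h) \<Rightarrow> nat \<Rightarrow> (nat \<Rightarrow> real) \<Rightarrow>
    (nat \<Rightarrow> ('h::complex_hilbert_space \<Rightarrow>\<^sub>L 'h)) \<Rightarrow> 'w \<Rightarrow> 'h" where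
  "step_integral Z n \<alpha> U x = (\<Sum>i<n. blinfun_apply (U i) (Z (\<alpha> (Suc i)) x - Z (\<alpha> i) x))"

text \<open>Continuous linear extension from step functions: \<open>Y\<close> is the mean square limit of the
  integrals of step functions that approximate \<open>U\<close> in \<open>B\<^sub>\<infinity>\<close>. The integral of step functions is a
  contraction and step functions are dense, so \<open>Y\<close> exists and is unique almost surely, and does
  not depend on the approximating sequence.\<close>

definition has_stoch_integral :: "'w measure \<Rightarrow> real measure \<Rightarrow>
    (real \<Rightarrow> 'w \<Rightarrow> 'h::{complex_hilbert_space, second_countable_topology}) \<Rightarrow>
    (real \<Rightarrow> ('h \<Rightarrow>\<^sub>L 'h)) \<Rightarrow> ('w \<Rightarrow> 'h) \<Rightarrow> bool" where
  "has_stoch_integral P \<mu> Z U Y \<longleftrightarrow> Y \<in> L2 P \<and>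
     (\<exists>n \<alpha> V. (\<forall>m::nat. step_data (n m) (\<alpha> m) (V m))
        \<and> (\<lambda>m. B_inf_norm2 \<mu> (\<lambda>\<omega>. U \<omega> - step_fun (n m) (\<alpha> m) (V m) \<omega>)) \<longlonglongrightarrow> 0
        \<and> (\<lambda>m. L2_norm P (\<lambda>x. Y x - step_integral Z (n m) (\<alpha> m) (V m) x)) \<longlonglongrightarrow> 0)"

definition stoch_integral :: "'w measure \<Rightarrow> real measure \<Rightarrow>
    (real \<Rightarrow> 'w \<Rightarrow> 'h::{complex_hilbert_space, second_countable_topology}) \<Rightarrow>
    (real \<Rightarrow> ('h \<Rightarrow>\<^sub>L 'h)) \<Rightarrow> 'w \<Rightarrow> 'h" where
  "stoch_integral P \<mu> Z U = (SOME Y. has_stoch_integral P \<mu> Z U Y)"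

definition stoch_integral_on :: "'w measure \<Rightarrow> real measure \<Rightarrow>
    (real \<Rightarrow> 'w \<Rightarrow> 'h::{complex_hilbert_space, second_countable_topology}) \<Rightarrow> real set \<Rightarrow>
    (real \<Rightarrow> ('h \<Rightarrow>\<^sub>L 'h)) \<Rightarrow> 'w \<Rightarrow> 'h" where
  "stoch_integral_on P \<mu> Z M U = stoch_integral P \<mu> Z (\<lambda>\<omega>. indicat_real M \<omega> *\<^sub>R U \<omega>)"


section \<open>Cramer--Karhunen--Loeve representations and rank reductions\<close>

abbreviation continuity_part :: "nat \<Rightarrow> (nat \<Rightarrow> real) \<Rightarrow> real set" where
  "continuity_part k w \<equiv> {- pi<..pi} - w ` {1..k}"

text \<open>The discontinuity points are \<open>w 1 < \<dots> < w k\<close>, and \<open>\<nu> \<omega> j\<close>, \<open>\<phi> \<omega> j\<close> (\<open>j \<ge> 1\<close>) are the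
  eigenpairs at frequency \<open>\<omega>\<close>: of the spectral density \<open>f \<omega>\<close> if \<open>\<omega>\<close> lies in the continuity part,
  and of the jump of the spectral measure if \<open>\<omega>\<close> is one of the \<open>w l\<close>.\<close>

definition has_CKL_representation :: "'w measure \<Rightarrow>
    (int \<Rightarrow> 'w \<Rightarrow> 'h::{complex_hilbert_space, second_countable_topology}) \<Rightarrow>
    (real set \<Rightarrow> ('h \<Rightarrow>\<^sub>L 'h)) \<Rightarrow> (real \<Rightarrow> 'w \<Rightarrow> 'h) \<Rightarrow>
    nat \<Rightarrow> (nat \<Rightarrow> real) \<Rightarrow> (real \<Rightarrow> nat \<Rightarrow> real) \<Rightarrow> (real \<Rightarrow> nat \<Rightarrow> 'h) \<Rightarrow> bool" where
  "has_CKL_representation P X F Z k w \<nu> \<phi> \<longleftrightarrow>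
     strict_mono_on {1..k} w \<and> w ` {1..k} \<subseteq> {- pi<..pi}
   \<and> (\<forall>t. AE x in P. X t x =
        stoch_integral_on P (trace_measure F) Z (continuity_part k w)
          (\<lambda>\<omega>. scale_op (cis (of_int t * \<omega>)) id_blinfun) x
        + (\<Sum>l\<in>{1..k}. cis (of_int t * w l) *\<^sub>C process_jump P Z (w l) x))
   \<and> (\<exists>f. (AE \<omega> in lebesgue. \<omega> \<in> continuity_part k w \<longrightarrow>
              f \<omega> \<in> S1_pos \<and> eigen_system (f \<omega>) (\<nu> \<omega>) (\<phi> \<omega>))
        \<and> (\<forall>E\<in>sets borel. E \<subseteq> continuity_part k w \<longrightarrow>
            (\<forall>A\<in>S1_pos. set_integrable lebesgue E (\<lambda>\<omega>. tr (f \<omega> o\<^sub>L A))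
               \<and> tr (F E o\<^sub>L A) = (LINT \<omega>:E|lebesgue. tr (f \<omega> o\<^sub>L A)))))
   \<and> (\<forall>l\<in>{1..k}. eigen_system (spectral_jump F (w l)) (\<nu> (w l)) (\<phi> (w l)))
   \<and> (\<forall>j\<ge>1. (\<lambda>\<omega>. \<phi> \<omega> j) \<in> borel_measurable (restrict_space lebesgue (continuity_part k w)))
   \<and> (\<lambda>\<omega>. indicat_real (continuity_part k w) \<omega> *\<^sub>R full_projection (\<phi> \<omega>))
        \<in> B_inf (trace_measure F)
   \<and> (\<forall>t. AE x in P. X t x =
        stoch_integral_on P (trace_measure F) Z (continuity_part k w)
          (\<lambda>\<omega>. scale_op (cis (of_int t * \<omega>)) (full_projection (\<phi> \<omega>))) x
        + (\<Sum>l\<in>{1..k}. cis (of_int t * w l) *\<^sub>C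
             blinfun_apply (full_projection (\<phi> (w l))) (process_jump P Z (w l) x)))"

definition cadlag_on :: "real \<Rightarrow> real \<Rightarrow> (real \<Rightarrow> 'b::topological_space) \<Rightarrow> bool" where
  "cadlag_on a b f \<longleftrightarrow> (\<forall>t\<in>{a..<b}. (f \<longlongrightarrow> f t) (at_right t))
     \<and> (\<forall>t\<in>{a<..b}. \<exists>l. (f \<longlongrightarrow> l) (at_left t))"

definition CKL_truncation :: "'w measure \<Rightarrow>
    (real set \<Rightarrow> ('h::{complex_hilbert_space, second_countable_topology} \<Rightarrow>\<^sub>L 'h)) \<Rightarrow>
    (real \<Rightarrow> 'w \<Rightarrow> 'h) \<Rightarrow> nat \<Rightarrow> (nat \<Rightarrow> real) \<Rightarrow> (real \<Rightarrow> nat \<Rightarrow> 'h) \<Rightarrow> (real \<Rightarrow> nat) \<Rightarrow>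
    int \<Rightarrow> 'w \<Rightarrow> 'h" where
  "CKL_truncation P F Z k w \<phi> p t x =
     stoch_integral_on P (trace_measure F) Z (continuity_part k w)
       (\<lambda>\<omega>. scale_op (cis (of_int t * \<omega>)) (truncated_projection (p \<omega>) (\<phi> \<omega>))) x
     + (\<Sum>l\<in>{1..k}. cis (of_int t * w l) *\<^sub>C
          blinfun_apply (truncated_projection (p (w l)) (\<phi> (w l))) (process_jump P Z (w l) x))"

definition is_rank_reduction :: "'w measure \<Rightarrow>
    (real set \<Rightarrow> ('h::{complex_hilbert_space, second_countable_topology} \<Rightarrow>\<^sub>L 'h)) \<Rightarrow>
    (real \<Rightarrow> 'w \<Rightarrow> 'h) \<Rightarrow> (real \<Rightarrow> nat) \<Rightarrow> (int \<Rightarrow> 'w \<Rightarrow> 'h) \<Rightarrow> bool" where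
  "is_rank_reduction P F Z p Y \<longleftrightarrow>
     (\<exists>A\<in>B_inf (trace_measure F).
        (AE \<omega> in trace_measure F. crank (A \<omega>) \<le> enat (p \<omega>))
      \<and> (\<forall>t. Y t \<in> L2 P \<and> (AE x in P. Y t x =
            stoch_integral P (trace_measure F) Z (\<lambda>\<omega>. scale_op (cis (of_int t * \<omega>)) (A \<omega>)) x)))"

end

theory Submission
  imports Defs
begin

text \<open>
  The argument replaces the random elements by explicit functions. Let \<open>N\<close> be the measure on pairs
  \<open>(k, \<omega>)\<close> which gives the eigenvector \<open>\<phi> \<omega> k\<close> the mass \<open>\<nu> \<omega> k\<close>, with respect to Lebesgue measure on
  the continuity part and with respect to unit masses at the jumps \<open>w l\<close>. The eigendecompositions say
  that the operator measure \<open>F\<close> is the second moment of the vector \<open>\<psi> (k, \<omega>) = \<phi> \<omega> k\<close>: the quadratic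
  form of \<open>F E\<close> at \<open>g\<close> is the integral of \<open>(cmod (cinner \<psi> g))\<^sup>2\<close> over the pairs with \<open>\<omega> \<in> E\<close>
  (\<open>model_quadratic\<close>). Hence the functions \<open>cis (t * \<omega>) *\<^sub>C \<psi>\<close> in \<open>L2 N\<close> have the same covariances as
  the random elements \<open>X t\<close>.

  Equal covariances are enough to transport everything (\<open>L2_isometry_of_covariances\<close>): expanding
  in an orthonormal basis and moving operators to the other side of the inner product shows
  that \<open>\<Sum>t. U t (X t)\<close> and \<open>\<Sum>t. U t (cis (t * \<omega>) *\<^sub>C \<psi>)\<close> have the same mean square norm for all bounded
  complex linear \<open>U t\<close>. The closure of this correspondence (\<open>corresponds\<close>) pairs \<open>Z a\<close>
  with \<open>\<psi>\<close> restricted to \<open>\<omega> \<in> {- pi<..a}\<close>, the jump of \<open>Z\<close> at \<open>a\<close> with \<open>\<psi>\<close> restricted to \<open>\<omega> = a\<close>, and the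
  stochastic integral of \<open>U\<close> with the function \<open>U \<omega> (\<psi> (k, \<omega>))\<close>. In particular, all integrands of the
  Bochner space have integrals, because step functions are dense and mean square limits exist.

  For a process \<open>Y\<close> with integrand \<open>A\<close> the mean squared error thus becomes the integral over \<open>\<omega>\<close> of
  \<open>\<Sum>k. \<nu> \<omega> k * (norm (\<phi> \<omega> k - A \<omega> (\<phi> \<omega> k)))\<^sup>2\<close>, in which the factor \<open>cis (t * \<omega>)\<close> cancels
  (\<open>residual_nn_integral\<close>). At each frequency this is the approximation problem of Eckart and
  Young: if the rank of \<open>A \<omega>\<close> is at most \<open>p \<omega>\<close>, the sum is at least the sum of the eigenvalues beyond
  the first \<open>p \<omega>\<close>, with equality for the projection onto the first \<open>p \<omega>\<close> eigenvectors
  (\<open>eckart_young\<close>, \<open>eckart_young_attained\<close>).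

  The spectral measure is only given through its density and the jumps of its distribution
  function. That the jump at \<open>a\<close> is \<open>F {a}\<close> (\<open>spectral_jump_eq\<close>) requires convergence in operator norm,
  which follows since the norm of a positive operator is bounded by its trace.
\<close>

section \<open>Complex Hilbert spaces\<close>

lemma cinner_add_right: "cinner x (y + z) = cinner x y + cinner x (z::'h::complex_hilbert_space)"
  by (metis cinner_add_left cinner_commute complex_cnj_add)

lemma cinner_scaleC_right: "cinner x (c *\<^sub>C y) = cnj c * cinner x (y::'h::complex_hilbert_space)"
  by (metis cinner_scaleC_left cinner_commute complex_cnj_mult)

lemma scaleR_scaleC: "r *\<^sub>R x = complex_of_real r *\<^sub>C (x::'h::complex_hilbert_space)"
  by (simp add: scaleC_of_real)

lemma cinner_scaleR_left: "cinner (r *\<^sub>R x) y = r *\<^sub>R cinner x (y::'h::complex_hilbert_space)"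
  by (simp add: scaleR_scaleC cinner_scaleC_left scaleR_conv_of_real)

lemma cinner_scaleR_right: "cinner x (r *\<^sub>R y) = r *\<^sub>R cinner x (y::'h::complex_hilbert_space)"
  by (simp add: scaleR_scaleC cinner_scaleC_right scaleR_conv_of_real)

lemma cinner_self: "cinner x x = complex_of_real ((norm x)\<^sup>2)" for x :: "'h::complex_hilbert_space"
proof -
  have "Im (cinner x x) = 0"
    using arg_cong[OF cinner_commute[of x x], of Im] by simp
  moreover have "Re (cinner x x) = (norm x)\<^sup>2"
    by (metis inner_eq_Re_cinner power2_norm_eq_inner)
  ultimately show ?thesis by (simp add: complex_eq_iff)
qed

lemma norm_scaleC: "norm (c *\<^sub>C x) = cmod c * norm x" for x :: "'h::complex_hilbert_space"
proof -
  have "complex_of_real ((norm (c *\<^sub>C x))\<^sup>2) = c * cnj c * cinner x x"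
    by (metis cinner_self cinner_scaleC_left cinner_scaleC_right mult.assoc)
  also have "\<dots> = complex_of_real ((cmod c * norm x)\<^sup>2)"
    by (simp only: cinner_self complex_norm_square[symmetric] power_mult_distrib of_real_mult of_real_power)
  finally have "(norm (c *\<^sub>C x))\<^sup>2 = (cmod c * norm x)\<^sup>2"
    using of_real_eq_iff by blast
  then show ?thesis by simp
qed

lemma cmod_cinner_le: "cmod (cinner x y) \<le> norm x * norm y" for x y :: "'h::complex_hilbert_space"
proof (cases "cinner x y = 0")
  case False
  define c where "c = cnj (cinner x y) / complex_of_real (cmod (cinner x y))"
  have c: "cmod c = 1" using False by (simp add: c_def norm_divide)
  have "c * cinner x y = complex_of_real (cmod (cinner x y))"
    using False by (simp add: c_def mult.commute complex_norm_square[symmetric] power2_eq_square)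
  then have "cmod (cinner x y) = Re (cinner (c *\<^sub>C x) y)"
    by (simp add: cinner_scaleC_left)
  also have "\<dots> = inner (c *\<^sub>C x) y" by (simp add: inner_eq_Re_cinner)
  also have "\<dots> \<le> norm (c *\<^sub>C x) * norm y" by (rule norm_cauchy_schwarz)
  finally show ?thesis using c by (simp add: norm_scaleC)
qed auto

lemma bounded_bilinear_cinner:
  "bounded_bilinear (cinner :: 'h::complex_hilbert_space \<Rightarrow> 'h \<Rightarrow> complex)"
  by unfold_locales
    (auto simp: cinner_add_left cinner_add_right cinner_scaleR_left cinner_scaleR_right
      intro!: exI[of _ 1] cmod_cinner_le)

lemma bounded_bilinear_scaleC:
  "bounded_bilinear (scaleC :: complex \<Rightarrow> 'h::complex_hilbert_space \<Rightarrow> 'h)"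
  by unfold_locales
    (auto simp: scaleC_add_left scaleC_add_right scaleR_scaleC scaleC_scaleC norm_scaleC
      scaleR_conv_of_real mult.commute intro!: exI[of _ 1])

interpretation cinner: bounded_bilinear "cinner :: 'h::complex_hilbert_space \<Rightarrow> 'h \<Rightarrow> complex"
  by (rule bounded_bilinear_cinner)

interpretation scaleC: bounded_bilinear "scaleC :: complex \<Rightarrow> 'h::complex_hilbert_space \<Rightarrow> 'h"
  by (rule bounded_bilinear_scaleC)

declare cinner.zero_left [simp] cinner.zero_right [simp] scaleC.zero_left [simp] scaleC.zero_right [simp]

lemma measurable_cinner [measurable (raw)]:
  fixes f g :: "'a \<Rightarrow> 'h::{complex_hilbert_space, second_countable_topology}"
  assumes "f \<in> borel_measurable M" "g \<in> borel_measurable M"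
  shows "(\<lambda>x. cinner (f x) (g x)) \<in> borel_measurable M"
  using assms by (rule borel_measurable_continuous_Pair)
    (intro continuous_intros cinner.continuous_on)

lemma measurable_scaleC [measurable (raw)]:
  fixes f :: "'a \<Rightarrow> complex" and g :: "'a \<Rightarrow> 'h::{complex_hilbert_space, second_countable_topology}"
  assumes "f \<in> borel_measurable M" "g \<in> borel_measurable M"
  shows "(\<lambda>x. f x *\<^sub>C g x) \<in> borel_measurable M"
  using assms by (rule borel_measurable_continuous_Pair)
    (intro continuous_intros scaleC.continuous_on)

lemma mult_le_sum_squares: "0 \<le> a \<Longrightarrow> 0 \<le> b \<Longrightarrow> a * b \<le> a\<^sup>2 + b\<^sup>2" for a b :: real
  using sum_squares_bound[of a b] mult_nonneg_nonneg[of a b] by linarith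

text \<open>Polarization: the values at \<open>(g + h, g + h)\<close> and \<open>(\<i> *\<^sub>C g + h, \<i> *\<^sub>C g + h)\<close> determine
  \<open>B g h + B h g\<close> and \<open>B g h - B h g\<close>.\<close>

lemma sesquilinear_eqI:
  fixes B B' :: "'h::complex_hilbert_space \<Rightarrow> 'h \<Rightarrow> complex"
  assumes "\<And>g h k. B (g + h) k = B g k + B h k" "\<And>g h k. B k (g + h) = B k g + B k h"
    and "\<And>c g h. B (c *\<^sub>C g) h = c * B g h" "\<And>c g h. B h (c *\<^sub>C g) = cnj c * B h g"
    and "\<And>g h k. B' (g + h) k = B' g k + B' h k" "\<And>g h k. B' k (g + h) = B' k g + B' k h"
    and "\<And>c g h. B' (c *\<^sub>C g) h = c * B' g h" "\<And>c g h. B' h (c *\<^sub>C g) = cnj c * B' h g"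
    and diag: "\<And>g. B g g = B' g g"
  shows "B g h = B' g h"
proof -
  have 1: "B g h + B h g = B' g h + B' h g"
    using diag[of "g + h"] diag[of g] diag[of h] by (simp add: assms(1,2,5,6) algebra_simps)
  have "B (\<i> *\<^sub>C g) h + B h (\<i> *\<^sub>C g) = B' (\<i> *\<^sub>C g) h + B' h (\<i> *\<^sub>C g)"
    using diag[of "\<i> *\<^sub>C g + h"] diag[of "\<i> *\<^sub>C g"] diag[of h]
    by (simp add: assms(1,2,5,6) algebra_simps)
  then have "\<i> * (B g h - B h g) = \<i> * (B' g h - B' h g)"
    by (simp add: assms(3,4,7,8) algebra_simps)
  then have "B g h - B h g = B' g h - B' h g" by simp
  then have "B g h + B h g + (B g h - B h g) = B' g h + B' h g + (B' g h - B' h g)"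
    using 1 by metis
  then show ?thesis by simp
qed

lemma clinear_opD: "clinear_op A \<Longrightarrow> blinfun_apply A (c *\<^sub>C x) = c *\<^sub>C blinfun_apply A x"
  by (auto simp: clinear_op_def)

lemma clinear_op_eqI:
  assumes A: "clinear_op A" and B: "clinear_op B"
    and eq: "\<And>g. cinner (blinfun_apply A g) g = cinner (blinfun_apply B g) g"
  shows "A = B"
proof (rule blinfun_eqI)
  fix g
  have *: "cinner (blinfun_apply A g) h = cinner (blinfun_apply B g) h" for h
    by (rule sesquilinear_eqI[where B="\<lambda>g h. cinner (blinfun_apply A g) h"
          and B'="\<lambda>g h. cinner (blinfun_apply B g) h"])
      (auto simp: blinfun.add_right cinner_add_left cinner_add_right cinner_scaleC_left
        cinner_scaleC_right clinear_opD[OF A] clinear_opD[OF B] eq)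
  have "cinner (blinfun_apply A g - blinfun_apply B g) (blinfun_apply A g - blinfun_apply B g) = 0"
    using *[of "blinfun_apply A g - blinfun_apply B g"] by (simp add: cinner.diff_left)
  then show "blinfun_apply A g = blinfun_apply B g" by (simp add: cinner_self)
qed

lemma clinear_op_zero: "clinear_op 0" and
  clinear_op_id: "clinear_op id_blinfun" and
  clinear_op_add: "clinear_op A \<Longrightarrow> clinear_op B \<Longrightarrow> clinear_op (A + B)" and
  clinear_op_diff: "clinear_op A \<Longrightarrow> clinear_op B \<Longrightarrow> clinear_op (A - B)" and
  clinear_op_scaleR: "clinear_op A \<Longrightarrow> clinear_op (r *\<^sub>R A)" and
  clinear_op_compose: "clinear_op A \<Longrightarrow> clinear_op B \<Longrightarrow> clinear_op (A o\<^sub>L B)"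
  by (auto simp: clinear_op_def blinfun.add_left blinfun.diff_left blinfun.scaleR_left
      scaleC_add_right scaleC.diff_right scaleR_scaleC scaleC_scaleC mult.commute)

lemma clinear_op_sum: "(\<And>i. i \<in> I \<Longrightarrow> clinear_op (A i)) \<Longrightarrow> clinear_op (\<Sum>i\<in>I. A i)"
  by (induction I rule: infinite_finite_induct) (auto intro: clinear_op_zero clinear_op_add)

lemma blinfun_scale_op: "blinfun_apply (scale_op c A) x = c *\<^sub>C blinfun_apply A x"
proof -
  have "bounded_linear (\<lambda>x. c *\<^sub>C blinfun_apply A x)"
    by (rule bounded_linear_compose[OF scaleC.bounded_linear_right blinfun.bounded_linear_right])
  then show ?thesis by (simp add: scale_op_def bounded_linear_Blinfun_apply)
qed

lemma clinear_op_scale_op: "clinear_op A \<Longrightarrow> clinear_op (scale_op c A)"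
  by (simp add: clinear_op_def blinfun_scale_op scaleC_scaleC mult.commute)

lemma blinfun_outer: "blinfun_apply (outer x y) g = cinner g y *\<^sub>C x"
proof -
  have "bounded_linear (\<lambda>g. cinner g y *\<^sub>C x)"
    by (rule bounded_linear_compose[OF scaleC.bounded_linear_left cinner.bounded_linear_left])
  then show ?thesis by (simp add: outer_def bounded_linear_Blinfun_apply)
qed

lemma clinear_op_outer: "clinear_op (outer x y)"
  by (simp add: clinear_op_def blinfun_outer cinner_scaleC_left scaleC_scaleC)

lemma norm_scale_op: "norm (scale_op c A) = cmod c * norm A"
proof (rule antisym)
  show "norm (scale_op c A) \<le> cmod c * norm A"
    by (rule norm_blinfun_bound)
      (auto simp: blinfun_scale_op norm_scaleC mult.assoc intro!: mult_left_mono norm_blinfun)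
  show "cmod c * norm A \<le> norm (scale_op c A)"
  proof (cases "c = 0")
    case False
    have "norm A \<le> norm (scale_op c A) / cmod c"
    proof (rule norm_blinfun_bound)
      fix x
      have "cmod c * norm (blinfun_apply A x) \<le> norm (scale_op c A) * norm x"
        using norm_blinfun[of "scale_op c A" x] by (simp add: blinfun_scale_op norm_scaleC)
      then show "norm (blinfun_apply A x) \<le> norm (scale_op c A) / cmod c * norm x"
        using False by (simp add: field_simps)
    qed simp
    then show ?thesis using False by (simp add: field_simps)
  qed simp
qed

section \<open>Orthonormal systems and bases\<close>

text \<open>Orthonormal sequences may be padded by zeros, so that finite and infinite systems need not
  be distinguished.\<close>

definition ortho_seq :: "(nat \<Rightarrow> 'h::complex_hilbert_space) \<Rightarrow> bool" where
  "ortho_seq e \<longleftrightarrow> (\<forall>i j. i \<noteq> j \<longrightarrow> cinner (e i) (e j) = 0) \<and> (\<forall>i. norm (e i) = 1 \<or> e i = 0)"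

lemma cinner_fourier_sum:
  assumes "ortho_seq e" "finite I"
  shows "cinner (\<Sum>i\<in>I. c i *\<^sub>C e i) (e j) = (if j \<in> I \<and> e j \<noteq> 0 then c j else 0)"
proof -
  have "cinner (\<Sum>i\<in>I. c i *\<^sub>C e i) (e j) = (\<Sum>i\<in>I. if i = j \<and> e j \<noteq> 0 then c j else 0)"
    unfolding cinner.sum_left
  proof (rule sum.cong)
    fix i
    show "cinner (c i *\<^sub>C e i) (e j) = (if i = j \<and> e j \<noteq> 0 then c j else 0)"
    proof (cases "i = j \<and> e j \<noteq> 0")
      case True
      then have "norm (e j) = 1" using assms(1) by (auto simp: ortho_seq_def)
      then show ?thesis using True by (simp add: cinner_scaleC_left cinner_self)
    qed (use assms(1) in \<open>auto simp: ortho_seq_def cinner_scaleC_left\<close>)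
  qed simp
  also have "\<dots> = (if j \<in> I \<and> e j \<noteq> 0 then c j else 0)"
    using assms(2) by (cases "e j = 0") (auto simp: sum.delta' intro!: sum.neutral)
  finally show ?thesis .
qed

lemma norm_fourier_sum:
  assumes "ortho_seq e" "finite I"
  shows "(norm (\<Sum>i\<in>I. c i *\<^sub>C e i))\<^sup>2 = (\<Sum>i\<in>I. if e i = 0 then 0 else (cmod (c i))\<^sup>2)"
proof -
  have "complex_of_real ((norm (\<Sum>i\<in>I. c i *\<^sub>C e i))\<^sup>2)
      = (\<Sum>j\<in>I. cinner (\<Sum>i\<in>I. c i *\<^sub>C e i) (c j *\<^sub>C e j))"
    by (metis cinner_self cinner.sum_right)
  also have "\<dots> = (\<Sum>j\<in>I. if e j = 0 then 0 else cnj (c j) * c j)"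
    by (rule sum.cong) (auto simp: cinner_scaleC_right cinner_fourier_sum[OF assms])
  also have "\<dots> = (\<Sum>i\<in>I. complex_of_real (if e i = 0 then 0 else (cmod (c i))\<^sup>2))"
    by (rule sum.cong) (auto simp: complex_norm_square[symmetric] mult.commute simp flip: of_real_power)
  finally have "complex_of_real ((norm (\<Sum>i\<in>I. c i *\<^sub>C e i))\<^sup>2)
      = complex_of_real (\<Sum>i\<in>I. if e i = 0 then 0 else (cmod (c i))\<^sup>2)" by simp
  then show ?thesis using of_real_eq_iff by blast
qed

text \<open>The remainder of the partial Fourier sum is orthogonal to the sum, which gives both Bessel's
  inequality and the distance of \<open>x\<close> from the span.\<close>

lemma norm_fourier_remainder:
  assumes e: "ortho_seq e" and I: "finite I"
  shows "(norm (x - (\<Sum>i\<in>I. cinner x (e i) *\<^sub>C e i)))\<^sup>2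
    = (norm x)\<^sup>2 - (\<Sum>i\<in>I. (cmod (cinner x (e i)))\<^sup>2)"
proof -
  let ?s = "\<Sum>i\<in>I. cinner x (e i) *\<^sub>C e i"
  have n: "(norm ?s)\<^sup>2 = (\<Sum>i\<in>I. (cmod (cinner x (e i)))\<^sup>2)"
    unfolding norm_fourier_sum[OF assms] by (intro sum.cong) auto
  have "inner x ?s = Re (\<Sum>i\<in>I. cnj (cinner x (e i)) * cinner x (e i))"
    by (simp add: inner_eq_Re_cinner cinner.sum_right cinner_scaleC_right)
  also have "\<dots> = (\<Sum>i\<in>I. (cmod (cinner x (e i)))\<^sup>2)"
    by (simp add: mult.commute complex_norm_square[symmetric])
  finally show ?thesis
    using n by (simp add: power2_norm_eq_inner inner_diff_left inner_diff_right inner_commute)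
qed

lemma bessel:
  assumes "ortho_seq e" "finite I"
  shows "(\<Sum>i\<in>I. (cmod (cinner x (e i)))\<^sup>2) \<le> (norm x)\<^sup>2"
  using norm_fourier_remainder[OF assms, of x] zero_le_power2[of "norm (x - (\<Sum>i\<in>I. cinner x (e i) *\<^sub>C e i))"]
  by linarith

lemma summable_bessel:
  assumes "ortho_seq e"
  shows "summable (\<lambda>i. (cmod (cinner x (e i)))\<^sup>2)"
  by (rule summableI_nonneg_bounded[where x="(norm x)\<^sup>2"]) (use bessel[OF assms] in auto)

text \<open>A square summable sequence of coefficients is realised by a vector: the partial sums of
  \<open>\<Sum>i. c i *\<^sub>C e i\<close> are Cauchy.\<close>

lemma fourier_series_converges:
  assumes e: "ortho_seq e" and c: "summable (\<lambda>i. (cmod (c i))\<^sup>2)"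
  shows "convergent (\<lambda>n. \<Sum>i<n. c i *\<^sub>C e i)"
proof (rule Cauchy_convergent, rule metric_CauchyI)
  fix \<epsilon> :: real assume "\<epsilon> > 0"
  then obtain N where N: "\<And>m n. m \<ge> N \<Longrightarrow> norm (\<Sum>i\<in>{m..<n}. (cmod (c i))\<^sup>2) < \<epsilon>\<^sup>2"
    using c unfolding summable_Cauchy by (meson zero_less_power)
  have *: "dist (\<Sum>i<m. c i *\<^sub>C e i) (\<Sum>i<n. c i *\<^sub>C e i) < \<epsilon>" if "m \<ge> N" "n \<ge> m" for m n
  proof -
    have "(\<Sum>i<n. c i *\<^sub>C e i) - (\<Sum>i<m. c i *\<^sub>C e i) = (\<Sum>i\<in>{m..<n}. c i *\<^sub>C e i)"
      using sum_diff_nat_ivl[of 0 m n "\<lambda>i. c i *\<^sub>C e i"] that by (simp add: lessThan_atLeast0)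
    then have "(dist (\<Sum>i<m. c i *\<^sub>C e i) (\<Sum>i<n. c i *\<^sub>C e i))\<^sup>2
        = (norm (\<Sum>i\<in>{m..<n}. c i *\<^sub>C e i))\<^sup>2"
      by (metis dist_commute dist_norm)
    also have "\<dots> \<le> (\<Sum>i\<in>{m..<n}. (cmod (c i))\<^sup>2)"
      unfolding norm_fourier_sum[OF e finite_atLeastLessThan] by (intro sum_mono) auto
    also have "\<dots> < \<epsilon>\<^sup>2" using N[OF that(1), of n] by (auto simp: abs_less_iff)
    finally show ?thesis using \<open>\<epsilon> > 0\<close> by (meson less_imp_le power2_less_imp_less)
  qed
  show "\<exists>M. \<forall>m\<ge>M. \<forall>n\<ge>M. dist (\<Sum>i<m. c i *\<^sub>C e i) (\<Sum>i<n. c i *\<^sub>C e i) < \<epsilon>"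
  proof (intro exI allI impI)
    fix m n assume "m \<ge> N" "n \<ge> N"
    then show "dist (\<Sum>i<m. c i *\<^sub>C e i) (\<Sum>i<n. c i *\<^sub>C e i) < \<epsilon>"
      using *[of m n] *[of n m] by (cases "m \<le> n") (auto simp: dist_commute)
  qed
qed

lemma fourier_coefficient_limit:
  assumes e: "ortho_seq e" and lim: "(\<lambda>n. \<Sum>i<n. c i *\<^sub>C e i) \<longlonglongrightarrow> y"
  shows "cinner y (e j) = (if e j = 0 then 0 else c j)"
proof (rule LIMSEQ_unique)
  show "(\<lambda>n. cinner (\<Sum>i<n. c i *\<^sub>C e i) (e j)) \<longlonglongrightarrow> cinner y (e j)"
    by (intro cinner.tendsto lim tendsto_const)
  have "eventually (\<lambda>n. cinner (\<Sum>i<n. c i *\<^sub>C e i) (e j) = (if e j = 0 then 0 else c j)) sequentially"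
    using eventually_gt_at_top[of j] by eventually_elim (simp add: cinner_fourier_sum[OF e])
  then show "(\<lambda>n. cinner (\<Sum>i<n. c i *\<^sub>C e i) (e j)) \<longlonglongrightarrow> (if e j = 0 then 0 else c j)"
    by (rule tendsto_eventually)
qed

text \<open>If nothing is orthogonal to an orthonormal sequence, Fourier series converge to the vector,
  because the remainder is orthogonal to the sequence.\<close>

lemma fourier_expansion:
  assumes e: "ortho_seq e" and total: "\<And>z. (\<And>i. cinner z (e i) = 0) \<Longrightarrow> z = 0"
  shows "(\<lambda>n. \<Sum>i<n. cinner x (e i) *\<^sub>C e i) \<longlonglongrightarrow> x"
proof -
  obtain y where y: "(\<lambda>n. \<Sum>i<n. cinner x (e i) *\<^sub>C e i) \<longlonglongrightarrow> y"
    using fourier_series_converges[OF e summable_bessel[OF e]] by (auto simp: convergent_def)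
  have "cinner (x - y) (e i) = 0" for i
    using fourier_coefficient_limit[OF e y, of i] by (auto simp: cinner.diff_left)
  then have "x - y = 0" by (rule total)
  then show ?thesis using y by simp
qed

lemma parseval:
  assumes e: "ortho_seq e" and total: "\<And>z. (\<And>i. cinner z (e i) = 0) \<Longrightarrow> z = 0"
  shows "(\<lambda>i. (cmod (cinner x (e i)))\<^sup>2) sums (norm x)\<^sup>2"
    and "(\<lambda>i. cinner x (e i) * cnj (cinner y (e i))) sums cinner x y"
proof -
  let ?s = "\<lambda>n. \<Sum>i<n. cinner x (e i) *\<^sub>C e i"
  have lim: "?s \<longlonglongrightarrow> x" by (rule fourier_expansion[OF assms])
  have "(norm (?s n))\<^sup>2 = (\<Sum>i<n. (cmod (cinner x (e i)))\<^sup>2)" for n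
    unfolding norm_fourier_sum[OF e finite_lessThan] by (intro sum.cong) auto
  then show "(\<lambda>i. (cmod (cinner x (e i)))\<^sup>2) sums (norm x)\<^sup>2"
    unfolding sums_def using tendsto_power[OF tendsto_norm[OF lim], of 2] by simp
  have "cinner (?s n) y = (\<Sum>i<n. cinner x (e i) * cnj (cinner y (e i)))" for n
    by (simp add: cinner.sum_left cinner_scaleC_left cinner_commute[symmetric])
  then show "(\<lambda>i. cinner x (e i) * cnj (cinner y (e i))) sums cinner x y"
    unfolding sums_def using cinner.tendsto[OF lim tendsto_const, of y] by simp
qed

definition orthonormal_set :: "'h::complex_hilbert_space set \<Rightarrow> bool" where
  "orthonormal_set B \<longleftrightarrow> (\<forall>x\<in>B. \<forall>y\<in>B. cinner x y = (if x = y then 1 else 0))"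

lemma orthonormal_set_norm: "orthonormal_set B \<Longrightarrow> x \<in> B \<Longrightarrow> norm x = 1"
proof -
  assume "orthonormal_set B" "x \<in> B"
  then have "complex_of_real ((norm x)\<^sup>2) = complex_of_real 1"
    using cinner_self[of x] by (simp add: orthonormal_set_def)
  then have "(norm x)\<^sup>2 = 1" using of_real_eq_iff by blast
  then show ?thesis by (simp add: power2_eq_1_iff) (use norm_ge_zero[of x] in linarith)
qed

text \<open>Countable orthonormal sets are turned into sequences. Indices that are not used by the
  enumeration are mapped to \<open>0\<close>, which contributes nothing to Fourier series and traces.\<close>

definition enumerate_set :: "'h::complex_hilbert_space set \<Rightarrow> nat \<Rightarrow> 'h" where
  "enumerate_set B n = (if n \<in> to_nat_on B ` B then from_nat_into B n else 0)"

text \<open>Distinct orthonormal vectors have distance \<open>sqrt 2\<close>, so balls of radius \<open>1 / 2\<close> around them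
  are disjoint.\<close>

lemma countable_orthonormal_set:
  fixes B :: "'h::{complex_hilbert_space, second_countable_topology} set"
  assumes B: "orthonormal_set B"
  shows "countable B"
proof -
  have far: "dist x y > 1" if "x \<in> B" "y \<in> B" "x \<noteq> y" for x y
  proof -
    have "inner x y = 0" using B that by (simp add: orthonormal_set_def inner_eq_Re_cinner)
    then have "(dist x y)\<^sup>2 = (norm x)\<^sup>2 + (norm y)\<^sup>2"
      by (simp add: dist_norm power2_norm_eq_inner inner_diff_left inner_diff_right inner_commute)
    also have "\<dots> = 2" using orthonormal_set_norm[OF B] that by simp
    finally have "1 < (dist x y)\<^sup>2" by simp
    then show ?thesis
      by (metis abs_of_nonneg one_power2 power2_less_imp_less zero_le_dist)
  qed
  have "inj_on (\<lambda>x. ball x (1/2)) B"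
  proof (rule inj_onI, rule ccontr)
    fix x y assume xy: "x \<in> B" "y \<in> B" "ball x (1/2) = ball y (1/2)" "x \<noteq> y"
    then have "y \<in> ball x (1/2)" by simp
    then show False using far[OF xy(1,2,4)] by simp
  qed
  moreover have "countable ((\<lambda>x. ball x (1/2)) ` B)"
  proof (rule countable_disjoint_open_subsets)
    show "pairwise disjnt ((\<lambda>x. ball x (1/2)) ` B)"
    proof (rule pairwise_imageI)
      fix x y assume xy: "x \<in> B" "y \<in> B" "x \<noteq> y"
      show "disjnt (ball x (1/2)) (ball y (1/2))"
        unfolding disjnt_iff
      proof (intro allI notI)
        fix z assume "z \<in> ball x (1/2) \<and> z \<in> ball y (1/2)"
        then have "dist x z < 1/2" "dist y z < 1/2" by auto
        then show False using far[OF xy] dist_triangle2[of x y z] by linarith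
      qed
    qed
  qed auto
  ultimately show ?thesis using countable_image_inj_on by blast
qed

lemma enumerate_set:
  assumes B: "orthonormal_set B" "countable B"
  shows "ortho_seq (enumerate_set B)"
    and "b \<in> B \<Longrightarrow> \<exists>n. enumerate_set B n = b"
    and "enumerate_set B n \<in> insert 0 B"
proof -
  let ?I = "to_nat_on B ` B"
  have inB: "enumerate_set B n \<in> B" if "n \<in> ?I" for n
    using that from_nat_into[of B n] by (auto simp: enumerate_set_def)
  have inj: "m = n" if "enumerate_set B m = enumerate_set B n" "m \<in> ?I" "n \<in> ?I" for m n
    using that B(2) by (auto simp: enumerate_set_def)
  show "enumerate_set B n \<in> insert 0 B"
    using inB[of n] by (auto simp: enumerate_set_def)
  show "\<exists>n. enumerate_set B n = b" if "b \<in> B"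
    using that B(2) by (intro exI[of _ "to_nat_on B b"]) (auto simp: enumerate_set_def)
  show "ortho_seq (enumerate_set B)"
    unfolding ortho_seq_def
  proof (intro conjI allI impI)
    fix m n :: nat assume mn: "m \<noteq> n"
    show "cinner (enumerate_set B m) (enumerate_set B n) = 0"
    proof (cases "m \<in> ?I \<and> n \<in> ?I")
      case True
      then have "enumerate_set B m \<noteq> enumerate_set B n" using inj mn by blast
      then show ?thesis
        using inB True B(1) by (simp add: orthonormal_set_def)
    qed (auto simp: enumerate_set_def)
  next
    fix n
    show "norm (enumerate_set B n) = 1 \<or> enumerate_set B n = 0"
      using inB[of n] orthonormal_set_norm[OF B(1)] by (auto simp: enumerate_set_def)
  qed
qed

text \<open>A maximal orthonormal set spans a dense subspace: otherwise the remainder of a Fourier series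
  would yield a further unit vector orthogonal to the set.\<close>

lemma ex_onb: "\<exists>B :: 'h::{complex_hilbert_space, second_countable_topology} set. is_onb B"
proof -
  have "\<exists>B\<in>{B :: 'h set. orthonormal_set B}. \<forall>X\<in>{B. orthonormal_set B}. B \<subseteq> X \<longrightarrow> X = B"
  proof (rule subset_Zorn')
    fix C :: "'h set set" assume C: "subset.chain {B. orthonormal_set B} C"
    have "cinner x y = (if x = y then 1 else 0)" if xy: "x \<in> \<Union>C" "y \<in> \<Union>C" for x y
    proof -
      obtain S T where ST: "S \<in> C" "x \<in> S" "T \<in> C" "y \<in> T" using xy by auto
      have "S \<subseteq> T \<or> T \<subseteq> S" using C ST unfolding subset.chain_def by blast
      moreover have "orthonormal_set S" "orthonormal_set T"
        using C ST unfolding subset.chain_def by auto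
      ultimately show ?thesis using ST unfolding orthonormal_set_def by blast
    qed
    then show "\<Union>C \<in> {B. orthonormal_set B}" by (simp add: orthonormal_set_def)
  qed
  then obtain B :: "'h set" where B: "orthonormal_set B"
    and max: "\<And>X. orthonormal_set X \<Longrightarrow> B \<subseteq> X \<Longrightarrow> X = B" by blast
  define e where "e = enumerate_set B"
  note enum = enumerate_set[OF B countable_orthonormal_set[OF B], folded e_def]
  have total: "z = 0" if z: "\<And>i. cinner z (e i) = 0" for z
  proof (rule ccontr)
    assume "z \<noteq> 0"
    define u where "u = complex_of_real (inverse (norm z)) *\<^sub>C z"
    have zB: "cinner z b = 0" if "b \<in> B" for b using enum(2)[OF that] z by blast
    have uB: "cinner u b = 0" "cinner b u = 0" if "b \<in> B" for b
      using zB[OF that] cinner_commute[of b u] by (simp_all add: u_def cinner_scaleC_left)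
    have "norm u = 1" using \<open>z \<noteq> 0\<close> by (simp add: u_def norm_scaleC norm_inverse)
    then have "cinner u u = 1" by (simp add: cinner_self)
    then have "orthonormal_set (insert u B)"
      using B uB unfolding orthonormal_set_def by auto
    then have "u \<in> B" using max by blast
    then show False using uB(1) \<open>cinner u u = 1\<close> by fastforce
  qed
  have "x \<in> closure (chilbert.span B)" for x
  proof -
    have "(\<Sum>i<n. cinner x (e i) *\<^sub>C e i) \<in> chilbert.span B" for n
      using enum(3) by (intro chilbert.span_sum chilbert.span_scale)
        (metis chilbert.span_base chilbert.span_zero insertE)
    moreover have "(\<lambda>n. \<Sum>i<n. cinner x (e i) *\<^sub>C e i) \<longlonglongrightarrow> x"
      using enum(1) total by (rule fourier_expansion)
    ultimately show ?thesis
      unfolding closure_sequential by (intro exI[of _ "\<lambda>n. \<Sum>i<n. cinner x (e i) *\<^sub>C e i"] conjI allI)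
  qed
  then have "is_onb B" using B unfolding is_onb_def orthonormal_set_def by blast
  then show ?thesis ..
qed

definition onb_seq :: "nat \<Rightarrow> 'h::{complex_hilbert_space, second_countable_topology}" where
  "onb_seq = enumerate_set some_onb"

lemma is_onb_some_onb: "is_onb (some_onb :: 'h::{complex_hilbert_space, second_countable_topology} set)"
  unfolding some_onb_def using ex_onb by (rule someI_ex)

lemma orthonormal_some_onb:
  "orthonormal_set (some_onb :: 'h::{complex_hilbert_space, second_countable_topology} set)"
  using is_onb_some_onb unfolding is_onb_def orthonormal_set_def by blast

lemmas countable_some_onb = countable_orthonormal_set[OF orthonormal_some_onb]

lemmas ortho_seq_onb = enumerate_set(1)[OF orthonormal_some_onb countable_some_onb, folded onb_seq_def]

lemma onb_seq_total:
  assumes "\<And>i. cinner z (onb_seq i) = 0"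
  shows "z = (0 :: 'h::{complex_hilbert_space, second_countable_topology})"
proof -
  have B: "cinner z b = 0" if "b \<in> some_onb" for b
    using enumerate_set(2)[OF orthonormal_some_onb countable_some_onb that] assms
    unfolding onb_seq_def by metis
  have "cinner z y = 0" if "y \<in> chilbert.span some_onb" for y
    using that by (induction rule: chilbert.span_induct_alt)
      (auto simp: cinner_add_right cinner_scaleC_right B)
  then have "chilbert.span some_onb \<subseteq> {y. cinner z y = 0}" by blast
  then have "closure (chilbert.span some_onb) \<subseteq> {y. cinner z y = 0}"
    by (intro closure_minimal closed_Collect_eq cinner.continuous_on continuous_intros)
  then have "cinner z z = 0"
    using is_onb_some_onb[where 'h='h] unfolding is_onb_def by auto
  then show ?thesis by (simp add: cinner_self)
qed

lemmas onb_parseval = parseval[OF ortho_seq_onb onb_seq_total]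

lemmas onb_expansion = fourier_expansion[OF ortho_seq_onb onb_seq_total]

lemma has_sum_some_onb:
  fixes g :: "'h::{complex_hilbert_space, second_countable_topology} \<Rightarrow> 'b::{comm_monoid_add, topological_space}"
  assumes "g 0 = 0"
  shows "(g has_sum s) some_onb \<longleftrightarrow> ((\<lambda>n. g (onb_seq n)) has_sum s) UNIV"
proof -
  let ?B = "some_onb :: 'h set"
  have "(g has_sum s) ?B \<longleftrightarrow> ((\<lambda>n. g (from_nat_into ?B n)) has_sum s) (to_nat_on ?B ` ?B)"
    by (subst has_sum_reindex) (auto simp: o_def countable_some_onb inj_on_to_nat_on intro!: has_sum_cong)
  also have "\<dots> \<longleftrightarrow> ((\<lambda>n. g (onb_seq n)) has_sum s) UNIV"
    by (rule has_sum_cong_neutral) (auto simp: onb_seq_def enumerate_set_def assms)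
  finally show ?thesis .
qed

section \<open>The trace and positive operators\<close>

lemma tr_eqI:
  assumes "((\<lambda>n. cinner (blinfun_apply A (onb_seq n)) (onb_seq n)) has_sum s) UNIV"
  shows "tr A = s"
  using assms unfolding tr_def
  by (intro infsumI) (subst has_sum_some_onb; simp)

lemma has_sum_cinner_onb:
  "((\<lambda>n. cinner x (onb_seq n) * cnj (cinner y (onb_seq n))) has_sum cinner x y) UNIV"
proof (rule norm_summable_imp_has_sum)
  show "summable (\<lambda>n. cmod (cinner x (onb_seq n) * cnj (cinner y (onb_seq n))))"
  proof (rule summable_comparison_test')
    show "summable (\<lambda>n. (cmod (cinner x (onb_seq n)))\<^sup>2 + (cmod (cinner y (onb_seq n)))\<^sup>2)"
      by (intro summable_add summable_bessel ortho_seq_onb)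
    fix n
    show "norm (cmod (cinner x (onb_seq n) * cnj (cinner y (onb_seq n))))
      \<le> (cmod (cinner x (onb_seq n)))\<^sup>2 + (cmod (cinner y (onb_seq n)))\<^sup>2"
      unfolding complex_mod_cnj norm_mult real_norm_def abs_mult abs_norm_cancel
      by (intro mult_le_sum_squares norm_ge_zero)
  qed
qed (rule onb_parseval)

text \<open>Parseval's identity for \<open>A g\<close> and \<open>g\<close>. Rank one operators thus recover quadratic forms from
  traces.\<close>

lemma tr_outer:
  fixes A :: "'h::{complex_hilbert_space, second_countable_topology} \<Rightarrow>\<^sub>L 'h"
  assumes "clinear_op A"
  shows "tr (A o\<^sub>L outer g g) = cinner (blinfun_apply A g) g"
proof (rule tr_eqI)
  show "((\<lambda>n. cinner (blinfun_apply (A o\<^sub>L outer g g) (onb_seq n)) (onb_seq n))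
      has_sum cinner (blinfun_apply A g) g) UNIV"
    using has_sum_cinner_onb[of "blinfun_apply A g" g]
    by (simp add: blinfun_outer clinear_opD[OF assms] cinner_scaleC_left mult.commute
        cinner_commute[symmetric])
qed

lemma outer_in_S1_pos:
  fixes g :: "'h::{complex_hilbert_space, second_countable_topology}"
  shows "outer g g \<in> S1_pos"
proof -
  have *: "cinner (blinfun_apply (outer g g) x) x = complex_of_real ((cmod (cinner x g))\<^sup>2)" for x
    unfolding complex_norm_square
    by (simp add: blinfun_outer cinner_scaleC_left cinner_commute[symmetric])
  have "((\<lambda>n. cinner (blinfun_apply (outer g g) (onb_seq n)) (onb_seq n))
      has_sum cinner g g) UNIV"
    using has_sum_cinner_onb[of g g]
    by (simp add: blinfun_outer cinner_scaleC_left mult.commute cinner_commute[symmetric])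
  then have "(\<lambda>e. cinner (blinfun_apply (outer g g) e) e) summable_on some_onb"
    unfolding summable_on_def by (subst has_sum_some_onb) auto
  then show ?thesis
    unfolding S1_pos_def using * by (auto simp: clinear_op_outer simp flip: of_real_power)
qed

lemma S1_posD:
  assumes "A \<in> S1_pos"
  shows "clinear_op A"
    and "cinner (blinfun_apply A x) x = complex_of_real (Re (cinner (blinfun_apply A x) x))"
    and "0 \<le> Re (cinner (blinfun_apply A x) x)"
  using assms by (auto simp: S1_pos_def complex_is_Real_iff complex_eq_iff)

lemma tr_sums:
  fixes A :: "'h::{complex_hilbert_space, second_countable_topology} \<Rightarrow>\<^sub>L 'h"
  assumes A: "A \<in> S1_pos"
  shows "(\<lambda>n. Re (cinner (blinfun_apply A (onb_seq n)) (onb_seq n))) sums Re (tr A)"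
    and "tr A = complex_of_real (Re (tr A))" "0 \<le> Re (tr A)"
proof -
  have "(\<lambda>e. cinner (blinfun_apply A e) e) summable_on some_onb"
    using A by (simp add: S1_pos_def)
  then obtain s where s: "((\<lambda>e. cinner (blinfun_apply A e) e) has_sum s) some_onb"
    by (auto simp: summable_on_def)
  then have *: "((\<lambda>n. cinner (blinfun_apply A (onb_seq n)) (onb_seq n)) has_sum s) UNIV"
    by (subst (asm) has_sum_some_onb) auto
  then have s: "s = tr A" using tr_eqI by metis
  have sums: "(\<lambda>n. cinner (blinfun_apply A (onb_seq n)) (onb_seq n)) sums tr A"
    using has_sum_imp_sums[OF *] s by simp
  show 1: "(\<lambda>n. Re (cinner (blinfun_apply A (onb_seq n)) (onb_seq n))) sums Re (tr A)"
    using sums by (rule sums_Re)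
  have "(\<lambda>n. complex_of_real (Re (cinner (blinfun_apply A (onb_seq n)) (onb_seq n))))
      sums complex_of_real (Re (tr A))"
    using 1 by (rule sums_of_real)
  then show "tr A = complex_of_real (Re (tr A))"
    using sums S1_posD(2)[OF A] sums_unique2 by (metis (no_types, lifting) sums_cong)
  show "0 \<le> Re (tr A)"
    using 1 S1_posD(3)[OF A] by (intro sums_le[OF _ sums_zero 1]) auto
qed

text \<open>Both sides are sesquilinear and agree on the diagonal, where they are real.\<close>

lemma positive_op_hermitian:
  assumes A: "A \<in> S1_pos"
  shows "cnj (cinner (blinfun_apply A y) x) = cinner (blinfun_apply A x) y"
proof -
  have d: "cnj (cinner (blinfun_apply A g) g) = cinner (blinfun_apply A g) g" for g
    by (metis S1_posD(2)[OF A] complex_cnj_complex_of_real)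
  show ?thesis
    by (rule sesquilinear_eqI[where B="\<lambda>x y. cnj (cinner (blinfun_apply A y) x)"
          and B'="\<lambda>x y. cinner (blinfun_apply A x) y"])
      (auto simp: d blinfun.add_right cinner_add_left cinner_add_right cinner_scaleC_left
        cinner_scaleC_right clinear_opD[OF S1_posD(1)[OF A]])
qed

text \<open>The Cauchy--Schwarz inequality for the semi-inner product \<open>cinner (A x) y\<close>, which need not be
  definite: the quadratic form is nonnegative at \<open>x - r * s *\<^sub>C y\<close> for all real \<open>r\<close>, where \<open>s\<close> is the mixed
  value. If the form vanishes at \<open>y\<close>, large \<open>r\<close> force \<open>s = 0\<close>; otherwise \<open>r\<close> is the minimizer.\<close>

lemma positive_op_Cauchy_Schwarz:
  assumes A: "A \<in> S1_pos"
  shows "(cmod (cinner (blinfun_apply A x) y))\<^sup>2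
    \<le> Re (cinner (blinfun_apply A x) x) * Re (cinner (blinfun_apply A y) y)"
proof -
  define s where "s = cinner (blinfun_apply A x) y"
  define a where "a = Re (cinner (blinfun_apply A x) x)"
  define b where "b = Re (cinner (blinfun_apply A y) y)"
  have herm: "cinner (blinfun_apply A y) x = cnj s"
    using positive_op_hermitian[OF A, of x y] by (simp add: s_def)
  have quad: "0 \<le> a - 2 * r * (cmod s)\<^sup>2 + r\<^sup>2 * (cmod s)\<^sup>2 * b" for r :: real
  proof -
    define l where "l = - (complex_of_real r * s)"
    have "cinner (blinfun_apply A (x + l *\<^sub>C y)) (x + l *\<^sub>C y)
      = cinner (blinfun_apply A x) x + cnj l * s + l * cnj s + l * cnj l * cinner (blinfun_apply A y) y"
      by (simp add: blinfun.add_right clinear_opD[OF S1_posD(1)[OF A]] cinner_add_left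
          cinner_add_right cinner_scaleC_left cinner_scaleC_right herm s_def[symmetric] algebra_simps)
    moreover have "cnj l * s = complex_of_real (- r * (cmod s)\<^sup>2)" "l * cnj s = complex_of_real (- r * (cmod s)\<^sup>2)"
      unfolding of_real_mult complex_norm_square by (auto simp: l_def)
    moreover have "l * cnj l = complex_of_real (r\<^sup>2 * (cmod s)\<^sup>2)"
      unfolding of_real_mult complex_norm_square by (auto simp: l_def power2_eq_square)
    ultimately have "Re (cinner (blinfun_apply A (x + l *\<^sub>C y)) (x + l *\<^sub>C y))
      = a - 2 * r * (cmod s)\<^sup>2 + r\<^sup>2 * (cmod s)\<^sup>2 * b"
      by (simp only: plus_complex.sel Re_complex_of_real)
        (simp add: a_def b_def algebra_simps)
    then show ?thesis using S1_posD(3)[OF A, of "x + l *\<^sub>C y"] by simp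
  qed
  have ab: "0 \<le> a" "0 \<le> b" using S1_posD(3)[OF A] by (auto simp: a_def b_def)
  have "(cmod s)\<^sup>2 \<le> a * b"
  proof (cases "b = 0")
    case True
    have "s = 0"
    proof (rule ccontr)
      assume "s \<noteq> 0"
      then have "0 < (cmod s)\<^sup>2" by simp
      then show False
        using quad[of "(a + 1) / (cmod s)\<^sup>2"] True ab \<open>s \<noteq> 0\<close> by simp
    qed
    then show ?thesis using ab by simp
  next
    case False
    then have "0 < b" using ab by simp
    have "0 \<le> a - (cmod s)\<^sup>2 / b"
      using quad[of "1 / b"] False by (simp add: power2_eq_square)
    then show ?thesis using \<open>0 < b\<close> by (simp add: field_simps)
  qed
  then show ?thesis by (simp add: s_def a_def b_def)
qed

text \<open>Parseval's identity and the Cauchy--Schwarz inequality for the form of \<open>A\<close> bound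
  \<open>(norm (A x))\<^sup>2\<close> by the form at \<open>x\<close> times the trace.\<close>

lemma norm_le_tr:
  fixes A :: "'h::{complex_hilbert_space, second_countable_topology} \<Rightarrow>\<^sub>L 'h"
  assumes A: "A \<in> S1_pos"
  shows "norm A \<le> Re (tr A)"
proof (rule norm_blinfun_bound)
  fix x
  let ?a = "Re (cinner (blinfun_apply A x) x)"
  have "(norm (blinfun_apply A x))\<^sup>2 \<le> ?a * Re (tr A)"
  proof (rule sums_le)
    show "(\<lambda>n. (cmod (cinner (blinfun_apply A x) (onb_seq n)))\<^sup>2) sums (norm (blinfun_apply A x))\<^sup>2"
      by (rule onb_parseval)
    show "(\<lambda>n. ?a * Re (cinner (blinfun_apply A (onb_seq n)) (onb_seq n))) sums (?a * Re (tr A))"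
      by (intro sums_mult tr_sums A)
  qed (rule positive_op_Cauchy_Schwarz[OF A])
  also have "\<dots> \<le> (norm (blinfun_apply A x) * norm x) * Re (tr A)"
    by (intro mult_right_mono tr_sums(3)[OF A] order.trans[OF complex_Re_le_cmod cmod_cinner_le])
  finally have "norm (blinfun_apply A x) * norm (blinfun_apply A x)
      \<le> norm (blinfun_apply A x) * (Re (tr A) * norm x)"
    by (simp add: power2_eq_square algebra_simps)
  then show "norm (blinfun_apply A x) \<le> Re (tr A) * norm x"
    using tr_sums(3)[OF A] by (cases "blinfun_apply A x = 0") (auto simp: mult_le_cancel_left)
qed (rule tr_sums(3)[OF A])

text \<open>The Riesz representation theorem, applied to \<open>\<lambda>x. cinner (U x) g\<close>; the vector \<open>h\<close> is the
  image of \<open>g\<close> under the adjoint of \<open>U\<close>.\<close>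

lemma ex_adjoint_vector:
  fixes U :: "'h::{complex_hilbert_space, second_countable_topology} \<Rightarrow>\<^sub>L 'h"
  assumes U: "clinear_op U"
  shows "\<exists>h. \<forall>x. cinner (blinfun_apply U x) g = cinner x h"
proof -
  define c where "c i = cinner g (blinfun_apply U (onb_seq i))" for i
  have "summable (\<lambda>i. (cmod (c i))\<^sup>2)"
  proof (rule summableI_nonneg_bounded)
    fix n
    define y where "y = (\<Sum>i<n. c i *\<^sub>C (onb_seq i :: 'h))"
    define s where "s = (\<Sum>i<n. (cmod (c i))\<^sup>2)"
    have "(norm y)\<^sup>2 \<le> s"
      unfolding y_def s_def norm_fourier_sum[OF ortho_seq_onb finite_lessThan] by (intro sum_mono) auto
    have "complex_of_real s = cinner (blinfun_apply U y) g"
      by (simp add: y_def s_def blinfun.sum_right clinear_opD[OF U] cinner.sum_left cinner_scaleC_left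
          c_def complex_norm_square cinner_commute[symmetric] del: of_real_power)
    then have "s \<le> norm U * norm y * norm g"
      by (metis Re_complex_of_real complex_Re_le_cmod cmod_cinner_le norm_blinfun mult_right_mono
          norm_ge_zero order_trans)
    have "0 \<le> s" unfolding s_def by (simp add: sum_nonneg)
    have "s\<^sup>2 \<le> (norm U * norm y * norm g)\<^sup>2"
      using \<open>0 \<le> s\<close> \<open>s \<le> _\<close> by (rule power_mono[rotated])
    also have "\<dots> = (norm U * norm g)\<^sup>2 * (norm y)\<^sup>2" by (simp add: power_mult_distrib)
    also have "\<dots> \<le> (norm U * norm g)\<^sup>2 * s" using \<open>(norm y)\<^sup>2 \<le> s\<close> by (intro mult_left_mono) auto
    finally have "s * s \<le> (norm U * norm g)\<^sup>2 * s" by (simp add: power2_eq_square)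
    then show "(\<Sum>i<n. (cmod (c i))\<^sup>2) \<le> (norm U * norm g)\<^sup>2"
      using \<open>0 \<le> s\<close> unfolding s_def[symmetric] by (cases "s = 0") auto
  qed auto
  then obtain h :: 'h where h: "(\<lambda>n. \<Sum>i<n. c i *\<^sub>C onb_seq i) \<longlonglongrightarrow> h"
    using fourier_series_converges[OF ortho_seq_onb] by (auto simp: convergent_def)
  have "cinner (blinfun_apply U x) g = cinner x h" for x
  proof -
    let ?x = "\<lambda>n. \<Sum>i<n. cinner x (onb_seq i) *\<^sub>C onb_seq i"
    have "(\<lambda>n. cinner (blinfun_apply U (?x n)) g) \<longlonglongrightarrow> cinner (blinfun_apply U x) g"
      by (intro cinner.tendsto tendsto_const blinfun.tendsto onb_expansion)
    moreover have "cinner (blinfun_apply U (?x n)) g = cinner x (\<Sum>i<n. c i *\<^sub>C onb_seq i)" for n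
      by (simp add: blinfun.sum_right clinear_opD[OF U] cinner.sum_left cinner_scaleC_left
          cinner.sum_right cinner_scaleC_right c_def cinner_commute[symmetric] mult.commute)
    moreover have "(\<lambda>n. cinner x (\<Sum>i<n. c i *\<^sub>C onb_seq i)) \<longlonglongrightarrow> cinner x h"
      by (intro cinner.tendsto tendsto_const h)
    ultimately show ?thesis by (simp add: LIMSEQ_unique)
  qed
  then show ?thesis by blast
qed

section \<open>Square integrable random elements\<close>

lemma L2_measurable: "Y \<in> L2 M \<Longrightarrow> Y \<in> borel_measurable M"
  and L2_integrable: "Y \<in> L2 M \<Longrightarrow> integrable M (\<lambda>x. (norm (Y x))\<^sup>2)"
  by (auto simp: L2_def)

lemma L2_iff_nn_integral:
  "Y \<in> L2 M \<longleftrightarrow> Y \<in> borel_measurable M \<and> (\<integral>\<^sup>+x. ennreal ((norm (Y x))\<^sup>2) \<partial>M) < \<infinity>"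
proof -
  have "integrable M (\<lambda>x. (norm (Y x))\<^sup>2) \<longleftrightarrow> (\<integral>\<^sup>+x. ennreal ((norm (Y x))\<^sup>2) \<partial>M) < \<infinity>"
    if "Y \<in> borel_measurable M"
    using that by (simp add: integrable_iff_bounded)
  then show ?thesis by (auto simp: L2_def)
qed

lemma L2_norm_nonneg: "0 \<le> L2_norm M Y"
  by (simp add: L2_norm_def)

lemma L2_norm_power2: "(L2_norm M Y)\<^sup>2 = (\<integral>x. (norm (Y x))\<^sup>2 \<partial>M)"
  by (simp add: L2_norm_def)

lemma ennreal_L2_norm_power2:
  "Y \<in> L2 M \<Longrightarrow> ennreal ((L2_norm M Y)\<^sup>2) = (\<integral>\<^sup>+x. ennreal ((norm (Y x))\<^sup>2) \<partial>M)"
  by (simp add: L2_norm_power2 L2_integrable nn_integral_eq_integral)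

lemma L2_norm_le_iff:
  assumes "Y \<in> L2 M" "0 \<le> c"
  shows "L2_norm M Y \<le> c \<longleftrightarrow> (\<integral>\<^sup>+x. ennreal ((norm (Y x))\<^sup>2) \<partial>M) \<le> ennreal (c\<^sup>2)"
proof -
  have "L2_norm M Y \<le> c \<longleftrightarrow> (L2_norm M Y)\<^sup>2 \<le> c\<^sup>2"
    using assms(2) L2_norm_nonneg by (metis power2_le_imp_le power_mono)
  then show ?thesis by (simp add: ennreal_L2_norm_power2[OF assms(1), symmetric])
qed

lemma L2_norm_cong_AE:
  assumes "Y \<in> borel_measurable M" "Y' \<in> borel_measurable M" "AE x in M. Y x = Y' x"
  shows "L2_norm M Y = L2_norm M Y'"
  unfolding L2_norm_def using assms by (intro arg_cong[of _ _ sqrt] integral_cong_AE) auto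

lemma L2_cong_AE:
  assumes "Y \<in> L2 M" "Y' \<in> borel_measurable M" "AE x in M. Y x = Y' x"
  shows "Y' \<in> L2 M"
proof -
  have "(\<integral>\<^sup>+x. ennreal ((norm (Y x))\<^sup>2) \<partial>M) = (\<integral>\<^sup>+x. ennreal ((norm (Y' x))\<^sup>2) \<partial>M)"
    using assms(3) by (intro nn_integral_cong_AE) auto
  then show ?thesis using assms by (simp add: L2_iff_nn_integral)
qed

lemma L2_zero: "(\<lambda>x. 0) \<in> L2 M" "L2_norm M (\<lambda>x. 0) = 0"
  by (auto simp: L2_def L2_norm_def)

lemma norm_add_power2_le: "(norm (a + b))\<^sup>2 \<le> 2 * (norm a)\<^sup>2 + 2 * (norm b)\<^sup>2"
  for a b :: "'b::real_normed_vector"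
proof -
  have "(norm (a + b))\<^sup>2 \<le> (norm a + norm b)\<^sup>2"
    by (intro power_mono norm_triangle_ineq norm_ge_zero)
  also have "\<dots> \<le> 2 * (norm a)\<^sup>2 + 2 * (norm b)\<^sup>2"
    using sum_squares_bound[of "norm a" "norm b"] by (simp add: power2_sum)
  finally show ?thesis .
qed

lemma L2_add: "Y \<in> L2 M \<Longrightarrow> W \<in> L2 M \<Longrightarrow> (\<lambda>x. Y x + W x) \<in> L2 M"
proof -
  assume YW: "Y \<in> L2 M" "W \<in> L2 M"
  have "integrable M (\<lambda>x. (norm (Y x + W x))\<^sup>2)"
  proof (rule Bochner_Integration.integrable_bound)
    show "integrable M (\<lambda>x. 2 * (norm (Y x))\<^sup>2 + 2 * (norm (W x))\<^sup>2)"
      using YW by (simp add: L2_integrable)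
  qed (use YW norm_add_power2_le in \<open>auto simp: L2_def\<close>)
  moreover have "(\<lambda>x. Y x + W x) \<in> borel_measurable M"
    using YW[THEN L2_measurable] by measurable
  ultimately show ?thesis by (simp add: L2_def)
qed

lemma L2_blinfun:
  assumes "Y \<in> L2 M"
  shows "(\<lambda>x. blinfun_apply U (Y x)) \<in> L2 M"
    and "L2_norm M (\<lambda>x. blinfun_apply U (Y x)) \<le> norm U * L2_norm M Y"
proof -
  have le: "(norm (blinfun_apply U (Y x)))\<^sup>2 \<le> (norm U)\<^sup>2 * (norm (Y x))\<^sup>2" for x
    unfolding power_mult_distrib[symmetric] by (intro power_mono norm_blinfun) auto
  have m: "(\<lambda>x. blinfun_apply U (Y x)) \<in> borel_measurable M"
    using L2_measurable[OF assms]
    by (rule borel_measurable_continuous_on[rotated]) (intro continuous_intros)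
  have i: "integrable M (\<lambda>x. (norm U)\<^sup>2 * (norm (Y x))\<^sup>2)"
    using assms by (simp add: L2_integrable)
  show L: "(\<lambda>x. blinfun_apply U (Y x)) \<in> L2 M"
    using m le by (auto simp: L2_def intro!: Bochner_Integration.integrable_bound[OF i])
  have "(L2_norm M (\<lambda>x. blinfun_apply U (Y x)))\<^sup>2 \<le> (\<integral>x. (norm U)\<^sup>2 * (norm (Y x))\<^sup>2 \<partial>M)"
    unfolding L2_norm_power2 by (intro integral_mono L2_integrable L i le)
  also have "\<dots> = (norm U * L2_norm M Y)\<^sup>2"
    by (simp add: power_mult_distrib L2_norm_power2)
  finally show "L2_norm M (\<lambda>x. blinfun_apply U (Y x)) \<le> norm U * L2_norm M Y"
    by (rule power2_le_imp_le) (simp add: L2_norm_nonneg)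
qed

lemma L2_uminus: "Y \<in> L2 M \<Longrightarrow> (\<lambda>x. - Y x) \<in> L2 M"
  by (simp add: L2_def)

lemma L2_norm_minus_commute: "L2_norm M (\<lambda>x. Y x - W x) = L2_norm M (\<lambda>x. W x - Y x)"
  by (simp add: L2_norm_def norm_minus_commute)

lemma L2_diff: "Y \<in> L2 M \<Longrightarrow> W \<in> L2 M \<Longrightarrow> (\<lambda>x. Y x - W x) \<in> L2 M"
  using L2_add[OF _ L2_uminus, of Y M W] by simp

lemma L2_sum: "(\<And>i. i \<in> I \<Longrightarrow> Y i \<in> L2 M) \<Longrightarrow> (\<lambda>x. \<Sum>i\<in>I. Y i x) \<in> L2 M"
  by (induction I rule: infinite_finite_induct) (auto intro: L2_zero L2_add)

lemma L2_scaleC: "Y \<in> L2 M \<Longrightarrow> (\<lambda>x. c *\<^sub>C Y x) \<in> L2 M"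
  using L2_blinfun(1)[of Y M "scale_op c id_blinfun"] by (simp add: blinfun_scale_op)

text \<open>Minkowski's inequality: for \<open>a = L2_norm Y > 0\<close> and \<open>b = L2_norm W > 0\<close>, integrate
  \<open>(norm (Y + W))\<^sup>2 \<le> (1 + b / a) * (norm Y)\<^sup>2 + (1 + a / b) * (norm W)\<^sup>2\<close>.\<close>

lemma L2_norm_triangle:
  assumes Y: "Y \<in> L2 M" and W: "W \<in> L2 M"
  shows "L2_norm M (\<lambda>x. Y x + W x) \<le> L2_norm M Y + L2_norm M W"
proof -
  define a where "a = L2_norm M Y"
  define b where "b = L2_norm M W"
  have a0: "0 \<le> a" "0 \<le> b" by (auto simp: a_def b_def L2_norm_nonneg)
  have le: "L2_norm M (\<lambda>x. Y x + W x) \<le> a' + b'" if "a < a'" "b < b'" for a' b'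
  proof -
    have pos: "0 < a'" "0 < b'" using that a0 by auto
    have ineq: "(norm (Y x + W x))\<^sup>2 \<le> (1 + b' / a') * (norm (Y x))\<^sup>2 + (1 + a' / b') * (norm (W x))\<^sup>2" for x
    proof -
      have "0 \<le> (b' * norm (Y x) - a' * norm (W x))\<^sup>2 / (a' * b')" using pos by simp
      also have "\<dots> = b' / a' * (norm (Y x))\<^sup>2 + a' / b' * (norm (W x))\<^sup>2 - 2 * norm (Y x) * norm (W x)"
        using pos by (simp add: power2_eq_square field_simps)
      finally have "(norm (Y x) + norm (W x))\<^sup>2
          \<le> (1 + b' / a') * (norm (Y x))\<^sup>2 + (1 + a' / b') * (norm (W x))\<^sup>2"
        by (simp add: power2_sum algebra_simps)
      moreover have "(norm (Y x + W x))\<^sup>2 \<le> (norm (Y x) + norm (W x))\<^sup>2"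
        by (intro power_mono norm_triangle_ineq norm_ge_zero)
      ultimately show ?thesis by linarith
    qed
    have "(L2_norm M (\<lambda>x. Y x + W x))\<^sup>2
      \<le> (\<integral>x. (1 + b' / a') * (norm (Y x))\<^sup>2 + (1 + a' / b') * (norm (W x))\<^sup>2 \<partial>M)"
      unfolding L2_norm_power2 using Y W
      by (intro integral_mono ineq L2_integrable L2_add Bochner_Integration.integrable_add
          integrable_mult_right)
    also have "\<dots> = (1 + b' / a') * a\<^sup>2 + (1 + a' / b') * b\<^sup>2"
      using Y W by (simp add: L2_integrable a_def b_def L2_norm_power2)
    also have "\<dots> \<le> (1 + b' / a') * a'\<^sup>2 + (1 + a' / b') * b'\<^sup>2"
      using that a0 pos by (intro add_mono mult_left_mono power_mono) auto
    also have "\<dots> = (a' + b')\<^sup>2"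
    proof -
      have "b' / a' * a'\<^sup>2 = a' * b'" "a' / b' * b'\<^sup>2 = a' * b'"
        using pos by (simp_all add: power2_eq_square)
      then show ?thesis by (simp only: distrib_right power2_sum)
    qed
    finally have "(L2_norm M (\<lambda>x. Y x + W x))\<^sup>2 \<le> (a' + b')\<^sup>2" .
    moreover have "0 \<le> a' + b'" using pos by simp
    ultimately show ?thesis by (rule power2_le_imp_le)
  qed
  have "L2_norm M (\<lambda>x. Y x + W x) \<le> a + b"
  proof (rule field_le_epsilon)
    fix e :: real assume "e > 0"
    then show "L2_norm M (\<lambda>x. Y x + W x) \<le> a + b + e"
      using le[of "a + e / 2" "b + e / 2"] by simp
  qed
  then show ?thesis by (simp add: a_def b_def)
qed

lemma L2_norm_triangle_diff:
  assumes "Y \<in> L2 M" "V \<in> L2 M" "W \<in> L2 M"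
  shows "L2_norm M (\<lambda>x. Y x - W x) \<le> L2_norm M (\<lambda>x. Y x - V x) + L2_norm M (\<lambda>x. V x - W x)"
  using L2_norm_triangle[OF L2_diff[OF assms(1,2)] L2_diff[OF assms(2,3)]] by simp

lemma L2_norm_close:
  assumes "Y \<in> L2 M" "W \<in> L2 M"
  shows "\<bar>L2_norm M Y - L2_norm M W\<bar> \<le> L2_norm M (\<lambda>x. Y x - W x)"
  using L2_norm_triangle[OF L2_diff[OF assms] assms(2)]
    L2_norm_triangle[OF L2_diff[OF assms(2,1)] assms(1)] L2_norm_minus_commute[of M W Y] by simp

lemma L2_norm_eq_0_AE:
  assumes "Y \<in> L2 M" "L2_norm M Y = 0"
  shows "AE x in M. Y x = 0"
proof -
  have "(\<integral>\<^sup>+x. ennreal ((norm (Y x))\<^sup>2) \<partial>M) = 0"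
    using ennreal_L2_norm_power2[OF assms(1)] assms(2) by simp
  then have "AE x in M. ennreal ((norm (Y x))\<^sup>2) = 0"
    using L2_measurable[OF assms(1)] by (subst (asm) nn_integral_0_iff_AE) auto
  then show ?thesis by (rule AE_mp) auto
qed

text \<open>The Riesz--Fischer argument: along a subsequence with \<open>(L2_norm (D j))\<^sup>2 \<le> (1/8)\<^sup>j\<close> for the increments \<open>D j\<close>,
  the sum \<open>\<Sum>j. 4\<^sup>j * (norm (D j))\<^sup>2\<close> has finite integral. Hence \<open>norm (D j)\<close> is almost everywhere
  dominated by a geometric sequence. Fatou's lemma turns pointwise convergence into convergence
  in mean square.\<close>

lemma L2_complete:
  assumes Y: "\<And>n::nat. Y n \<in> L2 M"
    and Cauchy: "\<And>\<epsilon>. \<epsilon> > 0 \<Longrightarrow> \<exists>N. \<forall>m\<ge>N. \<forall>n\<ge>N. L2_norm M (\<lambda>x. Y m x - Y n x) < \<epsilon>"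
  shows "\<exists>W\<in>L2 M. (\<lambda>n. L2_norm M (\<lambda>x. Y n x - W x)) \<longlonglongrightarrow> 0"
proof -
  note [measurable] = L2_measurable[OF Y]
  have "\<forall>j. \<exists>N. \<forall>m\<ge>N. \<forall>n\<ge>N. L2_norm M (\<lambda>x. Y m x - Y n x) < sqrt ((1/8)^j)"
    using Cauchy by simp
  then obtain K where K: "\<And>j m n. m \<ge> K j \<Longrightarrow> n \<ge> K j \<Longrightarrow> L2_norm M (\<lambda>x. Y m x - Y n x) < sqrt ((1/8)^j)"
    by metis
  \<comment> \<open>A simple choice of indices that dominates \<open>K\<close>, is monotone and tends to infinity.\<close>
  define r where "r j = (\<Sum>i\<le>j. K i) + j" for j
  have rK: "r j \<ge> K j" "r (Suc j) \<ge> K j" "r j \<ge> j" for j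
    using member_le_sum[of j "{..j}" K] member_le_sum[of j "{..Suc j}" K] by (auto simp: r_def)
  define D where "D j x = Y (r (Suc j)) x - Y (r j) x" for j x
  have D: "D j \<in> L2 M" for j unfolding D_def by (intro L2_diff Y)
  note [measurable] = L2_measurable[OF D]
  have D8: "(\<integral>\<^sup>+x. ennreal ((norm (D j x))\<^sup>2) \<partial>M) \<le> ennreal ((1/8)^j)" for j
  proof -
    have "L2_norm M (D j) < sqrt ((1/8)^j)" unfolding D_def by (intro K rK)
    then have "(L2_norm M (D j))\<^sup>2 \<le> (sqrt ((1/8)^j))\<^sup>2"
      by (intro power_mono L2_norm_nonneg) auto
    then show ?thesis by (subst ennreal_L2_norm_power2[OF D, symmetric]) (simp add: ennreal_leI)
  qed
  \<comment> \<open>The weights \<open>4^j\<close> turn the bounds \<open>(1/8)^j\<close> into the convergent series of \<open>(1/2)^j\<close>.\<close>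
  have "(\<integral>\<^sup>+x. (\<Sum>j. ennreal (4^j * (norm (D j x))\<^sup>2)) \<partial>M)
      = (\<Sum>j. \<integral>\<^sup>+x. ennreal (4^j) * ennreal ((norm (D j x))\<^sup>2) \<partial>M)"
    by (subst nn_integral_suminf) (auto simp: ennreal_mult)
  also have "\<dots> = (\<Sum>j. ennreal (4^j) * (\<integral>\<^sup>+x. ennreal ((norm (D j x))\<^sup>2) \<partial>M))"
    by (subst nn_integral_cmult) auto
  also have "\<dots> \<le> (\<Sum>j. ennreal ((1/2)^j))"
  proof (intro suminf_le summableI)
    fix j :: nat
    have "ennreal (4^j) * (\<integral>\<^sup>+x. ennreal ((norm (D j x))\<^sup>2) \<partial>M) \<le> ennreal (4^j) * ennreal ((1/8)^j)"
      by (intro mult_left_mono D8) auto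
    also have "\<dots> = ennreal ((1/2)^j)"
      by (simp add: ennreal_mult[symmetric] power_mult_distrib[symmetric])
    finally show "ennreal (4^j) * (\<integral>\<^sup>+x. ennreal ((norm (D j x))\<^sup>2) \<partial>M) \<le> ennreal ((1/2)^j)" .
  qed
  also have "\<dots> < \<infinity>"
    by (subst suminf_ennreal_eq[OF _ geometric_sums[of "1/2"]]) auto
  finally have "AE x in M. (\<Sum>j. ennreal (4^j * (norm (D j x))\<^sup>2)) \<noteq> \<infinity>"
    by (intro nn_integral_PInf_AE) auto
  then have conv: "AE x in M. convergent (\<lambda>j. Y (r j) x)"
  proof (rule AE_mp, intro AE_I2 impI)
    fix x assume "(\<Sum>j. ennreal (4^j * (norm (D j x))\<^sup>2)) \<noteq> \<infinity>"
    then have "summable (\<lambda>j. 4^j * (norm (D j x))\<^sup>2)"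
      by (intro summable_suminf_not_top) auto
    then have "(\<lambda>j. 4^j * (norm (D j x))\<^sup>2) \<longlonglongrightarrow> 0" by (rule summable_LIMSEQ_zero)
    then have "eventually (\<lambda>j. 4^j * (norm (D j x))\<^sup>2 < 1) sequentially"
      by (intro order_tendstoD) auto
    then have "eventually (\<lambda>j. norm (D j x) \<le> (1/2)^j) sequentially"
    proof (rule eventually_mono)
      fix j assume "4^j * (norm (D j x))\<^sup>2 < 1"
      then have "(2^j * norm (D j x))\<^sup>2 < 1\<^sup>2"
        by (simp add: power_mult_distrib power_mult[symmetric] mult.commute[of j] power_mult[of 2 2 j, simplified])
      then have "2^j * norm (D j x) < 1" by (rule power2_less_imp_less) auto
      then show "norm (D j x) \<le> (1/2)^j" by (simp add: power_divide field_simps)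
    qed
    then have "summable (\<lambda>j. D j x)"
      by (rule summable_comparison_test_ev[OF _ summable_geometric]) auto
    then have "convergent (\<lambda>n. \<Sum>j<n. D j x)" by (simp add: summable_iff_convergent)
    moreover have "(\<Sum>j<n. D j x) = Y (r n) x - Y (r 0) x" for n
      unfolding D_def by (rule sum_lessThan_telescope)
    ultimately have "convergent (\<lambda>n. Y (r n) x - Y (r 0) x)" by simp
    then show "convergent (\<lambda>j. Y (r j) x)" by (simp add: convergent_diff_const_right_iff)
  qed
  define W where "W x = lim (\<lambda>j. Y (r j) x)" for x
  have Wm [measurable]: "W \<in> borel_measurable M" unfolding W_def by measurable
  have lim: "AE x in M. (\<lambda>j. Y (r j) x) \<longlonglongrightarrow> W x"
    using conv by (rule AE_mp) (auto simp: W_def convergent_LIMSEQ_iff)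
  have close: "\<exists>N. \<forall>n\<ge>N. (\<integral>\<^sup>+x. ennreal ((norm (Y n x - W x))\<^sup>2) \<partial>M) \<le> ennreal (\<epsilon>\<^sup>2)" if "\<epsilon> > 0" for \<epsilon>
  proof -
    obtain N where N: "\<And>m n. m \<ge> N \<Longrightarrow> n \<ge> N \<Longrightarrow> L2_norm M (\<lambda>x. Y m x - Y n x) < \<epsilon>"
      using Cauchy[OF \<open>\<epsilon> > 0\<close>] by auto
    have "(\<integral>\<^sup>+x. ennreal ((norm (Y n x - W x))\<^sup>2) \<partial>M) \<le> ennreal (\<epsilon>\<^sup>2)" if n: "n \<ge> N" for n
    proof -
      have "(\<integral>\<^sup>+x. ennreal ((norm (Y n x - W x))\<^sup>2) \<partial>M)
        \<le> (\<integral>\<^sup>+x. liminf (\<lambda>j. ennreal ((norm (Y n x - Y (r j) x))\<^sup>2)) \<partial>M)"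
      proof (rule nn_integral_mono_AE, use lim in \<open>rule AE_mp\<close>, intro AE_I2 impI)
        fix x assume "(\<lambda>j. Y (r j) x) \<longlonglongrightarrow> W x"
        then have *: "(\<lambda>j. ennreal ((norm (Y n x - Y (r j) x))\<^sup>2)) \<longlonglongrightarrow> ennreal ((norm (Y n x - W x))\<^sup>2)"
          by (intro tendsto_intros)
        then show "ennreal ((norm (Y n x - W x))\<^sup>2) \<le> liminf (\<lambda>j. ennreal ((norm (Y n x - Y (r j) x))\<^sup>2))"
          using lim_imp_Liminf[OF sequentially_bot *] by (simp only: order_refl)
      qed
      also have "\<dots> \<le> liminf (\<lambda>j. \<integral>\<^sup>+x. ennreal ((norm (Y n x - Y (r j) x))\<^sup>2) \<partial>M)"
        by (rule nn_integral_liminf) measurable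
      also have "\<dots> \<le> ennreal (\<epsilon>\<^sup>2)"
      proof (rule Liminf_le[OF sequentially_bot], rule eventually_mono[OF eventually_ge_at_top[of N]])
        fix j assume "N \<le> j"
        then have "L2_norm M (\<lambda>x. Y n x - Y (r j) x) \<le> \<epsilon>"
          using N[OF n, of "r j"] rK(3)[of j] by simp
        then show "(\<integral>\<^sup>+x. ennreal ((norm (Y n x - Y (r j) x))\<^sup>2) \<partial>M) \<le> ennreal (\<epsilon>\<^sup>2)"
          using \<open>\<epsilon> > 0\<close> by (subst (asm) L2_norm_le_iff) (auto intro: L2_diff Y)
      qed
      finally show ?thesis .
    qed
    then show ?thesis by blast
  qed
  have W: "W \<in> L2 M"
  proof -
    obtain n where "(\<integral>\<^sup>+x. ennreal ((norm (Y n x - W x))\<^sup>2) \<partial>M) \<le> ennreal (1\<^sup>2)"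
      using close[of 1] by auto
    then have "(\<lambda>x. Y n x - W x) \<in> L2 M"
      by (simp add: L2_iff_nn_integral) (metis ennreal_one_less_top order_le_less_trans)
    from L2_diff[OF Y[of n] this] show ?thesis by simp
  qed
  have "(\<lambda>n. L2_norm M (\<lambda>x. Y n x - W x)) \<longlonglongrightarrow> 0"
  proof (rule LIMSEQ_I)
    fix \<epsilon> :: real assume "\<epsilon> > 0"
    then obtain N where "\<forall>n\<ge>N. (\<integral>\<^sup>+x. ennreal ((norm (Y n x - W x))\<^sup>2) \<partial>M) \<le> ennreal ((\<epsilon>/2)\<^sup>2)"
      using close[of "\<epsilon> / 2"] by auto
    then have "\<forall>n\<ge>N. L2_norm M (\<lambda>x. Y n x - W x) \<le> \<epsilon> / 2"
      using \<open>\<epsilon> > 0\<close> by (subst L2_norm_le_iff) (auto intro: L2_diff Y W)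
    then show "\<exists>N. \<forall>n\<ge>N. norm (L2_norm M (\<lambda>x. Y n x - W x) - 0) < \<epsilon>"
      using \<open>\<epsilon> > 0\<close> by (intro exI[of _ N]) (auto simp: L2_norm_nonneg intro: le_less_trans)
  qed
  then show ?thesis using W by blast
qed

section \<open>Equal covariances give isometries\<close>

lemma integrable_cinner_mult:
  fixes Y W :: "'a \<Rightarrow> 'h::{complex_hilbert_space, second_countable_topology}"
  assumes "Y \<in> L2 M" "W \<in> L2 M"
  shows "integrable M (\<lambda>x. cinner (Y x) g * cnj (cinner (W x) h))"
proof (rule Bochner_Integration.integrable_bound)
  show "integrable M (\<lambda>x. (norm g * norm h) * ((norm (Y x))\<^sup>2 + (norm (W x))\<^sup>2))"
    using assms by (simp add: L2_integrable)
  note [measurable] = assms[THEN L2_measurable]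
  show "(\<lambda>x. cinner (Y x) g * cnj (cinner (W x) h)) \<in> borel_measurable M"
    unfolding cinner_commute[symmetric] by measurable
  show "AE x in M. norm (cinner (Y x) g * cnj (cinner (W x) h))
      \<le> norm ((norm g * norm h) * ((norm (Y x))\<^sup>2 + (norm (W x))\<^sup>2))"
  proof (rule AE_I2)
    fix x
    have "norm (cinner (Y x) g * cnj (cinner (W x) h)) \<le> (norm (Y x) * norm g) * (norm (W x) * norm h)"
      by (simp add: norm_mult) (intro mult_mono cmod_cinner_le; simp)
    also have "\<dots> = (norm g * norm h) * (norm (Y x) * norm (W x))" by simp
    also have "\<dots> \<le> (norm g * norm h) * ((norm (Y x))\<^sup>2 + (norm (W x))\<^sup>2)"
      by (intro mult_left_mono mult_le_sum_squares) simp_all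
    finally show "norm (cinner (Y x) g * cnj (cinner (W x) h))
      \<le> norm ((norm g * norm h) * ((norm (Y x))\<^sup>2 + (norm (W x))\<^sup>2))" by simp
  qed
qed

text \<open>Parseval's identity inside the integral; since all terms are nonnegative, sum and integral
  can be exchanged.\<close>

lemma L2_norm_expansion:
  fixes V :: "'a \<Rightarrow> 'h::{complex_hilbert_space, second_countable_topology}"
  assumes V: "V \<in> L2 M"
  shows "ennreal ((L2_norm M V)\<^sup>2) = (\<Sum>n. ennreal (\<integral>x. (cmod (cinner (V x) (onb_seq n)))\<^sup>2 \<partial>M))"
proof -
  note [measurable] = L2_measurable[OF V]
  have i: "integrable M (\<lambda>x. (cmod (cinner (V x) (onb_seq n)))\<^sup>2)" for n
    using integrable_norm[OF integrable_cinner_mult[OF V V, of "onb_seq n" "onb_seq n"]]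
    by (simp add: norm_mult power2_eq_square)
  have "ennreal ((norm (V x))\<^sup>2) = (\<Sum>n. ennreal ((cmod (cinner (V x) (onb_seq n)))\<^sup>2))" for x
    by (rule suminf_ennreal_eq[symmetric]) (auto intro: onb_parseval)
  then have "ennreal ((L2_norm M V)\<^sup>2)
      = (\<Sum>n. \<integral>\<^sup>+x. ennreal ((cmod (cinner (V x) (onb_seq n)))\<^sup>2) \<partial>M)"
    by (simp add: ennreal_L2_norm_power2[OF V] nn_integral_suminf)
  also have "\<dots> = (\<Sum>n. ennreal (\<integral>x. (cmod (cinner (V x) (onb_seq n)))\<^sup>2 \<partial>M))"
    by (intro suminf_cong nn_integral_eq_integral i) auto
  finally show ?thesis .
qed

text \<open>Expand the norm in the orthonormal basis and move the operators to the other side of the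
  inner product; what remains are integrals of \<open>cinner (Y i) g * cnj (cinner (Y j) h)\<close>, which are
  determined by those with \<open>g = h\<close> by polarization.\<close>

lemma L2_isometry_of_covariances:
  fixes Y :: "'i \<Rightarrow> 'a \<Rightarrow> 'h::{complex_hilbert_space, second_countable_topology}"
    and W :: "'i \<Rightarrow> 'b \<Rightarrow> 'h"
  assumes fin: "finite I" and Y: "\<And>i. i \<in> I \<Longrightarrow> Y i \<in> L2 M" and W: "\<And>i. i \<in> I \<Longrightarrow> W i \<in> L2 N"
    and U: "\<And>i. i \<in> I \<Longrightarrow> clinear_op (U i)"
    and cov: "\<And>i j g. i \<in> I \<Longrightarrow> j \<in> I \<Longrightarrow>
      (\<integral>x. cinner (Y i x) g * cnj (cinner (Y j x) g) \<partial>M)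
        = (\<integral>x. cinner (W i x) g * cnj (cinner (W j x) g) \<partial>N)"
  shows "L2_norm M (\<lambda>x. \<Sum>i\<in>I. blinfun_apply (U i) (Y i x))
    = L2_norm N (\<lambda>x. \<Sum>i\<in>I. blinfun_apply (U i) (W i x))"
proof -
  have cov': "(\<integral>x. cinner (Y i x) h * cnj (cinner (Y j x) g) \<partial>M)
        = (\<integral>x. cinner (W i x) h * cnj (cinner (W j x) g) \<partial>N)" if "i \<in> I" "j \<in> I" for i j g h
    by (rule sesquilinear_eqI[where B="\<lambda>g h. \<integral>x. cinner (Y i x) h * cnj (cinner (Y j x) g) \<partial>M"
          and B'="\<lambda>g h. \<integral>x. cinner (W i x) h * cnj (cinner (W j x) g) \<partial>N"])
      (use Y[OF that(1)] Y[OF that(2)] W[OF that(1)] W[OF that(2)] cov[OF that] in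
        \<open>simp_all add: cinner_add_right cinner_scaleC_right distrib_left distrib_right
          integrable_cinner_mult mult.assoc mult.left_commute\<close>)
  have "\<forall>i\<in>I. \<forall>n. \<exists>h. \<forall>x. cinner (blinfun_apply (U i) x) (onb_seq n) = cinner x h"
    using ex_adjoint_vector[OF U] by blast
  then obtain a where a: "\<And>i n x. i \<in> I \<Longrightarrow> cinner (blinfun_apply (U i) x) (onb_seq n) = cinner x (a i n)"
    by metis
  have coeff: "complex_of_real (\<integral>x. (cmod (cinner (\<Sum>i\<in>I. blinfun_apply (U i) (V i x)) (onb_seq n)))\<^sup>2 \<partial>K)
    = (\<Sum>i\<in>I. \<Sum>j\<in>I. \<integral>x. cinner (V i x) (a i n) * cnj (cinner (V j x) (a j n)) \<partial>K)"
    if V: "\<And>i. i \<in> I \<Longrightarrow> V i \<in> L2 K" for V :: "'i \<Rightarrow> 'c \<Rightarrow> 'h" and K n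
  proof -
    have "complex_of_real ((cmod (cinner (\<Sum>i\<in>I. blinfun_apply (U i) (V i x)) (onb_seq n)))\<^sup>2)
      = (\<Sum>i\<in>I. \<Sum>j\<in>I. cinner (V i x) (a i n) * cnj (cinner (V j x) (a j n)))" for x
      unfolding complex_norm_square by (simp add: cinner.sum_left a sum_product)
    then have "complex_of_real (\<integral>x. (cmod (cinner (\<Sum>i\<in>I. blinfun_apply (U i) (V i x)) (onb_seq n)))\<^sup>2 \<partial>K)
      = (\<integral>x. (\<Sum>i\<in>I. \<Sum>j\<in>I. cinner (V i x) (a i n) * cnj (cinner (V j x) (a j n))) \<partial>K)"
      by (simp only: integral_complex_of_real[symmetric])
    also have "\<dots> = (\<Sum>i\<in>I. \<Sum>j\<in>I. \<integral>x. cinner (V i x) (a i n) * cnj (cinner (V j x) (a j n)) \<partial>K)"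
      using V by (subst Bochner_Integration.integral_sum)
        (auto intro!: Bochner_Integration.integrable_sum integrable_cinner_mult sum.cong
          Bochner_Integration.integral_sum)
    finally show ?thesis .
  qed
  have "complex_of_real (\<integral>x. (cmod (cinner (\<Sum>i\<in>I. blinfun_apply (U i) (Y i x)) (onb_seq n)))\<^sup>2 \<partial>M)
      = complex_of_real (\<integral>x. (cmod (cinner (\<Sum>i\<in>I. blinfun_apply (U i) (W i x)) (onb_seq n)))\<^sup>2 \<partial>N)" for n
    using coeff[of Y M n, OF Y] coeff[of W N n, OF W] cov' by (simp cong: sum.cong)
  then have "(\<integral>x. (cmod (cinner (\<Sum>i\<in>I. blinfun_apply (U i) (Y i x)) (onb_seq n)))\<^sup>2 \<partial>M)
      = (\<integral>x. (cmod (cinner (\<Sum>i\<in>I. blinfun_apply (U i) (W i x)) (onb_seq n)))\<^sup>2 \<partial>N)" for n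
    using of_real_eq_iff by blast
  then have "ennreal ((L2_norm M (\<lambda>x. \<Sum>i\<in>I. blinfun_apply (U i) (Y i x)))\<^sup>2)
    = ennreal ((L2_norm N (\<lambda>x. \<Sum>i\<in>I. blinfun_apply (U i) (W i x)))\<^sup>2)"
    using Y W by (subst (1 2) L2_norm_expansion) (auto intro!: L2_sum L2_blinfun)
  then show ?thesis by (simp add: L2_norm_nonneg)
qed

section \<open>Covariance operators\<close>

lemma cov_op:
  fixes Y W :: "'a \<Rightarrow> 'h::{complex_hilbert_space, second_countable_topology}"
  assumes Y: "Y \<in> L2 M" and W: "W \<in> L2 M"
  shows "clinear_op (cov_op M Y W)"
    and "cinner (blinfun_apply (cov_op M Y W) g) g
      = (\<integral>x. cinner (Y x) g * cnj (cinner (W x) g) \<partial>M)"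
proof -
  note [measurable] = Y[THEN L2_measurable] W[THEN L2_measurable]
  have prod: "integrable M (\<lambda>x. norm (W x) * norm (Y x))"
  proof (rule Bochner_Integration.integrable_bound)
    show "integrable M (\<lambda>x. (norm (W x))\<^sup>2 + (norm (Y x))\<^sup>2)"
      using Y W by (simp add: L2_integrable)
    show "AE x in M. norm (norm (W x) * norm (Y x)) \<le> norm ((norm (W x))\<^sup>2 + (norm (Y x))\<^sup>2)"
      by (simp add: mult_le_sum_squares)
  qed measurable
  have le: "norm (cinner g (W x) *\<^sub>C Y x) \<le> norm g * (norm (W x) * norm (Y x))" for g x
    using mult_right_mono[OF cmod_cinner_le[of g "W x"] norm_ge_zero[of "Y x"]]
    by (simp add: norm_scaleC mult.assoc)
  have int: "integrable M (\<lambda>x. cinner g (W x) *\<^sub>C Y x)" for g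
    by (rule Bochner_Integration.integrable_bound[OF integrable_mult_right[OF prod, of "norm g"]])
      (use le in \<open>auto simp: abs_mult\<close>)
  have bl: "bounded_linear (\<lambda>g. \<integral>x. cinner g (W x) *\<^sub>C Y x \<partial>M)"
  proof (rule bounded_linear_intro[where K="\<integral>x. norm (W x) * norm (Y x) \<partial>M"])
    show "norm (\<integral>x. cinner g (W x) *\<^sub>C Y x \<partial>M) \<le> norm g * (\<integral>x. norm (W x) * norm (Y x) \<partial>M)" for g
    proof -
      have "norm (\<integral>x. cinner g (W x) *\<^sub>C Y x \<partial>M) \<le> (\<integral>x. norm g * (norm (W x) * norm (Y x)) \<partial>M)"
        using int[of g] prod le[of g]
        by (intro order.trans[OF Bochner_Integration.integral_norm_bound] integral_mono) auto
      then show ?thesis by simp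
    qed
  qed (simp_all add: cinner_add_left scaleC_add_left int cinner_scaleR_left scaleC.scaleR_left)
  have app: "blinfun_apply (cov_op M Y W) g = (\<integral>x. cinner g (W x) *\<^sub>C Y x \<partial>M)" for g
    unfolding cov_op_def by (simp add: bounded_linear_Blinfun_apply bl)
  show "clinear_op (cov_op M Y W)"
    unfolding clinear_op_def app
  proof (intro allI)
    fix c g
    have "(\<integral>x. cinner (c *\<^sub>C g) (W x) *\<^sub>C Y x \<partial>M) = (\<integral>x. c *\<^sub>C cinner g (W x) *\<^sub>C Y x \<partial>M)"
      by (simp only: cinner_scaleC_left scaleC_scaleC)
    also have "\<dots> = c *\<^sub>C (\<integral>x. cinner g (W x) *\<^sub>C Y x \<partial>M)"
      by (rule integral_bounded_linear[OF scaleC.bounded_linear_right int])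
    finally show "(\<integral>x. cinner (c *\<^sub>C g) (W x) *\<^sub>C Y x \<partial>M) = c *\<^sub>C (\<integral>x. cinner g (W x) *\<^sub>C Y x \<partial>M)" .
  qed
  show "cinner (blinfun_apply (cov_op M Y W) g) g
      = (\<integral>x. cinner (Y x) g * cnj (cinner (W x) g) \<partial>M)"
    unfolding app integral_bounded_linear[OF cinner.bounded_linear_left int, symmetric]
    by (simp only: cinner_scaleC_left cinner_commute[symmetric] mult.commute)
qed

lemma measurable_cis: "(\<lambda>\<omega>. cis (r * \<omega>)) \<in> borel_measurable freq_borel"
  by (intro measurable_restrict_space1 borel_measurable_continuous_onI continuous_intros)

text \<open>The intervals decrease to the empty set. Finiteness of the measure makes it continuous along
  a sequence of them, and monotonicity extends this to the filter.\<close>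

lemma measure_left_interval_tendsto_0:
  fixes a c :: real
  assumes D: "finite_measure D" and "c < a" and meas: "\<And>b. c \<le> b \<Longrightarrow> {b<..<a} \<in> sets D"
  shows "((\<lambda>b. measure D {b<..<a}) \<longlongrightarrow> 0) (at_left a)"
proof (rule order_tendstoI)
  interpret finite_measure D by (rule D)
  define b where "b n = max c (a - 1 / real (Suc n))" for n
  have b: "c \<le> b n" "b n < a" for n using \<open>c < a\<close> by (auto simp: b_def)
  have "(\<lambda>n. measure D {b n<..<a}) \<longlonglongrightarrow> measure D (\<Inter>n. {b n<..<a})"
  proof (rule finite_Lim_measure_decseq)
    show "range (\<lambda>n. {b n<..<a}) \<subseteq> sets D" using b meas by auto
    show "decseq (\<lambda>n. {b n<..<a})"
    proof (rule decseq_SucI, rule greaterThanLessThan_subseteq_greaterThanLessThan[THEN iffD2], intro impI conjI)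
      fix n
      have "1 / real (Suc (Suc n)) \<le> 1 / real (Suc n)" by (intro divide_left_mono) auto
      then show "b n \<le> b (Suc n)" unfolding b_def by (intro max.mono) auto
    qed simp
  qed
  moreover have "(\<Inter>n. {b n<..<a}) = {}"
  proof (intro equals0I)
    fix \<omega> assume \<omega>: "\<omega> \<in> (\<Inter>n. {b n<..<a})"
    then have "0 < a - \<omega>" by auto
    then obtain n where "1 / real (Suc n) < a - \<omega>" using nat_approx_posE by metis
    moreover have "b n < \<omega>" using \<omega> by auto
    ultimately show False unfolding b_def by auto
  qed
  ultimately have lim: "(\<lambda>n. measure D {b n<..<a}) \<longlonglongrightarrow> 0" by simp
  fix e :: real assume "0 < e"
  then have "eventually (\<lambda>n. measure D {b n<..<a} < e) sequentially"
    using lim by (intro order_tendstoD) auto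
  then obtain n where n: "measure D {b n<..<a} < e" by (auto simp: eventually_sequentially)
  have "eventually (\<lambda>\<omega>. \<omega> \<in> {b n<..<a}) (at_left a)"
    using b(2)[of n] eventually_at_left_real by blast
  then show "eventually (\<lambda>\<omega>. measure D {\<omega><..<a} < e) (at_left a)"
  proof (rule eventually_mono)
    fix \<omega> assume "\<omega> \<in> {b n<..<a}"
    then have "measure D {\<omega><..<a} \<le> measure D {b n<..<a}"
      using b[of n] meas by (intro finite_measure_mono) auto
    then show "measure D {\<omega><..<a} < e" using n by simp
  qed
qed (auto intro!: always_eventually intro: less_le_trans)

section \<open>A model of the spectral representation\<close>

text \<open>The measure \<open>N\<close>, the frequency \<open>q\<close> and the vector \<open>\<psi>\<close> represent \<open>F\<close> as second moment operator of
  \<open>\<psi>\<close>. The underlying space stays abstract here, since only integrals of functions of \<open>q\<close>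
  and \<open>\<psi>\<close> enter the mean square norms.\<close>

locale spectral_model =
  fixes P :: "'w measure"
    and X :: "int \<Rightarrow> 'w \<Rightarrow> 'h::{complex_hilbert_space, second_countable_topology}"
    and F :: "real set \<Rightarrow> ('h \<Rightarrow>\<^sub>L 'h)"
    and Z :: "real \<Rightarrow> 'w \<Rightarrow> 'h"
    and N :: "'n measure" and q :: "'n \<Rightarrow> real" and \<psi> :: "'n \<Rightarrow> 'h"
  assumes stationary: "weakly_stationary P X"
    and spectral: "is_spectral_measure P X F"
    and increments: "is_increment_process P X F Z"
    and q [measurable]: "q \<in> measurable N freq_borel"
    and \<psi>: "\<psi> \<in> L2 N"
    and model: "E \<in> sets freq_borel \<Longrightarrow> cinner (blinfun_apply (F E) g) g
      = complex_of_real (\<integral>x. indicat_real E (q x) * (cmod (cinner (\<psi> x) g))\<^sup>2 \<partial>N)"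
begin

abbreviation "\<mu> \<equiv> trace_measure F"

lemma \<psi>_measurable [measurable]: "\<psi> \<in> borel_measurable N"
  using \<psi> by (rule L2_measurable)

lemma F_S1_pos: "E \<in> sets freq_borel \<Longrightarrow> F E \<in> S1_pos"
  using spectral by (simp add: is_spectral_measure_def)

lemma X_L2: "X t \<in> L2 P"
  using stationary by (simp add: weakly_stationary_def)

lemma integrable_cinner_\<psi>: "integrable N (\<lambda>x. (cmod (cinner (\<psi> x) g))\<^sup>2)"
  using integrable_norm[OF integrable_cinner_mult[OF \<psi> \<psi>, of g g]]
  by (simp add: norm_mult power2_eq_square)

lemma integrable_indicator_cinner_\<psi>:
  assumes [measurable]: "E \<in> sets freq_borel"
  shows "integrable N (\<lambda>x. indicat_real E (q x) * (cmod (cinner (\<psi> x) g))\<^sup>2)"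
  by (rule Bochner_Integration.integrable_bound[OF integrable_cinner_\<psi>[of g]])
    (auto simp: indicator_def)

lemma F_nn_integral:
  assumes [measurable]: "E \<in> sets freq_borel"
  shows "ennreal (Re (cinner (blinfun_apply (F E) g) g))
    = (\<integral>\<^sup>+x. indicator E (q x) * ennreal ((cmod (cinner (\<psi> x) g))\<^sup>2) \<partial>N)"
proof -
  have "ennreal (Re (cinner (blinfun_apply (F E) g) g))
    = (\<integral>\<^sup>+x. ennreal (indicat_real E (q x) * (cmod (cinner (\<psi> x) g))\<^sup>2) \<partial>N)"
    by (simp add: model nn_integral_eq_integral integrable_indicator_cinner_\<psi>)
  also have "\<dots> = (\<integral>\<^sup>+x. indicator E (q x) * ennreal ((cmod (cinner (\<psi> x) g))\<^sup>2) \<partial>N)"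
    by (intro nn_integral_cong) (auto simp: indicator_def)
  finally show ?thesis .
qed

text \<open>Summing the quadratic forms over an orthonormal basis turns \<open>(cmod (cinner \<psi> g))\<^sup>2\<close> into
  \<open>(norm \<psi>)\<^sup>2\<close> by Parseval's identity.\<close>

lemma tr_F_nn_integral:
  assumes E [measurable]: "E \<in> sets freq_borel"
  shows "ennreal (Re (tr (F E))) = (\<integral>\<^sup>+x. indicator E (q x) * ennreal ((norm (\<psi> x))\<^sup>2) \<partial>N)"
proof -
  have "ennreal (Re (tr (F E)))
      = (\<Sum>n. ennreal (Re (cinner (blinfun_apply (F E) (onb_seq n)) (onb_seq n))))"
    using S1_posD(3)[OF F_S1_pos[OF E]] tr_sums(1)[OF F_S1_pos[OF E]]
    by (intro suminf_ennreal_eq[symmetric]) auto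
  also have "\<dots> = (\<integral>\<^sup>+x. (\<Sum>n. indicator E (q x) * ennreal ((cmod (cinner (\<psi> x) (onb_seq n)))\<^sup>2)) \<partial>N)"
    by (subst nn_integral_suminf) (auto simp: F_nn_integral)
  also have "(\<lambda>x. \<Sum>n. indicator E (q x) * ennreal ((cmod (cinner (\<psi> x) (onb_seq n)))\<^sup>2))
      = (\<lambda>x. indicator E (q x) * ennreal ((norm (\<psi> x))\<^sup>2))"
    by (intro ext, subst ennreal_suminf_cmult)
      (auto intro!: arg_cong[of _ _ "\<lambda>y. _ * y"] suminf_ennreal_eq onb_parseval)
  finally show ?thesis .
qed

lemma emeasure_distr_density_q:
  assumes [measurable]: "h \<in> borel_measurable N" and E [measurable]: "E \<in> sets freq_borel"
  shows "emeasure (distr (density N h) freq_borel q) E = (\<integral>\<^sup>+x. indicator E (q x) * h x \<partial>N)"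
proof -
  have "emeasure (distr (density N h) freq_borel q) E = emeasure (density N h) (q -` E \<inter> space N)"
    by (subst emeasure_distr) auto
  also have "\<dots> = (\<integral>\<^sup>+x. h x * indicator (q -` E \<inter> space N) x \<partial>N)"
    by (intro emeasure_density) measurable
  also have "\<dots> = (\<integral>\<^sup>+x. indicator E (q x) * h x \<partial>N)"
    by (intro nn_integral_cong) (auto simp: indicator_def)
  finally show ?thesis .
qed

text \<open>The scalar measures derived from \<open>F\<close> are given by \<open>measure_of\<close>. They agree with an image
  measure on all measurable sets, so their countable additivity need not be checked separately.\<close>

lemma measure_of_eqI_distr:
  assumes "\<And>E. E \<in> sets freq_borel \<Longrightarrow> f E = emeasure (distr D freq_borel q) E"
  shows "measure_of {- pi..pi} (sets freq_borel) f = distr D freq_borel q"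
proof -
  let ?D = "distr D freq_borel q"
  have sp: "space freq_borel = {- pi..pi}" by (simp add: space_restrict_space)
  have "measure_of {- pi..pi} (sets freq_borel) f = measure_of {- pi..pi} (sets freq_borel) (emeasure ?D)"
  proof (rule measure_of_eq)
    show "sets freq_borel \<subseteq> Pow {- pi..pi}" using sets.space_closed[of freq_borel] sp by simp
    show "f E = emeasure ?D E" if "E \<in> sigma_sets {- pi..pi} (sets freq_borel)" for E
      using that sets.sigma_sets_eq[of freq_borel] assms unfolding sp by blast
  qed
  also have "\<dots> = measure_of (space ?D) (sets ?D) (emeasure ?D)" by (simp only: space_distr sets_distr sp)
  finally show ?thesis by (simp only: measure_of_of_measure)
qed

lemma paired_measure_eq:
  "paired_measure F (outer g g)
    = distr (density N (\<lambda>x. ennreal ((cmod (cinner (\<psi> x) g))\<^sup>2))) freq_borel q"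
  unfolding paired_measure_def
  by (rule measure_of_eqI_distr)
    (simp add: emeasure_distr_density_q tr_outer S1_posD(1)[OF F_S1_pos] F_nn_integral)

lemma trace_measure_eq:
  "\<mu> = distr (density N (\<lambda>x. ennreal ((norm (\<psi> x))\<^sup>2))) freq_borel q"
  unfolding trace_measure_def
  by (rule measure_of_eqI_distr) (simp add: emeasure_distr_density_q tr_F_nn_integral)

lemma sets_\<mu> [measurable_cong, simp]: "sets \<mu> = sets freq_borel"
  by (simp add: trace_measure_eq)

lemma space_\<mu>: "space \<mu> = {- pi..pi}"
  using sets_eq_imp_space_eq[OF sets_\<mu>] by (simp add: space_restrict_space)

lemma nn_integral_\<mu>:
  assumes [measurable]: "h \<in> borel_measurable freq_borel"
  shows "(\<integral>\<^sup>+\<omega>. h \<omega> \<partial>\<mu>) = (\<integral>\<^sup>+x. ennreal ((norm (\<psi> x))\<^sup>2) * h (q x) \<partial>N)"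
  unfolding trace_measure_eq by (subst nn_integral_distr) (auto simp: nn_integral_density)

lemma finite_\<mu>: "finite_measure \<mu>"
proof (rule finite_measureI)
  have "emeasure \<mu> (space \<mu>) = (\<integral>\<^sup>+\<omega>. 1 \<partial>\<mu>)" by simp
  also have "\<dots> = (\<integral>\<^sup>+x. ennreal ((norm (\<psi> x))\<^sup>2) * 1 \<partial>N)"
    by (rule nn_integral_\<mu>) simp
  also have "\<dots> = ennreal ((L2_norm N \<psi>)\<^sup>2)"
    by (simp add: ennreal_L2_norm_power2[OF \<psi>])
  finally show "emeasure \<mu> (space \<mu>) \<noteq> \<infinity>" by simp
qed

lemma emeasure_\<mu>_left_end: "emeasure \<mu> {- pi} = 0"
proof -
  have "- pi \<le> pi" using pi_gt_zero by linarith
  then have [measurable]: "{- pi} \<in> sets freq_borel" by (simp add: sets_restrict_space_iff)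
  have F0: "F {- pi} = 0" using spectral by (simp add: is_spectral_measure_def)
  have "emeasure \<mu> {- pi} = ennreal (Re (tr (F {- pi})))"
    by (simp add: trace_measure_eq emeasure_distr_density_q tr_F_nn_integral)
  also have "tr (F {- pi}) = 0" by (simp add: F0 tr_def)
  finally show ?thesis by simp
qed

text \<open>The elements \<open>X t\<close> have the same covariances as \<open>cis (t * q) *\<^sub>C \<psi>\<close>.\<close>

definition harmonic :: "int \<Rightarrow> 'n \<Rightarrow> 'h" where
  "harmonic t x = cis (of_int t * q x) *\<^sub>C \<psi> x"

lemma q_borel [measurable]: "q \<in> borel_measurable N"
  using q by (simp add: measurable_restrict_space2_iff)

lemma q_range: "x \<in> space N \<Longrightarrow> q x \<in> {- pi..pi}"
  using measurable_space[OF q] by (simp add: space_restrict_space)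

lemma measurable_cis_q [measurable]: "(\<lambda>x. cis (r * q x)) \<in> borel_measurable N"
  unfolding cis_conv_exp by measurable

lemma harmonic_L2: "harmonic t \<in> L2 N"
proof -
  have [measurable]: "harmonic t \<in> borel_measurable N" unfolding harmonic_def by measurable
  show ?thesis
    using L2_integrable[OF \<psi>] by (simp add: L2_def) (simp add: harmonic_def norm_scaleC)
qed

lemma harmonic_covariance:
  "(\<integral>x. cinner (X t x) g * cnj (cinner (X s x) g) \<partial>P)
    = (\<integral>x. cinner (harmonic t x) g * cnj (cinner (harmonic s x) g) \<partial>N)"
proof -
  have "(\<integral>x. cinner (X t x) g * cnj (cinner (X s x) g) \<partial>P)
      = cinner (blinfun_apply (cov_op P (X t) (X s)) g) g"
    by (simp add: cov_op X_L2)
  also have "cov_op P (X t) (X s) = cov_op P (X (t - s)) (X 0)"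
    using stationary by (simp add: weakly_stationary_def)
  also have "cinner (blinfun_apply (cov_op P (X (t - s)) (X 0)) g) g
      = tr (cov_op P (X (t - s)) (X 0) o\<^sub>L outer g g)"
    by (simp add: tr_outer cov_op X_L2)
  also have "\<dots> = (\<integral>\<omega>. cis (of_int (t - s) * \<omega>) \<partial>(paired_measure F (outer g g)))"
  proof -
    have "\<forall>h. \<forall>A\<in>S1_pos. tr (cov_op P (X h) (X 0) o\<^sub>L A)
        = (\<integral>\<omega>. cis (of_int h * \<omega>) \<partial>(paired_measure F A))"
      by (rule spectral[unfolded is_spectral_measure_def, THEN conjunct2, THEN conjunct2, THEN conjunct2])
    from bspec[OF spec[OF this] outer_in_S1_pos] show ?thesis .
  qed
  also have "\<dots> = (\<integral>x. cis (of_int (t - s) * q x) \<partial>density N (\<lambda>x. ennreal ((cmod (cinner (\<psi> x) g))\<^sup>2)))"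
    unfolding paired_measure_eq
    by (rule integral_distr) (simp_all add: q measurable_cis)
  also have "\<dots> = (\<integral>x. (cmod (cinner (\<psi> x) g))\<^sup>2 *\<^sub>R cis (of_int (t - s) * q x) \<partial>N)"
    by (rule integral_density) simp_all
  also have "\<dots> = (\<integral>x. cinner (harmonic t x) g * cnj (cinner (harmonic s x) g) \<partial>N)"
  proof (rule Bochner_Integration.integral_cong[OF refl])
    fix x
    have *: "cis (of_int (t - s) * q x) = cis (of_int t * q x) * cnj (cis (of_int s * q x))"
      by (simp add: cis_cnj cis_mult left_diff_distrib)
    show "(cmod (cinner (\<psi> x) g))\<^sup>2 *\<^sub>R cis (of_int (t - s) * q x)
        = cinner (harmonic t x) g * cnj (cinner (harmonic s x) g)"
      unfolding scaleR_conv_of_real complex_norm_square harmonic_def cinner_scaleC_left *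
      by (simp only: complex_cnj_mult ac_simps)
  qed
  finally show ?thesis .
qed

text \<open>The correspondence is the graph of the isometry that extends
  \<open>\<Sum>t. U t (X t) \<mapsto> \<Sum>t. U t (harmonic t)\<close> to mean square limits.\<close>

definition corresponds :: "('w \<Rightarrow> 'h) \<Rightarrow> ('n \<Rightarrow> 'h) \<Rightarrow> bool" where
  "corresponds Y W \<longleftrightarrow> Y \<in> L2 P \<and> W \<in> L2 N \<and>
    (\<forall>\<epsilon>>0. \<exists>S U. finite S \<and> (\<forall>t\<in>S. clinear_op (U t))
      \<and> L2_norm P (\<lambda>x. Y x - (\<Sum>t\<in>S. blinfun_apply (U t) (X t x))) < \<epsilon>
      \<and> L2_norm N (\<lambda>x. W x - (\<Sum>t\<in>S. blinfun_apply (U t) (harmonic t x))) < \<epsilon>)"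

lemma correspondsD: "corresponds Y W \<Longrightarrow> Y \<in> L2 P" "corresponds Y W \<Longrightarrow> W \<in> L2 N"
  by (auto simp: corresponds_def)

lemma combination_L2:
  "(\<lambda>x. \<Sum>t\<in>S. blinfun_apply (U t) (X t x)) \<in> L2 P"
  "(\<lambda>x. \<Sum>t\<in>S. blinfun_apply (U t) (harmonic t x)) \<in> L2 N"
  by (intro L2_sum L2_blinfun X_L2 harmonic_L2)+

text \<open>Combinations of the \<open>X t\<close> and the \<open>harmonic t\<close> with the same operators have equal norms by
  equality of the covariances, and this passes to the limit.\<close>

lemma corresponds_norm:
  assumes "corresponds Y W"
  shows "L2_norm P Y = L2_norm N W"
proof -
  have "\<bar>L2_norm P Y - L2_norm N W\<bar> \<le> \<epsilon>" if "\<epsilon> > 0" for \<epsilon>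
  proof -
    obtain S U where SU: "finite S" "\<forall>t\<in>S. clinear_op (U t)"
      "L2_norm P (\<lambda>x. Y x - (\<Sum>t\<in>S. blinfun_apply (U t) (X t x))) < \<epsilon> / 2"
      "L2_norm N (\<lambda>x. W x - (\<Sum>t\<in>S. blinfun_apply (U t) (harmonic t x))) < \<epsilon> / 2"
      using assms \<open>\<epsilon> > 0\<close> unfolding corresponds_def by (meson half_gt_zero)
    have "L2_norm P (\<lambda>x. \<Sum>t\<in>S. blinfun_apply (U t) (X t x))
      = L2_norm N (\<lambda>x. \<Sum>t\<in>S. blinfun_apply (U t) (harmonic t x))"
      by (rule L2_isometry_of_covariances) (use SU X_L2 harmonic_L2 harmonic_covariance in auto)
    then show ?thesis
      using L2_norm_close[OF correspondsD(1)[OF assms] combination_L2(1)[of U S]]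
        L2_norm_close[OF correspondsD(2)[OF assms] combination_L2(2)[of U S]] SU(3,4)
      by linarith
  qed
  then have "\<bar>L2_norm P Y - L2_norm N W\<bar> \<le> 0"
    by (rule field_le_epsilon) simp
  then show ?thesis by simp
qed

lemma corresponds_limit:
  assumes YW: "Y \<in> L2 P" "W \<in> L2 N"
    and approx: "\<And>\<epsilon>. \<epsilon> > 0 \<Longrightarrow> \<exists>Y' W'. corresponds Y' W'
      \<and> L2_norm P (\<lambda>x. Y x - Y' x) < \<epsilon> \<and> L2_norm N (\<lambda>x. W x - W' x) < \<epsilon>"
  shows "corresponds Y W"
  unfolding corresponds_def
proof (intro conjI YW allI impI)
  fix \<epsilon> :: real assume "\<epsilon> > 0"
  then obtain Y' W' where YW': "corresponds Y' W'"
    "L2_norm P (\<lambda>x. Y x - Y' x) < \<epsilon> / 2" "L2_norm N (\<lambda>x. W x - W' x) < \<epsilon> / 2"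
    using approx by (meson half_gt_zero)
  then obtain S U where SU: "finite S" "\<forall>t\<in>S. clinear_op (U t)"
    "L2_norm P (\<lambda>x. Y' x - (\<Sum>t\<in>S. blinfun_apply (U t) (X t x))) < \<epsilon> / 2"
    "L2_norm N (\<lambda>x. W' x - (\<Sum>t\<in>S. blinfun_apply (U t) (harmonic t x))) < \<epsilon> / 2"
    using \<open>\<epsilon> > 0\<close> unfolding corresponds_def by (meson half_gt_zero)
  have "L2_norm P (\<lambda>x. Y x - (\<Sum>t\<in>S. blinfun_apply (U t) (X t x))) < \<epsilon>"
    using L2_norm_triangle_diff[OF YW(1) correspondsD(1)[OF YW'(1)] combination_L2(1)[of U S]]
      YW'(2) SU(3) by linarith
  moreover have "L2_norm N (\<lambda>x. W x - (\<Sum>t\<in>S. blinfun_apply (U t) (harmonic t x))) < \<epsilon>"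
    using L2_norm_triangle_diff[OF YW(2) correspondsD(2)[OF YW'(1)] combination_L2(2)[of U S]]
      YW'(3) SU(4) by linarith
  ultimately show "\<exists>S U. finite S \<and> (\<forall>t\<in>S. clinear_op (U t))
      \<and> L2_norm P (\<lambda>x. Y x - (\<Sum>t\<in>S. blinfun_apply (U t) (X t x))) < \<epsilon>
      \<and> L2_norm N (\<lambda>x. W x - (\<Sum>t\<in>S. blinfun_apply (U t) (harmonic t x))) < \<epsilon>"
    using SU by blast
qed

lemma corresponds_combination:
  assumes "finite S" "\<And>t. t \<in> S \<Longrightarrow> clinear_op (U t)"
  shows "corresponds (\<lambda>x. \<Sum>t\<in>S. blinfun_apply (U t) (X t x))
    (\<lambda>x. \<Sum>t\<in>S. blinfun_apply (U t) (harmonic t x))"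
  unfolding corresponds_def using assms
  by (intro conjI combination_L2 allI impI exI[of _ S] exI[of _ U]) (auto simp: L2_zero)

lemma corresponds_X: "corresponds (X t) (harmonic t)"
  using corresponds_combination[of "{t}" "\<lambda>_. id_blinfun"] by (simp add: clinear_op_id)

text \<open>Composing the approximating combinations with \<open>A\<close> increases the errors at most by the factor
  \<open>norm A\<close>.\<close>

lemma corresponds_op:
  assumes YW: "corresponds Y W" and A: "clinear_op A"
  shows "corresponds (\<lambda>x. blinfun_apply A (Y x)) (\<lambda>x. blinfun_apply A (W x))"
proof (rule corresponds_limit)
  fix \<epsilon> :: real assume "\<epsilon> > 0"
  define \<delta> where "\<delta> = \<epsilon> / (norm A + 1)"
  have "norm A + 1 > 0" by (simp add: add_nonneg_pos)
  then have \<delta>: "\<delta> > 0" "norm A * \<delta> < \<epsilon>"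
    using \<open>\<epsilon> > 0\<close> by (auto simp: \<delta>_def field_simps)
  obtain S U where SU: "finite S" "\<forall>t\<in>S. clinear_op (U t)"
    "L2_norm P (\<lambda>x. Y x - (\<Sum>t\<in>S. blinfun_apply (U t) (X t x))) < \<delta>"
    "L2_norm N (\<lambda>x. W x - (\<Sum>t\<in>S. blinfun_apply (U t) (harmonic t x))) < \<delta>"
    using YW \<open>\<delta> > 0\<close> unfolding corresponds_def by meson
  have "corresponds (\<lambda>x. \<Sum>t\<in>S. blinfun_apply (A o\<^sub>L U t) (X t x))
      (\<lambda>x. \<Sum>t\<in>S. blinfun_apply (A o\<^sub>L U t) (harmonic t x))"
    using SU(1,2) by (intro corresponds_combination clinear_op_compose A) auto
  moreover have "L2_norm P (\<lambda>x. blinfun_apply A (Y x) - (\<Sum>t\<in>S. blinfun_apply (A o\<^sub>L U t) (X t x)))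
      \<le> norm A * \<delta>"
    using L2_blinfun(2)[OF L2_diff[OF correspondsD(1)[OF YW] combination_L2(1)[of U S]], of A] SU(3)
    by (simp add: blinfun.diff_right blinfun.sum_right)
      (meson less_imp_le mult_left_mono norm_ge_zero order_trans)
  moreover have "L2_norm N (\<lambda>x. blinfun_apply A (W x) - (\<Sum>t\<in>S. blinfun_apply (A o\<^sub>L U t) (harmonic t x)))
      \<le> norm A * \<delta>"
    using L2_blinfun(2)[OF L2_diff[OF correspondsD(2)[OF YW] combination_L2(2)[of U S]], of A] SU(4)
    by (simp add: blinfun.diff_right blinfun.sum_right)
      (meson less_imp_le mult_left_mono norm_ge_zero order_trans)
  ultimately show "\<exists>Y' W'. corresponds Y' W'
      \<and> L2_norm P (\<lambda>x. blinfun_apply A (Y x) - Y' x) < \<epsilon>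
      \<and> L2_norm N (\<lambda>x. blinfun_apply A (W x) - W' x) < \<epsilon>"
    using \<delta>(2) by (meson le_less_trans)
qed (use YW in \<open>auto intro!: L2_blinfun dest: correspondsD\<close>)

lemma combination_extend:
  fixes v :: "int \<Rightarrow> 'h" and U U' :: "int \<Rightarrow> 'h \<Rightarrow>\<^sub>L 'h"
  assumes "finite S" "finite S'"
  shows "(\<Sum>t\<in>S \<union> S'. blinfun_apply ((if t \<in> S then U t else 0) + (if t \<in> S' then U' t else 0)) (v t))
    = (\<Sum>t\<in>S. blinfun_apply (U t) (v t)) + (\<Sum>t\<in>S'. blinfun_apply (U' t) (v t))"
proof -
  have *: "(\<Sum>t\<in>S \<union> S'. blinfun_apply (if t \<in> T then V t else 0) (v t)) = (\<Sum>t\<in>T. blinfun_apply (V t) (v t))"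
    if "T \<subseteq> S \<union> S'" for T and V :: "int \<Rightarrow> 'h \<Rightarrow>\<^sub>L 'h"
    using assms that by (intro sum.mono_neutral_cong_right) auto
  show ?thesis
    using *[of S U] *[of S' U'] by (simp add: blinfun.add_left sum.distrib)
qed

lemma corresponds_add:
  assumes YW: "corresponds Y W" "corresponds Y' W'"
  shows "corresponds (\<lambda>x. Y x + Y' x) (\<lambda>x. W x + W' x)"
proof (rule corresponds_limit)
  fix \<epsilon> :: real assume "\<epsilon> > 0"
  then have "\<epsilon> / 2 > 0" by simp
  then obtain S U where SU: "finite S" "\<forall>t\<in>S. clinear_op (U t)"
    "L2_norm P (\<lambda>x. Y x - (\<Sum>t\<in>S. blinfun_apply (U t) (X t x))) < \<epsilon> / 2"
    "L2_norm N (\<lambda>x. W x - (\<Sum>t\<in>S. blinfun_apply (U t) (harmonic t x))) < \<epsilon> / 2"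
    using YW(1) unfolding corresponds_def by meson
  obtain S' U' where SU': "finite S'" "\<forall>t\<in>S'. clinear_op (U' t)"
    "L2_norm P (\<lambda>x. Y' x - (\<Sum>t\<in>S'. blinfun_apply (U' t) (X t x))) < \<epsilon> / 2"
    "L2_norm N (\<lambda>x. W' x - (\<Sum>t\<in>S'. blinfun_apply (U' t) (harmonic t x))) < \<epsilon> / 2"
    using YW(2) \<open>\<epsilon> / 2 > 0\<close> unfolding corresponds_def by meson
  define V where "V t = (if t \<in> S then U t else 0) + (if t \<in> S' then U' t else 0)" for t
  have "corresponds (\<lambda>x. \<Sum>t\<in>S \<union> S'. blinfun_apply (V t) (X t x))
      (\<lambda>x. \<Sum>t\<in>S \<union> S'. blinfun_apply (V t) (harmonic t x))"
    using SU SU' by (intro corresponds_combination) (auto simp: V_def intro!: clinear_op_add clinear_op_zero)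
  moreover have "L2_norm P (\<lambda>x. Y x + Y' x - (\<Sum>t\<in>S \<union> S'. blinfun_apply (V t) (X t x))) < \<epsilon>"
    using L2_norm_triangle[OF L2_diff[OF correspondsD(1)[OF YW(1)] combination_L2(1)[of U S]]
        L2_diff[OF correspondsD(1)[OF YW(2)] combination_L2(1)[of U' S']]] SU(3) SU'(3)
    unfolding V_def combination_extend[OF SU(1) SU'(1)] by (simp add: algebra_simps)
  moreover have "L2_norm N (\<lambda>x. W x + W' x - (\<Sum>t\<in>S \<union> S'. blinfun_apply (V t) (harmonic t x))) < \<epsilon>"
    using L2_norm_triangle[OF L2_diff[OF correspondsD(2)[OF YW(1)] combination_L2(2)[of U S]]
        L2_diff[OF correspondsD(2)[OF YW(2)] combination_L2(2)[of U' S']]] SU(4) SU'(4)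
    unfolding V_def combination_extend[OF SU(1) SU'(1)] by (simp add: algebra_simps)
  ultimately show "\<exists>V V'. corresponds V V'
      \<and> L2_norm P (\<lambda>x. Y x + Y' x - V x) < \<epsilon> \<and> L2_norm N (\<lambda>x. W x + W' x - V' x) < \<epsilon>"
    by blast
qed (use YW in \<open>auto intro!: L2_add dest: correspondsD\<close>)

lemma corresponds_diff:
  assumes "corresponds Y W" "corresponds Y' W'"
  shows "corresponds (\<lambda>x. Y x - Y' x) (\<lambda>x. W x - W' x)"
  using corresponds_add[OF assms(1) corresponds_op[OF assms(2) clinear_op_scaleR[OF clinear_op_id, of "-1"]]]
  by (simp add: blinfun.scaleR_left blinfun.minus_left)

lemma corresponds_zero: "corresponds (\<lambda>x. 0) (\<lambda>x. 0)"
  using corresponds_combination[of "{}"] by simp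

lemma corresponds_sum:
  assumes "finite I" "\<And>i. i \<in> I \<Longrightarrow> corresponds (Y i) (W i)"
  shows "corresponds (\<lambda>x. \<Sum>i\<in>I. Y i x) (\<lambda>x. \<Sum>i\<in>I. W i x)"
  using assms by (induction I rule: finite_induct) (auto intro: corresponds_zero corresponds_add)

lemma corresponds_scaleC:
  "corresponds Y W \<Longrightarrow> corresponds (\<lambda>x. c *\<^sub>C Y x) (\<lambda>x. c *\<^sub>C W x)"
  using corresponds_op[OF _ clinear_op_scale_op[OF clinear_op_id, of c]]
  by (simp add: blinfun_scale_op)

lemma corresponds_cong_AE:
  assumes "corresponds Y W" "Y' \<in> borel_measurable P" "W' \<in> borel_measurable N"
    "AE x in P. Y x = Y' x" "AE x in N. W x = W' x"
  shows "corresponds Y' W'"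
proof (rule corresponds_limit)
  note L = correspondsD[OF assms(1)]
  show Y': "Y' \<in> L2 P" and W': "W' \<in> L2 N"
    using L2_cong_AE[OF L(1) assms(2,4)] L2_cong_AE[OF L(2) assms(3,5)] by auto
  have "L2_norm P (\<lambda>x. Y' x - Y x) = L2_norm P (\<lambda>x. 0 :: 'h)"
    by (rule L2_norm_cong_AE) (use assms L2_measurable[OF L2_diff[OF Y' L(1)]] in auto)
  moreover have "L2_norm N (\<lambda>x. W' x - W x) = L2_norm N (\<lambda>x. 0 :: 'h)"
    by (rule L2_norm_cong_AE) (use assms L2_measurable[OF L2_diff[OF W' L(2)]] in auto)
  ultimately show "\<exists>V V'. corresponds V V' \<and> L2_norm P (\<lambda>x. Y' x - V x) < \<epsilon>
      \<and> L2_norm N (\<lambda>x. W' x - V' x) < \<epsilon>" if "\<epsilon> > 0" for \<epsilon>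
    using that assms(1) by (intro exI[of _ Y] exI[of _ W]) (auto simp: L2_zero)
qed

text \<open>A \<open>\<mu>\<close>-null set is invisible in the model, because \<open>\<mu>\<close> is the image of the measure with
  density \<open>(norm \<psi>)\<^sup>2\<close>.\<close>

lemma AE_\<mu>_transfer:
  assumes "AE \<omega> in \<mu>. Q \<omega>"
  shows "AE x in N. \<psi> x = 0 \<or> Q (q x)"
proof -
  obtain B where B: "{\<omega> \<in> space \<mu>. \<not> Q \<omega>} \<subseteq> B" "emeasure \<mu> B = 0" "B \<in> sets \<mu>"
    using assms by (auto elim: AE_E)
  have [measurable]: "B \<in> sets freq_borel" using B(3) by simp
  have "(\<integral>\<^sup>+x. indicator B (q x) * ennreal ((norm (\<psi> x))\<^sup>2) \<partial>N) = 0"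
    using B(2) by (simp add: trace_measure_eq emeasure_distr_density_q)
  then have "AE x in N. indicator B (q x) * ennreal ((norm (\<psi> x))\<^sup>2) = 0"
    by (subst (asm) nn_integral_0_iff_AE) auto
  then show ?thesis
  proof (rule AE_mp, intro AE_I2 impI)
    fix x assume x: "x \<in> space N" "indicator B (q x) * ennreal ((norm (\<psi> x))\<^sup>2) = 0"
    then have "\<psi> x = 0 \<or> q x \<notin> B" by (auto simp: indicator_def split: if_splits)
    then show "\<psi> x = 0 \<or> Q (q x)"
      using B(1) q_range[OF x(1)] by (auto simp: space_\<mu>)
  qed
qed

text \<open>The measure \<open>\<mu>\<close> is the image of \<open>(norm \<psi>)\<^sup>2\<close> under \<open>q\<close>, so multiplying \<open>\<psi>\<close> by a function of the
  frequency is an isometric embedding.\<close>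

lemma scalar_L2:
  fixes h :: "real \<Rightarrow> complex"
  assumes h: "h \<in> L2 \<mu>"
  shows "(\<lambda>x. h (q x) *\<^sub>C \<psi> x) \<in> L2 N"
    and "L2_norm N (\<lambda>x. h (q x) *\<^sub>C \<psi> x) = L2_norm \<mu> h"
proof -
  have [measurable]: "h \<in> borel_measurable freq_borel"
    using L2_measurable[OF h] by (simp cong: measurable_cong_sets)
  have eq: "(\<integral>\<^sup>+x. ennreal ((norm (h (q x) *\<^sub>C \<psi> x))\<^sup>2) \<partial>N) = ennreal ((L2_norm \<mu> h)\<^sup>2)"
    unfolding ennreal_L2_norm_power2[OF h]
    by (subst nn_integral_\<mu>) (auto simp: norm_scaleC power_mult_distrib ennreal_mult mult.commute)
  show L: "(\<lambda>x. h (q x) *\<^sub>C \<psi> x) \<in> L2 N"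
    unfolding L2_iff_nn_integral eq by (auto intro: measurable_scaleC)
  show "L2_norm N (\<lambda>x. h (q x) *\<^sub>C \<psi> x) = L2_norm \<mu> h"
    using eq unfolding ennreal_L2_norm_power2[OF L, symmetric] by (simp add: L2_norm_nonneg)
qed

lemma combination_in_closed_span:
  assumes "finite S"
  shows "(\<lambda>x. \<Sum>t\<in>S. c t *\<^sub>C X t x) \<in> closed_span P X"
  using assms unfolding closed_span_def
  by (auto intro!: L2_sum L2_scaleC X_L2 exI[of _ S] exI[of _ c] simp: L2_zero)

lemma closed_span_diff_combination:
  assumes Y: "Y \<in> closed_span P X" and S: "finite S"
  shows "(\<lambda>x. Y x - (\<Sum>t\<in>S. c t *\<^sub>C X t x)) \<in> closed_span P X"
  unfolding closed_span_def
proof (intro CollectI conjI allI impI)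
  show "(\<lambda>x. Y x - (\<Sum>t\<in>S. c t *\<^sub>C X t x)) \<in> L2 P"
    using Y by (intro L2_diff L2_sum L2_scaleC X_L2) (simp add: closed_span_def)
  fix \<epsilon> :: real assume "\<epsilon> > 0"
  then obtain S' c' where S': "finite S'" "L2_norm P (\<lambda>x. Y x - (\<Sum>t\<in>S'. c' t *\<^sub>C X t x)) < \<epsilon>"
    using Y unfolding closed_span_def by blast
  define d where "d t = (if t \<in> S' then c' t else 0) - (if t \<in> S then c t else 0)" for t
  have "(\<Sum>t\<in>S \<union> S'. d t *\<^sub>C X t x) = (\<Sum>t\<in>S'. c' t *\<^sub>C X t x) - (\<Sum>t\<in>S. c t *\<^sub>C X t x)" for x
  proof -
    have *: "(\<Sum>t\<in>S \<union> S'. (if t \<in> T then a t else 0) *\<^sub>C X t x) = (\<Sum>t\<in>T. a t *\<^sub>C X t x)"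
      if "T \<subseteq> S \<union> S'" for T and a :: "int \<Rightarrow> complex"
      using S S'(1) that by (intro sum.mono_neutral_cong_right) auto
    show ?thesis
      using *[of S c] *[of S' c'] by (simp add: d_def scaleC.diff_left sum_subtractf)
  qed
  then show "\<exists>S' c'. finite S' \<and>
      L2_norm P (\<lambda>x. Y x - (\<Sum>t\<in>S. c t *\<^sub>C X t x) - (\<Sum>t\<in>S'. c' t *\<^sub>C X t x)) < \<epsilon>"
    using S S' by (intro exI[of _ "S \<union> S'"] exI[of _ d]) (simp add: algebra_simps)
qed

lemma isometry_linear:
  assumes "spectral_isometry P X \<mu> T" "Y \<in> closed_span P X" "Y' \<in> closed_span P X"
  shows "AE \<omega> in \<mu>. T (\<lambda>x. a *\<^sub>C Y x + b *\<^sub>C Y' x) \<omega> = a * T Y \<omega> + b * T Y' \<omega>"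
  using assms unfolding spectral_isometry_def by simp

lemma isometry_combination:
  assumes T: "spectral_isometry P X \<mu> T" and "finite S"
  shows "AE \<omega> in \<mu>. T (\<lambda>x. \<Sum>t\<in>S. c t *\<^sub>C X t x) \<omega> = (\<Sum>t\<in>S. c t * cis (of_int t * \<omega>))"
  using \<open>finite S\<close>
proof (induction S rule: finite_induct)
  case empty
  have "AE \<omega> in \<mu>. T (\<lambda>x. 0 *\<^sub>C X 0 x + 0 *\<^sub>C X 0 x) \<omega> = 0 * T (X 0) \<omega> + 0 * T (X 0) \<omega>"
    using combination_in_closed_span[of "{0}" "\<lambda>_. 1"] by (intro isometry_linear[OF T]) auto
  then show ?case by simp
next
  case (insert t S)
  have Xt: "X t \<in> closed_span P X" using combination_in_closed_span[of "{t}" "\<lambda>_. 1"] by simp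
  have "AE \<omega> in \<mu>. T (\<lambda>x. c t *\<^sub>C X t x + 1 *\<^sub>C (\<Sum>t\<in>S. c t *\<^sub>C X t x)) \<omega>
      = c t * T (X t) \<omega> + 1 * T (\<lambda>x. \<Sum>t\<in>S. c t *\<^sub>C X t x) \<omega>"
    by (rule isometry_linear[OF T Xt combination_in_closed_span[OF insert.hyps(1)]])
  moreover have "AE \<omega> in \<mu>. T (X t) \<omega> = cis (of_int t * \<omega>)"
    using T unfolding spectral_isometry_def by blast
  ultimately show ?case
    using insert.IH by eventually_elim (use insert.hyps in simp)
qed

text \<open>If \<open>Y\<close> is close to \<open>\<Sum>t. c t *\<^sub>C X t\<close>, then \<open>T Y\<close> is equally close to \<open>\<Sum>t. c t * cis (t * \<omega>)\<close> in
  \<open>L2 \<mu>\<close>, as \<open>T\<close> is a linear isometry, and this distance is the one in the model.\<close>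

lemma corresponds_closed_span:
  assumes T: "spectral_isometry P X \<mu> T" and Y: "Y \<in> closed_span P X"
  shows "corresponds Y (\<lambda>x. T Y (q x) *\<^sub>C \<psi> x)"
proof (rule corresponds_limit)
  show YL: "Y \<in> L2 P" using Y by (simp add: closed_span_def)
  have TY: "T Y \<in> L2 \<mu>" using T Y by (simp add: spectral_isometry_def)
  show "(\<lambda>x. T Y (q x) *\<^sub>C \<psi> x) \<in> L2 N" by (rule scalar_L2[OF TY])
  fix \<epsilon> :: real assume "\<epsilon> > 0"
  then obtain S c where S: "finite S" and c: "L2_norm P (\<lambda>x. Y x - (\<Sum>t\<in>S. c t *\<^sub>C X t x)) < \<epsilon>"
    using Y unfolding closed_span_def by blast
  let ?V = "\<lambda>x. \<Sum>t\<in>S. c t *\<^sub>C X t x" and ?V' = "\<lambda>x. \<Sum>t\<in>S. c t *\<^sub>C harmonic t x"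
  have "corresponds ?V ?V'"
    using S by (intro corresponds_sum corresponds_scaleC corresponds_X)
  moreover have "L2_norm N (\<lambda>x. T Y (q x) *\<^sub>C \<psi> x - ?V' x) < \<epsilon>"
  proof -
    let ?D = "\<lambda>x. Y x - ?V x"
    have D: "?D \<in> closed_span P X" by (rule closed_span_diff_combination[OF Y S])
    have TD: "T ?D \<in> L2 \<mu>" "L2_norm \<mu> (T ?D) = L2_norm P ?D"
      using T D by (auto simp: spectral_isometry_def)
    have "AE \<omega> in \<mu>. T (\<lambda>x. 1 *\<^sub>C Y x + (- 1) *\<^sub>C ?V x) \<omega> = 1 * T Y \<omega> + (- 1) * T ?V \<omega>"
      by (rule isometry_linear[OF T Y combination_in_closed_span[OF S]])
    moreover have "(\<lambda>x. 1 *\<^sub>C Y x + (- 1) *\<^sub>C ?V x) = ?D" by (simp add: scaleC.minus_left)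
    ultimately have AE: "AE \<omega> in \<mu>. T ?D \<omega> = T Y \<omega> - (\<Sum>t\<in>S. c t * cis (of_int t * \<omega>))"
      using isometry_combination[OF T S, of c] by (simp only:) (auto elim: AE_mp)
    have "AE x in N. T ?D (q x) *\<^sub>C \<psi> x = T Y (q x) *\<^sub>C \<psi> x - ?V' x"
      using AE_\<mu>_transfer[OF AE]
    proof (rule AE_mp, intro AE_I2 impI)
      fix x assume "\<psi> x = 0 \<or> T ?D (q x) = T Y (q x) - (\<Sum>t\<in>S. c t * cis (of_int t * q x))"
      then show "T ?D (q x) *\<^sub>C \<psi> x = T Y (q x) *\<^sub>C \<psi> x - ?V' x"
        by (auto simp: harmonic_def scaleC.diff_left scaleC.sum_left scaleC_scaleC)
    qed
    then have "L2_norm N (\<lambda>x. T Y (q x) *\<^sub>C \<psi> x - ?V' x) = L2_norm N (\<lambda>x. T ?D (q x) *\<^sub>C \<psi> x)"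
      using scalar_L2(1)[OF TY] scalar_L2(1)[OF TD(1)] correspondsD(2)[OF \<open>corresponds ?V ?V'\<close>]
      by (intro L2_norm_cong_AE L2_measurable L2_diff) auto
    also have "\<dots> = L2_norm P ?D" by (simp add: scalar_L2(2)[OF TD(1)] TD(2))
    finally show ?thesis using c by simp
  qed
  ultimately show "\<exists>Y' W'. corresponds Y' W' \<and> L2_norm P (\<lambda>x. Y x - Y' x) < \<epsilon>
      \<and> L2_norm N (\<lambda>x. T Y (q x) *\<^sub>C \<psi> x - W' x) < \<epsilon>" using c by blast
qed

lemma indicator_L2_\<mu>:
  assumes "E \<in> sets freq_borel"
  shows "(indicator E :: real \<Rightarrow> complex) \<in> L2 \<mu>"
proof -
  interpret finite_measure \<mu> by (rule finite_\<mu>)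
  have [measurable]: "E \<in> sets \<mu>" using assms by simp
  have m: "(indicator E :: real \<Rightarrow> complex) \<in> borel_measurable \<mu>" by measurable
  have "integrable \<mu> (\<lambda>\<omega>. (norm (indicator E \<omega> :: complex))\<^sup>2)"
    by (rule integrable_const_bound[of _ 1]) (use m in \<open>auto simp: indicator_def\<close>)
  then show ?thesis using m by (simp add: L2_def)
qed

lemma indicator_scaleC: "indicator E \<omega> *\<^sub>C (y::'h) = indicat_real E \<omega> *\<^sub>R y"
  by (auto simp: indicator_def)

lemma corresponds_AE_indicator:
  assumes T: "spectral_isometry P X \<mu> T" and Y: "Y \<in> closed_span P X"
    and E: "E \<in> sets freq_borel" and AE: "AE \<omega> in \<mu>. T Y \<omega> = indicator E \<omega>"
  shows "corresponds Y (\<lambda>x. indicat_real E (q x) *\<^sub>R \<psi> x)"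
proof -
  note c = corresponds_closed_span[OF T Y]
  have "AE x in N. T Y (q x) *\<^sub>C \<psi> x = indicat_real E (q x) *\<^sub>R \<psi> x"
    using AE_\<mu>_transfer[OF AE]
    by (rule AE_mp) (auto simp: indicator_scaleC)
  moreover have "(\<lambda>x. indicat_real E (q x) *\<^sub>R \<psi> x) \<in> borel_measurable N"
    using E by measurable
  ultimately show ?thesis
    by (intro corresponds_cong_AE[OF c]) (auto intro: L2_measurable correspondsD(1)[OF c])
qed

lemma Ioc_in_freq_borel [measurable]:
  "- pi \<le> a \<Longrightarrow> b \<le> pi \<Longrightarrow> {a<..b} \<in> sets freq_borel"
  "- pi \<le> a \<Longrightarrow> b \<le> pi \<Longrightarrow> {a<..<b} \<in> sets freq_borel"
  by (auto simp: sets_restrict_space_iff)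

lemma corresponds_Z:
  assumes "a \<in> {- pi..pi}"
  shows "corresponds (Z a) (\<lambda>x. indicat_real {- pi<..a} (q x) *\<^sub>R \<psi> x)"
proof -
  obtain T where T: "spectral_isometry P X \<mu> T"
    and "\<forall>a\<in>{- pi..pi}. Z a \<in> closed_span P X \<and> (AE \<omega> in \<mu>. T (Z a) \<omega> = indicator {- pi<..a} \<omega>)"
    using increments unfolding is_increment_process_def by blast
  then show ?thesis
    using assms by (intro corresponds_AE_indicator[OF T] Ioc_in_freq_borel) auto
qed

text \<open>The spectral isometry is onto, so the scalar function \<open>indicator E\<close> is the image of some element.\<close>

lemma ex_corresponds_indicator:
  assumes "E \<in> sets freq_borel"
  shows "\<exists>Y. corresponds Y (\<lambda>x. indicat_real E (q x) *\<^sub>R \<psi> x)"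
proof -
  obtain T where T: "spectral_isometry P X \<mu> T"
    using increments unfolding is_increment_process_def by blast
  then obtain Y where "Y \<in> closed_span P X" "AE \<omega> in \<mu>. T Y \<omega> = indicator E \<omega>"
    using indicator_L2_\<mu>[OF assms] unfolding spectral_isometry_def by blast
  then show ?thesis using corresponds_AE_indicator[OF T _ assms] by blast
qed

text \<open>The element of the closed span that corresponds to \<open>{- pi<..<a}\<close> is a left limit of \<open>Z\<close> at \<open>a\<close>,
  because its squared distance from \<open>Z \<omega>\<close> is the \<open>\<mu>\<close>-measure of \<open>{\<omega><..<a}\<close>. Left limits are unique almost
  surely, so the version chosen by \<open>left_limit\<close> corresponds to the same function.\<close>

lemma corresponds_process_jump:
  assumes a: "a \<in> {- pi<..pi}"
  shows "corresponds (process_jump P Z a) (\<lambda>x. indicat_real {a} (q x) *\<^sub>R \<psi> x)"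
proof -
  have "{- pi<..<a} \<in> sets freq_borel" using a by (intro Ioc_in_freq_borel) auto
  then obtain Y where Y: "corresponds Y (\<lambda>x. indicat_real {- pi<..<a} (q x) *\<^sub>R \<psi> x)"
    using ex_corresponds_indicator by blast
  have dist: "L2_norm P (\<lambda>x. Z \<omega> x - Y x) = sqrt (measure \<mu> {\<omega><..<a})" if \<omega>: "\<omega> \<in> {- pi<..<a}" for \<omega>
  proof -
    have c: "corresponds (\<lambda>x. Z \<omega> x - Y x)
        (\<lambda>x. indicat_real {- pi<..\<omega>} (q x) *\<^sub>R \<psi> x - indicat_real {- pi<..<a} (q x) *\<^sub>R \<psi> x)"
      using \<omega> a by (intro corresponds_diff corresponds_Z Y) auto
    have E: "{\<omega><..<a} \<in> sets freq_borel" using \<omega> a by (intro Ioc_in_freq_borel) auto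
    have "(norm (indicat_real {- pi<..\<omega>} (q x) *\<^sub>R \<psi> x - indicat_real {- pi<..<a} (q x) *\<^sub>R \<psi> x))
      = norm (indicator {\<omega><..<a} (q x) *\<^sub>C \<psi> x)" for x
      using \<omega> by (auto simp: indicator_def)
    then have "L2_norm P (\<lambda>x. Z \<omega> x - Y x) = L2_norm N (\<lambda>x. indicator {\<omega><..<a} (q x) *\<^sub>C \<psi> x)"
      unfolding corresponds_norm[OF c] by (simp add: L2_norm_def)
    also have "\<dots> = L2_norm \<mu> (indicator {\<omega><..<a} :: real \<Rightarrow> complex)"
      by (rule scalar_L2[OF indicator_L2_\<mu>[OF E]])
    also have "\<dots> = sqrt (\<integral>\<omega>'. indicat_real {\<omega><..<a} \<omega>' \<partial>\<mu>)"
      unfolding L2_norm_def by (intro arg_cong[of _ _ sqrt] Bochner_Integration.integral_cong) (auto simp: indicator_def)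
    also have "\<dots> = sqrt (measure \<mu> {\<omega><..<a})"
      using E by (simp add: measure_def sets.Int_space_eq2)
    finally show ?thesis .
  qed
  have "((\<lambda>\<omega>. sqrt (measure \<mu> {\<omega><..<a})) \<longlongrightarrow> sqrt 0) (at_left a)"
    using a by (intro tendsto_real_sqrt measure_left_interval_tendsto_0[of \<mu> "- pi"] finite_\<mu>)
      (auto intro: Ioc_in_freq_borel)
  moreover have "eventually (\<lambda>\<omega>. sqrt (measure \<mu> {\<omega><..<a}) = L2_norm P (\<lambda>x. Z \<omega> x - Y x)) (at_left a)"
    using eventually_at_left_real[of "- pi" a] a by (auto simp: dist elim: eventually_mono)
  ultimately have limY: "((\<lambda>\<omega>. L2_norm P (\<lambda>x. Z \<omega> x - Y x)) \<longlongrightarrow> 0) (at_left a)"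
    using tendsto_cong by fastforce
  define L where "L = left_limit P Z a"
  have "L \<in> L2 P \<and> ((\<lambda>\<omega>. L2_norm P (\<lambda>x. Z \<omega> x - L x)) \<longlongrightarrow> 0) (at_left a)"
    unfolding L_def left_limit_def
    by (rule someI[of _ Y]) (use limY correspondsD(1)[OF Y] in blast)
  then have L: "L \<in> L2 P" "((\<lambda>\<omega>. L2_norm P (\<lambda>x. Z \<omega> x - L x)) \<longlongrightarrow> 0) (at_left a)" by auto
  have "L2_norm P (\<lambda>x. L x - Y x) \<le> 0"
  proof (rule tendsto_lowerbound)
    show "((\<lambda>\<omega>. L2_norm P (\<lambda>x. Z \<omega> x - L x) + L2_norm P (\<lambda>x. Z \<omega> x - Y x)) \<longlongrightarrow> 0) (at_left a)"
      using tendsto_add[OF L(2) limY] by simp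
    have "eventually (\<lambda>\<omega>. \<omega> \<in> {- pi<..<a}) (at_left a)"
      using a eventually_at_left_real[of "- pi" a] by simp
    then show "eventually (\<lambda>\<omega>. L2_norm P (\<lambda>x. L x - Y x)
      \<le> L2_norm P (\<lambda>x. Z \<omega> x - L x) + L2_norm P (\<lambda>x. Z \<omega> x - Y x)) (at_left a)"
    proof (rule eventually_mono)
      fix \<omega> assume "\<omega> \<in> {- pi<..<a}"
      then have "Z \<omega> \<in> L2 P" using a by (intro correspondsD(1)[OF corresponds_Z]) auto
      then show "L2_norm P (\<lambda>x. L x - Y x)
          \<le> L2_norm P (\<lambda>x. Z \<omega> x - L x) + L2_norm P (\<lambda>x. Z \<omega> x - Y x)"
        using L2_norm_triangle_diff[OF L(1) _ correspondsD(1)[OF Y], of "Z \<omega>"]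
        by (simp add: L2_norm_minus_commute[of P L])
    qed
  qed simp
  then have "AE x in P. L x - Y x = 0"
    by (intro L2_norm_eq_0_AE L2_diff L(1) correspondsD(1)[OF Y] antisym L2_norm_nonneg)
  then have "corresponds L (\<lambda>x. indicat_real {- pi<..<a} (q x) *\<^sub>R \<psi> x)"
    by (intro corresponds_cong_AE[OF Y] L2_measurable L(1) correspondsD(2)[OF Y]) auto
  then have "corresponds (\<lambda>x. Z a x - L x)
      (\<lambda>x. indicat_real {- pi<..a} (q x) *\<^sub>R \<psi> x - indicat_real {- pi<..<a} (q x) *\<^sub>R \<psi> x)"
    using a by (intro corresponds_diff corresponds_Z) auto
  moreover have "indicat_real {- pi<..a} (q x) *\<^sub>R \<psi> x - indicat_real {- pi<..<a} (q x) *\<^sub>R \<psi> x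
      = indicat_real {a} (q x) *\<^sub>R \<psi> x" for x
    using a by (auto simp: indicator_def)
  moreover have "(\<lambda>x. Z a x - L x) = process_jump P Z a" by (auto simp: L_def process_jump_def)
  ultimately show ?thesis by simp
qed

end

section \<open>Step functions are dense in the Bochner space\<close>

text \<open>The everywhere convergent version of strong measurability on the frequency domain. Elements
  of the Bochner space have such versions, and norms of these are Borel measurable.\<close>

definition strong_limit :: "(real \<Rightarrow> 'b::real_normed_vector) \<Rightarrow> bool" where
  "strong_limit U \<longleftrightarrow> (\<exists>s. (\<forall>n::nat. simple_function freq_borel (s n))
     \<and> (\<forall>\<omega>\<in>{- pi..pi}. (\<lambda>n. s n \<omega>) \<longlonglongrightarrow> U \<omega>))"

lemma space_freq_borel: "space freq_borel = {- pi..pi}"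
  by (simp add: space_restrict_space)

lemma strong_limit_simple: "simple_function freq_borel U \<Longrightarrow> strong_limit U"
  unfolding strong_limit_def by (intro exI[of _ "\<lambda>_. U"]) auto

lemma simple_function_indicator_freq:
  assumes "A \<in> sets borel"
  shows "simple_function freq_borel (indicat_real A)"
proof -
  have "simple_function freq_borel (indicat_real (A \<inter> {- pi..pi}))"
    using assms by (intro simple_function_indicator) (auto simp: sets_restrict_space_iff)
  then show ?thesis
    by (rule simple_function_cong[THEN iffD1, rotated]) (auto simp: space_restrict_space indicator_def)
qed

lemma simple_function_indicator_scaleR:
  "A \<in> sets borel \<Longrightarrow> simple_function freq_borel (\<lambda>\<omega>. indicat_real A \<omega> *\<^sub>R V)"
  by (rule simple_function_compose1[OF simple_function_indicator_freq])

lemma strong_limit_add: "strong_limit U \<Longrightarrow> strong_limit V \<Longrightarrow> strong_limit (\<lambda>\<omega>. U \<omega> + V \<omega>)"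
  unfolding strong_limit_def
proof (elim exE conjE)
  fix s s' assume *: "\<forall>n::nat. simple_function freq_borel (s n)" "\<forall>\<omega>\<in>{- pi..pi}. (\<lambda>n. s n \<omega>) \<longlonglongrightarrow> U \<omega>"
    "\<forall>n::nat. simple_function freq_borel (s' n)" "\<forall>\<omega>\<in>{- pi..pi}. (\<lambda>n. s' n \<omega>) \<longlonglongrightarrow> V \<omega>"
  show "\<exists>s. (\<forall>n::nat. simple_function freq_borel (s n)) \<and> (\<forall>\<omega>\<in>{- pi..pi}. (\<lambda>n. s n \<omega>) \<longlonglongrightarrow> U \<omega> + V \<omega>)"
    using * by (intro exI[of _ "\<lambda>n \<omega>. s n \<omega> + s' n \<omega>"])
      (auto intro!: tendsto_add simple_function_compose2[where h="(+)"])
qed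

lemma strong_limit_uminus: "strong_limit U \<Longrightarrow> strong_limit (\<lambda>\<omega>. - U \<omega>)"
  unfolding strong_limit_def
proof (elim exE conjE)
  fix s assume *: "\<forall>n::nat. simple_function freq_borel (s n)" "\<forall>\<omega>\<in>{- pi..pi}. (\<lambda>n. s n \<omega>) \<longlonglongrightarrow> U \<omega>"
  show "\<exists>s. (\<forall>n::nat. simple_function freq_borel (s n)) \<and> (\<forall>\<omega>\<in>{- pi..pi}. (\<lambda>n. s n \<omega>) \<longlonglongrightarrow> - U \<omega>)"
    using * by (intro exI[of _ "\<lambda>n \<omega>. - s n \<omega>"])
      (auto intro!: tendsto_minus simple_function_compose1[where g="uminus"])
qed

lemma strong_limit_diff: "strong_limit U \<Longrightarrow> strong_limit V \<Longrightarrow> strong_limit (\<lambda>\<omega>. U \<omega> - V \<omega>)"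
  using strong_limit_add[OF _ strong_limit_uminus, of U V] by simp

lemma strong_limit_restrict:
  fixes A :: "real \<Rightarrow> 'b::real_normed_vector"
  assumes "strong_limit A" "E \<in> sets borel"
  shows "strong_limit (\<lambda>\<omega>. indicat_real E \<omega> *\<^sub>R A \<omega>)"
proof -
  obtain s where s: "\<And>n::nat. simple_function freq_borel (s n)"
    "\<And>\<omega>. \<omega> \<in> {- pi..pi} \<Longrightarrow> (\<lambda>n. s n \<omega>) \<longlonglongrightarrow> A \<omega>"
    using assms(1) unfolding strong_limit_def by blast
  have E: "simple_function freq_borel (indicat_real E)"
    using assms(2) by (rule simple_function_indicator_freq)
  show ?thesis
    unfolding strong_limit_def
  proof (intro exI[of _ "\<lambda>n \<omega>. indicat_real E \<omega> *\<^sub>R s n \<omega>"] conjI allI ballI)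
    show "simple_function freq_borel (\<lambda>\<omega>. indicat_real E \<omega> *\<^sub>R s n \<omega>)" for n
      by (rule simple_function_compose2[OF E s(1)])
    show "(\<lambda>n. indicat_real E \<omega> *\<^sub>R s n \<omega>) \<longlonglongrightarrow> indicat_real E \<omega> *\<^sub>R A \<omega>" if "\<omega> \<in> {- pi..pi}" for \<omega>
      by (intro tendsto_intros s(2) that)
  qed
qed

lemma strong_limit_norm_measurable:
  assumes "strong_limit U"
  shows "(\<lambda>\<omega>. norm (U \<omega>)) \<in> borel_measurable freq_borel"
proof -
  obtain s where s: "\<And>n::nat. simple_function freq_borel (s n)"
    "\<And>\<omega>. \<omega> \<in> {- pi..pi} \<Longrightarrow> (\<lambda>n. s n \<omega>) \<longlonglongrightarrow> U \<omega>"
    using assms unfolding strong_limit_def by blast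
  show ?thesis
  proof (rule borel_measurable_LIMSEQ_metric)
    show "(\<lambda>\<omega>. norm (s n \<omega>)) \<in> borel_measurable freq_borel" for n
      using simple_function_compose1[OF s(1)] by (rule borel_measurable_simple_function)
    show "(\<lambda>n. norm (s n \<omega>)) \<longlonglongrightarrow> norm (U \<omega>)" if "\<omega> \<in> space freq_borel" for \<omega>
      using that by (intro tendsto_norm s(2)) (simp add: space_restrict_space)
  qed
qed

lemma B_inf_norm2_add_le:
  assumes \<mu>: "sets \<mu> = sets freq_borel" and U: "strong_limit U" and V: "strong_limit V"
  shows "B_inf_norm2 \<mu> (\<lambda>\<omega>. U \<omega> + V \<omega>) \<le> 2 * B_inf_norm2 \<mu> U + 2 * B_inf_norm2 \<mu> V"
proof -
  have [measurable_cong]: "sets \<mu> = sets freq_borel" by (rule \<mu>)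
  note [measurable] = strong_limit_norm_measurable[OF U] strong_limit_norm_measurable[OF V]
  have "B_inf_norm2 \<mu> (\<lambda>\<omega>. U \<omega> + V \<omega>)
      \<le> (\<integral>\<^sup>+\<omega>. 2 * ennreal ((norm (U \<omega>))\<^sup>2) + 2 * ennreal ((norm (V \<omega>))\<^sup>2) \<partial>\<mu>)"
    unfolding B_inf_norm2_def
  proof (rule nn_integral_mono)
    fix \<omega>
    have "ennreal ((norm (U \<omega> + V \<omega>))\<^sup>2) \<le> ennreal (2 * (norm (U \<omega>))\<^sup>2 + 2 * (norm (V \<omega>))\<^sup>2)"
      by (intro ennreal_leI norm_add_power2_le)
    also have "\<dots> = 2 * ennreal ((norm (U \<omega>))\<^sup>2) + 2 * ennreal ((norm (V \<omega>))\<^sup>2)"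
      by (simp add: ennreal_mult)
    finally show "ennreal ((norm (U \<omega> + V \<omega>))\<^sup>2) \<le> 2 * ennreal ((norm (U \<omega>))\<^sup>2) + 2 * ennreal ((norm (V \<omega>))\<^sup>2)" .
  qed
  also have "\<dots> = 2 * B_inf_norm2 \<mu> U + 2 * B_inf_norm2 \<mu> V"
    unfolding B_inf_norm2_def by (simp add: nn_integral_add nn_integral_cmult)
  finally show ?thesis .
qed

lemma B_inf_norm2_minus: "B_inf_norm2 \<mu> (\<lambda>\<omega>. - U \<omega>) = B_inf_norm2 \<mu> U"
  by (simp add: B_inf_norm2_def)

lemma B_inf_norm2_cong_AE:
  "AE \<omega> in \<mu>. U \<omega> = V \<omega> \<Longrightarrow> B_inf_norm2 \<mu> U = B_inf_norm2 \<mu> V"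
  unfolding B_inf_norm2_def by (intro nn_integral_cong_AE) auto

text \<open>Sums of step functions over different partitions are step functions over a common
  refinement. To make this a union of sets of partition points, step functions are described without
  an order of these points: \<open>U\<close> depends only on which points of \<open>S\<close> lie to the left of the argument and
  vanishes outside the range of \<open>S\<close>.\<close>

definition adapted :: "real set \<Rightarrow> (real \<Rightarrow> ('h::complex_hilbert_space \<Rightarrow>\<^sub>L 'h)) \<Rightarrow> bool" where
  "adapted S U \<longleftrightarrow> finite S \<and> S \<subseteq> {- pi..pi}
     \<and> (\<forall>\<omega> \<omega>'. (\<forall>s\<in>S. \<omega> \<le> s \<longleftrightarrow> \<omega>' \<le> s) \<longrightarrow> U \<omega> = U \<omega>')
     \<and> (\<forall>\<omega>. (\<forall>s\<in>S. \<omega> \<le> s) \<or> (\<forall>s\<in>S. s < \<omega>) \<longrightarrow> U \<omega> = 0)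
     \<and> (\<forall>\<omega>. clinear_op (U \<omega>))"

lemma adapted_add: "adapted S U \<Longrightarrow> adapted S' U' \<Longrightarrow> adapted (S \<union> S') (\<lambda>\<omega>. U \<omega> + U' \<omega>)"
proof -
  assume A: "adapted S U" "adapted S' U'"
  have const: "U \<omega> + U' \<omega> = U \<omega>' + U' \<omega>'" if "\<forall>s\<in>S \<union> S'. \<omega> \<le> s \<longleftrightarrow> \<omega>' \<le> s" for \<omega> \<omega>'
  proof -
    have "U \<omega> = U \<omega>'" using A(1) that unfolding adapted_def by blast
    moreover have "U' \<omega> = U' \<omega>'" using A(2) that unfolding adapted_def by blast
    ultimately show ?thesis by simp
  qed
  have zero: "U \<omega> + U' \<omega> = 0" if "(\<forall>s\<in>S \<union> S'. \<omega> \<le> s) \<or> (\<forall>s\<in>S \<union> S'. s < \<omega>)" for \<omega>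
  proof -
    have "U \<omega> = 0" using A(1) that unfolding adapted_def by blast
    moreover have "U' \<omega> = 0" using A(2) that unfolding adapted_def by blast
    ultimately show ?thesis by simp
  qed
  have "clinear_op (U \<omega> + U' \<omega>)" for \<omega>
    using A unfolding adapted_def by (intro clinear_op_add) auto
  moreover have "finite (S \<union> S')" "S \<union> S' \<subseteq> {- pi..pi}" using A unfolding adapted_def by auto
  ultimately show ?thesis
    unfolding adapted_def by (intro conjI allI impI) (assumption | erule const zero | fact)+
qed

lemma adapted_step_fun:
  assumes "step_data n \<alpha> V"
  shows "adapted (\<alpha> ` {..n}) (step_fun n \<alpha> V)"
proof -
  have i: "indicat_real {a<..b} \<omega> = (if \<omega> \<le> a \<or> \<not> \<omega> \<le> b then 0 else 1)" for a b \<omega> :: real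
    by (auto simp: indicator_def)
  have "step_fun n \<alpha> V \<omega> = step_fun n \<alpha> V \<omega>'"
    if "\<forall>s\<in>\<alpha> ` {..n}. \<omega> \<le> s \<longleftrightarrow> \<omega>' \<le> s" for \<omega> \<omega>'
    unfolding step_fun_def by (intro sum.cong) (use that in \<open>auto simp: i\<close>)
  moreover have "step_fun n \<alpha> V \<omega> = 0" if "(\<forall>s\<in>\<alpha> ` {..n}. \<omega> \<le> s) \<or> (\<forall>s\<in>\<alpha> ` {..n}. s < \<omega>)" for \<omega>
    unfolding step_fun_def
  proof (intro sum.neutral ballI)
    fix j assume "j \<in> {..<n}"
    then have "\<alpha> j \<in> \<alpha> ` {..n}" "\<alpha> (Suc j) \<in> \<alpha> ` {..n}" by auto
    then show "indicat_real {\<alpha> j<..\<alpha> (Suc j)} \<omega> *\<^sub>R V j = 0"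
      using that unfolding i by force
  qed
  moreover have "clinear_op (step_fun n \<alpha> V \<omega>)" for \<omega>
    unfolding step_fun_def
    by (intro clinear_op_sum clinear_op_scaleR) (use assms in \<open>auto simp: step_data_def\<close>)
  ultimately show ?thesis
    using assms unfolding adapted_def step_data_def by blast
qed

lemma step_data_zero: "step_data 0 (\<lambda>_. 0) (\<lambda>_. 0)"
  by (simp add: step_data_def mono_on_def)

text \<open>The cells between consecutive points of the sorted set \<open>S\<close> serve as partition; on each cell the
  function has its value at the right end point.\<close>

lemma adapted_imp_step_fun:
  assumes U: "adapted S U"
  shows "\<exists>n \<alpha> V. step_data n \<alpha> V \<and> U = step_fun n \<alpha> V"
proof (cases "S = {}")
  case True
  then have "U \<omega> = 0" for \<omega> using U unfolding adapted_def by blast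
  then show ?thesis
    by (intro exI[of _ 0] exI[of _ "\<lambda>_. 0"]) (auto simp: step_data_zero step_fun_def fun_eq_iff)
next
  case False
  have S: "finite S" "S \<subseteq> {- pi..pi}" using U by (auto simp: adapted_def)
  define xs where "xs = sorted_list_of_set S"
  define n where "n = length xs - 1"
  have set: "set xs = S" and sorted: "sorted_wrt (<) xs" and "xs \<noteq> []"
    using S False by (auto simp: xs_def)
  then have len: "length xs = Suc n" by (cases xs) (auto simp: n_def)
  have lt: "xs ! i < xs ! j" if "i < j" "j \<le> n" for i j
    using sorted_wrt_nth_less[OF sorted, of i j] that len by simp
  have mono: "xs ! i \<le> xs ! j \<longleftrightarrow> i \<le> j" if "i \<le> n" "j \<le> n" for i j
  proof (cases i j rule: linorder_cases)
    case less
    then show ?thesis using lt[OF less that(2)] by simp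
  next
    case greater
    then show ?thesis using lt[OF greater that(1)] by simp
  qed simp
  have S_eq: "S = (!) xs ` {..n}"
    using set len by (auto simp: set_conv_nth image_iff less_Suc_eq_le)
  let ?V = "\<lambda>i. U (xs ! Suc i)"
  have "step_data n ((!) xs) ?V"
    unfolding step_data_def
  proof (intro conjI allI impI)
    show "mono_on {..n} ((!) xs)" using mono by (intro mono_onI) auto
    show "(!) xs ` {..n} \<subseteq> {- pi..pi}" using S(2) S_eq by metis
    show "clinear_op (U (xs ! Suc i))" for i using U by (simp only: adapted_def)
  qed
  moreover have "U \<omega> = step_fun n ((!) xs) ?V \<omega>" for \<omega>
  proof (cases "(\<forall>s\<in>S. \<omega> \<le> s) \<or> (\<forall>s\<in>S. s < \<omega>)")
    case True
    then have "U \<omega> = 0" using U unfolding adapted_def by blast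
    moreover have "step_fun n ((!) xs) ?V \<omega> = 0"
      unfolding step_fun_def
    proof (intro sum.neutral ballI)
      fix i assume "i \<in> {..<n}"
      then have "xs ! i \<in> S" "xs ! Suc i \<in> S" by (auto simp: S_eq)
      then show "indicat_real {xs ! i<..xs ! Suc i} \<omega> *\<^sub>R U (xs ! Suc i) = 0"
        using True by (force simp: indicator_def)
    qed
    ultimately show ?thesis by simp
  next
    case False
    obtain s where s: "s \<in> S" "s < \<omega>" using False by (auto simp: not_le)
    obtain s' where s': "s' \<in> S" "\<omega> \<le> s'" using False by (auto simp: not_less)
    obtain a where a: "a \<le> n" "xs ! a < \<omega>" using s unfolding S_eq by auto
    obtain b where b: "b \<le> n" "\<omega> \<le> xs ! b" using s' unfolding S_eq by auto
    \<comment> \<open>\<open>xs ! j\<close> is the right end point of the cell that contains \<open>\<omega>\<close>.\<close>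
    define j where "j = (LEAST j. j \<le> n \<and> \<omega> \<le> xs ! j)"
    have j: "j \<le> n \<and> \<omega> \<le> xs ! j" unfolding j_def
      by (rule LeastI[of "\<lambda>j. j \<le> n \<and> \<omega> \<le> xs ! j" b]) (use b in simp)
    have j_least: "j \<le> m" if "m \<le> n" "\<omega> \<le> xs ! m" for m unfolding j_def
      using that by (intro Least_le conjI)
    have le_iff: "\<omega> \<le> xs ! m \<longleftrightarrow> j \<le> m" if "m \<le> n" for m
    proof
      assume "j \<le> m"
      then have "xs ! j \<le> xs ! m" using mono[of j m] j that by simp
      then show "\<omega> \<le> xs ! m" using j by linarith
    qed (use j_least that in auto)
    have "a < j" using le_iff[OF a(1)] a(2) by simp
    then obtain i0 where i0: "j = Suc i0" by (cases j) auto
    have "step_fun n ((!) xs) ?V \<omega> = (\<Sum>i<n. if i = i0 then U (xs ! j) else 0)"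
      unfolding step_fun_def
    proof (intro sum.cong refl)
      fix i assume "i \<in> {..<n}"
      then have "indicat_real {xs ! i<..xs ! Suc i} \<omega> = (if i = i0 then 1 else 0)"
        using le_iff[of i] le_iff[of "Suc i"] i0 by (auto simp: indicator_def not_le)
      then show "indicat_real {xs ! i<..xs ! Suc i} \<omega> *\<^sub>R U (xs ! Suc i) = (if i = i0 then U (xs ! j) else 0)"
        using i0 by simp
    qed
    also have "\<dots> = U (xs ! j)" using i0 j by (simp add: sum.delta)
    also have "\<dots> = U \<omega>"
    proof -
      have "\<forall>s\<in>S. xs ! j \<le> s \<longleftrightarrow> \<omega> \<le> s"
        using le_iff mono j by (auto simp: S_eq)
      then show ?thesis using U unfolding adapted_def by blast
    qed
    finally show ?thesis by simp
  qed
  ultimately show ?thesis by (intro exI[of _ n] exI[of _ "(!) xs"] exI[of _ ?V] conjI ext)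
qed

lemma step_fun_add:
  assumes "step_data n \<alpha> V" "step_data n' \<alpha>' V'"
  shows "\<exists>m \<beta> W. step_data m \<beta> W \<and> (\<forall>\<omega>. step_fun n \<alpha> V \<omega> + step_fun n' \<alpha>' V' \<omega> = step_fun m \<beta> W \<omega>)"
  using adapted_imp_step_fun[OF adapted_add[OF assms[THEN adapted_step_fun]]] by (metis)

lemma step_fun_uminus:
  assumes "step_data n \<alpha> V"
  shows "step_data n \<alpha> (\<lambda>i. - V i)" "step_fun n \<alpha> (\<lambda>i. - V i) \<omega> = - step_fun n \<alpha> V \<omega>"
  using assms clinear_op_scaleR[of _ "-1"]
  by (auto simp: step_data_def step_fun_def sum_negf)

lemma simple_function_step_fun:
  assumes "step_data n \<alpha> V"
  shows "simple_function freq_borel (step_fun n \<alpha> V)"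
proof -
  have "simple_function freq_borel (\<lambda>\<omega>. indicat_real {\<alpha> i<..\<alpha> (Suc i)} \<omega> *\<^sub>R V i)" if "i < n" for i
  proof (rule simple_function_compose1[where g="\<lambda>r. r *\<^sub>R V i"])
    have "\<alpha> i \<in> {- pi..pi}" "\<alpha> (Suc i) \<in> {- pi..pi}"
      using assms that by (simp_all add: step_data_def image_subset_iff)
    then show "simple_function freq_borel (indicat_real {\<alpha> i<..\<alpha> (Suc i)})"
      by (intro simple_function_indicator) (auto simp: sets_restrict_space_iff)
  qed
  then show ?thesis unfolding step_fun_def[abs_def] by (intro simple_function_sum) auto
qed

lemmas strong_limit_step_fun = strong_limit_simple[OF simple_function_step_fun]

definition step_approximable :: "real measure \<Rightarrow> (real \<Rightarrow> ('h::complex_hilbert_space \<Rightarrow>\<^sub>L 'h)) \<Rightarrow> bool" where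
  "step_approximable \<mu> U \<longleftrightarrow> strong_limit U \<and> (\<forall>\<epsilon>>0. \<exists>n \<alpha> V. step_data n \<alpha> V
     \<and> B_inf_norm2 \<mu> (\<lambda>\<omega>. U \<omega> - step_fun n \<alpha> V \<omega>) < \<epsilon>)"

lemma ennreal_double_split:
  fixes a b \<epsilon> :: ennreal
  assumes "a < \<epsilon> / 4" "b < \<epsilon> / 4"
  shows "2 * a + 2 * b < \<epsilon>"
proof (cases "\<epsilon> = \<infinity>")
  case True
  then have "a < \<top>" "b < \<top>" using assms by (auto simp: ennreal_top_divide less_top[symmetric])
  then show ?thesis using True by (auto simp: less_top[symmetric] ennreal_add_eq_top ennreal_mult_eq_top_iff)
next
  case False
  then obtain e where e: "\<epsilon> = ennreal e" "e \<ge> 0" by (cases \<epsilon>) auto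
  then have q: "\<epsilon> / 4 = ennreal (e / 4)" using divide_ennreal[of e 4] by simp
  obtain x y where xy: "a = ennreal x" "x \<ge> 0" "b = ennreal y" "y \<ge> 0"
    using assms by (cases a; cases b) auto
  have "x < e / 4" "y < e / 4" using assms xy by (auto simp: q ennreal_less_iff)
  then have "2 * x + 2 * y < e" by linarith
  moreover have "2 * a + 2 * b = ennreal (2 * x + 2 * y)" using xy by (simp add: ennreal_mult)
  ultimately show ?thesis unfolding e(1) using xy by (simp only: ennreal_less_iff)
qed

context
  fixes \<mu> :: "real measure"
  assumes sets_\<mu>: "sets \<mu> = sets freq_borel"
    and finite_\<mu>: "finite_measure \<mu>"
    and left_end: "emeasure \<mu> {- pi} = 0"
begin

lemma step_approximable_limit:
  assumes U: "strong_limit U"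
    and approx: "\<And>\<epsilon>. \<epsilon> > 0 \<Longrightarrow> \<exists>V. step_approximable \<mu> V \<and> B_inf_norm2 \<mu> (\<lambda>\<omega>. U \<omega> - V \<omega>) < \<epsilon>"
  shows "step_approximable \<mu> U"
  unfolding step_approximable_def
proof (intro conjI U allI impI)
  fix \<epsilon> :: ennreal assume "\<epsilon> > 0"
  then have "\<epsilon> / 4 > 0" by (simp add: ennreal_zero_less_divide)
  then obtain V where V: "step_approximable \<mu> V" "B_inf_norm2 \<mu> (\<lambda>\<omega>. U \<omega> - V \<omega>) < \<epsilon> / 4"
    using approx by blast
  then obtain n \<alpha> W where W: "step_data n \<alpha> W" "B_inf_norm2 \<mu> (\<lambda>\<omega>. V \<omega> - step_fun n \<alpha> W \<omega>) < \<epsilon> / 4"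
    using \<open>\<epsilon> / 4 > 0\<close> unfolding step_approximable_def by blast
  have "strong_limit V" using V by (simp add: step_approximable_def)
  have "B_inf_norm2 \<mu> (\<lambda>\<omega>. (U \<omega> - V \<omega>) + (V \<omega> - step_fun n \<alpha> W \<omega>))
      \<le> 2 * B_inf_norm2 \<mu> (\<lambda>\<omega>. U \<omega> - V \<omega>) + 2 * B_inf_norm2 \<mu> (\<lambda>\<omega>. V \<omega> - step_fun n \<alpha> W \<omega>)"
    by (intro B_inf_norm2_add_le sets_\<mu> strong_limit_diff U \<open>strong_limit V\<close> strong_limit_step_fun W)
  also have "\<dots> < \<epsilon>" using V(2) W(2) by (rule ennreal_double_split)
  finally show "\<exists>n \<alpha> V. step_data n \<alpha> V \<and> B_inf_norm2 \<mu> (\<lambda>\<omega>. U \<omega> - step_fun n \<alpha> V \<omega>) < \<epsilon>"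
    using W(1) by auto
qed

lemma step_approximable_add:
  assumes U: "step_approximable \<mu> U" and V: "step_approximable \<mu> V"
  shows "step_approximable \<mu> (\<lambda>\<omega>. U \<omega> + V \<omega>)"
  unfolding step_approximable_def
proof (intro conjI allI impI)
  have s: "strong_limit U" "strong_limit V" using U V by (auto simp: step_approximable_def)
  then show "strong_limit (\<lambda>\<omega>. U \<omega> + V \<omega>)" by (rule strong_limit_add)
  fix \<epsilon> :: ennreal assume "\<epsilon> > 0"
  then have "\<epsilon> / 4 > 0" by (simp add: ennreal_zero_less_divide)
  then obtain n \<alpha> A where
    A: "step_data n \<alpha> A" "B_inf_norm2 \<mu> (\<lambda>\<omega>. U \<omega> - step_fun n \<alpha> A \<omega>) < \<epsilon> / 4"
    using U unfolding step_approximable_def by blast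
  obtain n' \<alpha>' A' where
    A': "step_data n' \<alpha>' A'" "B_inf_norm2 \<mu> (\<lambda>\<omega>. V \<omega> - step_fun n' \<alpha>' A' \<omega>) < \<epsilon> / 4"
    using V \<open>\<epsilon> / 4 > 0\<close> unfolding step_approximable_def by blast
  obtain m \<beta> W where W: "step_data m \<beta> W"
    "\<And>\<omega>. step_fun n \<alpha> A \<omega> + step_fun n' \<alpha>' A' \<omega> = step_fun m \<beta> W \<omega>"
    using step_fun_add[OF A(1) A'(1)] by blast
  have eq: "(\<lambda>\<omega>. U \<omega> + V \<omega> - step_fun m \<beta> W \<omega>)
      = (\<lambda>\<omega>. (U \<omega> - step_fun n \<alpha> A \<omega>) + (V \<omega> - step_fun n' \<alpha>' A' \<omega>))"
    by (rule ext) (simp only: W(2)[symmetric] add_diff_add)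
  have "B_inf_norm2 \<mu> (\<lambda>\<omega>. (U \<omega> - step_fun n \<alpha> A \<omega>) + (V \<omega> - step_fun n' \<alpha>' A' \<omega>))
      \<le> 2 * B_inf_norm2 \<mu> (\<lambda>\<omega>. U \<omega> - step_fun n \<alpha> A \<omega>) + 2 * B_inf_norm2 \<mu> (\<lambda>\<omega>. V \<omega> - step_fun n' \<alpha>' A' \<omega>)"
    by (intro B_inf_norm2_add_le sets_\<mu> strong_limit_diff s strong_limit_step_fun A A')
  also have "\<dots> < \<epsilon>" using A(2) A'(2) by (rule ennreal_double_split)
  finally have "B_inf_norm2 \<mu> (\<lambda>\<omega>. U \<omega> + V \<omega> - step_fun m \<beta> W \<omega>) < \<epsilon>" unfolding eq .
  then show "\<exists>n \<alpha> A. step_data n \<alpha> A \<and> B_inf_norm2 \<mu> (\<lambda>\<omega>. U \<omega> + V \<omega> - step_fun n \<alpha> A \<omega>) < \<epsilon>"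
    by (intro exI[of _ m] exI[of _ \<beta>] exI[of _ W] conjI W(1))
qed

lemma step_approximable_uminus:
  assumes U: "step_approximable \<mu> U"
  shows "step_approximable \<mu> (\<lambda>\<omega>. - U \<omega>)"
  unfolding step_approximable_def
proof (intro conjI allI impI)
  show "strong_limit (\<lambda>\<omega>. - U \<omega>)"
    using U by (intro strong_limit_uminus) (simp add: step_approximable_def)
  fix \<epsilon> :: ennreal assume "\<epsilon> > 0"
  then obtain n \<alpha> A where A: "step_data n \<alpha> A" "B_inf_norm2 \<mu> (\<lambda>\<omega>. U \<omega> - step_fun n \<alpha> A \<omega>) < \<epsilon>"
    using U unfolding step_approximable_def by blast
  show "\<exists>n \<alpha> A. step_data n \<alpha> A \<and> B_inf_norm2 \<mu> (\<lambda>\<omega>. - U \<omega> - step_fun n \<alpha> A \<omega>) < \<epsilon>"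
    using step_fun_uminus[OF A(1)] A(2) B_inf_norm2_minus[of \<mu> "\<lambda>\<omega>. U \<omega> - step_fun n \<alpha> A \<omega>"]
    by (intro exI[of _ n] exI[of _ \<alpha>] exI[of _ "\<lambda>i. - A i"]) simp
qed

lemma step_approximable_step_fun:
  assumes "step_data n \<alpha> V"
  shows "step_approximable \<mu> (step_fun n \<alpha> V)"
  unfolding step_approximable_def using assms
  by (auto intro!: strong_limit_step_fun exI[of _ n] exI[of _ \<alpha>] exI[of _ V] simp: B_inf_norm2_def)

lemma step_approximable_zero: "step_approximable \<mu> (\<lambda>\<omega>. 0)"
proof -
  have "step_fun 0 (\<lambda>_. 0) (\<lambda>_. 0) = (\<lambda>\<omega>. 0 :: 'a \<Rightarrow>\<^sub>L 'a)"
    by (rule ext) (simp add: step_fun_def)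
  then show ?thesis using step_approximable_step_fun[OF step_data_zero] by metis
qed

lemma step_approximable_sum:
  assumes "finite I" "\<And>i. i \<in> I \<Longrightarrow> step_approximable \<mu> (U i)"
  shows "step_approximable \<mu> (\<lambda>\<omega>. \<Sum>i\<in>I. U i \<omega>)"
  using assms
proof (induction I rule: finite_induct)
  case empty
  show ?case using step_approximable_zero by simp
next
  case (insert i I)
  have "step_approximable \<mu> (\<lambda>\<omega>. U i \<omega> + (\<Sum>i\<in>I. U i \<omega>))"
    by (intro step_approximable_add insert.IH insert.prems) simp_all
  then show ?case using insert.hyps by simp
qed

lemma step_approximable_cong_AE:
  assumes "step_approximable \<mu> U" "strong_limit V" "AE \<omega> in \<mu>. U \<omega> = V \<omega>"
  shows "step_approximable \<mu> V"
proof -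
  have "B_inf_norm2 \<mu> (\<lambda>\<omega>. V \<omega> - step_fun n \<alpha> W \<omega>) = B_inf_norm2 \<mu> (\<lambda>\<omega>. U \<omega> - step_fun n \<alpha> W \<omega>)" for n \<alpha> W
    using assms(3) by (intro B_inf_norm2_cong_AE) auto
  then show ?thesis using assms(1,2) by (simp add: step_approximable_def)
qed

lemma AE_left_end: "AE \<omega> in \<mu>. \<omega> \<noteq> - pi"
proof (rule AE_I)
  have "{- pi} \<in> sets freq_borel" using pi_ge_zero by (simp add: sets_restrict_space_iff)
  then show "{- pi} \<in> sets \<mu>" by (simp add: sets_\<mu>)
qed (auto simp: left_end)

lemma step_approximable_interval:
  fixes V :: "'h::complex_hilbert_space \<Rightarrow>\<^sub>L 'h"
  assumes V: "clinear_op V"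
  shows "step_approximable \<mu> (\<lambda>\<omega>. indicat_real {a<..b} \<omega> *\<^sub>R V)"
proof -
  have sl: "strong_limit (\<lambda>\<omega>. indicat_real {a<..b} \<omega> *\<^sub>R V)"
    by (intro strong_limit_simple simple_function_indicator_scaleR) simp
  have space: "AE \<omega> in \<mu>. \<omega> \<in> {- pi..pi}"
    using sets_eq_imp_space_eq[OF sets_\<mu>] by (intro AE_I2) (simp add: space_restrict_space)
  show ?thesis
  proof (cases "max a (- pi) \<le> min b pi")
    case True
    define \<alpha> where "\<alpha> i = (if i = 0 then max a (- pi) else min b pi)" for i :: nat
    have "step_data 1 \<alpha> (\<lambda>_. V)"
      using True V pi_ge_zero by (auto simp: step_data_def \<alpha>_def mono_on_def)
    moreover have "step_fun 1 \<alpha> (\<lambda>_. V) = (\<lambda>\<omega>. indicat_real {max a (- pi)<..min b pi} \<omega> *\<^sub>R V)"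
      unfolding step_fun_def[abs_def] One_nat_def sum.lessThan_Suc lessThan_0 sum.empty by (simp add: \<alpha>_def)
    ultimately have "step_approximable \<mu> (\<lambda>\<omega>. indicat_real {max a (- pi)<..min b pi} \<omega> *\<^sub>R V)"
      using step_approximable_step_fun by metis
    \<comment> \<open>The two indicators may differ at \<open>- pi\<close>, which carries no mass.\<close>
    moreover have "AE \<omega> in \<mu>. indicat_real {max a (- pi)<..min b pi} \<omega> *\<^sub>R V = indicat_real {a<..b} \<omega> *\<^sub>R V"
      using space AE_left_end by eventually_elim (auto simp: indicator_def)
    ultimately show ?thesis
      by (rule step_approximable_cong_AE[OF _ sl])
  next
    case False
    have "AE \<omega> in \<mu>. 0 = indicat_real {a<..b} \<omega> *\<^sub>R V"
      using space by eventually_elim (use False in \<open>auto simp: indicator_def\<close>)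
    then show ?thesis by (rule step_approximable_cong_AE[OF step_approximable_zero sl])
  qed
qed

lemma B_inf_norm2_tendsto_0:
  fixes D :: "nat \<Rightarrow> real \<Rightarrow> ('h::complex_hilbert_space \<Rightarrow>\<^sub>L 'h)"
  assumes D: "\<And>n::nat. strong_limit (D n)"
    and w [measurable]: "w \<in> borel_measurable freq_borel" "(\<integral>\<^sup>+\<omega>. ennreal (w \<omega>) \<partial>\<mu>) < \<infinity>"
    and bound: "\<And>n \<omega>. \<omega> \<in> {- pi..pi} \<Longrightarrow> (norm (D n \<omega>))\<^sup>2 \<le> w \<omega>"
    and lim: "\<And>\<omega>. \<omega> \<in> {- pi..pi} \<Longrightarrow> (\<lambda>n. D n \<omega>) \<longlonglongrightarrow> 0"
  shows "(\<lambda>n. B_inf_norm2 \<mu> (D n)) \<longlonglongrightarrow> 0"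
proof -
  have [measurable_cong]: "sets \<mu> = sets freq_borel" by (rule sets_\<mu>)
  have sp: "space \<mu> = {- pi..pi}"
    using sets_eq_imp_space_eq[OF sets_\<mu>] by (simp add: space_restrict_space)
  note [measurable] = strong_limit_norm_measurable[OF D]
  have "(\<lambda>n. \<integral>\<^sup>+\<omega>. ennreal ((norm (D n \<omega>))\<^sup>2) \<partial>\<mu>) \<longlonglongrightarrow> (\<integral>\<^sup>+\<omega>. 0 \<partial>\<mu>)"
  proof (rule nn_integral_dominated_convergence[where w="\<lambda>\<omega>. ennreal (w \<omega>)"])
    show "AE \<omega> in \<mu>. (\<lambda>n. ennreal ((norm (D n \<omega>))\<^sup>2)) \<longlonglongrightarrow> 0"
    proof (rule AE_I2)
      fix \<omega> assume "\<omega> \<in> space \<mu>"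
      then have "(\<lambda>n. ennreal ((norm (D n \<omega>))\<^sup>2)) \<longlonglongrightarrow> ennreal ((norm (0 :: 'h \<Rightarrow>\<^sub>L 'h))\<^sup>2)"
        using lim sp by (intro tendsto_intros) auto
      then show "(\<lambda>n. ennreal ((norm (D n \<omega>))\<^sup>2)) \<longlonglongrightarrow> 0" by simp
    qed
  qed (use w(2) bound sp in \<open>auto intro!: AE_I2 ennreal_leI\<close>)
  then show ?thesis by (simp add: B_inf_norm2_def)
qed

text \<open>The sets with this property form a Dynkin system: complements are differences from an
  interval that covers the frequency domain, and indicators of disjoint unions are mean square limits
  of finite sums. Half-open intervals generate the Borel sets.\<close>

lemma step_approximable_indicator:
  assumes V: "clinear_op V" and A: "A \<in> sets borel"
  shows "step_approximable \<mu> (\<lambda>\<omega>. indicat_real A \<omega> *\<^sub>R V)"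
proof -
  interpret finite_measure \<mu> by (rule finite_\<mu>)
  let ?G = "range (\<lambda>(a, b). {a<..b::real})"
  have "Int_stable ?G" unfolding Int_stable_def by auto
  moreover have "?G \<subseteq> Pow UNIV" by simp
  moreover have "A \<in> sigma_sets UNIV ?G" using A by (simp add: borel_sigma_sets_Ioc)
  ultimately show ?thesis
  proof (induction A rule: sigma_sets_induct_disjoint)
    case (basic A)
    then show ?case using step_approximable_interval[OF V] by auto
  next
    case empty
    show ?case using step_approximable_interval[OF V, of 0 0] by simp
  next
    case (compl A)
    have A: "A \<in> sets borel" using compl(1) by (simp add: borel_sigma_sets_Ioc)
    \<comment> \<open>The half-open interval starts at \<open>- pi - 1\<close> so as to include the point \<open>- pi\<close>.\<close>
    have "step_approximable \<mu> (\<lambda>\<omega>. indicat_real {- pi - 1<..pi} \<omega> *\<^sub>R V + - (indicat_real A \<omega> *\<^sub>R V))"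
      by (intro step_approximable_add step_approximable_uminus step_approximable_interval V compl)
    then show ?case
    proof (rule step_approximable_cong_AE)
      show "strong_limit (\<lambda>\<omega>. indicat_real (UNIV - A) \<omega> *\<^sub>R V)"
        using A by (intro strong_limit_simple simple_function_indicator_scaleR) auto
      show "AE \<omega> in \<mu>. indicat_real {- pi - 1<..pi} \<omega> *\<^sub>R V + - (indicat_real A \<omega> *\<^sub>R V)
          = indicat_real (UNIV - A) \<omega> *\<^sub>R V"
        using sets_eq_imp_space_eq[OF sets_\<mu>]
        by (intro AE_I2) (auto simp: space_restrict_space indicator_def)
    qed
  next
    case (union A)
    have A: "A i \<in> sets borel" for i using union(2) by (auto simp: borel_sigma_sets_Ioc)
    let ?U = "\<lambda>\<omega>. indicat_real (\<Union>i. A i) \<omega> *\<^sub>R V" and ?W = "\<lambda>n \<omega>. \<Sum>i<n. indicat_real (A i) \<omega> *\<^sub>R V"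
    have U: "strong_limit ?U" using A by (intro strong_limit_simple simple_function_indicator_scaleR) auto
    have W: "step_approximable \<mu> (?W n)" for n by (intro step_approximable_sum union) auto
    have sums: "(\<lambda>i. indicat_real (A i) \<omega>) sums indicat_real (\<Union>i. A i) \<omega>" for \<omega>
      using union(1) by (intro indicator_sums) (auto simp: disjoint_family_on_def)
    have "(\<lambda>n. B_inf_norm2 \<mu> (\<lambda>\<omega>. ?U \<omega> - ?W n \<omega>)) \<longlonglongrightarrow> 0"
    proof (rule B_inf_norm2_tendsto_0[where w="\<lambda>_. (norm V)\<^sup>2"])
      show "strong_limit (\<lambda>\<omega>. ?U \<omega> - ?W n \<omega>)" for n
        using U W unfolding step_approximable_def by (intro strong_limit_diff) auto
      show "(\<integral>\<^sup>+\<omega>. ennreal ((norm V)\<^sup>2) \<partial>\<mu>) < \<infinity>"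
        by (simp add: ennreal_mult_eq_top_iff emeasure_finite less_top[symmetric])
      fix \<omega>
      show "(norm (?U \<omega> - ?W n \<omega>))\<^sup>2 \<le> (norm V)\<^sup>2" for n
      proof -
        have "0 \<le> (\<Sum>i<n. indicat_real (A i) \<omega>)" by (simp add: sum_nonneg)
        moreover have "(\<Sum>i<n. indicat_real (A i) \<omega>) \<le> indicat_real (\<Union>i. A i) \<omega>"
          using sum_le_suminf[OF sums_summable[OF sums], of "{..<n}"] sums_unique[OF sums] by simp
        moreover have "indicat_real (\<Union>i. A i) \<omega> \<le> 1" by (simp add: indicator_def)
        ultimately have "\<bar>indicat_real (\<Union>i. A i) \<omega> - (\<Sum>i<n. indicat_real (A i) \<omega>)\<bar> \<le> 1" by linarith
        then have "norm (?U \<omega> - ?W n \<omega>) \<le> 1 * norm V"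
          unfolding scaleR_left.sum[symmetric] scaleR_left_diff_distrib[symmetric] norm_scaleR
          by (intro mult_right_mono) auto
        then show ?thesis by (intro power_mono) auto
      qed
      have "(\<lambda>n. (indicat_real (\<Union>i. A i) \<omega> - (\<Sum>i<n. indicat_real (A i) \<omega>)) *\<^sub>R V)
          \<longlonglongrightarrow> (indicat_real (\<Union>i. A i) \<omega> - indicat_real (\<Union>i. A i) \<omega>) *\<^sub>R V"
        using sums unfolding sums_def by (intro tendsto_intros)
      then show "(\<lambda>n. ?U \<omega> - ?W n \<omega>) \<longlonglongrightarrow> 0"
        by (simp add: scaleR_left.sum scaleR_left_diff_distrib)
    qed simp
    then show ?case
    proof (intro step_approximable_limit U)
      fix \<epsilon> :: ennreal assume "(\<lambda>n. B_inf_norm2 \<mu> (\<lambda>\<omega>. ?U \<omega> - ?W n \<omega>)) \<longlonglongrightarrow> 0" "\<epsilon> > 0"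
      then have "eventually (\<lambda>n. B_inf_norm2 \<mu> (\<lambda>\<omega>. ?U \<omega> - ?W n \<omega>) < \<epsilon>) sequentially"
        by (intro order_tendstoD)
      then obtain n where "B_inf_norm2 \<mu> (\<lambda>\<omega>. ?U \<omega> - ?W n \<omega>) < \<epsilon>" by (auto simp: eventually_sequentially)
      then show "\<exists>V. step_approximable \<mu> V \<and> B_inf_norm2 \<mu> (\<lambda>\<omega>. ?U \<omega> - V \<omega>) < \<epsilon>"
        using W[of n] by (intro exI[of _ "?W n"] conjI)
    qed
  qed
qed

lemma step_approximable_simple:
  assumes s: "simple_function freq_borel s" and c: "\<And>\<omega>. \<omega> \<in> {- pi..pi} \<Longrightarrow> clinear_op (s \<omega>)"
  shows "step_approximable \<mu> s"
proof -
  let ?I = "s ` {- pi..pi}" and ?A = "\<lambda>v. s -` {v} \<inter> {- pi..pi}"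
  have fin: "finite ?I" using s by (simp add: simple_function_def space_restrict_space)
  have A: "?A v \<in> sets borel" if "v \<in> ?I" for v
    using s that by (auto simp: simple_function_def space_restrict_space sets_restrict_space_iff)
  have "step_approximable \<mu> (\<lambda>\<omega>. \<Sum>v\<in>?I. indicat_real (?A v) \<omega> *\<^sub>R v)"
    by (intro step_approximable_sum fin step_approximable_indicator A) (auto intro: c)
  then show ?thesis
  proof (rule step_approximable_cong_AE)
    show "AE \<omega> in \<mu>. (\<Sum>v\<in>?I. indicat_real (?A v) \<omega> *\<^sub>R v) = s \<omega>"
    proof (rule AE_I2)
      fix \<omega> assume "\<omega> \<in> space \<mu>"
      then have \<omega>: "\<omega> \<in> {- pi..pi}"
        using sets_eq_imp_space_eq[OF sets_\<mu>] by (simp add: space_restrict_space)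
      then have "(\<Sum>v\<in>?I. indicat_real (?A v) \<omega> *\<^sub>R v) = (\<Sum>v\<in>?I. if v = s \<omega> then s \<omega> else 0)"
        by (intro sum.cong) (auto simp: indicator_def)
      then show "(\<Sum>v\<in>?I. indicat_real (?A v) \<omega> *\<^sub>R v) = s \<omega>" using fin \<omega> by (simp add: sum.delta)
    qed
  qed (rule strong_limit_simple[OF s])
qed

end

text \<open>The projection of real linear operators onto complex linear ones, a contraction. It is needed
  because approximations of a complex linear operator need not be complex linear themselves.\<close>

definition clinear_part :: "('h::complex_hilbert_space \<Rightarrow>\<^sub>L 'h) \<Rightarrow> ('h \<Rightarrow>\<^sub>L 'h)" where
  "clinear_part A = (1/2) *\<^sub>R (A - (scale_op \<i> id_blinfun o\<^sub>L A o\<^sub>L scale_op \<i> id_blinfun))"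

lemma blinfun_clinear_part:
  "blinfun_apply (clinear_part A) x = (1/2) *\<^sub>R (blinfun_apply A x - \<i> *\<^sub>C blinfun_apply A (\<i> *\<^sub>C x))"
  by (simp add: clinear_part_def blinfun.scaleR_left blinfun.diff_left blinfun_scale_op)

lemma scaleC_complex_decomp: "c *\<^sub>C x = Re c *\<^sub>R x + Im c *\<^sub>R (\<i> *\<^sub>C (x::'h::complex_hilbert_space))"
proof -
  have "c *\<^sub>C x = (complex_of_real (Re c) + complex_of_real (Im c) * \<i>) *\<^sub>C x"
    by (metis complex_eq mult.commute)
  then show ?thesis by (simp add: scaleC_add_left scaleR_scaleC scaleC_scaleC)
qed

lemma clinear_part_clinear: "clinear_op (clinear_part A)"
proof -
  let ?C = "blinfun_apply (clinear_part A)"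
  have "\<i> *\<^sub>C \<i> *\<^sub>C y = - y" for y :: 'a
    using scaleC_scaleC[of \<i> \<i> y] scaleC_of_real[of "-1" y] by simp
  then have i: "?C (\<i> *\<^sub>C x) = \<i> *\<^sub>C ?C x" for x
    unfolding blinfun_clinear_part
    by (simp only: scaleC.scaleR_right scaleC.diff_right blinfun.minus_right scaleC.minus_right) simp
  show ?thesis
    unfolding clinear_op_def
  proof (intro allI)
    fix c x
    have "?C (c *\<^sub>C x) = Re c *\<^sub>R ?C x + Im c *\<^sub>R (\<i> *\<^sub>C ?C x)"
      by (subst scaleC_complex_decomp) (simp only: blinfun.add_right blinfun.scaleR_right i)
    then show "?C (c *\<^sub>C x) = c *\<^sub>C ?C x" by (simp only: scaleC_complex_decomp[symmetric])
  qed
qed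

lemma clinear_part_id:
  assumes "clinear_op A"
  shows "clinear_part A = A"
proof (rule blinfun_eqI)
  fix x
  have "\<i> *\<^sub>C \<i> *\<^sub>C y = - y" for y :: 'a
    using scaleC_scaleC[of \<i> \<i> y] scaleC_of_real[of "-1" y] by simp
  then show "blinfun_apply (clinear_part A) x = blinfun_apply A x"
    unfolding blinfun_clinear_part clinear_opD[OF assms] by (simp add: scaleR_2[symmetric])
qed

lemma norm_clinear_part: "norm (clinear_part A) \<le> norm A"
proof (rule norm_blinfun_bound)
  fix x
  have "norm (blinfun_apply A x - \<i> *\<^sub>C blinfun_apply A (\<i> *\<^sub>C x)) \<le> norm A * norm x + norm A * norm x"
    using norm_blinfun[of A x] norm_blinfun[of A "\<i> *\<^sub>C x"]
    by (intro norm_triangle_le_diff add_mono) (simp_all add: norm_scaleC)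
  then show "norm (blinfun_apply (clinear_part A) x) \<le> norm A * norm x"
    by (simp add: blinfun_clinear_part mult.commute)
qed simp

lemma clinear_part_diff: "clinear_part (A - B) = clinear_part A - clinear_part B"
  by (rule blinfun_eqI) (simp add: blinfun_clinear_part blinfun.diff_left scaleC.diff_right algebra_simps)

lemma tendsto_clinear_part:
  assumes "(\<lambda>n. A n) \<longlonglongrightarrow> B"
  shows "(\<lambda>n. clinear_part (A n)) \<longlonglongrightarrow> clinear_part B"
proof (rule Lim_transform_bound[of "\<lambda>n. clinear_part (A n) - clinear_part B" "\<lambda>n. A n - B", THEN Lim_null[THEN iffD2]])
  show "eventually (\<lambda>n. norm (clinear_part (A n) - clinear_part B) \<le> norm (A n - B)) sequentially"
    by (simp add: clinear_part_diff[symmetric] norm_clinear_part)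
  show "(\<lambda>n. A n - B) \<longlonglongrightarrow> 0" using assms by (simp add: Lim_null[symmetric])
qed

text \<open>Truncating the approximating simple functions at \<open>2 * norm (U \<omega>)\<close> makes dominated convergence
  applicable, and taking complex linear parts makes their values admissible.\<close>

lemma step_approximable_strong_limit:
  assumes \<mu>: "sets \<mu> = sets freq_borel" "finite_measure \<mu>" "emeasure \<mu> {- pi} = 0"
    and U: "strong_limit U" and c: "\<And>\<omega>. \<omega> \<in> {- pi..pi} \<Longrightarrow> clinear_op (U \<omega>)"
    and fin: "B_inf_norm2 \<mu> U < \<infinity>"
  shows "step_approximable \<mu> U"
proof -
  have [measurable_cong]: "sets \<mu> = sets freq_borel" by (rule \<mu>)
  obtain s where s: "\<And>n::nat. simple_function freq_borel (s n)"
    "\<And>\<omega>. \<omega> \<in> {- pi..pi} \<Longrightarrow> (\<lambda>n. s n \<omega>) \<longlonglongrightarrow> U \<omega>"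
    using U unfolding strong_limit_def by blast
  note [measurable] = strong_limit_norm_measurable[OF U] strong_limit_norm_measurable[OF strong_limit_simple[OF s(1)]]
  define r where "r n \<omega> = (if norm (s n \<omega>) \<le> 2 * norm (U \<omega>) then clinear_part (s n \<omega>) else 0)" for n \<omega>
  have r_simple: "simple_function freq_borel (r n)" for n
    unfolding r_def[abs_def]
  proof (intro simple_function_If simple_function_compose1[OF s(1), where g=clinear_part])
    show "{\<omega> \<in> space freq_borel. norm (s n \<omega>) \<le> 2 * norm (U \<omega>)} \<in> sets freq_borel"
      by measurable
  qed simp
  have r_appr: "step_approximable \<mu> (r n)" for n
    by (rule step_approximable_simple[OF \<mu> r_simple])
      (auto simp: r_def intro: clinear_part_clinear clinear_op_zero)
  have "(\<lambda>n. B_inf_norm2 \<mu> (\<lambda>\<omega>. U \<omega> - r n \<omega>)) \<longlonglongrightarrow> 0"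
  \<comment> \<open>\<open>norm (U \<omega> - r n \<omega>)\<close> is at most \<open>norm (U \<omega>) + 2 * norm (U \<omega>)\<close>, whose square is the majorant.\<close>
  proof (rule B_inf_norm2_tendsto_0[OF \<mu>, where w="\<lambda>\<omega>. 9 * (norm (U \<omega>))\<^sup>2"])
    show "strong_limit (\<lambda>\<omega>. U \<omega> - r n \<omega>)" for n
      by (intro strong_limit_diff U strong_limit_simple r_simple)
    show "(\<integral>\<^sup>+\<omega>. ennreal (9 * (norm (U \<omega>))\<^sup>2) \<partial>\<mu>) < \<infinity>"
      using fin unfolding B_inf_norm2_def
      by (simp add: ennreal_mult nn_integral_cmult ennreal_mult_less_top)
    fix \<omega> assume \<omega>: "\<omega> \<in> {- pi..pi}"
    show "(norm (U \<omega> - r n \<omega>))\<^sup>2 \<le> 9 * (norm (U \<omega>))\<^sup>2" for n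
    proof -
      have "norm (r n \<omega>) \<le> 2 * norm (U \<omega>)"
        using norm_clinear_part[of "s n \<omega>"] by (auto simp: r_def)
      then have "norm (U \<omega> - r n \<omega>) \<le> 3 * norm (U \<omega>)"
        using norm_triangle_ineq4[of "U \<omega>" "r n \<omega>"] by linarith
      then have "(norm (U \<omega> - r n \<omega>))\<^sup>2 \<le> (3 * norm (U \<omega>))\<^sup>2" by (intro power_mono) auto
      then show ?thesis by (simp add: power_mult_distrib)
    qed
    have "(\<lambda>n. r n \<omega>) \<longlonglongrightarrow> U \<omega>"
    proof (cases "U \<omega> = 0")
      case True
      then have "r n \<omega> = 0" for n using clinear_part_diff[of 0 0] by (auto simp: r_def)
      then show ?thesis using True by simp
    next
      case False
      have "(\<lambda>n. norm (s n \<omega>)) \<longlonglongrightarrow> norm (U \<omega>)" by (intro tendsto_norm s \<omega>)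
      then have "eventually (\<lambda>n. norm (s n \<omega>) < 2 * norm (U \<omega>)) sequentially"
        using False by (intro order_tendstoD) auto
      then have "eventually (\<lambda>n. clinear_part (s n \<omega>) = r n \<omega>) sequentially"
        by eventually_elim (simp add: r_def)
      moreover have "(\<lambda>n. clinear_part (s n \<omega>)) \<longlonglongrightarrow> U \<omega>"
        using tendsto_clinear_part[OF s(2)[OF \<omega>]] clinear_part_id[OF c[OF \<omega>]] by simp
      ultimately show ?thesis by (rule Lim_transform_eventually[rotated])
    qed
    then show "(\<lambda>n. U \<omega> - r n \<omega>) \<longlonglongrightarrow> 0"
      using tendsto_diff[OF tendsto_const, of "\<lambda>n. r n \<omega>" "U \<omega>" _ "U \<omega>"] by simp
  qed simp
  then have "eventually (\<lambda>n. B_inf_norm2 \<mu> (\<lambda>\<omega>. U \<omega> - r n \<omega>) < \<epsilon>) sequentially" if "\<epsilon> > 0" for \<epsilon>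
    using that by (rule order_tendstoD(2))
  then have "\<exists>n. B_inf_norm2 \<mu> (\<lambda>\<omega>. U \<omega> - r n \<omega>) < \<epsilon>" if "\<epsilon> > 0" for \<epsilon>
    using that by (auto simp: eventually_sequentially)
  then show ?thesis
    using r_appr by (intro step_approximable_limit[OF \<mu> U]) blast
qed

text \<open>Redefining \<open>U\<close> as zero on the null set where the approximation or linearity fails.\<close>

lemma B_inf_representative:
  assumes \<mu>: "sets \<mu> = sets freq_borel" and U: "U \<in> B_inf \<mu>"
  shows "\<exists>U'. strong_limit U' \<and> (\<forall>\<omega>. clinear_op (U' \<omega>)) \<and> (AE \<omega> in \<mu>. U \<omega> = U' \<omega>)"
proof -
  obtain s where s: "\<And>n::nat. simple_function \<mu> (s n)" "AE \<omega> in \<mu>. (\<lambda>n. s n \<omega>) \<longlonglongrightarrow> U \<omega>"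
    using U unfolding B_inf_def strongly_measurable_def by blast
  have "AE \<omega> in \<mu>. clinear_op (U \<omega>)" using U by (simp add: B_inf_def)
  then have "AE \<omega> in \<mu>. clinear_op (U \<omega>) \<and> (\<lambda>n. s n \<omega>) \<longlonglongrightarrow> U \<omega>" using s(2) by eventually_elim simp
  then obtain B where B: "{\<omega> \<in> space \<mu>. \<not> (clinear_op (U \<omega>) \<and> (\<lambda>n. s n \<omega>) \<longlonglongrightarrow> U \<omega>)} \<subseteq> B"
    "emeasure \<mu> B = 0" "B \<in> sets \<mu>" by (rule AE_E)
  have sp: "space \<mu> = {- pi..pi}"
    using sets_eq_imp_space_eq[OF \<mu>] by (simp add: space_restrict_space)
  define U' where "U' \<omega> = (if \<omega> \<in> space \<mu> - B then U \<omega> else 0)" for \<omega>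
  have "strong_limit U'"
    unfolding strong_limit_def
  proof (intro exI[of _ "\<lambda>n \<omega>. if \<omega> \<in> space \<mu> - B then s n \<omega> else 0"] conjI allI ballI)
    fix n
    have "simple_function \<mu> (\<lambda>\<omega>. if \<omega> \<in> space \<mu> - B then s n \<omega> else 0)"
      by (intro simple_function_If_set s(1) simple_function_const) (use B(3) in auto)
    then show "simple_function freq_borel (\<lambda>\<omega>. if \<omega> \<in> space \<mu> - B then s n \<omega> else 0)"
      using \<mu> sp by (simp add: simple_function_def space_freq_borel)
  qed (use B(1) in \<open>auto simp: U'_def\<close>)
  moreover have "clinear_op (U' \<omega>)" for \<omega>
    using B(1) by (auto simp: U'_def clinear_op_zero)
  moreover have "AE \<omega> in \<mu>. U \<omega> = U' \<omega>"
    using B(2,3) by (intro AE_I[of _ _ B]) (auto simp: U'_def)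
  ultimately show ?thesis by blast
qed

section \<open>Stochastic integrals in the model\<close>

lemma bounded_bilinear_scale_op:
  "bounded_bilinear (scale_op :: complex \<Rightarrow> ('h::complex_hilbert_space \<Rightarrow>\<^sub>L 'h) \<Rightarrow> _)"
proof
  show "scale_op (a + a') b = scale_op a b + scale_op a' b"
    "scale_op a (b + b') = scale_op a b + scale_op a b'"
    "scale_op (r *\<^sub>R a) b = r *\<^sub>R scale_op a b"
    "scale_op a (r *\<^sub>R b) = r *\<^sub>R scale_op a b" for a a' r and b b' :: "'h \<Rightarrow>\<^sub>L 'h"
    by (rule blinfun_eqI; simp add: blinfun_scale_op blinfun.add_left blinfun.scaleR_left
        scaleC_add_left scaleC_add_right scaleC.scaleR_left scaleC.scaleR_right)+
  show "\<exists>K. \<forall>a (b :: 'h \<Rightarrow>\<^sub>L 'h). norm (scale_op a b) \<le> norm a * norm b * K"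
    by (intro exI[of _ 1]) (simp add: norm_scale_op)
qed

lemma strong_limit_scale_cis:
  fixes U :: "real \<Rightarrow> ('h::complex_hilbert_space \<Rightarrow>\<^sub>L 'h)"
  assumes "strong_limit U"
  shows "strong_limit (\<lambda>\<omega>. scale_op (cis (r * \<omega>)) (U \<omega>))"
proof -
  obtain s where s: "\<And>n::nat. simple_function freq_borel (s n)"
    "\<And>\<omega>. \<omega> \<in> {- pi..pi} \<Longrightarrow> (\<lambda>n. s n \<omega>) \<longlonglongrightarrow> U \<omega>"
    using assms unfolding strong_limit_def by blast
  obtain c where c: "\<And>n::nat. simple_function freq_borel (c n)"
    "\<And>\<omega>. \<omega> \<in> space freq_borel \<Longrightarrow> (\<lambda>n. c n \<omega>) \<longlonglongrightarrow> cis (r * \<omega>)"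
    using borel_measurable_implies_sequence_metric[OF measurable_cis[of r], of 0] by blast
  show ?thesis
    unfolding strong_limit_def
  proof (intro exI[of _ "\<lambda>n \<omega>. scale_op (c n \<omega>) (s n \<omega>)"] conjI allI ballI)
    show "simple_function freq_borel (\<lambda>\<omega>. scale_op (c n \<omega>) (s n \<omega>))" for n
      by (rule simple_function_compose2[OF c(1) s(1)])
    fix \<omega> :: real assume "\<omega> \<in> {- pi..pi}"
    then show "(\<lambda>n. scale_op (c n \<omega>) (s n \<omega>)) \<longlonglongrightarrow> scale_op (cis (r * \<omega>)) (U \<omega>)"
      by (intro bounded_bilinear.tendsto[OF bounded_bilinear_scale_op] c s) (simp_all add: space_restrict_space)
  qed
qed

lemma B_inf_strong_limit:
  assumes \<mu>: "sets \<mu> = sets freq_borel" and U: "strong_limit U" "\<And>\<omega>. clinear_op (U \<omega>)"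
    and fin: "B_inf_norm2 \<mu> U < \<infinity>"
  shows "U \<in> B_inf \<mu>"
proof -
  have sp: "space \<mu> = {- pi..pi}"
    using sets_eq_imp_space_eq[OF \<mu>] by (simp add: space_restrict_space)
  obtain s where s: "\<And>n::nat. simple_function freq_borel (s n)"
    "\<And>\<omega>. \<omega> \<in> {- pi..pi} \<Longrightarrow> (\<lambda>n. s n \<omega>) \<longlonglongrightarrow> U \<omega>"
    using U(1) unfolding strong_limit_def by blast
  have "simple_function \<mu> (s n)" for n
    using s(1)[of n] \<mu> sp by (simp add: simple_function_def space_freq_borel)
  moreover have "AE \<omega> in \<mu>. (\<lambda>n. s n \<omega>) \<longlonglongrightarrow> U \<omega>"
    using s(2) by (intro AE_I2) (simp add: sp)
  ultimately have "strongly_measurable \<mu> U"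
    unfolding strongly_measurable_def by blast
  then show ?thesis using U(2) fin by (simp add: B_inf_def)
qed

lemma B_inf_cong_AE:
  assumes "U' \<in> B_inf \<mu>" "AE \<omega> in \<mu>. U \<omega> = U' \<omega>"
  shows "U \<in> B_inf \<mu>"
proof -
  obtain s where s: "\<And>n::nat. simple_function \<mu> (s n)" "AE \<omega> in \<mu>. (\<lambda>n. s n \<omega>) \<longlonglongrightarrow> U' \<omega>"
    using assms(1) unfolding B_inf_def strongly_measurable_def by blast
  have "AE \<omega> in \<mu>. (\<lambda>n. s n \<omega>) \<longlonglongrightarrow> U \<omega>" using s(2) assms(2) by eventually_elim simp
  then have "strongly_measurable \<mu> U" unfolding strongly_measurable_def using s(1) by blast
  moreover have "AE \<omega> in \<mu>. clinear_op (U' \<omega>)" using assms(1) by (simp add: B_inf_def)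
  then have "AE \<omega> in \<mu>. clinear_op (U \<omega>)" using assms(2) by eventually_elim simp
  moreover have "B_inf_norm2 \<mu> U = B_inf_norm2 \<mu> U'" using assms(2) by (rule B_inf_norm2_cong_AE)
  ultimately show ?thesis using assms(1) by (simp add: B_inf_def)
qed

lemma B_inf_scale_cis:
  assumes \<mu>: "sets \<mu> = sets freq_borel" and A: "A \<in> B_inf \<mu>"
    and A': "strong_limit A'" "\<And>\<omega>. clinear_op (A' \<omega>)" "AE \<omega> in \<mu>. A \<omega> = A' \<omega>"
  shows "(\<lambda>\<omega>. scale_op (cis (r * \<omega>)) (A \<omega>)) \<in> B_inf \<mu>"
proof (rule B_inf_cong_AE)
  have "B_inf_norm2 \<mu> (\<lambda>\<omega>. scale_op (cis (r * \<omega>)) (A' \<omega>)) = B_inf_norm2 \<mu> A'"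
    by (simp add: B_inf_norm2_def norm_scale_op)
  also have "\<dots> = B_inf_norm2 \<mu> A" using A'(3) by (intro B_inf_norm2_cong_AE) auto
  also have "\<dots> < \<infinity>" using A by (simp add: B_inf_def)
  finally have fin: "B_inf_norm2 \<mu> (\<lambda>\<omega>. scale_op (cis (r * \<omega>)) (A' \<omega>)) < \<infinity>" .
  show "(\<lambda>\<omega>. scale_op (cis (r * \<omega>)) (A' \<omega>)) \<in> B_inf \<mu>"
    by (rule B_inf_strong_limit[OF \<mu> strong_limit_scale_cis[OF A'(1)] clinear_op_scale_op[OF A'(2)] fin])
  show "AE \<omega> in \<mu>. scale_op (cis (r * \<omega>)) (A \<omega>) = scale_op (cis (r * \<omega>)) (A' \<omega>)"
    using A'(3) by eventually_elim simp
qed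

context spectral_model
begin

lemma op_measurable:
  fixes U :: "real \<Rightarrow> 'h \<Rightarrow>\<^sub>L 'h"
  assumes "strong_limit U"
  shows "(\<lambda>x. blinfun_apply (U (q x)) (\<psi> x)) \<in> borel_measurable N"
proof -
  obtain s where s: "\<And>n::nat. simple_function freq_borel (s n)"
    "\<And>\<omega>. \<omega> \<in> {- pi..pi} \<Longrightarrow> (\<lambda>n. s n \<omega>) \<longlonglongrightarrow> U \<omega>"
    using assms unfolding strong_limit_def by blast
  show ?thesis
  proof (rule borel_measurable_LIMSEQ_metric)
    fix n
    have 1: "(\<lambda>x. blinfun_apply A (\<psi> x)) \<in> borel_measurable N" for A :: "'h \<Rightarrow>\<^sub>L 'h"
      by (intro L2_measurable L2_blinfun \<psi>)
    have fin: "finite (s n ` {- pi..pi})"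
      using s(1)[of n] by (simp add: simple_function_def space_restrict_space)
    have 2: "s n \<in> measurable freq_borel (count_space (s n ` {- pi..pi}))"
      using measurable_simple_function[OF s(1)[of n]] fin
      by (intro measurable_count_space_eq2[THEN iffD2])
        (auto simp: space_restrict_space simple_functionD(2)[OF s(1)[of n]] intro: simple_functionD(2)[OF s(1)[of n], unfolded space_freq_borel])
    show "(\<lambda>x. blinfun_apply (s n (q x)) (\<psi> x)) \<in> borel_measurable N"
    proof (rule measurable_compose_countable'[where f="\<lambda>A x. blinfun_apply A (\<psi> x)" and I="s n ` {- pi..pi}"])
      show "(\<lambda>x. s n (q x)) \<in> measurable N (count_space (s n ` {- pi..pi}))"
        by (rule measurable_compose[OF q 2])
    qed (use fin 1 in \<open>simp_all add: countable_finite\<close>)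
  next
    fix x assume "x \<in> space N"
    then show "(\<lambda>n. blinfun_apply (s n (q x)) (\<psi> x)) \<longlonglongrightarrow> blinfun_apply (U (q x)) (\<psi> x)"
      by (intro blinfun.tendsto s tendsto_const q_range)
  qed
qed

text \<open>The bound \<open>norm (U \<psi>) \<le> norm U * norm \<psi>\<close> integrates to the norm of the Bochner space, since the
  norm of \<open>U\<close> depends on the frequency only.\<close>

lemma op_L2:
  assumes U: "strong_limit U" and fin: "B_inf_norm2 \<mu> U < \<infinity>"
  shows "(\<lambda>x. blinfun_apply (U (q x)) (\<psi> x)) \<in> L2 N"
    and "ennreal ((L2_norm N (\<lambda>x. blinfun_apply (U (q x)) (\<psi> x)))\<^sup>2) \<le> B_inf_norm2 \<mu> U"
proof -
  note [measurable] = strong_limit_norm_measurable[OF U]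
  have le: "(\<integral>\<^sup>+x. ennreal ((norm (blinfun_apply (U (q x)) (\<psi> x)))\<^sup>2) \<partial>N) \<le> B_inf_norm2 \<mu> U"
  proof -
    have "(\<integral>\<^sup>+x. ennreal ((norm (blinfun_apply (U (q x)) (\<psi> x)))\<^sup>2) \<partial>N)
        \<le> (\<integral>\<^sup>+x. ennreal ((norm (\<psi> x))\<^sup>2) * ennreal ((norm (U (q x)))\<^sup>2) \<partial>N)"
    proof (rule nn_integral_mono)
      fix x
      have "(norm (blinfun_apply (U (q x)) (\<psi> x)))\<^sup>2 \<le> (norm (U (q x)) * norm (\<psi> x))\<^sup>2"
        by (intro power_mono norm_blinfun) simp
      then show "ennreal ((norm (blinfun_apply (U (q x)) (\<psi> x)))\<^sup>2)
          \<le> ennreal ((norm (\<psi> x))\<^sup>2) * ennreal ((norm (U (q x)))\<^sup>2)"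
        by (simp add: ennreal_mult[symmetric] power_mult_distrib mult.commute ennreal_leI)
    qed
    also have "\<dots> = B_inf_norm2 \<mu> U"
      unfolding B_inf_norm2_def by (subst nn_integral_\<mu>) auto
    finally show ?thesis .
  qed
  show L: "(\<lambda>x. blinfun_apply (U (q x)) (\<psi> x)) \<in> L2 N"
    unfolding L2_iff_nn_integral using le fin op_measurable[OF U] by auto
  show "ennreal ((L2_norm N (\<lambda>x. blinfun_apply (U (q x)) (\<psi> x)))\<^sup>2) \<le> B_inf_norm2 \<mu> U"
    unfolding ennreal_L2_norm_power2[OF L] by (rule le)
qed

lemma op_L2_norm_less:
  assumes U: "strong_limit U" and "B_inf_norm2 \<mu> U < ennreal (\<epsilon>\<^sup>2)" "\<epsilon> > 0"
  shows "L2_norm N (\<lambda>x. blinfun_apply (U (q x)) (\<psi> x)) < \<epsilon>"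
proof -
  have "B_inf_norm2 \<mu> U < \<infinity>" using assms(2) by (metis ennreal_less_top infinity_ennreal_def order.strict_trans)
  then have "ennreal ((L2_norm N (\<lambda>x. blinfun_apply (U (q x)) (\<psi> x)))\<^sup>2) < ennreal (\<epsilon>\<^sup>2)"
    using op_L2(2)[OF U] assms(2) by (rule_tac le_less_trans)
  then have "(L2_norm N (\<lambda>x. blinfun_apply (U (q x)) (\<psi> x)))\<^sup>2 < \<epsilon>\<^sup>2"
    by (subst (asm) ennreal_less_iff) auto
  then show ?thesis using \<open>\<epsilon> > 0\<close> by (intro power2_less_imp_less[of _ \<epsilon>]) auto
qed

lemma corresponds_step_integral:
  assumes "step_data n \<alpha> V"
  shows "corresponds (step_integral Z n \<alpha> V) (\<lambda>x. blinfun_apply (step_fun n \<alpha> V (q x)) (\<psi> x))"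
proof -
  have 1: "corresponds (\<lambda>x. blinfun_apply (V i) (Z (\<alpha> (Suc i)) x - Z (\<alpha> i) x))
      (\<lambda>x. blinfun_apply (V i) (indicat_real {- pi<..\<alpha> (Suc i)} (q x) *\<^sub>R \<psi> x - indicat_real {- pi<..\<alpha> i} (q x) *\<^sub>R \<psi> x))"
    if "i < n" for i
  proof -
    have "\<alpha> i \<in> {- pi..pi}" "\<alpha> (Suc i) \<in> {- pi..pi}" "clinear_op (V i)"
      using assms that by (simp_all add: step_data_def image_subset_iff)
    then show ?thesis by (intro corresponds_op corresponds_diff corresponds_Z)
  qed
  have "corresponds (\<lambda>x. \<Sum>i<n. blinfun_apply (V i) (Z (\<alpha> (Suc i)) x - Z (\<alpha> i) x))
      (\<lambda>x. \<Sum>i<n. blinfun_apply (V i) (indicat_real {- pi<..\<alpha> (Suc i)} (q x) *\<^sub>R \<psi> x - indicat_real {- pi<..\<alpha> i} (q x) *\<^sub>R \<psi> x))"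
    by (intro corresponds_sum 1) auto
  moreover have "(\<Sum>i<n. blinfun_apply (V i) (indicat_real {- pi<..\<alpha> (Suc i)} (q x) *\<^sub>R \<psi> x - indicat_real {- pi<..\<alpha> i} (q x) *\<^sub>R \<psi> x))
      = blinfun_apply (step_fun n \<alpha> V (q x)) (\<psi> x)" for x
    unfolding step_fun_def blinfun.sum_left
  proof (intro sum.cong refl)
    fix i assume "i \<in> {..<n}"
    then have "\<alpha> i \<in> {- pi..pi}" "\<alpha> i \<le> \<alpha> (Suc i)"
      using assms by (auto simp: step_data_def image_subset_iff mono_on_def)
    then have "indicat_real {- pi<..\<alpha> (Suc i)} (q x) *\<^sub>R \<psi> x - indicat_real {- pi<..\<alpha> i} (q x) *\<^sub>R \<psi> x
        = indicat_real {\<alpha> i<..\<alpha> (Suc i)} (q x) *\<^sub>R \<psi> x"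
      by (auto simp: indicator_def)
    then show "blinfun_apply (V i) (indicat_real {- pi<..\<alpha> (Suc i)} (q x) *\<^sub>R \<psi> x - indicat_real {- pi<..\<alpha> i} (q x) *\<^sub>R \<psi> x)
        = blinfun_apply (indicat_real {\<alpha> i<..\<alpha> (Suc i)} (q x) *\<^sub>R V i) (\<psi> x)"
      by (simp only: blinfun.scaleR_right blinfun.scaleR_left)
  qed
  ultimately show ?thesis unfolding step_integral_def by simp
qed

text \<open>Step integrals correspond to step functions applied to \<open>\<psi>\<close>; convergence of the step functions in
  the Bochner space implies mean square convergence in the model.\<close>

lemma corresponds_has_stoch_integral:
  assumes Y: "has_stoch_integral P \<mu> Z U Y" and U: "U \<in> B_inf \<mu>"
    and U': "strong_limit U'" "AE \<omega> in \<mu>. U \<omega> = U' \<omega>"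
  shows "corresponds Y (\<lambda>x. blinfun_apply (U' (q x)) (\<psi> x))"
proof (rule corresponds_limit)
  obtain n \<alpha> V where step: "\<And>m::nat. step_data (n m) (\<alpha> m) (V m)"
    and limU: "(\<lambda>m. B_inf_norm2 \<mu> (\<lambda>\<omega>. U \<omega> - step_fun (n m) (\<alpha> m) (V m) \<omega>)) \<longlonglongrightarrow> 0"
    and limY: "(\<lambda>m. L2_norm P (\<lambda>x. Y x - step_integral Z (n m) (\<alpha> m) (V m) x)) \<longlonglongrightarrow> 0"
    using Y unfolding has_stoch_integral_def by blast
  show "Y \<in> L2 P" using Y by (simp add: has_stoch_integral_def)
  have "B_inf_norm2 \<mu> U' = B_inf_norm2 \<mu> U"
    using U'(2) by (intro B_inf_norm2_cong_AE) auto
  then have fin: "B_inf_norm2 \<mu> U' < \<infinity>" using U by (simp add: B_inf_def)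
  show "(\<lambda>x. blinfun_apply (U' (q x)) (\<psi> x)) \<in> L2 N" by (rule op_L2[OF U'(1) fin])
  fix \<epsilon> :: real assume "\<epsilon> > 0"
  have "eventually (\<lambda>m. B_inf_norm2 \<mu> (\<lambda>\<omega>. U \<omega> - step_fun (n m) (\<alpha> m) (V m) \<omega>) < ennreal (\<epsilon>\<^sup>2)) sequentially"
    using limU \<open>\<epsilon> > 0\<close> by (intro order_tendstoD) auto
  moreover have "eventually (\<lambda>m. L2_norm P (\<lambda>x. Y x - step_integral Z (n m) (\<alpha> m) (V m) x) < \<epsilon>) sequentially"
    using limY \<open>\<epsilon> > 0\<close> by (intro order_tendstoD) auto
  ultimately have "eventually (\<lambda>m. B_inf_norm2 \<mu> (\<lambda>\<omega>. U \<omega> - step_fun (n m) (\<alpha> m) (V m) \<omega>) < ennreal (\<epsilon>\<^sup>2)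
      \<and> L2_norm P (\<lambda>x. Y x - step_integral Z (n m) (\<alpha> m) (V m) x) < \<epsilon>) sequentially"
    by (rule eventually_conj)
  then obtain m where m: "B_inf_norm2 \<mu> (\<lambda>\<omega>. U \<omega> - step_fun (n m) (\<alpha> m) (V m) \<omega>) < ennreal (\<epsilon>\<^sup>2)"
    "L2_norm P (\<lambda>x. Y x - step_integral Z (n m) (\<alpha> m) (V m) x) < \<epsilon>"
    by (auto simp: eventually_sequentially)
  have "B_inf_norm2 \<mu> (\<lambda>\<omega>. U' \<omega> - step_fun (n m) (\<alpha> m) (V m) \<omega>)
      = B_inf_norm2 \<mu> (\<lambda>\<omega>. U \<omega> - step_fun (n m) (\<alpha> m) (V m) \<omega>)"
    using U'(2) by (intro B_inf_norm2_cong_AE) auto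
  then have "L2_norm N (\<lambda>x. blinfun_apply (U' (q x) - step_fun (n m) (\<alpha> m) (V m) (q x)) (\<psi> x)) < \<epsilon>"
    using m(1) \<open>\<epsilon> > 0\<close>
    by (intro op_L2_norm_less[of "\<lambda>\<omega>. U' \<omega> - step_fun (n m) (\<alpha> m) (V m) \<omega>"] strong_limit_diff U'
        strong_limit_step_fun step) simp_all
  then show "\<exists>Y' W'. corresponds Y' W' \<and> L2_norm P (\<lambda>x. Y x - Y' x) < \<epsilon>
      \<and> L2_norm N (\<lambda>x. blinfun_apply (U' (q x)) (\<psi> x) - W' x) < \<epsilon>"
    using corresponds_step_integral[OF step[of m]] m(2)
    by (intro exI[of _ "step_integral Z (n m) (\<alpha> m) (V m)"]
        exI[of _ "\<lambda>x. blinfun_apply (step_fun (n m) (\<alpha> m) (V m) (q x)) (\<psi> x)"] conjI)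
      (simp_all add: blinfun.diff_left)
qed

text \<open>The integrals of approximating step functions form a Cauchy sequence, since the model
  turns their distances into distances in the Bochner space.\<close>

lemma ex_has_stoch_integral:
  assumes U: "U \<in> B_inf \<mu>"
  shows "\<exists>Y. has_stoch_integral P \<mu> Z U Y"
proof -
  obtain U' where U': "strong_limit U'" "\<And>\<omega>. clinear_op (U' \<omega>)" "AE \<omega> in \<mu>. U \<omega> = U' \<omega>"
    using B_inf_representative[OF sets_\<mu> U] by blast
  have eq: "B_inf_norm2 \<mu> (\<lambda>\<omega>. U \<omega> - V \<omega>) = B_inf_norm2 \<mu> (\<lambda>\<omega>. U' \<omega> - V \<omega>)" for V
    using U'(3) by (intro B_inf_norm2_cong_AE) auto
  have fin: "B_inf_norm2 \<mu> U' < \<infinity>" using eq[of "\<lambda>_. 0"] U by (simp add: B_inf_def)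
  have appr: "step_approximable \<mu> U'"
    by (rule step_approximable_strong_limit[OF sets_\<mu> finite_\<mu> emeasure_\<mu>_left_end U'(1) U'(2) fin])
  define \<delta> where "\<delta> m = 1 / real (Suc m)" for m
  have \<delta>: "\<delta> m > 0" for m by (simp add: \<delta>_def)
  have "\<forall>m. \<exists>n \<alpha> V. step_data n \<alpha> V \<and> B_inf_norm2 \<mu> (\<lambda>\<omega>. U' \<omega> - step_fun n \<alpha> V \<omega>) < ennreal ((\<delta> m)\<^sup>2)"
  proof
    fix m
    have "ennreal ((\<delta> m)\<^sup>2) > 0" using \<delta>[of m] by simp
    then show "\<exists>n \<alpha> V. step_data n \<alpha> V \<and> B_inf_norm2 \<mu> (\<lambda>\<omega>. U' \<omega> - step_fun n \<alpha> V \<omega>) < ennreal ((\<delta> m)\<^sup>2)"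
      using appr unfolding step_approximable_def by blast
  qed
  then obtain n \<alpha> V where step: "\<And>m. step_data (n m) (\<alpha> m) (V m)"
    and close: "\<And>m. B_inf_norm2 \<mu> (\<lambda>\<omega>. U' \<omega> - step_fun (n m) (\<alpha> m) (V m) \<omega>) < ennreal ((\<delta> m)\<^sup>2)"
    by metis
  let ?S = "\<lambda>m. step_integral Z (n m) (\<alpha> m) (V m)"
  let ?W = "\<lambda>m x. blinfun_apply (step_fun (n m) (\<alpha> m) (V m) (q x)) (\<psi> x)"
  have S: "corresponds (?S m) (?W m)" for m by (rule corresponds_step_integral[OF step])
  have WL: "(\<lambda>x. blinfun_apply (U' (q x)) (\<psi> x)) \<in> L2 N" by (rule op_L2[OF U'(1) fin])
  have W: "L2_norm N (\<lambda>x. blinfun_apply (U' (q x)) (\<psi> x) - ?W m x) < \<delta> m" for m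
    using op_L2_norm_less[OF strong_limit_diff[OF U'(1) strong_limit_step_fun[OF step]] close \<delta>]
    by (simp add: blinfun.diff_left)
  have \<delta>0: "\<delta> \<longlonglongrightarrow> 0" unfolding \<delta>_def using LIMSEQ_inverse_real_of_nat by (simp add: inverse_eq_divide)
  have "\<exists>Y\<in>L2 P. (\<lambda>m. L2_norm P (\<lambda>x. ?S m x - Y x)) \<longlonglongrightarrow> 0"
  proof (rule L2_complete)
    fix \<epsilon> :: real assume "\<epsilon> > 0"
    then obtain K where K: "\<And>m. m \<ge> K \<Longrightarrow> \<delta> m < \<epsilon> / 2"
      using order_tendstoD(2)[OF \<delta>0, of "\<epsilon> / 2"] by (auto simp: eventually_sequentially)
    have "L2_norm P (\<lambda>x. ?S m x - ?S m' x) < \<epsilon>" if "m \<ge> K" "m' \<ge> K" for m m'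
    proof -
      have "L2_norm P (\<lambda>x. ?S m x - ?S m' x) = L2_norm N (\<lambda>x. ?W m x - ?W m' x)"
        by (intro corresponds_norm corresponds_diff S)
      also have "\<dots> \<le> L2_norm N (\<lambda>x. ?W m x - blinfun_apply (U' (q x)) (\<psi> x))
          + L2_norm N (\<lambda>x. blinfun_apply (U' (q x)) (\<psi> x) - ?W m' x)"
        by (intro L2_norm_triangle_diff correspondsD(2)[OF S] WL)
      also have "\<dots> < \<epsilon>"
        using W[of m] W[of m'] K[OF that(1)] K[OF that(2)] by (subst L2_norm_minus_commute) linarith
      finally show ?thesis .
    qed
    then show "\<exists>K. \<forall>m\<ge>K. \<forall>m'\<ge>K. L2_norm P (\<lambda>x. ?S m x - ?S m' x) < \<epsilon>" by blast
  qed (rule correspondsD(1)[OF S])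
  then obtain Y where Y: "Y \<in> L2 P" "(\<lambda>m. L2_norm P (\<lambda>x. ?S m x - Y x)) \<longlonglongrightarrow> 0" by blast
  have "(\<lambda>m. B_inf_norm2 \<mu> (\<lambda>\<omega>. U \<omega> - step_fun (n m) (\<alpha> m) (V m) \<omega>)) \<longlonglongrightarrow> 0"
  proof (rule tendsto_sandwich[of "\<lambda>_. 0" _ _ "\<lambda>m. ennreal ((\<delta> m)\<^sup>2)"])
    show "(\<lambda>m. ennreal ((\<delta> m)\<^sup>2)) \<longlonglongrightarrow> 0"
      using tendsto_ennrealI[OF tendsto_power[OF \<delta>0, of 2]] by simp
  qed (use close in \<open>auto simp: eq less_imp_le\<close>)
  then have "has_stoch_integral P \<mu> Z U Y"
    unfolding has_stoch_integral_def using Y step L2_norm_minus_commute[of P Y] by auto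
  then show ?thesis by (rule exI[of _ Y])
qed

lemma corresponds_stoch_integral:
  assumes "U \<in> B_inf \<mu>" "strong_limit U'" "AE \<omega> in \<mu>. U \<omega> = U' \<omega>"
  shows "corresponds (stoch_integral P \<mu> Z U) (\<lambda>x. blinfun_apply (U' (q x)) (\<psi> x))"
proof -
  have "has_stoch_integral P \<mu> Z U (stoch_integral P \<mu> Z U)"
    unfolding stoch_integral_def using ex_has_stoch_integral[OF assms(1)] by (rule someI_ex)
  then show ?thesis using assms by (rule corresponds_has_stoch_integral)
qed

lemma corresponds_unique:
  assumes "corresponds Y V" "corresponds Y' V"
  shows "AE x in P. Y x = Y' x"
proof -
  have c: "corresponds (\<lambda>x. Y x - Y' x) (\<lambda>x. V x - V x)" by (rule corresponds_diff[OF assms])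
  then have "L2_norm P (\<lambda>x. Y x - Y' x) = 0"
    using corresponds_norm[OF c] by (simp add: L2_zero)
  then have "AE x in P. Y x - Y' x = 0" by (rule L2_norm_eq_0_AE[OF correspondsD(1)[OF c]])
  then show ?thesis by (rule AE_mp) auto
qed

lemma corresponds_modulated_integral:
  assumes A: "A \<in> B_inf \<mu>"
    and A': "strong_limit A'" "\<And>\<omega>. clinear_op (A' \<omega>)" "AE \<omega> in \<mu>. A \<omega> = A' \<omega>"
  shows "corresponds (stoch_integral P \<mu> Z (\<lambda>\<omega>. scale_op (cis (of_int t * \<omega>)) (A \<omega>)))
    (\<lambda>x. cis (of_int t * q x) *\<^sub>C blinfun_apply (A' (q x)) (\<psi> x))"
proof -
  have "AE \<omega> in \<mu>. scale_op (cis (of_int t * \<omega>)) (A \<omega>) = scale_op (cis (of_int t * \<omega>)) (A' \<omega>)"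
    using A'(3) by eventually_elim simp
  from corresponds_stoch_integral[OF B_inf_scale_cis[OF sets_\<mu> A A'] strong_limit_scale_cis[OF A'(1)] this]
  show ?thesis by (simp add: blinfun_scale_op)
qed

text \<open>Both \<open>X t\<close> and the integral carry the factor \<open>cis (t * q)\<close>, which has modulus one.\<close>

lemma modulated_residual_norm:
  assumes Y: "corresponds Y (\<lambda>x. cis (of_int t * q x) *\<^sub>C blinfun_apply (A' (q x)) (\<psi> x))"
  shows "L2_norm P (\<lambda>x. X t x - Y x) = L2_norm N (\<lambda>x. \<psi> x - blinfun_apply (A' (q x)) (\<psi> x))"
proof -
  have "L2_norm P (\<lambda>x. X t x - Y x)
      = L2_norm N (\<lambda>x. harmonic t x - cis (of_int t * q x) *\<^sub>C blinfun_apply (A' (q x)) (\<psi> x))"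
    by (intro corresponds_norm corresponds_diff corresponds_X Y)
  also have "\<dots> = L2_norm N (\<lambda>x. \<psi> x - blinfun_apply (A' (q x)) (\<psi> x))"
    by (simp add: L2_norm_def harmonic_def scaleC.diff_right[symmetric] norm_scaleC)
  finally show ?thesis .
qed

end

section \<open>Operators of rank at most p\<close>

text \<open>Gram--Schmidt orthonormalisation. A vector that already lies in the span of its predecessors
  leaves a zero in the sequence.\<close>

lemma ex_orthonormal_span:
  fixes B :: "'h::complex_hilbert_space set"
  assumes "finite B"
  shows "\<exists>u. ortho_seq u \<and> (\<forall>b\<in>chilbert.span B. b = (\<Sum>i<card B. cinner b (u i) *\<^sub>C u i))
    \<and> (\<forall>i\<ge>card B. u i = 0)"
  using assms
proof (induction B rule: finite_induct)
  case empty
  show ?case by (intro exI[of _ "\<lambda>_. 0"]) (auto simp: ortho_seq_def)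
next
  case (insert b B)
  let ?n = "card B"
  obtain u where u: "ortho_seq u" "\<And>v. v \<in> chilbert.span B \<Longrightarrow> v = (\<Sum>i<?n. cinner v (u i) *\<^sub>C u i)"
    "\<And>i. i \<ge> ?n \<Longrightarrow> u i = 0"
    using insert.IH by blast
  \<comment> \<open>If \<open>z = 0\<close>, then also \<open>y = 0\<close>, as \<open>inverse 0 = 0\<close>.\<close>
  define z where "z = b - (\<Sum>i<?n. cinner b (u i) *\<^sub>C u i)"
  define y where "y = inverse (norm z) *\<^sub>R z"
  define u' where "u' = u(?n := y)"
  have zu: "cinner z (u i) = 0" for i
    using u(3)[of i]
    by (cases "u i = 0") (auto simp: z_def cinner.diff_left cinner_fourier_sum[OF u(1)] not_le[symmetric])
  then have yu: "cinner y (u i) = 0" "cinner (u i) y = 0" for i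
    using cinner_commute[of "u i" y] by (simp_all add: y_def cinner_scaleR_left)
  have y: "norm y = 1 \<or> y = 0" by (cases "z = 0") (simp_all add: y_def)
  have u': "ortho_seq u'"
    using u(1) yu y unfolding ortho_seq_def u'_def by auto
  have rep: "v = (\<Sum>i<Suc ?n. cinner v (u' i) *\<^sub>C u' i)" if v: "v \<in> chilbert.span (insert b B)" for v
  proof -
    let ?P = "\<lambda>v. \<Sum>i<Suc ?n. cinner v (u' i) *\<^sub>C u' i"
    have P: "?P v = (\<Sum>i<?n. cinner v (u i) *\<^sub>C u i) + cinner v y *\<^sub>C y" for v
      by (simp add: u'_def)
    have add: "?P (v + v') = ?P v + ?P v'" for v v'
      by (simp add: cinner_add_left scaleC_add_left sum.distrib)
    have scale: "?P (c *\<^sub>C v) = c *\<^sub>C ?P v" for c v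
      by (simp only: cinner_scaleC_left scaleC_scaleC[symmetric] scaleC.sum_right)
    have Py: "?P y = y"
      unfolding P using yu y by (auto simp: cinner_self)
    have "?P b = b"
    proof -
      have "?P (\<Sum>i<?n. cinner b (u i) *\<^sub>C u i) = (\<Sum>i<?n. cinner b (u i) *\<^sub>C u i)"
      proof -
        have c1: "cinner (\<Sum>i<?n. cinner b (u i) *\<^sub>C u i) (u j) *\<^sub>C u j = cinner b (u j) *\<^sub>C u j" if "j < ?n" for j
          using that by (cases "u j = 0") (simp_all add: cinner_fourier_sum[OF u(1)])
        have c2: "cinner (\<Sum>i<?n. cinner b (u i) *\<^sub>C u i) y = 0"
          unfolding cinner.sum_left by (simp add: cinner_scaleC_left yu)
        show ?thesis
          unfolding P c2 scaleC.zero_left add_0_right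
          by (rule sum.cong[OF refl]) (simp only: lessThan_iff c1)
      qed
      moreover have "z = complex_of_real (norm z) *\<^sub>C y"
        by (cases "z = 0") (simp_all add: y_def scaleC_of_real)
      then have "?P z = z" using scale[of "complex_of_real (norm z)" y] Py by metis
      moreover have "b = (\<Sum>i<?n. cinner b (u i) *\<^sub>C u i) + z" by (simp add: z_def)
      ultimately show ?thesis using add by metis
    qed
    moreover have "?P v = v" if "v \<in> B" for v
      using u(2)[OF chilbert.span_base[OF that]] yu
        cinner.sum_left[of "\<lambda>i. cinner v (u i) *\<^sub>C u i" "{..<?n}" y]
      unfolding P by (simp add: cinner_scaleC_left)
    ultimately have gen: "?P x = x" if "x \<in> insert b B" for x using that by blast
    have "?P v = v"
      using v
    proof (induction rule: chilbert.span_induct_alt)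
      case base
      show ?case by simp
    next
      case (step c x y)
      show ?case unfolding add scale gen[OF step(1)] step(2) ..
    qed
    then show ?thesis by simp
  qed
  have "card (insert b B) = Suc ?n" using insert.hyps by simp
  moreover have "\<forall>i\<ge>Suc ?n. u' i = 0" using u(3) by (simp add: u'_def)
  ultimately show ?case using u' rep by (intro exI[of _ u']) simp
qed

lemma crank_le_imp_span:
  assumes "crank A \<le> enat p"
  obtains B where "finite B" "card B \<le> p" "range (blinfun_apply A) \<subseteq> chilbert.span B"
proof -
  let ?V = "range (blinfun_apply A)"
  obtain C where C: "finite C" "?V \<subseteq> chilbert.span C" and dim: "chilbert.dim ?V \<le> p"
    using assms by (auto simp: crank_def split: if_splits)
  obtain B where B: "B \<subseteq> ?V" "chilbert.independent B" "?V \<subseteq> chilbert.span B" "card B = chilbert.dim ?V"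
    using chilbert.basis_exists by blast
  have "finite B" using chilbert.independent_span_bound[OF C(1) B(2)] B(1) C(2) by blast
  then show thesis using that B dim by simp
qed

text \<open>A weighted sum with nonincreasing weights is largest if the mass \<open>p\<close> available to the
  coefficients \<open>a k\<close> is spent on the first \<open>p\<close> weights.\<close>

lemma weighted_sum_le_head:
  fixes \<kappa> a :: "nat \<Rightarrow> real"
  assumes dec: "\<And>k m. k \<le> m \<Longrightarrow> \<kappa> m \<le> \<kappa> k" and pos: "\<And>k. 0 \<le> \<kappa> k"
    and a: "\<And>k. 0 \<le> a k" "\<And>k. a k \<le> 1" and mass: "(\<Sum>k<n. a k) \<le> real p" and "p \<le> n"
  shows "(\<Sum>k<n. \<kappa> k * a k) \<le> (\<Sum>k<p. \<kappa> k)"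
proof -
  \<comment> \<open>After subtracting \<open>\<kappa> p\<close>, the weights are nonnegative before \<open>p\<close> and nonpositive from \<open>p\<close> on.\<close>
  have "(\<Sum>k<n. (\<kappa> k - \<kappa> p) * a k) \<le> (\<Sum>k<n. if k < p then \<kappa> k - \<kappa> p else 0)"
  proof (rule sum_mono)
    fix k
    show "(\<kappa> k - \<kappa> p) * a k \<le> (if k < p then \<kappa> k - \<kappa> p else 0)"
      using dec[of k p] dec[of p k] a[of k] mult_left_le[of "a k" "\<kappa> k - \<kappa> p"]
      by (auto simp: mult_nonpos_nonneg)
  qed
  also have "\<dots> = (\<Sum>k<p. \<kappa> k - \<kappa> p)"
    using \<open>p \<le> n\<close> by (intro sum.mono_neutral_cong_right) auto
  finally have "(\<Sum>k<n. \<kappa> k * a k) - \<kappa> p * (\<Sum>k<n. a k) \<le> (\<Sum>k<p. \<kappa> k) - real p * \<kappa> p"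
    by (simp add: left_diff_distrib sum_subtractf sum_distrib_left)
  moreover have "\<kappa> p * (\<Sum>k<n. a k) \<le> \<kappa> p * real p" using pos mass by (intro mult_left_mono)
  ultimately show ?thesis by (simp add: mult.commute)
qed

text \<open>The Eckart--Young inequality. The squared distance from \<open>e k\<close> to the range of \<open>A\<close> is
  \<open>1 - a k\<close>, where \<open>a k\<close> is the squared norm of the projection of \<open>e k\<close> onto the range. By Bessel's
  inequality for the basis vectors of the range, the \<open>a k\<close> have total mass at most \<open>p\<close>.\<close>

lemma eckart_young:
  fixes e :: "nat \<Rightarrow> 'h::complex_hilbert_space"
  assumes e: "ortho_seq e" and dec: "\<And>k m. k \<le> m \<Longrightarrow> \<kappa> m \<le> \<kappa> k" and pos: "\<And>k. 0 \<le> \<kappa> k"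
    and pad: "\<And>k. e k = 0 \<Longrightarrow> \<kappa> k = 0" and A: "crank A \<le> enat p"
  shows "(\<Sum>k. ennreal (\<kappa> (k + p))) \<le> (\<Sum>k. ennreal (\<kappa> k * (norm (e k - blinfun_apply A (e k)))\<^sup>2))"
proof -
  obtain B where B: "finite B" "card B \<le> p" "range (blinfun_apply A) \<subseteq> chilbert.span B"
    using A by (rule crank_le_imp_span)
  obtain u where u: "ortho_seq u" "\<And>b. b \<in> chilbert.span B \<Longrightarrow> b = (\<Sum>i<card B. cinner b (u i) *\<^sub>C u i)"
    using ex_orthonormal_span[OF B(1)] by blast
  define a where "a k = (\<Sum>i<card B. (cmod (cinner (e k) (u i)))\<^sup>2)" for k
  have norm_e: "(norm (e k))\<^sup>2 \<le> 1" "(norm (u k))\<^sup>2 \<le> 1" for k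
  proof -
    have "norm (e k) \<le> 1" "norm (u k) \<le> 1"
      using e u(1) unfolding ortho_seq_def by (metis norm_zero order_refl zero_le_one)+
    then show "(norm (e k))\<^sup>2 \<le> 1" "(norm (u k))\<^sup>2 \<le> 1" by (simp_all add: power_le_one)
  qed
  have a: "0 \<le> a k" "a k \<le> 1" for k
    using bessel[OF u(1) finite_lessThan, of "e k" "card B"] norm_e(1)[of k]
    by (auto simp: a_def sum_nonneg)
  have mass: "(\<Sum>k<n. a k) \<le> real p" for n
  proof -
    have "(\<Sum>k<n. a k) = (\<Sum>i<card B. \<Sum>k<n. (cmod (cinner (u i) (e k)))\<^sup>2)"
    proof -
      have "cmod (cinner (e k) (u i)) = cmod (cinner (u i) (e k))" for i k
        by (subst cinner_commute) simp
      then show ?thesis unfolding a_def by (subst sum.swap) simp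
    qed
    also have "\<dots> \<le> (\<Sum>i<card B. 1)"
      by (intro sum_mono order.trans[OF bessel[OF e finite_lessThan] norm_e(2)])
    finally show ?thesis using B(2) by simp
  qed
  \<comment> \<open>\<open>A (e k)\<close> is fixed by the projection \<open>?P\<close>, so subtracting it does not change the remainder of \<open>e k\<close>.\<close>
  have dist: "\<kappa> k * (1 - a k) \<le> \<kappa> k * (norm (e k - blinfun_apply A (e k)))\<^sup>2" for k
  proof (cases "e k = 0")
    case False
    define v where "v = blinfun_apply A (e k)"
    let ?P = "\<lambda>x. \<Sum>i<card B. cinner x (u i) *\<^sub>C u i"
    have "v \<in> chilbert.span B" using B(3) unfolding v_def by blast
    from u(2)[OF this] have "?P v = v" by (rule sym)
    then have eq: "e k - v - ?P (e k - v) = e k - ?P (e k)"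
      by (simp add: cinner.diff_left scaleC.diff_left sum_subtractf)
    have "(norm (e k - ?P (e k)))\<^sup>2
        = (norm (e k - v))\<^sup>2 - (\<Sum>i<card B. (cmod (cinner (e k - v) (u i)))\<^sup>2)"
      unfolding eq[symmetric] by (rule norm_fourier_remainder[OF u(1) finite_lessThan])
    moreover have "0 \<le> (\<Sum>i<card B. (cmod (cinner (e k - v) (u i)))\<^sup>2)" by (simp add: sum_nonneg)
    ultimately have "(norm (e k - ?P (e k)))\<^sup>2 \<le> (norm (e k - v))\<^sup>2" by linarith
    moreover have "(norm (e k - ?P (e k)))\<^sup>2 = (norm (e k))\<^sup>2 - a k"
      unfolding a_def by (rule norm_fourier_remainder[OF u(1) finite_lessThan])
    moreover have "norm (e k) = 1" using e False by (auto simp: ortho_seq_def)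
    ultimately show ?thesis using pos[of k] by (intro mult_left_mono) (simp_all add: v_def)
  qed (simp add: pad)
  have tail: "(\<Sum>k<m. \<kappa> (k + p)) \<le> (\<Sum>k<m + p. \<kappa> k * (norm (e k - blinfun_apply A (e k)))\<^sup>2)" for m
  proof -
    have "(\<Sum>k<m + p. \<kappa> k) = (\<Sum>k<p. \<kappa> k) + (\<Sum>k<m. \<kappa> (k + p))"
      by (induction m) auto
    moreover have "(\<Sum>k<m + p. \<kappa> k * a k) \<le> (\<Sum>k<p. \<kappa> k)"
      by (rule weighted_sum_le_head[OF dec pos a mass]) auto
    moreover have "(\<Sum>k<m + p. \<kappa> k * (1 - a k))
        \<le> (\<Sum>k<m + p. \<kappa> k * (norm (e k - blinfun_apply A (e k)))\<^sup>2)"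
      by (intro sum_mono dist)
    ultimately show ?thesis by (simp add: right_diff_distrib sum_subtractf)
  qed
  have "(\<Sum>k<m. ennreal (\<kappa> (k + p))) \<le> (\<Sum>k. ennreal (\<kappa> k * (norm (e k - blinfun_apply A (e k)))\<^sup>2))" for m
  proof -
    have "(\<Sum>k<m. ennreal (\<kappa> (k + p))) = ennreal (\<Sum>k<m. \<kappa> (k + p))"
      using pos by (simp add: sum_ennreal)
    also have "\<dots> \<le> ennreal (\<Sum>k<m + p. \<kappa> k * (norm (e k - blinfun_apply A (e k)))\<^sup>2)"
      by (intro ennreal_leI tail)
    also have "\<dots> = (\<Sum>k<m + p. ennreal (\<kappa> k * (norm (e k - blinfun_apply A (e k)))\<^sup>2))"
      using pos by (simp add: sum_ennreal)
    also have "\<dots> \<le> (\<Sum>k. ennreal (\<kappa> k * (norm (e k - blinfun_apply A (e k)))\<^sup>2))"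
      by (rule sum_le_suminf) auto
    finally show ?thesis .
  qed
  then show ?thesis
    unfolding suminf_eq_SUP[of "\<lambda>k. ennreal (\<kappa> (k + p))"] by (intro SUP_least)
qed

lemma blinfun_truncated_projection:
  "blinfun_apply (truncated_projection n \<phi>) x = (\<Sum>k<n. cinner x (\<phi> (Suc k)) *\<^sub>C \<phi> (Suc k))"
  unfolding truncated_projection_def blinfun.sum_left blinfun_outer
  by (rule sum.reindex_bij_witness[of _ Suc "\<lambda>k. k - 1"]) auto

lemma clinear_op_truncated_projection: "clinear_op (truncated_projection n \<phi>)"
  unfolding truncated_projection_def by (intro clinear_op_sum clinear_op_outer)

lemma crank_truncated_projection: "crank (truncated_projection n \<phi>) \<le> enat n"
proof -
  let ?B = "(\<lambda>k. \<phi> (Suc k)) ` {..<n}"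
  have sub: "range (blinfun_apply (truncated_projection n \<phi>)) \<subseteq> chilbert.span ?B"
    unfolding blinfun_truncated_projection
    by (auto intro!: chilbert.span_sum chilbert.span_scale intro: chilbert.span_base)
  have "chilbert.dim (range (blinfun_apply (truncated_projection n \<phi>))) \<le> card ?B"
    using sub by (intro chilbert.dim_le_card) auto
  also have "\<dots> \<le> n" using card_image_le[of "{..<n}"] by simp
  finally show ?thesis
    unfolding crank_def using sub by (auto intro!: exI[of _ ?B])
qed

lemma norm_truncated_projection_le:
  assumes "ortho_seq (\<lambda>k. \<phi> (Suc k))"
  shows "norm (truncated_projection n \<phi>) \<le> 1"
proof (rule norm_blinfun_bound)
  fix x
  have "(norm (blinfun_apply (truncated_projection n \<phi>) x))\<^sup>2 \<le> (\<Sum>k<n. (cmod (cinner x (\<phi> (Suc k))))\<^sup>2)"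
    unfolding blinfun_truncated_projection norm_fourier_sum[OF assms finite_lessThan] by (intro sum_mono) auto
  also have "\<dots> \<le> (norm x)\<^sup>2" by (rule bessel[OF assms finite_lessThan])
  finally show "norm (blinfun_apply (truncated_projection n \<phi>) x) \<le> 1 * norm x"
    by (simp add: power2_le_iff_abs_le)
qed simp

text \<open>The truncated projection fixes the first \<open>p\<close> eigenvectors and annihilates the others.\<close>

lemma eckart_young_attained:
  assumes e: "ortho_seq (\<lambda>k. \<phi> (Suc k))" and pad: "\<And>k. \<phi> (Suc k) = 0 \<Longrightarrow> \<kappa> k = 0"
  shows "(\<Sum>k. ennreal (\<kappa> k * (norm (\<phi> (Suc k) - blinfun_apply (truncated_projection p \<phi>) (\<phi> (Suc k))))\<^sup>2))
    = (\<Sum>k. ennreal (\<kappa> (k + p)))"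
proof -
  let ?g = "\<lambda>k. \<kappa> k * (norm (\<phi> (Suc k) - blinfun_apply (truncated_projection p \<phi>) (\<phi> (Suc k))))\<^sup>2"
  have g: "?g k = (if k < p then 0 else \<kappa> k)" for k
  proof (cases "\<phi> (Suc k) = 0")
    case False
    then have n: "norm (\<phi> (Suc k)) = 1" using e by (auto simp: ortho_seq_def)
    have "cinner (\<phi> (Suc k)) (\<phi> (Suc i)) *\<^sub>C \<phi> (Suc i) = (if i = k then \<phi> (Suc k) else 0)" for i
      using e n by (auto simp: ortho_seq_def cinner_self)
    then have "blinfun_apply (truncated_projection p \<phi>) (\<phi> (Suc k)) = (if k < p then \<phi> (Suc k) else 0)"
      unfolding blinfun_truncated_projection by (simp add: sum.delta')
    then show ?thesis using n by simp
  qed (simp add: pad)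
  have "(\<Sum>k. ennreal (?g k)) = (\<Sum>k. ennreal (?g (k + p))) + (\<Sum>k<p. ennreal (?g k))"
    by (rule suminf_offset) (rule summableI)
  then show ?thesis by (simp add: g)
qed

section \<open>Eigendecompositions of positive operators\<close>

lemma eigen_ortho: "eigen_system A \<nu> \<phi> \<Longrightarrow> ortho_seq (\<lambda>k. \<phi> (Suc k))"
  unfolding eigen_system_def ortho_seq_def by auto

lemma eigen_decreasing: "eigen_system A \<nu> \<phi> \<Longrightarrow> k \<le> m \<Longrightarrow> \<nu> (Suc m) \<le> \<nu> (Suc k)"
  unfolding eigen_system_def by auto

lemma eigen_pad: "eigen_system A \<nu> \<phi> \<Longrightarrow> \<phi> (Suc k) = 0 \<Longrightarrow> \<nu> (Suc k) = 0"
  unfolding eigen_system_def by (metis norm_zero zero_neq_one le_add1 plus_1_eq_Suc)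

lemma eigen_norm: "eigen_system A \<nu> \<phi> \<Longrightarrow> \<nu> (Suc k) * (norm (\<phi> (Suc k)))\<^sup>2 = \<nu> (Suc k)"
proof -
  assume eig: "eigen_system A \<nu> \<phi>"
  show ?thesis
  proof (cases "\<phi> (Suc k) = 0")
    case False
    then have "norm (\<phi> (Suc k)) = 1" using eigen_ortho[OF eig] by (auto simp: ortho_seq_def)
    then show ?thesis by simp
  qed (simp add: eigen_pad[OF eig])
qed

lemma eigen_sums:
  assumes "eigen_system A \<nu> \<phi>"
  shows "(\<lambda>k. \<nu> (Suc k) *\<^sub>R (cinner x (\<phi> (Suc k)) *\<^sub>C \<phi> (Suc k))) sums blinfun_apply A x"
proof -
  have "((\<lambda>j. \<nu> j *\<^sub>R (cinner x (\<phi> j) *\<^sub>C \<phi> j)) has_sum blinfun_apply A x) {1..}"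
    using assms by (simp add: eigen_system_def)
  moreover have "bij_betw Suc UNIV {1..}"
    by (rule bij_betwI[of _ _ _ "\<lambda>k. k - 1"]) auto
  ultimately show ?thesis
    using has_sum_reindex_bij_betw[of Suc UNIV "{1..}" "\<lambda>j. \<nu> j *\<^sub>R (cinner x (\<phi> j) *\<^sub>C \<phi> j)"]
    by (intro has_sum_imp_sums) simp
qed

lemma eigen_quadratic_sums:
  assumes "eigen_system A \<nu> \<phi>"
  shows "(\<lambda>k. \<nu> (Suc k) * (cmod (cinner x (\<phi> (Suc k))))\<^sup>2) sums Re (cinner (blinfun_apply A x) x)"
proof -
  have "(\<lambda>k. Re (cinner (\<nu> (Suc k) *\<^sub>R (cinner x (\<phi> (Suc k)) *\<^sub>C \<phi> (Suc k))) x)) sums Re (cinner (blinfun_apply A x) x)"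
    by (intro sums_Re bounded_linear.sums[OF cinner.bounded_linear_left] eigen_sums assms)
  moreover have "Re (cinner (\<nu> (Suc k) *\<^sub>R (cinner x (\<phi> (Suc k)) *\<^sub>C \<phi> (Suc k))) x)
      = \<nu> (Suc k) * (cmod (cinner x (\<phi> (Suc k))))\<^sup>2" for k
  proof -
    have "cinner x (\<phi> (Suc k)) * cinner (\<phi> (Suc k)) x = complex_of_real ((cmod (cinner x (\<phi> (Suc k))))\<^sup>2)"
      unfolding complex_norm_square by (simp add: cinner_commute[symmetric])
    then show ?thesis by (simp add: cinner_scaleR_left cinner_scaleC_left)
  qed
  ultimately show ?thesis by simp
qed

lemma eigen_value:
  assumes "eigen_system A \<nu> \<phi>"
  shows "\<nu> (Suc k) = Re (cinner (blinfun_apply A (\<phi> (Suc k))) (\<phi> (Suc k)))"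
proof -
  let ?f = "\<lambda>i. \<nu> (Suc i) * (cmod (cinner (\<phi> (Suc k)) (\<phi> (Suc i))))\<^sup>2"
  have "?f i = (if i = k then \<nu> (Suc k) else 0)" for i
  proof (cases "i = k")
    case True
    have "norm (\<phi> (Suc k)) = 1 \<or> \<phi> (Suc k) = 0" using eigen_ortho[OF assms] by (simp add: ortho_seq_def)
    then show ?thesis
      using True eigen_pad[OF assms, of k] by (auto simp: cinner_self norm_power)
  qed (use eigen_ortho[OF assms] in \<open>simp add: ortho_seq_def\<close>)
  then have "?f sums \<nu> (Suc k)" using sums_single[of k "\<lambda>_. \<nu> (Suc k)"] by simp
  then show ?thesis using eigen_quadratic_sums[OF assms, of "\<phi> (Suc k)"] sums_unique2 by blast
qed

lemma eigen_nonneg: "eigen_system A \<nu> \<phi> \<Longrightarrow> A \<in> S1_pos \<Longrightarrow> 0 \<le> \<nu> (Suc k)"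
  using eigen_value[of A \<nu> \<phi> k] S1_posD(3)[of A] by simp

text \<open>Both sides are the double sum of \<open>\<nu> (Suc k) * (cmod (cinner e (\<phi> (Suc k))))\<^sup>2\<close> over \<open>k\<close> and an orthonormal
  basis; its terms are nonnegative, so that the order of summation is immaterial.\<close>

lemma eigen_trace:
  fixes A :: "'h::{complex_hilbert_space, second_countable_topology} \<Rightarrow>\<^sub>L 'h"
  assumes A: "A \<in> S1_pos" and eig: "eigen_system A \<nu> \<phi>"
  shows "ennreal (Re (tr A)) = (\<Sum>k. ennreal (\<nu> (Suc k)))" and "summable (\<lambda>k. \<nu> (Suc k))"
proof -
  note pos = eigen_nonneg[OF eig A]
  let ?f = "\<lambda>k n. ennreal (\<nu> (Suc k) * (cmod (cinner (onb_seq n) (\<phi> (Suc k))))\<^sup>2)"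
  have "ennreal (Re (tr A)) = (\<Sum>n. ennreal (Re (cinner (blinfun_apply A (onb_seq n)) (onb_seq n))))"
    using tr_sums(1)[OF A] S1_posD(3)[OF A] by (intro suminf_ennreal_eq[symmetric])
  also have "\<dots> = (\<Sum>n. \<Sum>k. ?f k n)"
    using eigen_quadratic_sums[OF eig] pos by (intro suminf_cong suminf_ennreal_eq[symmetric]) auto
  also have "\<dots> = (\<integral>\<^sup>+n. (\<Sum>k. ?f k n) \<partial>count_space UNIV)"
    by (rule nn_integral_count_space_nat[symmetric])
  also have "\<dots> = (\<Sum>k. \<Sum>n. ?f k n)"
    by (subst nn_integral_suminf) (auto simp: nn_integral_count_space_nat)
  also have "\<dots> = (\<Sum>k. ennreal (\<nu> (Suc k)))"
  proof (intro suminf_cong)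
    fix k
    have "(\<lambda>n. \<nu> (Suc k) * (cmod (cinner (\<phi> (Suc k)) (onb_seq n)))\<^sup>2) sums (\<nu> (Suc k) * (norm (\<phi> (Suc k)))\<^sup>2)"
      by (intro sums_mult onb_parseval)
    then have "(\<lambda>n. \<nu> (Suc k) * (cmod (cinner (onb_seq n) (\<phi> (Suc k))))\<^sup>2) sums \<nu> (Suc k)"
      unfolding eigen_norm[OF eig] by (metis (no_types, lifting) sums_cong cinner_commute complex_mod_cnj)
    then show "(\<Sum>n. ?f k n) = ennreal (\<nu> (Suc k))"
      using pos by (intro suminf_ennreal_eq) auto
  qed
  finally show eq: "ennreal (Re (tr A)) = (\<Sum>k. ennreal (\<nu> (Suc k)))" .
  show "summable (\<lambda>k. \<nu> (Suc k))"
    using pos eq by (intro summable_suminf_not_top) auto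
qed

section \<open>The spectral measure from density and jumps\<close>

definition sum_measure :: "'a measure \<Rightarrow> 'a measure \<Rightarrow> 'a measure" where
  "sum_measure A B = measure_of (space A) (sets A) (\<lambda>E. emeasure A E + emeasure B E)"

lemma space_sum_measure [simp]: "space (sum_measure A B) = space A"
  and sets_sum_measure [simp, measurable_cong]: "sets (sum_measure A B) = sets A"
  by (simp_all add: sum_measure_def)

lemma emeasure_sum_measure:
  assumes AB: "sets B = sets A" and E: "E \<in> sets A"
  shows "emeasure (sum_measure A B) E = emeasure A E + emeasure B E"
proof (rule emeasure_measure_of[OF sum_measure_def])
  show "sets A \<subseteq> Pow (space A)" by (rule sets.space_closed)
  show "positive (sets (sum_measure A B)) (\<lambda>E. emeasure A E + emeasure B E)"
    by (simp add: positive_def)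
  show "countably_additive (sets (sum_measure A B)) (\<lambda>E. emeasure A E + emeasure B E)"
    unfolding countably_additive_def
  proof (intro allI impI)
    fix C :: "nat \<Rightarrow> 'a set"
    assume "range C \<subseteq> sets (sum_measure A B)" "disjoint_family C"
    then have "(\<Sum>i. emeasure A (C i)) = emeasure A (\<Union>i. C i)" "(\<Sum>i. emeasure B (C i)) = emeasure B (\<Union>i. C i)"
      using AB by (simp_all add: suminf_emeasure)
    then show "(\<Sum>i. emeasure A (C i) + emeasure B (C i)) = emeasure A (\<Union>i. C i) + emeasure B (\<Union>i. C i)"
      by (simp add: suminf_add[OF summableI summableI, symmetric])
  qed
qed (use E in simp)

lemma nn_integral_sum_measure:
  assumes AB: "sets B = sets A" and h: "h \<in> borel_measurable A"
  shows "(\<integral>\<^sup>+x. h x \<partial>sum_measure A B) = (\<integral>\<^sup>+x. h x \<partial>A) + (\<integral>\<^sup>+x. h x \<partial>B)"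
  using h
proof (induction h rule: borel_measurable_induct)
  case (cong f g)
  have "space B = space A" using AB by (rule sets_eq_imp_space_eq)
  then have "(\<integral>\<^sup>+x. f x \<partial>C) = (\<integral>\<^sup>+x. g x \<partial>C)" if "C = A \<or> C = B \<or> C = sum_measure A B" for C
    using that cong(3) by (intro nn_integral_cong) auto
  then show ?case using cong(4) by metis
next
  case (set E)
  then show ?case using AB by (simp add: emeasure_sum_measure)
next
  case (mult u c)
  have [measurable]: "u \<in> borel_measurable A" "u \<in> borel_measurable B" "u \<in> borel_measurable (sum_measure A B)"
    using mult(2) AB by (simp_all cong: measurable_cong_sets)
  show ?case using mult(4) by (simp add: nn_integral_cmult distrib_left)
next
  case (add u v)
  have [measurable]: "u \<in> borel_measurable A" "u \<in> borel_measurable B" "u \<in> borel_measurable (sum_measure A B)"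
    "v \<in> borel_measurable A" "v \<in> borel_measurable B" "v \<in> borel_measurable (sum_measure A B)"
    using add.hyps AB by (simp_all cong: measurable_cong_sets)
  show ?case using add.IH by (simp add: nn_integral_add ac_simps)
next
  case (seq U)
  have m: "U i \<in> borel_measurable A" "U i \<in> borel_measurable B" "U i \<in> borel_measurable (sum_measure A B)" for i
    using seq.hyps(1) AB by (simp_all cong: measurable_cong_sets)
  have mono: "incseq (\<lambda>i. \<integral>\<^sup>+x. U i x \<partial>C)" for C
    using incseq_SucD[OF seq.hyps(3)] by (intro incseq_SucI nn_integral_mono) (simp add: le_fun_def)
  have "(\<integral>\<^sup>+x. (SUP i. U i) x \<partial>C) = (SUP i. \<integral>\<^sup>+x. U i x \<partial>C)" if "C = A \<or> C = B \<or> C = sum_measure A B" for C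
    unfolding SUP_apply using that m seq.hyps(3) by (intro nn_integral_monotone_convergence_SUP) auto
  then show ?case
    using seq.IH mono[of A] mono[of B] by (simp add: ennreal_SUP_add)
qed

text \<open>The set \<open>G\<close> carries the absolutely continuous part of the spectral measure: it consists of those
  frequencies of the continuity part at which the density is positive with the given eigenpairs, so that
  these properties hold without exceptional null sets. The finite set \<open>W\<close> carries the atoms.\<close>

locale spectral_decomposition =
  fixes P :: "'w measure"
    and X :: "int \<Rightarrow> 'w \<Rightarrow> 'h::{complex_hilbert_space, second_countable_topology}"
    and F :: "real set \<Rightarrow> ('h \<Rightarrow>\<^sub>L 'h)"
    and Z :: "real \<Rightarrow> 'w \<Rightarrow> 'h"
    and f :: "real \<Rightarrow> ('h \<Rightarrow>\<^sub>L 'h)" and G W :: "real set"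
    and \<nu> :: "real \<Rightarrow> nat \<Rightarrow> real" and \<phi> :: "real \<Rightarrow> nat \<Rightarrow> 'h"
  assumes stationary: "weakly_stationary P X"
    and spectral: "is_spectral_measure P X F"
    and increments: "is_increment_process P X F Z"
    and W: "finite W" "W \<subseteq> {- pi<..pi}"
    and G: "G \<in> sets lebesgue" "G \<subseteq> {- pi<..pi} - W" "{- pi<..pi} - W - G \<in> null_sets lebesgue"
    and density_pos: "\<And>\<omega>. \<omega> \<in> G \<Longrightarrow> f \<omega> \<in> S1_pos"
    and density_eigen: "\<And>\<omega>. \<omega> \<in> G \<Longrightarrow> eigen_system (f \<omega>) (\<nu> \<omega>) (\<phi> \<omega>)"
    and density: "\<And>E A. E \<in> sets borel \<Longrightarrow> E \<subseteq> {- pi<..pi} - W \<Longrightarrow> A \<in> S1_pos \<Longrightarrow>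
      set_integrable lebesgue E (\<lambda>\<omega>. tr (f \<omega> o\<^sub>L A))
        \<and> tr (F E o\<^sub>L A) = (LINT \<omega>:E|lebesgue. tr (f \<omega> o\<^sub>L A))"
    and jump_eigen: "\<And>a. a \<in> W \<Longrightarrow> eigen_system (spectral_jump F a) (\<nu> a) (\<phi> a)"
    and \<phi>_measurable: "\<And>j. j \<ge> 1 \<Longrightarrow>
      (\<lambda>\<omega>. \<phi> \<omega> j) \<in> borel_measurable (restrict_space lebesgue ({- pi<..pi} - W))"
begin

abbreviation "M \<equiv> {- pi<..pi} - W"

lemma M_borel: "M \<in> sets borel"
  using W(1) by (simp add: finite_imp_closed borel_closed sets.Diff)

lemma AE_G: "AE \<omega> in lebesgue. \<omega> \<in> M \<longrightarrow> \<omega> \<in> G"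
  using G(3) by (rule AE_I') auto

lemma freq_borelI: "E \<in> sets borel \<Longrightarrow> E \<subseteq> {- pi..pi} \<Longrightarrow> E \<in> sets freq_borel"
  by (simp add: sets_restrict_space_iff)

lemma freq_borelD: "E \<in> sets freq_borel \<Longrightarrow> E \<in> sets borel \<and> E \<subseteq> {- pi..pi}"
  by (simp add: sets_restrict_space_iff)

lemma F_S1_pos: "E \<in> sets freq_borel \<Longrightarrow> F E \<in> S1_pos"
  using spectral by (simp add: is_spectral_measure_def)

text \<open>Countable additivity is only known after pairing with positive trace class operators. For rank one
  operators it gives additivity of all quadratic forms, and these determine a complex linear operator.\<close>

lemma F_additive:
  assumes E: "E \<in> sets freq_borel" and E': "E' \<in> sets freq_borel" and disj: "E \<inter> E' = {}"
  shows "F (E \<union> E') = F E + F E'"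
proof (rule clinear_op_eqI)
  have add: "range B \<subseteq> sets freq_borel \<Longrightarrow> disjoint_family B \<Longrightarrow> A \<in> S1_pos \<Longrightarrow>
      (\<lambda>i::nat. tr (F (B i) o\<^sub>L A)) sums tr (F (\<Union>i. B i) o\<^sub>L A)" for A B
    using spectral unfolding is_spectral_measure_def by simp
  have empty: "tr (F {} o\<^sub>L A) = 0" if "A \<in> S1_pos" for A
  proof -
    have "(\<lambda>i::nat. tr (F {} o\<^sub>L A)) sums tr (F (\<Union>i::nat. {}) o\<^sub>L A)"
      by (rule add[OF _ _ that]) (auto simp: disjoint_family_on_def)
    then show ?thesis using summable_const_iff sums_summable by blast
  qed
  fix g
  have "(\<lambda>i. tr (F (binaryset E E' i) o\<^sub>L outer g g)) sums tr (F (\<Union>i. binaryset E E' i) o\<^sub>L outer g g)"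
    using E E' disj by (intro add outer_in_S1_pos) (auto simp: range_binaryset_eq disjoint_family_on_def binaryset_def)
  moreover have "(\<lambda>i. tr (F (binaryset E E' i) o\<^sub>L outer g g)) sums (tr (F E o\<^sub>L outer g g) + tr (F E' o\<^sub>L outer g g))"
    by (rule binaryset_sums) (rule empty[OF outer_in_S1_pos])
  ultimately have "tr (F (E \<union> E') o\<^sub>L outer g g) = tr (F E o\<^sub>L outer g g) + tr (F E' o\<^sub>L outer g g)"
    using sums_unique2 by (metis UN_binaryset_eq)
  then show "cinner (blinfun_apply (F (E \<union> E')) g) g = cinner (blinfun_apply (F E + F E') g) g"
    using E E' by (simp add: tr_outer S1_posD(1) F_S1_pos blinfun.add_left cinner_add_left)
next
  show "clinear_op (F (E \<union> E'))" using E E' by (intro S1_posD(1)[OF F_S1_pos]) auto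
  show "clinear_op (F E + F E')" by (intro clinear_op_add S1_posD(1)[OF F_S1_pos] E E')
qed

lemma F_left_end: "F {- pi} = 0"
  using spectral by (simp add: is_spectral_measure_def)

lemma density_quadratic_measurable: "(\<lambda>\<omega>. indicat_real G \<omega> * Re (cinner (blinfun_apply (f \<omega>) g) g)) \<in> borel_measurable lebesgue"
proof -
  have "set_integrable lebesgue M (\<lambda>\<omega>. tr (f \<omega> o\<^sub>L outer g g))"
    using density[OF M_borel order_refl outer_in_S1_pos] by simp
  then have "(\<lambda>\<omega>. indicat_real M \<omega> *\<^sub>R tr (f \<omega> o\<^sub>L outer g g)) \<in> borel_measurable lebesgue"
    unfolding set_integrable_def by (rule borel_measurable_integrable)
  then have "(\<lambda>\<omega>. indicat_real G \<omega> * Re (indicat_real M \<omega> *\<^sub>R tr (f \<omega> o\<^sub>L outer g g))) \<in> borel_measurable lebesgue"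
    using G(1) by measurable
  also have "(\<lambda>\<omega>. indicat_real G \<omega> * Re (indicat_real M \<omega> *\<^sub>R tr (f \<omega> o\<^sub>L outer g g)))
      = (\<lambda>\<omega>. indicat_real G \<omega> * Re (cinner (blinfun_apply (f \<omega>) g) g))"
    using G(2) density_pos by (auto simp: fun_eq_iff indicator_def tr_outer S1_posD(1))
  finally show ?thesis .
qed

lemma F_density_quadratic:
  assumes E: "E \<in> sets borel" "E \<subseteq> M"
  shows "ennreal (Re (cinner (blinfun_apply (F E) g) g))
    = (\<integral>\<^sup>+\<omega>. indicator E \<omega> * ennreal (indicat_real G \<omega> * Re (cinner (blinfun_apply (f \<omega>) g) g)) \<partial>lebesgue)"
proof -
  let ?h = "\<lambda>\<omega>. indicat_real E \<omega> * (indicat_real G \<omega> * Re (cinner (blinfun_apply (f \<omega>) g) g))"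
  note d = density[OF E outer_in_S1_pos[of g]]
  have int: "integrable lebesgue (\<lambda>\<omega>. Re (indicat_real E \<omega> *\<^sub>R tr (f \<omega> o\<^sub>L outer g g)))"
    using d unfolding set_integrable_def by (intro integrable_bounded_linear[OF bounded_linear_Re]) simp
  have E': "E \<in> sets lebesgue" using E(1) by simp
  have AE: "AE \<omega> in lebesgue. Re (indicat_real E \<omega> *\<^sub>R tr (f \<omega> o\<^sub>L outer g g)) = ?h \<omega>"
    using AE_G
  proof eventually_elim
    case (elim \<omega>)
    then show ?case
      using E(2) density_pos[of \<omega>] by (auto simp: indicator_def tr_outer S1_posD(1))
  qed
  have meas: "?h \<in> borel_measurable lebesgue"
    using density_quadratic_measurable E' by measurable
  have int_h: "integrable lebesgue ?h"
    using integrable_cong_AE_imp[OF int meas] AE by (auto elim: eventually_mono)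
  have "F E \<in> S1_pos" using E by (intro F_S1_pos freq_borelI) auto
  then have "Re (cinner (blinfun_apply (F E) g) g) = Re (LINT \<omega>:E|lebesgue. tr (f \<omega> o\<^sub>L outer g g))"
    using d by (simp add: tr_outer S1_posD(1))
  also have "\<dots> = (LINT \<omega>|lebesgue. Re (indicat_real E \<omega> *\<^sub>R tr (f \<omega> o\<^sub>L outer g g)))"
    unfolding set_lebesgue_integral_def using d unfolding set_integrable_def by (intro integral_Re[symmetric]) simp
  also have "\<dots> = (LINT \<omega>|lebesgue. ?h \<omega>)"
    using int meas AE by (intro integral_cong_AE) auto
  finally have "ennreal (Re (cinner (blinfun_apply (F E) g) g)) = (\<integral>\<^sup>+\<omega>. ennreal (?h \<omega>) \<partial>lebesgue)"
    using density_pos S1_posD(3) by (subst nn_integral_eq_integral[OF int_h]) (auto simp: indicator_def)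
  also have "\<dots> = (\<integral>\<^sup>+\<omega>. indicator E \<omega> * ennreal (indicat_real G \<omega> * Re (cinner (blinfun_apply (f \<omega>) g) g)) \<partial>lebesgue)"
    by (intro nn_integral_cong) (auto simp: indicator_def)
  finally show ?thesis .
qed

lemma density_trace:
  "(\<Sum>n. ennreal (indicat_real G \<omega> * Re (cinner (blinfun_apply (f \<omega>) (onb_seq n)) (onb_seq n))))
    = indicator G \<omega> * (\<Sum>k. ennreal (\<nu> \<omega> (Suc k)))"
proof (cases "\<omega> \<in> G")
  case True
  have "(\<Sum>n. ennreal (indicat_real G \<omega> * Re (cinner (blinfun_apply (f \<omega>) (onb_seq n)) (onb_seq n))))
      = ennreal (Re (tr (f \<omega>)))"
    using True tr_sums(1)[OF density_pos[OF True]] S1_posD(3)[OF density_pos[OF True]]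
    by (intro suminf_ennreal_eq) auto
  also have "\<dots> = (\<Sum>k. ennreal (\<nu> \<omega> (Suc k)))"
    by (rule eigen_trace[OF density_pos[OF True] density_eigen[OF True]])
  finally show ?thesis using True by simp
qed simp

lemma density_trace_measurable:
  "(\<lambda>\<omega>. indicator G \<omega> * (\<Sum>k. ennreal (\<nu> \<omega> (Suc k)))) \<in> borel_measurable lebesgue"
  unfolding density_trace[symmetric] using density_quadratic_measurable by measurable

text \<open>The density is assumed for pairings with trace class operators, to which the identity does
  not belong. Its trace is recovered by monotone convergence from the quadratic forms at the elements of
  an orthonormal basis.\<close>

lemma F_density_trace:
  assumes E: "E \<in> sets borel" "E \<subseteq> M"
  shows "ennreal (Re (tr (F E))) = (\<integral>\<^sup>+\<omega>. indicator E \<omega> * (indicator G \<omega> * (\<Sum>k. ennreal (\<nu> \<omega> (Suc k)))) \<partial>lebesgue)"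
proof -
  note [measurable] = density_quadratic_measurable
  have [measurable]: "E \<in> sets lebesgue" using E(1) by simp
  let ?h = "\<lambda>\<omega> n. ennreal (indicat_real G \<omega> * Re (cinner (blinfun_apply (f \<omega>) (onb_seq n)) (onb_seq n)))"
  have FE: "F E \<in> S1_pos" using E by (intro F_S1_pos freq_borelI) auto
  have "ennreal (Re (tr (F E))) = (\<Sum>n. ennreal (Re (cinner (blinfun_apply (F E) (onb_seq n)) (onb_seq n))))"
    using tr_sums(1)[OF FE] S1_posD(3)[OF FE] by (intro suminf_ennreal_eq[symmetric])
  also have "\<dots> = (\<integral>\<^sup>+\<omega>. (\<Sum>n. indicator E \<omega> * ?h \<omega> n) \<partial>lebesgue)"
    by (subst nn_integral_suminf) (auto simp: F_density_quadratic[OF E])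
  also have "\<dots> = (\<integral>\<^sup>+\<omega>. indicator E \<omega> * (indicator G \<omega> * (\<Sum>k. ennreal (\<nu> \<omega> (Suc k)))) \<partial>lebesgue)"
    unfolding density_trace[symmetric] by (simp add: ennreal_suminf_cmult)
  finally show ?thesis .
qed

text \<open>The jump of the distribution function at \<open>a\<close>. Left of \<open>a\<close> the spectral measure has a density,
  so that the trace of \<open>F {\<omega><..<a}\<close>, and with it its norm, vanishes in the limit.\<close>

lemma spectral_jump_eq:
  assumes a: "a \<in> W"
  shows "spectral_jump F a = F {a}"
proof -
  have a': "- pi < a" "a \<le> pi" using a W(2) by auto
  \<comment> \<open>Between \<open>c\<close> and \<open>a\<close> there is no other atom, so the density describes \<open>F\<close> there.\<close>
  define c where "c = Max (insert (- pi) {s \<in> W. s < a})"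
  have fin: "finite (insert (- pi) {s \<in> W. s < a})" using W(1) by simp
  have "c \<in> insert (- pi) {s \<in> W. s < a}" unfolding c_def by (rule Max_in) (use fin in auto)
  then have c: "- pi \<le> c" "c < a" using a' W(2) by auto
  have c_max: "s \<le> c" if "s \<in> W" "s < a" for s
    unfolding c_def using that fin by (intro Max_ge) auto
  have sub: "{c<..<a} \<subseteq> M"
  proof
    fix x assume "x \<in> {c<..<a}"
    then show "x \<in> M" using c(1) a' c_max[of x] by auto
  qed
  \<comment> \<open>The trace of \<open>F\<close> on \<open>{c<..<a}\<close> as a scalar measure; its continuity from above gives the limit.\<close>
  define D where "D = density lebesgue (\<lambda>\<omega>. indicator {c<..<a} \<omega> * (indicator G \<omega> * (\<Sum>k. ennreal (\<nu> \<omega> (Suc k)))))"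
  have D_measurable: "(\<lambda>\<omega>. indicator {c<..<a} \<omega> * (indicator G \<omega> * (\<Sum>k. ennreal (\<nu> \<omega> (Suc k)))))
      \<in> borel_measurable lebesgue"
    by (intro borel_measurable_times_ennreal density_trace_measurable borel_measurable_indicator) simp
  have D: "emeasure D {b<..<a} = ennreal (Re (tr (F {b<..<a})))" if "c \<le> b" for b
  proof -
    have "emeasure D {b<..<a} = (\<integral>\<^sup>+\<omega>. indicator {c<..<a} \<omega> * (indicator G \<omega> * (\<Sum>k. ennreal (\<nu> \<omega> (Suc k))))
        * indicator {b<..<a} \<omega> \<partial>lebesgue)"
      unfolding D_def by (intro emeasure_density D_measurable) simp
    also have "\<dots> = (\<integral>\<^sup>+\<omega>. indicator {b<..<a} \<omega> * (indicator G \<omega> * (\<Sum>k. ennreal (\<nu> \<omega> (Suc k)))) \<partial>lebesgue)"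
      using that by (intro nn_integral_cong) (auto simp: indicator_def)
    also have "\<dots> = ennreal (Re (tr (F {b<..<a})))"
    proof -
      have "{b<..<a} \<subseteq> M" using sub that by force
      then show ?thesis by (intro F_density_trace[symmetric]) auto
    qed
    finally show ?thesis .
  qed
  have "finite_measure D"
  proof (rule finite_measureI)
    have "emeasure D (space D) = (\<integral>\<^sup>+\<omega>. indicator {c<..<a} \<omega> * (indicator G \<omega> * (\<Sum>k. ennreal (\<nu> \<omega> (Suc k)))) \<partial>lebesgue)"
      unfolding D_def by (subst emeasure_density[OF D_measurable]) auto
    also have "\<dots> = ennreal (Re (tr (F {c<..<a})))"
      using sub by (intro F_density_trace[symmetric]) auto
    finally show "emeasure D (space D) \<noteq> \<infinity>" by simp
  qed
  moreover have "{b<..<a} \<in> sets D" for b by (simp add: D_def)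
  ultimately have lim_D: "((\<lambda>b. measure D {b<..<a}) \<longlongrightarrow> 0) (at_left a)"
    using c(2) by (intro measure_left_interval_tendsto_0[of D c a])
  have near: "eventually (\<lambda>b. b \<in> {c<..<a}) (at_left a)"
    using c(2) by (rule eventually_at_left_real)
  have S1: "F {b<..<a} \<in> S1_pos" if "b \<in> {c<..<a}" for b
    using that c a' by (intro F_S1_pos freq_borelI) auto
  have lim_F: "((\<lambda>b. F {b<..<a}) \<longlongrightarrow> 0) (at_left a)"
  proof (rule Lim_null_comparison[OF _ lim_D], rule eventually_mono[OF near])
    fix b assume b: "b \<in> {c<..<a}"
    have "norm (F {b<..<a}) \<le> Re (tr (F {b<..<a}))" by (rule norm_le_tr[OF S1[OF b]])
    also have "\<dots> = measure D {b<..<a}"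
      using D[of b] b tr_sums(3)[OF S1[OF b]] by (simp add: measure_def)
    finally show "norm (F {b<..<a}) \<le> measure D {b<..<a}" .
  qed
  have "((\<lambda>b. F {- pi..a} - F {a} - F {b<..<a}) \<longlongrightarrow> F {- pi..a} - F {a} - 0) (at_left a)"
    by (intro tendsto_intros lim_F)
  moreover have "eventually (\<lambda>b. F {- pi..a} - F {a} - F {b<..<a} = F {- pi..b}) (at_left a)"
  proof (rule eventually_mono[OF near])
    fix b assume b: "b \<in> {c<..<a}"
    have meas: "{- pi..b} \<in> sets freq_borel" "{b<..<a} \<in> sets freq_borel" "{a} \<in> sets freq_borel"
      using b c a' by (auto intro!: freq_borelI)
    have "F ({- pi..b} \<union> ({b<..<a} \<union> {a})) = F {- pi..b} + F ({b<..<a} \<union> {a})"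
      using b by (intro F_additive sets.Un meas) auto
    moreover have "F ({b<..<a} \<union> {a}) = F {b<..<a} + F {a}"
      by (intro F_additive meas) auto
    moreover have "{- pi..b} \<union> ({b<..<a} \<union> {a}) = {- pi..a}"
      using b c by auto
    ultimately have "F {- pi..a} = F {- pi..b} + (F {b<..<a} + F {a})" by simp
    then show "F {- pi..a} - F {a} - F {b<..<a} = F {- pi..b}" by simp
  qed
  ultimately have "((\<lambda>b. F {- pi..b}) \<longlongrightarrow> F {- pi..a} - F {a} - 0) (at_left a)"
    by (rule Lim_transform_eventually)
  then have "Lim (at_left a) (\<lambda>b. F {- pi..b}) = F {- pi..a} - F {a}"
    by (intro tendsto_Lim) auto
  then show ?thesis by (simp add: spectral_jump_def)
qed

lemma atom_pos: "a \<in> W \<Longrightarrow> F {a} \<in> S1_pos"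
  using W(2) by (intro F_S1_pos freq_borelI) auto

lemma atom_eigen: "a \<in> W \<Longrightarrow> eigen_system (F {a}) (\<nu> a) (\<phi> a)"
  using jump_eigen[of a] by (simp add: spectral_jump_eq)

lemma F_finite_quadratic:
  assumes "finite S" "S \<subseteq> {- pi..pi}"
  shows "ennreal (Re (cinner (blinfun_apply (F S) g) g)) = (\<Sum>a\<in>S. ennreal (Re (cinner (blinfun_apply (F {a}) g) g)))"
  using assms
proof (induction S rule: finite_induct)
  case empty
  have "F ({} \<union> {}) = F {} + F {}" by (rule F_additive) auto
  then have "F {} = 0" by simp
  then show ?case by simp
next
  case (insert a S)
  have meas: "{a} \<in> sets freq_borel" "S \<in> sets freq_borel"
    using insert.prems insert.hyps(1) by (auto intro!: freq_borelI finite_imp_closed borel_closed)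
  have "F ({a} \<union> S) = F {a} + F S" using insert.hyps by (intro F_additive meas) auto
  then show ?case
    using insert.IH insert.prems insert.hyps S1_posD(3)[OF F_S1_pos[OF meas(1)]] S1_posD(3)[OF F_S1_pos[OF meas(2)]]
    by (simp add: blinfun.add_left cinner_add_left ennreal_plus)
qed

text \<open>The remaining point \<open>- pi\<close> carries no mass.\<close>

lemma F_decomposition:
  assumes E: "E \<in> sets freq_borel"
  shows "ennreal (Re (cinner (blinfun_apply (F E) g) g))
    = ennreal (Re (cinner (blinfun_apply (F (E \<inter> M)) g) g))
      + (\<Sum>a\<in>E \<inter> W. ennreal (Re (cinner (blinfun_apply (F {a}) g) g)))"
proof -
  note E' = freq_borelD[OF E]
  have fin: "finite (E \<inter> W)" "finite (E \<inter> {- pi})" using W(1) by auto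
  have m: "E \<inter> M \<in> sets freq_borel" "E \<inter> W \<in> sets freq_borel" "E \<inter> {- pi} \<in> sets freq_borel"
    using E' M_borel fin finite_imp_closed[OF fin(1)] finite_imp_closed[OF fin(2)]
    by (auto intro!: freq_borelI intro: sets.Int borel_closed)
  have "F (E \<inter> {- pi}) = 0"
  proof (cases "- pi \<in> E")
    case True
    then show ?thesis using F_left_end by simp
  next
    case False
    have "F ({} \<union> {}) = F {} + F {}" by (rule F_additive) auto
    then show ?thesis using False by simp
  qed
  moreover have "F ((E \<inter> M) \<union> ((E \<inter> W) \<union> (E \<inter> {- pi}))) = F (E \<inter> M) + (F (E \<inter> W) + F (E \<inter> {- pi}))"
  proof -
    have "- pi \<notin> W" using W(2) by auto
    then have "F ((E \<inter> W) \<union> (E \<inter> {- pi})) = F (E \<inter> W) + F (E \<inter> {- pi})"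
      by (intro F_additive m) auto
    moreover have "F ((E \<inter> M) \<union> ((E \<inter> W) \<union> (E \<inter> {- pi}))) = F (E \<inter> M) + F ((E \<inter> W) \<union> (E \<inter> {- pi}))"
      by (intro F_additive m sets.Un) auto
    ultimately show ?thesis by simp
  qed
  moreover have "(E \<inter> M) \<union> ((E \<inter> W) \<union> (E \<inter> {- pi})) = E" using E' W(2) by auto
  ultimately have "F E = F (E \<inter> M) + F (E \<inter> W)" by simp
  then have "Re (cinner (blinfun_apply (F E) g) g)
      = Re (cinner (blinfun_apply (F (E \<inter> M)) g) g) + Re (cinner (blinfun_apply (F (E \<inter> W)) g) g)"
    by (simp add: blinfun.add_left cinner_add_left)
  then show ?thesis
    using S1_posD(3)[OF F_S1_pos[OF m(1)]] S1_posD(3)[OF F_S1_pos[OF m(2)]] fin(1) E'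
    by (subst F_finite_quadratic[symmetric]) (auto simp: ennreal_plus)
qed

text \<open>The model lives on pairs of an index \<open>k\<close> and a frequency \<open>\<omega>\<close>, weighted by the eigenvalues;
  its vector at \<open>(k, \<omega>)\<close> is an eigenvector. Its mixed moments reproduce the quadratic forms of
  \<open>F\<close>. Outside \<open>G \<union> W\<close> everything is set to zero.\<close>

abbreviation "L \<equiv> restrict_space lebesgue {- pi..pi}"

definition base :: "real measure" where
  "base = sum_measure (density L (indicator G)) (distr (count_space W) L (\<lambda>a. a))"

text \<open>Eigenpairs are counted from \<open>1\<close>, the indices of the model from \<open>0\<close>; hence the shift to \<open>Suc k\<close>.\<close>

definition eigval :: "nat \<Rightarrow> real \<Rightarrow> real" where
  "eigval k \<omega> = (if \<omega> \<in> G \<union> W then \<nu> \<omega> (Suc k) else 0)"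

definition eigvec :: "nat \<Rightarrow> real \<Rightarrow> 'h" where
  "eigvec k \<omega> = (if \<omega> \<in> G \<union> W then \<phi> \<omega> (Suc k) else 0)"

lemma eigen_cases:
  assumes "\<omega> \<in> G \<union> W"
  obtains A where "A \<in> S1_pos" "eigen_system A (\<nu> \<omega>) (\<phi> \<omega>)" "\<omega> \<in> G \<Longrightarrow> A = f \<omega>" "\<omega> \<in> W \<Longrightarrow> A = F {\<omega>}"
proof (cases "\<omega> \<in> G")
  case True
  then have "\<omega> \<notin> W" using G(2) by auto
  then show ?thesis using that[of "f \<omega>"] density_pos[OF True] density_eigen[OF True] by simp
next
  case False
  then show ?thesis using that[of "F {\<omega>}"] assms atom_pos[of \<omega>] atom_eigen[of \<omega>] by simp
qed

lemma eigval_nonneg: "0 \<le> eigval k \<omega>"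
proof (cases "\<omega> \<in> G \<union> W")
  case True
  then obtain A where "A \<in> S1_pos" "eigen_system A (\<nu> \<omega>) (\<phi> \<omega>)" by (rule eigen_cases)
  then show ?thesis using True eigen_nonneg[of A "\<nu> \<omega>" "\<phi> \<omega>" k] by (simp add: eigval_def)
qed (simp add: eigval_def eigvec_def ortho_seq_def)

lemma eigval_decreasing:
  assumes "k \<le> m"
  shows "eigval m \<omega> \<le> eigval k \<omega>"
proof (cases "\<omega> \<in> G \<union> W")
  case True
  then obtain A where "A \<in> S1_pos" "eigen_system A (\<nu> \<omega>) (\<phi> \<omega>)" by (rule eigen_cases)
  then show ?thesis using True eigen_decreasing[of A "\<nu> \<omega>" "\<phi> \<omega>", OF _ assms] by (simp add: eigval_def)
qed (simp add: eigval_def)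

lemma eigvec_ortho: "ortho_seq (\<lambda>k. eigvec k \<omega>)"
proof (cases "\<omega> \<in> G \<union> W")
  case True
  then obtain A where "A \<in> S1_pos" "eigen_system A (\<nu> \<omega>) (\<phi> \<omega>)" by (rule eigen_cases)
  then show ?thesis using True eigen_ortho[of A "\<nu> \<omega>" "\<phi> \<omega>"] by (simp add: eigvec_def)
qed (simp add: eigval_def eigvec_def ortho_seq_def)

lemma eigvec_pad:
  assumes "eigvec k \<omega> = 0"
  shows "eigval k \<omega> = 0"
proof (cases "\<omega> \<in> G \<union> W")
  case True
  then obtain A where "A \<in> S1_pos" "eigen_system A (\<nu> \<omega>) (\<phi> \<omega>)" by (rule eigen_cases)
  then show ?thesis using True assms eigen_pad[of A "\<nu> \<omega>" "\<phi> \<omega>" k] by (simp add: eigval_def eigvec_def)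
qed (simp add: eigval_def)

lemma eigval_norm: "eigval k \<omega> * (norm (eigvec k \<omega>))\<^sup>2 = eigval k \<omega>"
proof (cases "\<omega> \<in> G \<union> W")
  case True
  then obtain A where "A \<in> S1_pos" "eigen_system A (\<nu> \<omega>) (\<phi> \<omega>)" by (rule eigen_cases)
  then show ?thesis using True eigen_norm[of A "\<nu> \<omega>" "\<phi> \<omega>" k] by (simp add: eigval_def eigvec_def)
qed (simp add: eigval_def eigvec_def ortho_seq_def)

lemma eigval_summable: "summable (\<lambda>k. eigval k \<omega>)"
proof (cases "\<omega> \<in> G \<union> W")
  case True
  then obtain A where "A \<in> S1_pos" "eigen_system A (\<nu> \<omega>) (\<phi> \<omega>)" by (rule eigen_cases)
  then show ?thesis using True eigen_trace(2)[of A "\<nu> \<omega>" "\<phi> \<omega>"] by (simp add: eigval_def)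
qed (simp add: eigval_def eigvec_def ortho_seq_def)

lemma eigen_quadratic:
  assumes "\<omega> \<in> G \<union> W" "A \<in> S1_pos" "eigen_system A (\<nu> \<omega>) (\<phi> \<omega>)"
  shows "(\<Sum>k. ennreal (eigval k \<omega> * (cmod (cinner (eigvec k \<omega>) g))\<^sup>2)) = ennreal (Re (cinner (blinfun_apply A g) g))"
proof -
  have c: "cmod (cinner (\<phi> \<omega> (Suc k)) g) = cmod (cinner g (\<phi> \<omega> (Suc k)))" for k
    by (subst cinner_commute) simp
  show ?thesis
    using assms(1) eigen_quadratic_sums[OF assms(3), of g] eigval_nonneg[of _ \<omega>]
    by (intro suminf_ennreal_eq) (auto simp: eigval_def eigvec_def c)
qed

lemma G_sub: "G \<subseteq> {- pi..pi}" and W_sub: "W \<subseteq> {- pi..pi}" and GW: "G \<inter> W = {}"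
  using G(2) W(2) by auto

lemma space_L: "space L = {- pi..pi}" by (simp add: space_restrict_space)

lemma measurable_id_L: "(\<lambda>\<omega>. \<omega>) \<in> measurable L freq_borel"
  by (auto simp: measurable_restrict_space2_iff space_L intro!: measurable_restrict_space1 measurable_completion)

lemma measurable_L: "h \<in> measurable freq_borel K \<Longrightarrow> h \<in> measurable L K"
  by (rule measurable_compose[OF measurable_id_L, of h K])

lemma G_L [measurable]: "G \<in> sets L"
  using G(1) G_sub by (simp add: sets_restrict_space_iff)

lemma sets_base [measurable_cong, simp]: "sets base = sets L" and space_base: "space base = {- pi..pi}"
  by (simp_all add: base_def space_restrict_space)

lemma nn_integral_base:
  assumes h [measurable]: "h \<in> borel_measurable L"
  shows "(\<integral>\<^sup>+\<omega>. h \<omega> \<partial>base) = (\<integral>\<^sup>+\<omega>. indicator G \<omega> * h \<omega> \<partial>lebesgue) + (\<Sum>a\<in>W. h a)"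
proof -
  have id: "(\<lambda>a. a) \<in> measurable (count_space W) L"
    using W_sub by (simp add: space_L subset_iff)
  have "(\<integral>\<^sup>+\<omega>. h \<omega> \<partial>base) = (\<integral>\<^sup>+\<omega>. h \<omega> \<partial>density L (indicator G)) + (\<integral>\<^sup>+\<omega>. h \<omega> \<partial>distr (count_space W) L (\<lambda>a. a))"
    unfolding base_def by (rule nn_integral_sum_measure) simp_all
  also have "(\<integral>\<^sup>+\<omega>. h \<omega> \<partial>density L (indicator G)) = (\<integral>\<^sup>+\<omega>. indicator G \<omega> * h \<omega> \<partial>L)"
    by (rule nn_integral_density) measurable
  also have "\<dots> = (\<integral>\<^sup>+\<omega>. indicator G \<omega> * h \<omega> * indicator {- pi..pi} \<omega> \<partial>lebesgue)"
    by (rule nn_integral_restrict_space) simp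
  also have "\<dots> = (\<integral>\<^sup>+\<omega>. indicator G \<omega> * h \<omega> \<partial>lebesgue)"
    using G_sub by (intro nn_integral_cong) (auto simp: indicator_def)
  also have "(\<integral>\<^sup>+\<omega>. h \<omega> \<partial>distr (count_space W) L (\<lambda>a. a)) = (\<integral>\<^sup>+a. h a \<partial>count_space W)"
    by (rule nn_integral_distr[OF id]) simp
  also have "\<dots> = (\<Sum>a\<in>W. h a)"
    using W(1) by (rule nn_integral_count_space_finite)
  finally show ?thesis .
qed

lemma measurable_support_L:
  fixes h :: "real \<Rightarrow> 'b::real_normed_vector"
  assumes h: "(\<lambda>\<omega>. indicat_real G \<omega> *\<^sub>R h \<omega>) \<in> borel_measurable lebesgue"
  shows "(\<lambda>\<omega>. if \<omega> \<in> G \<union> W then h \<omega> else 0) \<in> borel_measurable L"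
proof -
  define s where "s \<omega> = (if \<omega> \<in> W then h \<omega> else indicat_real G \<omega> *\<^sub>R h \<omega>)" for \<omega>
  have "s \<in> borel_measurable lebesgue"
    using countable_finite[OF W(1)]
  proof (rule measurable_discrete_difference[OF h])
    show "{a} \<in> sets lebesgue" for a by simp
  qed (auto simp: s_def)
  then have "s \<in> borel_measurable L" by (rule measurable_restrict_space1)
  moreover have "s = (\<lambda>\<omega>. if \<omega> \<in> G \<union> W then h \<omega> else 0)"
    by (auto simp: s_def fun_eq_iff)
  ultimately show ?thesis by simp
qed

lemma \<phi>_G_measurable: "(\<lambda>\<omega>. indicat_real G \<omega> *\<^sub>R \<phi> \<omega> (Suc k)) \<in> borel_measurable lebesgue"
proof -
  have "M \<inter> space lebesgue \<in> sets lebesgue" using M_borel by simp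
  then have "(\<lambda>\<omega>. if \<omega> \<in> M then \<phi> \<omega> (Suc k) else 0) \<in> borel_measurable lebesgue"
    using \<phi>_measurable[of "Suc k"] measurable_restrict_space_iff[of M lebesgue 0 borel "\<lambda>\<omega>. \<phi> \<omega> (Suc k)"] by simp
  then have "(\<lambda>\<omega>. indicat_real G \<omega> *\<^sub>R (if \<omega> \<in> M then \<phi> \<omega> (Suc k) else 0)) \<in> borel_measurable lebesgue"
    using G(1) by measurable
  also have "(\<lambda>\<omega>. indicat_real G \<omega> *\<^sub>R (if \<omega> \<in> M then \<phi> \<omega> (Suc k) else 0)) = (\<lambda>\<omega>. indicat_real G \<omega> *\<^sub>R \<phi> \<omega> (Suc k))"
    using G(2) by (auto simp: fun_eq_iff indicator_def)
  finally show ?thesis .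
qed

text \<open>The eigenvalues inherit measurability from the density and the eigenvectors by
  \<open>\<nu> = Re (cinner (f \<phi>) \<phi>)\<close>; here \<open>\<phi>\<close> is approximated by simple functions, for which the
  measurability of the quadratic forms of \<open>f\<close> at fixed vectors suffices.\<close>

lemma \<nu>_G_measurable: "(\<lambda>\<omega>. indicat_real G \<omega> *\<^sub>R \<nu> \<omega> (Suc k)) \<in> borel_measurable lebesgue"
proof -
  obtain s where s: "\<And>n::nat. simple_function lebesgue (s n)"
    "\<And>\<omega>. \<omega> \<in> space lebesgue \<Longrightarrow> (\<lambda>n. s n \<omega>) \<longlonglongrightarrow> indicat_real G \<omega> *\<^sub>R \<phi> \<omega> (Suc k)"
    using borel_measurable_implies_sequence_metric[OF \<phi>_G_measurable[of k], of 0] by blast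
  show ?thesis
  proof (rule borel_measurable_LIMSEQ_metric)
    show "(\<lambda>\<omega>. indicat_real G \<omega> * Re (cinner (blinfun_apply (f \<omega>) (s n \<omega>)) (s n \<omega>))) \<in> borel_measurable lebesgue" for n
    proof (rule measurable_compose_countable'[where f="\<lambda>g \<omega>. indicat_real G \<omega> * Re (cinner (blinfun_apply (f \<omega>) g) g)" and I="range (s n)"])
      show "countable (range (s n))"
        using simple_functionD(1)[OF s(1)[of n]] by (simp add: countable_finite)
      have "s n -` {c} \<in> sets lebesgue" for c
        using simple_functionD(2)[OF s(1)[of n], of "{c}"] by simp
      then show "s n \<in> measurable lebesgue (count_space (range (s n)))"
        using simple_functionD(1)[OF s(1)[of n]] by (subst measurable_count_space_eq2) auto
    qed (rule density_quadratic_measurable)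
    fix \<omega> :: real
    have eq: "indicat_real G \<omega> *\<^sub>R \<nu> \<omega> (Suc k)
        = indicat_real G \<omega> * Re (cinner (blinfun_apply (f \<omega>) (indicat_real G \<omega> *\<^sub>R \<phi> \<omega> (Suc k))) (indicat_real G \<omega> *\<^sub>R \<phi> \<omega> (Suc k)))"
    proof (cases "\<omega> \<in> G")
      case True
      then show ?thesis using eigen_value[OF density_eigen[OF True], of k] by simp
    qed simp
    show "(\<lambda>n. indicat_real G \<omega> * Re (cinner (blinfun_apply (f \<omega>) (s n \<omega>)) (s n \<omega>)))
        \<longlonglongrightarrow> indicat_real G \<omega> *\<^sub>R \<nu> \<omega> (Suc k)"
      unfolding eq
      by (intro tendsto_mult tendsto_const tendsto_Re cinner.tendsto blinfun.tendsto s(2)) simp_all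
  qed
qed

lemma eigvec_measurable [measurable]: "eigvec k \<in> borel_measurable L"
  unfolding eigvec_def[abs_def] by (rule measurable_support_L[OF \<phi>_G_measurable])

lemma eigval_measurable [measurable]: "eigval k \<in> borel_measurable L"
  unfolding eigval_def[abs_def] by (rule measurable_support_L[OF \<nu>_G_measurable])

lemma nn_integral_base_eigval:
  "(\<integral>\<^sup>+\<omega>. (\<Sum>k. ennreal (eigval k \<omega>)) \<partial>base) < \<infinity>"
proof -
  have "(\<integral>\<^sup>+\<omega>. (\<Sum>k. ennreal (eigval k \<omega>)) \<partial>base)
    = (\<integral>\<^sup>+\<omega>. indicator G \<omega> * (\<Sum>k. ennreal (eigval k \<omega>)) \<partial>lebesgue) + (\<Sum>a\<in>W. \<Sum>k. ennreal (eigval k a))"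
    by (rule nn_integral_base) measurable
  also have "(\<integral>\<^sup>+\<omega>. indicator G \<omega> * (\<Sum>k. ennreal (eigval k \<omega>)) \<partial>lebesgue) = ennreal (Re (tr (F M)))"
    unfolding F_density_trace[OF M_borel order_refl]
    using G(2) by (intro nn_integral_cong) (auto simp: indicator_def eigval_def)
  also have "(\<Sum>a\<in>W. \<Sum>k. ennreal (eigval k a)) = (\<Sum>a\<in>W. ennreal (Re (tr (F {a}))))"
    by (intro sum.cong refl) (simp add: eigval_def eigen_trace(1)[OF atom_pos atom_eigen])
  also have "\<dots> = ennreal (\<Sum>a\<in>W. Re (tr (F {a})))"
    by (rule sum_ennreal) (rule tr_sums(3)[OF atom_pos])
  finally show ?thesis by simp
qed

lemma finite_base: "finite_measure base"
proof (rule finite_measureI)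
  have "emeasure base (space base) = (\<integral>\<^sup>+\<omega>. 1 \<partial>base)" by simp
  also have "\<dots> = (\<integral>\<^sup>+\<omega>. indicator G \<omega> * 1 \<partial>lebesgue) + (\<Sum>a\<in>W. 1)"
    by (rule nn_integral_base) simp
  also have "(\<integral>\<^sup>+\<omega>. indicator G \<omega> * 1 \<partial>lebesgue) = emeasure lebesgue G" using G(1) by simp
  also have "emeasure lebesgue G \<le> emeasure lebesgue {- pi..pi}"
    using G_sub by (intro emeasure_mono) auto
  then have "emeasure lebesgue G + (\<Sum>a\<in>W. 1) < \<infinity>"
    by (simp add: less_top[symmetric] top_unique)
      (metis emeasure_lborel_Icc_eq ennreal_neq_top top.extremum_unique)
  finally show "emeasure base (space base) \<noteq> \<infinity>" by simp
qed

definition model_measure :: "(nat \<times> real) measure" where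
  "model_measure = density (count_space UNIV \<Otimes>\<^sub>M base) (\<lambda>(k, \<omega>). ennreal (eigval k \<omega>))"

definition model_vector :: "nat \<times> real \<Rightarrow> 'h" where
  "model_vector = (\<lambda>(k, \<omega>). eigvec k \<omega>)"

lemma model_measurableI:
  fixes h :: "nat \<times> real \<Rightarrow> 'b"
  assumes "\<And>k. (\<lambda>\<omega>. h (k, \<omega>)) \<in> measurable L N"
  shows "h \<in> measurable (count_space UNIV \<Otimes>\<^sub>M base) N"
  using assms by (intro measurable_pair_measure_countable1) (simp_all cong: measurable_cong_sets)

lemma sets_model [measurable_cong, simp]: "sets model_measure = sets (count_space UNIV \<Otimes>\<^sub>M base)"
  by (simp add: model_measure_def)

lemma space_model: "space model_measure = UNIV \<times> {- pi..pi}"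
  by (simp add: model_measure_def space_pair_measure space_base)

lemma nn_integral_model:
  assumes h: "h \<in> borel_measurable model_measure"
  shows "(\<integral>\<^sup>+x. h x \<partial>model_measure) = (\<integral>\<^sup>+\<omega>. (\<Sum>k. ennreal (eigval k \<omega>) * h (k, \<omega>)) \<partial>base)"
proof -
  interpret base: finite_measure base by (rule finite_base)
  have [measurable]: "(\<lambda>x. ennreal (eigval (fst x) (snd x))) \<in> borel_measurable (count_space UNIV \<Otimes>\<^sub>M base)"
    by (rule model_measurableI) simp
  have h' [measurable]: "h \<in> borel_measurable (count_space UNIV \<Otimes>\<^sub>M base)"
    using h by (simp cong: measurable_cong_sets)
  have "(\<integral>\<^sup>+x. h x \<partial>model_measure) = (\<integral>\<^sup>+x. ennreal (eigval (fst x) (snd x)) * h x \<partial>(count_space UNIV \<Otimes>\<^sub>M base))"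
    unfolding model_measure_def case_prod_beta by (rule nn_integral_density) measurable
  also have "\<dots> = (\<integral>\<^sup>+k. \<integral>\<^sup>+\<omega>. ennreal (eigval k \<omega>) * h (k, \<omega>) \<partial>base \<partial>count_space UNIV)"
    by (subst base.nn_integral_fst[symmetric]) simp_all
  also have "\<dots> = (\<Sum>k. \<integral>\<^sup>+\<omega>. ennreal (eigval k \<omega>) * h (k, \<omega>) \<partial>base)"
    by (rule nn_integral_count_space_nat)
  also have "\<dots> = (\<integral>\<^sup>+\<omega>. (\<Sum>k. ennreal (eigval k \<omega>) * h (k, \<omega>)) \<partial>base)"
    by (rule nn_integral_suminf[symmetric]) measurable
  finally show ?thesis .
qed

lemma model_vector_measurable: "model_vector \<in> borel_measurable model_measure"
proof -
  have "model_vector \<in> borel_measurable (count_space UNIV \<Otimes>\<^sub>M base)"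
    by (rule model_measurableI) (simp add: model_vector_def)
  then show ?thesis by (simp cong: measurable_cong_sets)
qed

lemma snd_model_measurable: "snd \<in> measurable model_measure freq_borel"
proof -
  have "snd \<in> measurable (count_space (UNIV :: nat set) \<Otimes>\<^sub>M base) freq_borel"
    by (intro model_measurableI) (simp add: measurable_id_L)
  then show ?thesis by (simp cong: measurable_cong_sets)
qed

lemma model_vector_L2: "model_vector \<in> L2 model_measure"
proof -
  note [measurable] = model_vector_measurable
  have "(\<integral>\<^sup>+x. ennreal ((norm (model_vector x))\<^sup>2) \<partial>model_measure)
      = (\<integral>\<^sup>+\<omega>. (\<Sum>k. ennreal (eigval k \<omega>) * ennreal ((norm (model_vector (k, \<omega>)))\<^sup>2)) \<partial>base)"
    by (rule nn_integral_model) measurable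
  also have "\<dots> = (\<integral>\<^sup>+\<omega>. (\<Sum>k. ennreal (eigval k \<omega>)) \<partial>base)"
    by (simp add: ennreal_mult[symmetric] eigval_nonneg model_vector_def eigval_norm)
  finally show ?thesis
    using nn_integral_base_eigval by (simp add: L2_iff_nn_integral)
qed

lemma model_quadratic:
  assumes E: "E \<in> sets freq_borel"
  shows "cinner (blinfun_apply (F E) g) g
    = complex_of_real (\<integral>x. indicat_real E (snd x) * (cmod (cinner (model_vector x) g))\<^sup>2 \<partial>model_measure)"
proof -
  note [measurable] = model_vector_measurable snd_model_measurable E
  note E' = freq_borelD[OF E]
  \<comment> \<open>The integral splits along \<open>base\<close>: at frequencies of \<open>G\<close> the eigendecomposition of \<open>f \<omega>\<close> applies, at those of \<open>W\<close> the one of \<open>F {a}\<close>.\<close>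
  have E_L [measurable]: "E \<in> sets L" using E' by (simp add: sets_restrict_space_iff)
  let ?s = "\<lambda>\<omega>. \<Sum>k. ennreal (eigval k \<omega> * (cmod (cinner (eigvec k \<omega>) g))\<^sup>2)"
  have "(\<integral>\<^sup>+x. ennreal (indicat_real E (snd x) * (cmod (cinner (model_vector x) g))\<^sup>2) \<partial>model_measure)
      = (\<integral>\<^sup>+\<omega>. (\<Sum>k. ennreal (eigval k \<omega>) * ennreal (indicat_real E \<omega> * (cmod (cinner (eigvec k \<omega>) g))\<^sup>2)) \<partial>base)"
    by (subst nn_integral_model) (auto simp: model_vector_def)
  also have "\<dots> = (\<integral>\<^sup>+\<omega>. indicator E \<omega> * ?s \<omega> \<partial>base)"
    by (intro nn_integral_cong) (auto simp: indicator_def ennreal_mult eigval_nonneg)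
  also have "\<dots> = (\<integral>\<^sup>+\<omega>. indicator G \<omega> * (indicator E \<omega> * ?s \<omega>) \<partial>lebesgue) + (\<Sum>a\<in>W. indicator E a * ?s a)"
    by (rule nn_integral_base) measurable
  also have "(\<integral>\<^sup>+\<omega>. indicator G \<omega> * (indicator E \<omega> * ?s \<omega>) \<partial>lebesgue)
      = ennreal (Re (cinner (blinfun_apply (F (E \<inter> M)) g) g))"
  proof -
    have "E \<inter> M \<in> sets borel" using E' M_borel by blast
    moreover have "E \<inter> M \<subseteq> M" by blast
    ultimately have "ennreal (Re (cinner (blinfun_apply (F (E \<inter> M)) g) g))
        = (\<integral>\<^sup>+\<omega>. indicator (E \<inter> M) \<omega> * ennreal (indicat_real G \<omega> * Re (cinner (blinfun_apply (f \<omega>) g) g)) \<partial>lebesgue)"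
      by (rule F_density_quadratic)
    also have "\<dots> = (\<integral>\<^sup>+\<omega>. indicator G \<omega> * (indicator E \<omega> * ?s \<omega>) \<partial>lebesgue)"
    proof (rule nn_integral_cong)
      fix \<omega>
      show "indicator (E \<inter> M) \<omega> * ennreal (indicat_real G \<omega> * Re (cinner (blinfun_apply (f \<omega>) g) g))
          = indicator G \<omega> * (indicator E \<omega> * ?s \<omega>)"
      proof (cases "\<omega> \<in> G")
        case True
        then show ?thesis
          using G(2) eigen_quadratic[OF _ density_pos[OF True] density_eigen[OF True], of g]
          by (auto simp: indicator_def)
      qed simp
    qed
    finally show ?thesis by simp
  qed
  also have "(\<Sum>a\<in>W. indicator E a * ?s a) = (\<Sum>a\<in>W. if a \<in> E then ennreal (Re (cinner (blinfun_apply (F {a}) g) g)) else 0)"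
    by (intro sum.cong refl) (simp add: indicator_def eigen_quadratic[OF _ atom_pos atom_eigen])
  also have "\<dots> = (\<Sum>a\<in>E \<inter> W. ennreal (Re (cinner (blinfun_apply (F {a}) g) g)))"
    using W(1) by (simp add: sum.inter_restrict[symmetric] Int_commute)
  also have "ennreal (Re (cinner (blinfun_apply (F (E \<inter> M)) g) g)) + \<dots> = ennreal (Re (cinner (blinfun_apply (F E) g) g))"
    by (rule F_decomposition[OF E, symmetric])
  finally have "(\<integral>x. indicat_real E (snd x) * (cmod (cinner (model_vector x) g))\<^sup>2 \<partial>model_measure)
      = Re (cinner (blinfun_apply (F E) g) g)"
    by (subst integral_eq_nn_integral) (auto simp: S1_posD(3)[OF F_S1_pos[OF E]])
  then show ?thesis using S1_posD(2)[OF F_S1_pos[OF E], of g] by simp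
qed

sublocale spectral_model P X F Z model_measure snd model_vector
  by unfold_locales
    (fact stationary spectral increments snd_model_measurable model_vector_L2 model_quadratic)+

end

section \<open>Truncated projections as integrands\<close>

text \<open>A right continuous function with values in the discrete space of natural numbers is the limit
  of its values at the next point to the right in a grid of mesh \<open>1 / n\<close>.\<close>

lemma cadlag_nat_measurable:
  fixes p :: "real \<Rightarrow> nat"
  assumes "cadlag_on (- pi) pi p"
  shows "p \<in> measurable freq_borel (count_space UNIV)"
proof -
  \<comment> \<open>The grid point is strictly to the right of \<open>\<omega>\<close>; the minimum keeps it in the domain and gives \<open>pi\<close> at \<open>\<omega> = pi\<close>.\<close>
  define t where "t n \<omega> = min pi ((of_int \<lfloor>real (Suc n) * \<omega>\<rfloor> + 1) / real (Suc n))" for n \<omega>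
  have "(\<lambda>\<omega>. real (p \<omega>)) \<in> borel_measurable freq_borel"
  proof (rule borel_measurable_LIMSEQ_metric)
    show "(\<lambda>\<omega>. real (p (t n \<omega>))) \<in> borel_measurable freq_borel" for n
    proof -
      have "(\<lambda>\<omega>. \<lfloor>real (Suc n) * \<omega>\<rfloor>) \<in> measurable freq_borel (count_space UNIV)"
        by (intro measurable_restrict_space1) measurable
      then show ?thesis
        unfolding t_def
        by (rule measurable_compose[where g="\<lambda>i. real (p (min pi ((of_int i + 1) / real (Suc n))))"]) simp
    qed
    fix \<omega> assume "\<omega> \<in> space freq_borel"
    then have \<omega>: "- pi \<le> \<omega>" "\<omega> \<le> pi" by (auto simp: space_restrict_space)
    have "eventually (\<lambda>n. p (t n \<omega>) = p \<omega>) sequentially"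
    proof (cases "\<omega> = pi")
      case True
      have "t n pi = pi" for n
      proof -
        have "real (Suc n) * pi < of_int \<lfloor>real (Suc n) * pi\<rfloor> + 1" by linarith
        then have "pi < (of_int \<lfloor>real (Suc n) * pi\<rfloor> + 1) / real (Suc n)" by (simp add: field_simps)
        then show ?thesis by (simp add: t_def)
      qed
      then show ?thesis using True by simp
    next
      case False
      then have "\<omega> < pi" using \<omega> by simp
      have gt: "\<omega> < t n \<omega>" for n
      proof -
        have "real (Suc n) * \<omega> < of_int \<lfloor>real (Suc n) * \<omega>\<rfloor> + 1" by linarith
        then have "\<omega> < (of_int \<lfloor>real (Suc n) * \<omega>\<rfloor> + 1) / real (Suc n)" by (simp add: field_simps)
        then show ?thesis using \<open>\<omega> < pi\<close> by (simp add: t_def)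
      qed
      have le: "t n \<omega> \<le> \<omega> + 1 / real (Suc n)" for n
      proof -
        have "(of_int \<lfloor>real (Suc n) * \<omega>\<rfloor> + 1) / real (Suc n) \<le> (real (Suc n) * \<omega> + 1) / real (Suc n)"
          by (intro divide_right_mono) (linarith, simp)
        also have "\<dots> = \<omega> + 1 / real (Suc n)" by (simp add: add_divide_distrib del: of_nat_Suc)
        finally show ?thesis unfolding t_def by linarith
      qed
      have "(\<lambda>n. \<omega> + 1 / real (Suc n)) \<longlonglongrightarrow> \<omega> + 0"
        using LIMSEQ_inverse_real_of_nat by (intro tendsto_intros) (simp add: inverse_eq_divide)
      then have "(\<lambda>n. t n \<omega>) \<longlonglongrightarrow> \<omega>"
        by (intro tendsto_sandwich[of "\<lambda>_. \<omega>" "\<lambda>n. t n \<omega>" _ "\<lambda>n. \<omega> + 1 / real (Suc n)"])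
          (auto intro!: always_eventually gt[THEN less_imp_le] le simp del: of_nat_Suc)
      then have "filterlim (\<lambda>n. t n \<omega>) (at_right \<omega>) sequentially"
        using gt by (simp add: filterlim_at always_eventually less_imp_neq[THEN not_sym])
      moreover have "(p \<longlongrightarrow> p \<omega>) (at_right \<omega>)"
        using assms \<omega> \<open>\<omega> < pi\<close> unfolding cadlag_on_def by simp
      ultimately have "(\<lambda>n. p (t n \<omega>)) \<longlonglongrightarrow> p \<omega>" by (rule filterlim_compose[rotated])
      then show ?thesis by (simp add: tendsto_discrete)
    qed
    then have "eventually (\<lambda>n. real (p (t n \<omega>)) = real (p \<omega>)) sequentially"
      by eventually_elim simp
    then show "(\<lambda>n. real (p (t n \<omega>))) \<longlonglongrightarrow> real (p \<omega>)" by (rule tendsto_eventually)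
  qed
  then have [measurable]: "(\<lambda>\<omega>. real (p \<omega>)) \<in> borel_measurable freq_borel" .
  have "p -` {n} \<inter> space freq_borel \<in> sets freq_borel" for n
  proof -
    have "{\<omega> \<in> space freq_borel. real (p \<omega>) = real n} \<in> sets freq_borel" by measurable
    moreover have "{\<omega> \<in> space freq_borel. real (p \<omega>) = real n} = p -` {n} \<inter> space freq_borel" by auto
    ultimately show ?thesis by simp
  qed
  then show ?thesis by (simp add: measurable_count_space_eq2_countable)
qed

lemma bounded_bilinear_outer:
  "bounded_bilinear (outer :: 'h::complex_hilbert_space \<Rightarrow> 'h \<Rightarrow> _)"
proof
  show "outer (a + a') b = outer a b + outer a' b" "outer a (b + b') = outer a b + outer a b'"
    "outer (r *\<^sub>R a) b = r *\<^sub>R outer a b" "outer a (r *\<^sub>R b) = r *\<^sub>R outer a b" for a a' b b' :: 'h and r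
    by (rule blinfun_eqI; simp add: blinfun_outer blinfun.add_left blinfun.scaleR_left scaleC_add_left
        scaleC_add_right cinner_add_right scaleC.scaleR_right cinner_scaleR_right scaleC.scaleR_left)+
  show "\<exists>K. \<forall>a b :: 'h. norm (outer a b) \<le> norm a * norm b * K"
  proof (intro exI[of _ 1] allI)
    fix a b :: 'h
    have "norm (outer a b) \<le> norm a * norm b"
    proof (rule norm_blinfun_bound)
      show "norm (blinfun_apply (outer a b) x) \<le> norm a * norm b * norm x" for x
        using mult_right_mono[OF cmod_cinner_le[of x b] norm_ge_zero[of a]]
        by (simp add: blinfun_outer norm_scaleC ac_simps)
    qed simp
    then show "norm (outer a b) \<le> norm a * norm b * 1" by simp
  qed
qed

lemma simple_function_lebesgue_AE_borel:
  fixes g :: "real \<Rightarrow> 'b::real_normed_vector"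
  assumes "simple_function (restrict_space lebesgue {- pi..pi}) g"
  shows "\<exists>g'. simple_function freq_borel g' \<and> (AE \<omega> in lebesgue. \<omega> \<in> {- pi..pi} \<longrightarrow> g \<omega> = g' \<omega>)"
proof -
  have "simple_function lebesgue (\<lambda>\<omega>. indicat_real {- pi..pi} \<omega> *\<^sub>R g \<omega>)"
    using assms by (subst (asm) simple_function_restrict_space) simp_all
  then obtain h where h: "simple_function lborel h"
    "AE \<omega> in lborel. indicat_real {- pi..pi} \<omega> *\<^sub>R g \<omega> = h \<omega>"
    using completion_ex_simple_function by blast
  have "simple_function borel h" using h(1) by (simp add: simple_function_def)
  then have "simple_function freq_borel h"
    by (subst simple_function_restrict_space)
      (auto intro!: simple_function_compose2[where h="(*\<^sub>R)"] simple_function_indicator)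
  moreover have "AE \<omega> in lebesgue. \<omega> \<in> {- pi..pi} \<longrightarrow> g \<omega> = h \<omega>"
    using AE_completion[OF h(2)] by eventually_elim auto
  ultimately show ?thesis by blast
qed

context spectral_decomposition
begin

lemma emeasure_\<mu>: "E \<in> sets freq_borel \<Longrightarrow> emeasure \<mu> E = ennreal (Re (tr (F E)))"
  by (simp add: trace_measure_eq emeasure_distr_density_q tr_F_nn_integral)

text \<open>On the continuity part \<open>\<mu>\<close> has a density with respect to Lebesgue measure, and \<open>- pi\<close> carries no mass.\<close>

lemma AE_\<mu>I:
  assumes leb: "AE \<omega> in lebesgue. \<omega> \<in> M \<longrightarrow> Q \<omega>" and atoms: "\<And>a. a \<in> W \<Longrightarrow> Q a"
  shows "AE \<omega> in \<mu>. Q \<omega>"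
proof -
  have "AE \<omega> in lborel. \<omega> \<in> M \<longrightarrow> Q \<omega>" using leb by (simp add: AE_completion_iff)
  then obtain B where B: "{\<omega> \<in> space lborel. \<not> (\<omega> \<in> M \<longrightarrow> Q \<omega>)} \<subseteq> B" "emeasure lborel B = 0" "B \<in> sets lborel"
    by (rule AE_E)
  have BM: "B \<inter> M \<in> sets borel" using B(3) M_borel by auto
  have BM': "B \<inter> M \<in> sets freq_borel" using BM by (intro freq_borelI) auto
  have "B \<in> null_sets lebesgue" using B(2,3) by (intro null_sets_completionI) auto
  then have notin: "AE \<omega> in lebesgue. \<omega> \<notin> B" by (rule AE_not_in)
  have "emeasure \<mu> (B \<inter> M) = (\<integral>\<^sup>+\<omega>. indicator (B \<inter> M) \<omega> * (indicator G \<omega> * (\<Sum>k. ennreal (\<nu> \<omega> (Suc k)))) \<partial>lebesgue)"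
    using BM by (simp add: emeasure_\<mu>[OF BM'] F_density_trace)
  also have "\<dots> = (\<integral>\<^sup>+(\<omega>::real). 0 \<partial>lebesgue)"
  proof (rule nn_integral_cong_AE)
    show "AE \<omega> in lebesgue. indicator (B \<inter> M) \<omega> * (indicator G \<omega> * (\<Sum>k. ennreal (\<nu> \<omega> (Suc k)))) = 0"
      using notin by eventually_elim simp
  qed
  finally have "emeasure \<mu> (B \<inter> M) = 0" by simp
  then have "AE \<omega> in \<mu>. \<omega> \<notin> B \<inter> M"
    using BM' by (intro AE_not_in null_setsI) auto
  moreover have "AE \<omega> in \<mu>. \<omega> \<noteq> - pi"
    by (rule AE_left_end[OF sets_\<mu> finite_\<mu> emeasure_\<mu>_left_end])
  moreover have "AE \<omega> in \<mu>. \<omega> \<in> {- pi..pi}" by (rule AE_I2) (simp add: space_\<mu>)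
  ultimately show ?thesis
  proof eventually_elim
    case (elim \<omega>)
    show ?case
    proof (rule ccontr)
      assume "\<not> Q \<omega>"
      then have "\<omega> \<in> M" using elim atoms by auto
      then have "\<omega> \<in> B" using \<open>\<not> Q \<omega>\<close> by (intro subsetD[OF B(1)]) simp
      then show False using elim(1) \<open>\<omega> \<in> M\<close> by blast
    qed
  qed
qed

text \<open>The density of \<open>\<mu>\<close> with respect to \<open>base\<close> is the sum of the eigenvalues.\<close>

lemma AE_base:
  assumes "AE \<omega> in \<mu>. Q \<omega>"
  shows "AE \<omega> in base. (\<forall>k. eigval k \<omega> = 0) \<or> Q \<omega>"
proof -
  obtain B where B: "{\<omega> \<in> space \<mu>. \<not> Q \<omega>} \<subseteq> B" "emeasure \<mu> B = 0" "B \<in> sets \<mu>"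
    using assms by (rule AE_E)
  have [measurable]: "B \<in> sets freq_borel" using B(3) by simp
  have [measurable]: "B \<in> sets L" using freq_borelD[of B] B(3) by (simp add: sets_restrict_space_iff)
  note [measurable] = snd_model_measurable model_vector_measurable
  have "0 = (\<integral>\<^sup>+x. indicator B (snd x) * ennreal ((norm (model_vector x))\<^sup>2) \<partial>model_measure)"
    using B(2) by (simp add: trace_measure_eq emeasure_distr_density_q)
  also have "\<dots> = (\<integral>\<^sup>+\<omega>. (\<Sum>k. ennreal (eigval k \<omega>) * (indicator B \<omega> * ennreal ((norm (eigvec k \<omega>))\<^sup>2))) \<partial>base)"
    by (subst nn_integral_model) (auto simp: model_vector_def)
  also have "\<dots> = (\<integral>\<^sup>+\<omega>. indicator B \<omega> * (\<Sum>k. ennreal (eigval k \<omega>)) \<partial>base)"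
    by (intro nn_integral_cong) (auto simp: indicator_def ennreal_mult[symmetric] eigval_nonneg eigval_norm)
  finally have "AE \<omega> in base. indicator B \<omega> * (\<Sum>k. ennreal (eigval k \<omega>)) = 0"
    by (subst (asm) eq_commute, subst (asm) nn_integral_0_iff_AE) auto
  then show ?thesis
  proof (rule AE_mp, intro AE_I2 impI)
    fix \<omega> assume \<omega>: "\<omega> \<in> space base" "indicator B \<omega> * (\<Sum>k. ennreal (eigval k \<omega>)) = 0"
    show "(\<forall>k. eigval k \<omega> = 0) \<or> Q \<omega>"
    proof (cases "\<omega> \<in> B")
      case True
      then have 0: "(\<Sum>k. ennreal (eigval k \<omega>)) = 0" using \<omega>(2) by simp
      have "eigval k \<omega> = 0" for k
      proof -
        have "ennreal (eigval k \<omega>) \<le> (\<Sum>k. ennreal (eigval k \<omega>))"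
          using sum_le_suminf[of "\<lambda>k. ennreal (eigval k \<omega>)" "{k}"] by simp
        then show ?thesis using eigval_nonneg[of k \<omega>] unfolding 0 by (simp add: ennreal_eq_0_iff)
      qed
      then show ?thesis by simp
    next
      case False
      then show ?thesis using B(1) \<omega>(1) by (auto simp: space_\<mu> space_base)
    qed
  qed
qed

text \<open>The eigenvectors are only Lebesgue measurable, whereas the Bochner space asks for Borel simple
  functions. On \<open>G\<close> the simple functions are corrected on Lebesgue null sets, which are \<open>\<mu>\<close>-null in the
  continuity part; at the finitely many atoms the values are prescribed. Cutting the number of terms off
  at \<open>n\<close> makes each approximation a finite sum.\<close>

lemma truncation_B_inf:
  assumes p: "p \<in> measurable freq_borel (count_space UNIV)"
  shows "(\<lambda>\<omega>. truncated_projection (p \<omega>) (\<phi> \<omega>)) \<in> B_inf \<mu>"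
proof -
  let ?T = "\<lambda>\<omega>. truncated_projection (p \<omega>) (\<phi> \<omega>)"
  have p_L [measurable]: "p \<in> measurable L (count_space UNIV)" using p by (rule measurable_L)
  have "\<forall>k. \<exists>s. (\<forall>n::nat. simple_function L (s n)) \<and> (\<forall>\<omega>\<in>{- pi..pi}. (\<lambda>n. s n \<omega>) \<longlonglongrightarrow> eigvec k \<omega>)"
  proof
    fix k
    obtain s where "\<And>n::nat. simple_function L (s n)" "\<And>\<omega>. \<omega> \<in> space L \<Longrightarrow> (\<lambda>n. s n \<omega>) \<longlonglongrightarrow> eigvec k \<omega>"
      using borel_measurable_implies_sequence_metric[OF eigvec_measurable[of k], of 0] by blast
    then show "\<exists>s. (\<forall>n::nat. simple_function L (s n)) \<and> (\<forall>\<omega>\<in>{- pi..pi}. (\<lambda>n. s n \<omega>) \<longlonglongrightarrow> eigvec k \<omega>)"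
      unfolding space_L by blast
  qed
  then obtain s where s: "\<And>k n::nat. simple_function L (s k n)"
    "\<And>k \<omega>. \<omega> \<in> {- pi..pi} \<Longrightarrow> (\<lambda>n. s k n \<omega>) \<longlonglongrightarrow> eigvec k \<omega>" by metis
  \<comment> \<open>The condition \<open>k < p \<omega>\<close> replaces a summation range that depends on \<open>\<omega>\<close>.\<close>
  define A where "A n \<omega> = (\<Sum>k<n. if k < p \<omega> then outer (s k n \<omega>) (s k n \<omega>) else 0)" for n \<omega>
  have A: "simple_function L (A n)" for n
    unfolding A_def[abs_def]
  proof (intro simple_function_sum simple_function_If)
    show "simple_function L (\<lambda>\<omega>. outer (s k n \<omega>) (s k n \<omega>))" for k
      by (rule simple_function_compose1[OF s(1)])
    show "{\<omega> \<in> space L. k < p \<omega>} \<in> sets L" for k by measurable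
  qed simp
  have lim: "(\<lambda>n. A n \<omega>) \<longlonglongrightarrow> ?T \<omega>" if \<omega>: "\<omega> \<in> G \<union> W" for \<omega>
  proof (rule Lim_transform_eventually)
    have "\<omega> \<in> {- pi..pi}" using \<omega> G_sub W_sub by auto
    then have "(\<lambda>n. \<Sum>k<p \<omega>. outer (s k n \<omega>) (s k n \<omega>)) \<longlonglongrightarrow> (\<Sum>k<p \<omega>. outer (eigvec k \<omega>) (eigvec k \<omega>))"
      by (intro tendsto_sum bounded_bilinear.tendsto[OF bounded_bilinear_outer] s(2))
    also have "(\<Sum>k<p \<omega>. outer (eigvec k \<omega>) (eigvec k \<omega>)) = ?T \<omega>"
      unfolding truncated_projection_def using \<omega>
      by (intro sum.reindex_bij_witness[of _ "\<lambda>k. k - 1" Suc]) (auto simp: eigvec_def)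
    finally show "(\<lambda>n. \<Sum>k<p \<omega>. outer (s k n \<omega>) (s k n \<omega>)) \<longlonglongrightarrow> ?T \<omega>" .
    have "(\<Sum>k<p \<omega>. outer (s k n \<omega>) (s k n \<omega>)) = A n \<omega>" if "p \<omega> \<le> n" for n
      unfolding A_def using that by (intro sum.mono_neutral_cong_left) auto
    then show "eventually (\<lambda>n. (\<Sum>k<p \<omega>. outer (s k n \<omega>) (s k n \<omega>)) = A n \<omega>) sequentially"
      by (intro eventually_sequentiallyI)
  qed
  have "\<forall>n. \<exists>g. simple_function freq_borel g \<and> (AE \<omega> in lebesgue. \<omega> \<in> {- pi..pi} \<longrightarrow> A n \<omega> = g \<omega>)"
    using simple_function_lebesgue_AE_borel[OF A] by blast
  then obtain g where g: "\<And>n. simple_function freq_borel (g n)"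
    "\<And>n. AE \<omega> in lebesgue. \<omega> \<in> {- pi..pi} \<longrightarrow> A n \<omega> = g n \<omega>" by metis
  have W_meas: "W \<in> sets freq_borel"
    using W_sub finite_imp_closed[OF W(1)] by (intro freq_borelI borel_closed)
  \<comment> \<open>The values at the atoms, written as a simple function.\<close>
  let ?a = "\<lambda>\<omega>. \<Sum>a\<in>W. indicat_real {a} \<omega> *\<^sub>R ?T a"
  have a: "?a \<omega> = ?T \<omega>" if "\<omega> \<in> W" for \<omega>
  proof -
    have "?a \<omega> = (\<Sum>a\<in>W. if a = \<omega> then ?T \<omega> else 0)" by (intro sum.cong) (auto simp: indicator_def)
    then show ?thesis using that W(1) by (simp add: sum.delta)
  qed
  have "strongly_measurable \<mu> ?T"
    unfolding strongly_measurable_def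
  proof (intro exI[of _ "\<lambda>n \<omega>. if \<omega> \<in> W then ?a \<omega> else g n \<omega>"] conjI allI)
    fix n
    have "simple_function freq_borel (\<lambda>\<omega>. if \<omega> \<in> W then ?a \<omega> else g n \<omega>)"
    proof (intro simple_function_If_set simple_function_sum g)
      show "simple_function freq_borel (\<lambda>\<omega>. indicat_real {a} \<omega> *\<^sub>R ?T a)" for a
        by (rule simple_function_indicator_scaleR) simp
    qed (use W_meas W_sub in \<open>simp add: space_restrict_space Int_absorb2\<close>)
    then show "simple_function \<mu> (\<lambda>\<omega>. if \<omega> \<in> W then ?a \<omega> else g n \<omega>)"
      by (simp add: simple_function_def space_\<mu> space_freq_borel)
  next
    show "AE \<omega> in \<mu>. (\<lambda>n. if \<omega> \<in> W then ?a \<omega> else g n \<omega>) \<longlonglongrightarrow> ?T \<omega>"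
    proof (rule AE_\<mu>I)
      have "AE \<omega> in lebesgue. \<forall>n. \<omega> \<in> {- pi..pi} \<longrightarrow> A n \<omega> = g n \<omega>"
        unfolding AE_all_countable using g(2) by blast
      then show "AE \<omega> in lebesgue. \<omega> \<in> M \<longrightarrow> (\<lambda>n. if \<omega> \<in> W then ?a \<omega> else g n \<omega>) \<longlonglongrightarrow> ?T \<omega>"
        using AE_G
      proof eventually_elim
        case (elim \<omega>)
        show ?case
        proof
          assume "\<omega> \<in> M"
          then have "\<omega> \<in> G" "\<omega> \<notin> W" "\<omega> \<in> {- pi..pi}" using elim(2) by auto
          then have "(\<lambda>n. if \<omega> \<in> W then ?a \<omega> else g n \<omega>) = (\<lambda>n. A n \<omega>)" using elim(1) by auto
          then show "(\<lambda>n. if \<omega> \<in> W then ?a \<omega> else g n \<omega>) \<longlonglongrightarrow> ?T \<omega>"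
            using lim[of \<omega>] \<open>\<omega> \<in> G\<close> by simp
        qed
      qed
    qed (simp add: a)
  qed
  moreover have "B_inf_norm2 \<mu> ?T < \<infinity>"
  proof -
    have "AE \<omega> in \<mu>. \<omega> \<in> G \<union> W"
      by (rule AE_\<mu>I) (use AE_G in \<open>auto elim: eventually_mono\<close>)
    then have "AE \<omega> in \<mu>. ennreal ((norm (?T \<omega>))\<^sup>2) \<le> 1"
    proof (rule AE_mp, intro AE_I2 impI)
      fix \<omega> assume "\<omega> \<in> G \<union> W"
      then obtain A where "eigen_system A (\<nu> \<omega>) (\<phi> \<omega>)" by (rule eigen_cases)
      then have "norm (?T \<omega>) \<le> 1" by (intro norm_truncated_projection_le eigen_ortho)
      then show "ennreal ((norm (?T \<omega>))\<^sup>2) \<le> 1" by (simp add: power_le_one)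
    qed
    then have "B_inf_norm2 \<mu> ?T \<le> (\<integral>\<^sup>+\<omega>. 1 \<partial>\<mu>)"
      unfolding B_inf_norm2_def by (intro nn_integral_mono_AE)
    also have "\<dots> < \<infinity>"
      using finite_measure.emeasure_finite[OF finite_\<mu>, of "space \<mu>"] by (simp add: less_top[symmetric])
    finally show ?thesis .
  qed
  ultimately show ?thesis by (simp add: B_inf_def clinear_op_truncated_projection)
qed

section \<open>The mean squared error of a modulated integral\<close>

text \<open>The norm of \<open>X t - Y\<close> is the norm of \<open>\<psi> - A \<psi>\<close> in the model, since the common factor of modulus one
  cancels. As \<open>\<psi> (k, \<omega>)\<close> is an eigenvector, this is an integral of Eckart--Young errors.\<close>

lemma residual_nn_integral:
  assumes Y: "corresponds Y (\<lambda>x. cis (of_int t * snd x) *\<^sub>C blinfun_apply (A (snd x)) (model_vector x))"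
    and A: "strong_limit A" "B_inf_norm2 \<mu> A < \<infinity>"
  shows "ennreal ((L2_norm P (\<lambda>x. X t x - Y x))\<^sup>2)
    = (\<integral>\<^sup>+\<omega>. (\<Sum>k. ennreal (eigval k \<omega> * (norm (eigvec k \<omega> - blinfun_apply (A \<omega>) (eigvec k \<omega>)))\<^sup>2)) \<partial>base)"
proof -
  have L: "(\<lambda>x. model_vector x - blinfun_apply (A (snd x)) (model_vector x)) \<in> L2 model_measure"
    by (intro L2_diff model_vector_L2 op_L2 A)
  note [measurable] = L2_measurable[OF L]
  have "ennreal ((L2_norm P (\<lambda>x. X t x - Y x))\<^sup>2) = (\<integral>\<^sup>+\<omega>. (\<Sum>k. ennreal (eigval k \<omega>)
      * ennreal ((norm (model_vector (k, \<omega>) - blinfun_apply (A (snd (k, \<omega>))) (model_vector (k, \<omega>))))\<^sup>2)) \<partial>base)"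
    unfolding modulated_residual_norm[OF Y] ennreal_L2_norm_power2[OF L]
    by (rule nn_integral_model) measurable
  then show ?thesis by (simp add: model_vector_def ennreal_mult eigval_nonneg)
qed

definition tail :: "(real \<Rightarrow> nat) \<Rightarrow> real \<Rightarrow> real" where
  "tail p \<omega> = (\<Sum>k. eigval (k + p \<omega>) \<omega>)"

lemma eigval_tail_summable: "summable (\<lambda>k. eigval (k + n) \<omega>)"
  using eigval_summable by (subst summable_iff_shift)

lemma ennreal_tail: "(\<Sum>k. ennreal (eigval (k + p \<omega>) \<omega>)) = ennreal (tail p \<omega>)"
  unfolding tail_def using eigval_nonneg eigval_tail_summable by (intro suminf_ennreal2)

lemma tail_nonneg: "0 \<le> tail p \<omega>"
  unfolding tail_def using eigval_nonneg eigval_tail_summable by (intro suminf_nonneg)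

lemma tail_infsum:
  assumes "\<omega> \<in> G \<union> W"
  shows "(\<Sum>\<^sub>\<infinity>j\<in>{p \<omega><..}. \<nu> \<omega> j) = tail p \<omega>"
proof -
  have "((\<lambda>k. eigval (k + p \<omega>) \<omega>) has_sum tail p \<omega>) UNIV"
    unfolding tail_def using eigval_nonneg eigval_tail_summable
    by (intro sums_nonneg_imp_has_sum summable_sums)
  moreover have "bij_betw (\<lambda>k. Suc (k + p \<omega>)) UNIV {p \<omega><..}"
    by (rule bij_betwI[of _ _ _ "\<lambda>j. j - Suc (p \<omega>)"]) auto
  ultimately have "(\<nu> \<omega> has_sum tail p \<omega>) {p \<omega><..}"
    using has_sum_reindex_bij_betw[of "\<lambda>k. Suc (k + p \<omega>)" UNIV "{p \<omega><..}" "\<nu> \<omega>"] assms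
    by (simp add: eigval_def)
  then show ?thesis by (rule infsumI)
qed

text \<open>The rank condition holds \<open>\<mu>\<close>-almost everywhere, and \<open>\<mu>\<close> ignores exactly the frequencies at which
  all eigenvalues vanish. There both sides are zero; elsewhere the Eckart--Young inequality applies.\<close>

lemma residual_lower_bound:
  assumes Y: "corresponds Y (\<lambda>x. cis (of_int t * snd x) *\<^sub>C blinfun_apply (A (snd x)) (model_vector x))"
    and A: "strong_limit A" "B_inf_norm2 \<mu> A < \<infinity>"
    and rank: "AE \<omega> in \<mu>. crank (A \<omega>) \<le> enat (p \<omega>)"
  shows "(\<integral>\<^sup>+\<omega>. ennreal (tail p \<omega>) \<partial>base) \<le> ennreal ((L2_norm P (\<lambda>x. X t x - Y x))\<^sup>2)"
  unfolding residual_nn_integral[OF Y A]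
proof (rule nn_integral_mono_AE, use AE_base[OF rank] in \<open>rule AE_mp\<close>, intro AE_I2 impI)
  fix \<omega> assume "(\<forall>k. eigval k \<omega> = 0) \<or> crank (A \<omega>) \<le> enat (p \<omega>)"
  then show "ennreal (tail p \<omega>) \<le> (\<Sum>k. ennreal (eigval k \<omega> * (norm (eigvec k \<omega> - blinfun_apply (A \<omega>) (eigvec k \<omega>)))\<^sup>2))"
  proof
    assume "\<forall>k. eigval k \<omega> = 0"
    then show ?thesis by (simp add: tail_def)
  next
    assume "crank (A \<omega>) \<le> enat (p \<omega>)"
    then show ?thesis
      unfolding ennreal_tail[symmetric]
      by (intro eckart_young eigvec_ortho eigval_decreasing eigval_nonneg eigvec_pad)
  qed
qed

lemma residual_attained:
  assumes Y: "corresponds Y (\<lambda>x. cis (of_int t * snd x) *\<^sub>C blinfun_apply (A (snd x)) (model_vector x))"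
    and A: "strong_limit A" "B_inf_norm2 \<mu> A < \<infinity>"
    and trunc: "AE \<omega> in \<mu>. truncated_projection (p \<omega>) (\<phi> \<omega>) = A \<omega>"
  shows "ennreal ((L2_norm P (\<lambda>x. X t x - Y x))\<^sup>2) = (\<integral>\<^sup>+\<omega>. ennreal (tail p \<omega>) \<partial>base)"
  unfolding residual_nn_integral[OF Y A]
proof (rule nn_integral_cong_AE, use AE_base[OF trunc] in \<open>rule AE_mp\<close>, intro AE_I2 impI)
  fix \<omega> assume \<omega>: "(\<forall>k. eigval k \<omega> = 0) \<or> truncated_projection (p \<omega>) (\<phi> \<omega>) = A \<omega>"
  show "(\<Sum>k. ennreal (eigval k \<omega> * (norm (eigvec k \<omega> - blinfun_apply (A \<omega>) (eigvec k \<omega>)))\<^sup>2)) = ennreal (tail p \<omega>)"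
  proof (cases "(\<forall>k. eigval k \<omega> = 0) \<or> \<omega> \<notin> G \<union> W")
    case True
    then have "eigval k \<omega> = 0" for k by (auto simp: eigval_def)
    then show ?thesis by (simp add: tail_def)
  next
    case False
    then have T: "truncated_projection (p \<omega>) (\<phi> \<omega>) = A \<omega>" and vec: "eigvec k \<omega> = \<phi> \<omega> (Suc k)" for k
      using \<omega> by (auto simp: eigvec_def)
    show ?thesis
      unfolding ennreal_tail[symmetric] T[symmetric] vec
      by (rule eckart_young_attained)
        (use eigvec_ortho[of \<omega>] eigvec_pad[of _ \<omega>] vec in auto)
  qed
qed

section \<open>Optimality of the truncation\<close>

text \<open>The integral over the continuity part and the jumps together make up the integral of a
  single integrand: almost every frequency of the model lies in exactly one of \<open>M\<close>, \<open>{w 1}\<close>, \<dots>, \<open>{w k}\<close>.\<close>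

lemma corresponds_truncation:
  assumes W_eq: "W = w ` {1..k}" and inj: "inj_on w {1..k}"
    and A: "strong_limit A" "\<And>\<omega>. clinear_op (A \<omega>)" "B_inf_norm2 \<mu> A < \<infinity>"
    and trunc: "AE \<omega> in \<mu>. truncated_projection (p \<omega>) (\<phi> \<omega>) = A \<omega>"
  shows "corresponds (CKL_truncation P F Z k w \<phi> p t)
    (\<lambda>x. cis (of_int t * snd x) *\<^sub>C blinfun_apply (A (snd x)) (model_vector x))"
proof -
  let ?T = "\<lambda>\<omega>. truncated_projection (p \<omega>) (\<phi> \<omega>)"
  let ?A = "\<lambda>\<omega>. indicat_real M \<omega> *\<^sub>R A \<omega>" and ?TM = "\<lambda>\<omega>. indicat_real M \<omega> *\<^sub>R ?T \<omega>"
  have A': "strong_limit ?A" "\<And>\<omega>. clinear_op (?A \<omega>)"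
    using A by (auto intro: strong_limit_restrict[OF _ M_borel] clinear_op_scaleR)
  have "B_inf_norm2 \<mu> ?A \<le> B_inf_norm2 \<mu> A"
    unfolding B_inf_norm2_def by (intro nn_integral_mono) (auto simp: indicator_def)
  then have fin: "B_inf_norm2 \<mu> ?A < \<infinity>" using A(3) by (rule le_less_trans)
  have AE: "AE \<omega> in \<mu>. ?TM \<omega> = ?A \<omega>" using trunc by eventually_elim simp
  have TM: "?TM \<in> B_inf \<mu>" by (rule B_inf_cong_AE[OF B_inf_strong_limit[OF sets_\<mu> A' fin] AE])
  let ?I = "stoch_integral_on P \<mu> Z M (\<lambda>\<omega>. scale_op (cis (of_int t * \<omega>)) (?T \<omega>))"
  have "(\<lambda>\<omega>. indicat_real M \<omega> *\<^sub>R scale_op (cis (of_int t * \<omega>)) (?T \<omega>)) = (\<lambda>\<omega>. scale_op (cis (of_int t * \<omega>)) (?TM \<omega>))"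
    by (simp add: bounded_bilinear.scaleR_right[OF bounded_bilinear_scale_op])
  then have cont: "corresponds ?I (\<lambda>x. cis (of_int t * snd x) *\<^sub>C blinfun_apply (?A (snd x)) (model_vector x))"
    unfolding stoch_integral_on_def using corresponds_modulated_integral[OF TM A' AE, of t] by simp
  have wl: "w l \<in> W" "w l \<in> {- pi<..pi}" if "l \<in> {1..k}" for l
  proof -
    show "w l \<in> W" using that W_eq by blast
    then show "w l \<in> {- pi<..pi}" using W(2) by blast
  qed
  have jump: "corresponds (\<lambda>x. cis (of_int t * w l) *\<^sub>C blinfun_apply (?T (w l)) (process_jump P Z (w l) x))
      (\<lambda>x. cis (of_int t * w l) *\<^sub>C blinfun_apply (?T (w l)) (indicat_real {w l} (snd x) *\<^sub>R model_vector x))"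
    if "l \<in> {1..k}" for l
    using wl[OF that]
    by (intro corresponds_scaleC corresponds_op corresponds_process_jump clinear_op_truncated_projection)
  let ?V = "\<lambda>x. cis (of_int t * snd x) *\<^sub>C blinfun_apply (?A (snd x)) (model_vector x)
      + (\<Sum>l\<in>{1..k}. cis (of_int t * w l) *\<^sub>C blinfun_apply (?T (w l)) (indicat_real {w l} (snd x) *\<^sub>R model_vector x))"
  have c: "corresponds (CKL_truncation P F Z k w \<phi> p t) ?V"
    unfolding CKL_truncation_def W_eq[symmetric]
    by (intro corresponds_add cont corresponds_sum jump) auto
  have "AE \<omega> in \<mu>. \<omega> \<noteq> - pi \<and> ?T \<omega> = A \<omega>"
    using AE_left_end[OF sets_\<mu> finite_\<mu> emeasure_\<mu>_left_end] trunc by eventually_elim simp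
  then have "AE x in model_measure. model_vector x = 0 \<or> (snd x \<noteq> - pi \<and> ?T (snd x) = A (snd x))"
    by (rule AE_\<mu>_transfer)
  then have "AE x in model_measure. ?V x = cis (of_int t * snd x) *\<^sub>C blinfun_apply (A (snd x)) (model_vector x)"
  proof (rule AE_mp, intro AE_I2 impI)
    fix x assume x: "x \<in> space model_measure"
      "model_vector x = 0 \<or> (snd x \<noteq> - pi \<and> ?T (snd x) = A (snd x))"
    show "?V x = cis (of_int t * snd x) *\<^sub>C blinfun_apply (A (snd x)) (model_vector x)"
    proof (cases "model_vector x = 0")
      case False
      then have q: "snd x \<noteq> - pi" "?T (snd x) = A (snd x)" using x(2) by auto
      show ?thesis
      proof (cases "snd x \<in> W")
        case True
        then obtain l where l: "l \<in> {1..k}" "snd x = w l" using W_eq by auto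
        have "cis (of_int t * w i) *\<^sub>C blinfun_apply (?T (w i)) (indicat_real {w i} (snd x) *\<^sub>R model_vector x)
            = (if i = l then cis (of_int t * w l) *\<^sub>C blinfun_apply (?T (w l)) (model_vector x) else 0)" if "i \<in> {1..k}" for i
          using l inj_onD[OF inj _ that l(1)] by (auto simp: indicator_def)
        then have "(\<Sum>i\<in>{1..k}. cis (of_int t * w i) *\<^sub>C blinfun_apply (?T (w i)) (indicat_real {w i} (snd x) *\<^sub>R model_vector x))
            = (\<Sum>i\<in>{1..k}. if i = l then cis (of_int t * w l) *\<^sub>C blinfun_apply (?T (w l)) (model_vector x) else 0)"
          by (intro sum.cong refl)
        also have "\<dots> = cis (of_int t * w l) *\<^sub>C blinfun_apply (?T (w l)) (model_vector x)"
          using l(1) by (simp only: sum.delta' sum.delta finite_atLeastAtMost if_True)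
        finally show ?thesis using q(2) True l(2) by simp
      next
        case False
        have "snd x \<in> {- pi..pi}" using x(1) by (auto simp: space_model)
        then have "snd x \<in> M" using False q(1) by auto
        moreover have "(\<Sum>i\<in>{1..k}. cis (of_int t * w i) *\<^sub>C blinfun_apply (?T (w i)) (indicat_real {w i} (snd x) *\<^sub>R model_vector x)) = 0"
          using False wl(1) by (intro sum.neutral) (auto simp: indicator_def)
        ultimately show ?thesis by simp
      qed
    qed simp
  qed
  moreover have "(\<lambda>x. cis (of_int t * snd x) *\<^sub>C blinfun_apply (A (snd x)) (model_vector x)) \<in> borel_measurable model_measure"
    using corresponds_modulated_integral[OF B_inf_strong_limit[OF sets_\<mu> A] A(1,2), of t]
    by (intro L2_measurable correspondsD(2)) auto
  ultimately show ?thesis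
    by (rule corresponds_cong_AE[OF c L2_measurable[OF correspondsD(1)[OF c]] _ AE_I2[OF refl], rotated])
qed

text \<open>The eigenvalue tails are dominated by the traces, which are integrable with respect to \<open>base\<close>.\<close>

lemma tail_integral:
  assumes p: "p \<in> measurable freq_borel (count_space UNIV)"
  shows "set_integrable lebesgue M (\<lambda>\<omega>. \<Sum>\<^sub>\<infinity>j\<in>{p \<omega><..}. \<nu> \<omega> j)"
    and "(\<integral>\<^sup>+\<omega>. ennreal (tail p \<omega>) \<partial>base)
      = ennreal ((LINT \<omega>:M|lebesgue. \<Sum>\<^sub>\<infinity>j\<in>{p \<omega><..}. \<nu> \<omega> j) + (\<Sum>a\<in>W. \<Sum>\<^sub>\<infinity>j\<in>{p a<..}. \<nu> a j))"
proof -
  let ?s = "\<lambda>\<omega>. \<Sum>\<^sub>\<infinity>j\<in>{p \<omega><..}. \<nu> \<omega> j"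
  have p_L: "p \<in> measurable L (count_space UNIV)" using p by (rule measurable_L)
  have "(\<lambda>\<omega>. eigval (k + p \<omega>) \<omega>) \<in> borel_measurable L" for k
    by (rule measurable_compose_countable[OF _ p_L]) simp
  then have tail_L [measurable]: "tail p \<in> borel_measurable L"
    unfolding tail_def[abs_def] by (rule borel_measurable_suminf)
  let ?h = "\<lambda>\<omega>. indicat_real G \<omega> * tail p \<omega>"
  have "(\<lambda>\<omega>. indicat_real G \<omega> *\<^sub>R tail p \<omega>) \<in> borel_measurable L" by measurable
  then have "(\<lambda>\<omega>. indicat_real {- pi..pi} \<omega> *\<^sub>R (indicat_real G \<omega> *\<^sub>R tail p \<omega>)) \<in> borel_measurable lebesgue"
    by (subst (asm) borel_measurable_restrict_space_iff) simp_all
  also have "(\<lambda>\<omega>. indicat_real {- pi..pi} \<omega> *\<^sub>R (indicat_real G \<omega> *\<^sub>R tail p \<omega>)) = ?h"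
    using G_sub by (auto simp: fun_eq_iff indicator_def)
  finally have h [measurable]: "?h \<in> borel_measurable lebesgue" .
  have h_nonneg: "0 \<le> ?h \<omega>" for \<omega> using tail_nonneg by simp
  have nn: "(\<integral>\<^sup>+\<omega>. ennreal (tail p \<omega>) \<partial>base) = (\<integral>\<^sup>+\<omega>. ennreal (?h \<omega>) \<partial>lebesgue) + (\<Sum>a\<in>W. ennreal (tail p a))"
  proof -
    have "(\<integral>\<^sup>+\<omega>. ennreal (tail p \<omega>) \<partial>base)
        = (\<integral>\<^sup>+\<omega>. indicator G \<omega> * ennreal (tail p \<omega>) \<partial>lebesgue) + (\<Sum>a\<in>W. ennreal (tail p a))"
      by (rule nn_integral_base) measurable
    also have "(\<integral>\<^sup>+\<omega>. indicator G \<omega> * ennreal (tail p \<omega>) \<partial>lebesgue) = (\<integral>\<^sup>+\<omega>. ennreal (?h \<omega>) \<partial>lebesgue)"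
      by (intro nn_integral_cong) (auto simp: indicator_def)
    finally show ?thesis .
  qed
  have "tail p \<omega> \<le> (\<Sum>k. eigval k \<omega>)" for \<omega>
  proof -
    have "(\<Sum>k. eigval k \<omega>) = tail p \<omega> + (\<Sum>k<p \<omega>. eigval k \<omega>)"
      unfolding tail_def by (rule suminf_split_initial_segment[OF eigval_summable])
    then show ?thesis using eigval_nonneg by (simp add: sum_nonneg)
  qed
  then have "(\<integral>\<^sup>+\<omega>. ennreal (tail p \<omega>) \<partial>base) \<le> (\<integral>\<^sup>+\<omega>. ennreal (\<Sum>k. eigval k \<omega>) \<partial>base)"
    by (intro nn_integral_mono ennreal_leI)
  also have "\<dots> < \<infinity>"
    using nn_integral_base_eigval by (simp add: suminf_ennreal2 eigval_nonneg eigval_summable)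
  finally have "(\<integral>\<^sup>+\<omega>. ennreal (?h \<omega>) \<partial>lebesgue) < \<infinity>"
    unfolding nn by (simp add: ennreal_add_eq_top less_top)
  then have int_h: "integrable lebesgue ?h"
    using h_nonneg by (intro integrableI_nonneg) auto
  have AE: "AE \<omega> in lebesgue. ?h \<omega> = indicat_real M \<omega> *\<^sub>R ?s \<omega>"
    using AE_G
  proof eventually_elim
    case (elim \<omega>)
    then show ?case using G(2) tail_infsum[of \<omega> p] by (auto simp: indicator_def)
  qed
  have s: "(\<lambda>\<omega>. indicat_real M \<omega> *\<^sub>R ?s \<omega>) \<in> borel_measurable lebesgue"
    by (rule borel_measurable_AE[OF h AE])
  show "set_integrable lebesgue M ?s"
    unfolding set_integrable_def by (rule integrable_cong_AE_imp[OF int_h s]) (use AE in \<open>auto elim: eventually_mono\<close>)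
  have LINT: "(LINT \<omega>:M|lebesgue. ?s \<omega>) = (\<integral>\<omega>. ?h \<omega> \<partial>lebesgue)"
    unfolding set_lebesgue_integral_def
    by (rule integral_cong_AE[OF s h]) (use AE in \<open>auto elim: eventually_mono\<close>)
  have "(\<Sum>a\<in>W. ennreal (tail p a)) = ennreal (\<Sum>a\<in>W. ?s a)"
    using tail_nonneg[of p] by (simp add: tail_infsum cong: sum.cong)
  moreover have "0 \<le> (\<Sum>a\<in>W. ?s a)" using tail_nonneg[of p] by (intro sum_nonneg) (simp add: tail_infsum)
  ultimately show "(\<integral>\<^sup>+\<omega>. ennreal (tail p \<omega>) \<partial>base) = ennreal ((LINT \<omega>:M|lebesgue. ?s \<omega>) + (\<Sum>a\<in>W. ?s a))"
    unfolding nn LINT using h_nonneg nn_integral_eq_integral[OF int_h]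
    by (simp add: ennreal_plus integral_nonneg_AE)
qed

text \<open>The Eckart--Young problem is solved frequency by frequency: the lower bound holds for the integrand of any
  rank reduction, and the truncated projections attain it.\<close>

lemma truncation_optimal:
  assumes W_eq: "W = w ` {1..k}" and inj: "inj_on w {1..k}"
    and p: "p \<in> measurable freq_borel (count_space UNIV)"
  shows "is_rank_reduction P F Z p (CKL_truncation P F Z k w \<phi> p)"
    and "is_rank_reduction P F Z p Y \<Longrightarrow>
      (L2_norm P (\<lambda>x. X t x - CKL_truncation P F Z k w \<phi> p t x))\<^sup>2 \<le> (L2_norm P (\<lambda>x. X t x - Y t x))\<^sup>2"
    and "(L2_norm P (\<lambda>x. X t x - CKL_truncation P F Z k w \<phi> p t x))\<^sup>2 =
      (LINT \<omega>:M|lebesgue. \<Sum>\<^sub>\<infinity>j\<in>{p \<omega><..}. \<nu> \<omega> j) + (\<Sum>l\<in>{1..k}. \<Sum>\<^sub>\<infinity>j\<in>{p (w l)<..}. \<nu> (w l) j)"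
proof -
  let ?T = "\<lambda>\<omega>. truncated_projection (p \<omega>) (\<phi> \<omega>)"
  have T: "?T \<in> B_inf \<mu>" by (rule truncation_B_inf[OF p])
  obtain A where A: "strong_limit A" "\<And>\<omega>. clinear_op (A \<omega>)" "AE \<omega> in \<mu>. ?T \<omega> = A \<omega>"
    using B_inf_representative[OF sets_\<mu> T] by blast
  have norm_A: "B_inf_norm2 \<mu> A < \<infinity>"
    using B_inf_norm2_cong_AE[OF A(3)] T by (simp add: B_inf_def)
  have c: "corresponds (CKL_truncation P F Z k w \<phi> p t)
      (\<lambda>x. cis (of_int t * snd x) *\<^sub>C blinfun_apply (A (snd x)) (model_vector x))" for t
    by (rule corresponds_truncation[OF W_eq inj A(1,2) norm_A A(3)])
  show "is_rank_reduction P F Z p (CKL_truncation P F Z k w \<phi> p)"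
    unfolding is_rank_reduction_def
  proof (intro bexI[OF _ T] conjI allI)
    show "AE \<omega> in \<mu>. crank (?T \<omega>) \<le> enat (p \<omega>)" by (simp add: crank_truncated_projection)
    show "CKL_truncation P F Z k w \<phi> p t \<in> L2 P" for t by (rule correspondsD(1)[OF c])
    show "AE x in P. CKL_truncation P F Z k w \<phi> p t x
        = stoch_integral P \<mu> Z (\<lambda>\<omega>. scale_op (cis (of_int t * \<omega>)) (?T \<omega>)) x" for t
      by (rule corresponds_unique[OF c corresponds_modulated_integral[OF T A]])
  qed
  have attained: "ennreal ((L2_norm P (\<lambda>x. X t x - CKL_truncation P F Z k w \<phi> p t x))\<^sup>2)
      = (\<integral>\<^sup>+\<omega>. ennreal (tail p \<omega>) \<partial>base)"
    by (rule residual_attained[OF c A(1) norm_A A(3)])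
  show "(L2_norm P (\<lambda>x. X t x - CKL_truncation P F Z k w \<phi> p t x))\<^sup>2 \<le> (L2_norm P (\<lambda>x. X t x - Y t x))\<^sup>2"
    if Y: "is_rank_reduction P F Z p Y"
  proof -
    obtain B where B: "B \<in> B_inf \<mu>" "AE \<omega> in \<mu>. crank (B \<omega>) \<le> enat (p \<omega>)"
      and Yt: "Y t \<in> L2 P" "AE x in P. Y t x = stoch_integral P \<mu> Z (\<lambda>\<omega>. scale_op (cis (of_int t * \<omega>)) (B \<omega>)) x"
      using Y unfolding is_rank_reduction_def by blast
    obtain B' where B': "strong_limit B'" "\<And>\<omega>. clinear_op (B' \<omega>)" "AE \<omega> in \<mu>. B \<omega> = B' \<omega>"
      using B_inf_representative[OF sets_\<mu> B(1)] by blast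
    have norm_B': "B_inf_norm2 \<mu> B' < \<infinity>"
      using B_inf_norm2_cong_AE[OF B'(3)] B(1) by (simp add: B_inf_def)
    have rank: "AE \<omega> in \<mu>. crank (B' \<omega>) \<le> enat (p \<omega>)" using B(2) B'(3) by eventually_elim simp
    note cB = corresponds_modulated_integral[OF B(1) B', of t]
    have cY: "corresponds (Y t) (\<lambda>x. cis (of_int t * snd x) *\<^sub>C blinfun_apply (B' (snd x)) (model_vector x))"
      by (rule corresponds_cong_AE[OF cB L2_measurable[OF Yt(1)] L2_measurable[OF correspondsD(2)[OF cB]]])
        (use Yt(2) in \<open>auto elim: eventually_mono\<close>)
    have "ennreal ((L2_norm P (\<lambda>x. X t x - CKL_truncation P F Z k w \<phi> p t x))\<^sup>2) \<le> ennreal ((L2_norm P (\<lambda>x. X t x - Y t x))\<^sup>2)"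
      unfolding attained by (rule residual_lower_bound[OF cY B'(1) norm_B' rank])
    then show ?thesis by simp
  qed
  have "0 \<le> (LINT \<omega>:M|lebesgue. \<Sum>\<^sub>\<infinity>j\<in>{p \<omega><..}. \<nu> \<omega> j) + (\<Sum>a\<in>W. \<Sum>\<^sub>\<infinity>j\<in>{p a<..}. \<nu> a j)"
  proof (rule add_nonneg_nonneg)
    have "AE \<omega> in lebesgue. 0 \<le> indicat_real M \<omega> *\<^sub>R (\<Sum>\<^sub>\<infinity>j\<in>{p \<omega><..}. \<nu> \<omega> j)"
      using AE_G
    proof eventually_elim
      case (elim \<omega>)
      then show ?case using tail_infsum[of \<omega> p] tail_nonneg[of p \<omega>] by (auto simp: indicator_def)
    qed
    then show "0 \<le> (LINT \<omega>:M|lebesgue. \<Sum>\<^sub>\<infinity>j\<in>{p \<omega><..}. \<nu> \<omega> j)"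
      unfolding set_lebesgue_integral_def by (rule integral_nonneg_AE)
    show "0 \<le> (\<Sum>a\<in>W. \<Sum>\<^sub>\<infinity>j\<in>{p a<..}. \<nu> a j)"
      using tail_nonneg[of p] by (intro sum_nonneg) (simp add: tail_infsum)
  qed
  then have "(L2_norm P (\<lambda>x. X t x - CKL_truncation P F Z k w \<phi> p t x))\<^sup>2
      = (LINT \<omega>:M|lebesgue. \<Sum>\<^sub>\<infinity>j\<in>{p \<omega><..}. \<nu> \<omega> j) + (\<Sum>a\<in>W. \<Sum>\<^sub>\<infinity>j\<in>{p a<..}. \<nu> a j)"
    using attained unfolding tail_integral(2)[OF p] by (subst (asm) ennreal_inj) auto
  also have "(\<Sum>a\<in>W. \<Sum>\<^sub>\<infinity>j\<in>{p a<..}. \<nu> a j) = (\<Sum>l\<in>{1..k}. \<Sum>\<^sub>\<infinity>j\<in>{p (w l)<..}. \<nu> (w l) j)"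
    unfolding W_eq using inj by (simp add: sum.reindex)
  finally show "(L2_norm P (\<lambda>x. X t x - CKL_truncation P F Z k w \<phi> p t x))\<^sup>2 =
      (LINT \<omega>:M|lebesgue. \<Sum>\<^sub>\<infinity>j\<in>{p \<omega><..}. \<nu> \<omega> j) + (\<Sum>l\<in>{1..k}. \<Sum>\<^sub>\<infinity>j\<in>{p (w l)<..}. \<nu> (w l) j)" .
qed

end

theorem corollary4p9:
  fixes P :: "'w measure"
    and X :: "int \<Rightarrow> 'w \<Rightarrow> 'h::{complex_hilbert_space, second_countable_topology}"
    and F :: "real set \<Rightarrow> ('h \<Rightarrow>\<^sub>L 'h)"
    and Z :: "real \<Rightarrow> 'w \<Rightarrow> 'h"
    and k :: nat and w :: "nat \<Rightarrow> real"
    and \<nu> :: "real \<Rightarrow> nat \<Rightarrow> real" and \<phi> :: "real \<Rightarrow> nat \<Rightarrow> 'h"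
    and p :: "real \<Rightarrow> nat"
  assumes "prob_space P"
    and "weakly_stationary P X"
    and "is_spectral_measure P X F"
    and "is_increment_process P X F Z"
    and "has_CKL_representation P X F Z k w \<nu> \<phi>"
    and "cadlag_on (- pi) pi p"
  shows "is_rank_reduction P F Z p (CKL_truncation P F Z k w \<phi> p)
    \<and> (\<forall>Y. is_rank_reduction P F Z p Y \<longrightarrow>
          (\<forall>t. (L2_norm P (\<lambda>x. X t x - CKL_truncation P F Z k w \<phi> p t x))\<^sup>2 \<le> (L2_norm P (\<lambda>x. X t x - Y t x))\<^sup>2))
    \<and> set_integrable lebesgue (continuity_part k w) (\<lambda>\<omega>. \<Sum>\<^sub>\<infinity>j\<in>{p \<omega><..}. \<nu> \<omega> j)
    \<and> (\<forall>t. (L2_norm P (\<lambda>x. X t x - CKL_truncation P F Z k w \<phi> p t x))\<^sup>2 =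
          (LINT \<omega>:continuity_part k w|lebesgue. \<Sum>\<^sub>\<infinity>j\<in>{p \<omega><..}. \<nu> \<omega> j)
          + (\<Sum>l\<in>{1..k}. \<Sum>\<^sub>\<infinity>j\<in>{p (w l)<..}. \<nu> (w l) j))"
proof -
  let ?W = "w ` {1..k}" and ?M = "continuity_part k w"
  have w: "strict_mono_on {1..k} w" "?W \<subseteq> {- pi<..pi}"
    using assms(5) unfolding has_CKL_representation_def by auto
  obtain f where f: "AE \<omega> in lebesgue. \<omega> \<in> ?M \<longrightarrow> f \<omega> \<in> S1_pos \<and> eigen_system (f \<omega>) (\<nu> \<omega>) (\<phi> \<omega>)"
    and density: "\<forall>E\<in>sets borel. E \<subseteq> ?M \<longrightarrow> (\<forall>A\<in>S1_pos. set_integrable lebesgue E (\<lambda>\<omega>. tr (f \<omega> o\<^sub>L A))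
      \<and> tr (F E o\<^sub>L A) = (LINT \<omega>:E|lebesgue. tr (f \<omega> o\<^sub>L A)))"
    using assms(5) unfolding has_CKL_representation_def by blast
  have jumps: "\<forall>l\<in>{1..k}. eigen_system (spectral_jump F (w l)) (\<nu> (w l)) (\<phi> (w l))"
    and meas: "\<forall>j\<ge>1. (\<lambda>\<omega>. \<phi> \<omega> j) \<in> borel_measurable (restrict_space lebesgue ?M)"
    using assms(5) unfolding has_CKL_representation_def by simp_all
  obtain B where B: "{\<omega> \<in> space lebesgue. \<not> (\<omega> \<in> ?M \<longrightarrow> f \<omega> \<in> S1_pos \<and> eigen_system (f \<omega>) (\<nu> \<omega>) (\<phi> \<omega>))} \<subseteq> B"
    "emeasure lebesgue B = 0" "B \<in> sets lebesgue"
    using f by (rule AE_E)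
  have "?M \<in> sets borel" by (intro sets.Diff[OF _ borel_closed[OF finite_imp_closed]]) auto
  then have M: "?M \<in> sets lebesgue" by simp
  \<comment> \<open>\<open>B\<close> is a null set that contains all frequencies at which the density misbehaves.\<close>
  interpret spectral_decomposition P X F Z f "?M - B" ?W \<nu> \<phi>
  proof
    have "?M - (?M - B) = ?M \<inter> B" by blast
    moreover have "?M \<inter> B \<in> null_sets lebesgue"
      using B(2,3) M by (intro null_set_Int1) auto
    ultimately show "?M - (?M - B) \<in> null_sets lebesgue" by simp
  qed (use assms(2,3,4) w(2) M B(1,3) density jumps meas in auto)
  have inj: "inj_on w {1..k}" using w(1) by (rule strict_mono_on_imp_inj_on)
  have p: "p \<in> measurable freq_borel (count_space UNIV)" using assms(6) by (rule cadlag_nat_measurable)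
  show ?thesis
    using truncation_optimal[OF refl inj p] tail_integral(1)[OF p] by blast
qed

end
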